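(* Let $P$ be a set of prime numbers, $G$ a pro-$P$ group, $\Omega\cong\mathbb Z_P=\prod_{p\in P}\mathbb Z_p$ with a fixed topological generator $\omega$, and $d:G\to\Omega$ a surjective continuous homomorphism. Let $\mathfrak E$ be a $G$-spectrum and let $(C,v)$ be a Fesenko--Neukirch datum on $\mathfrak E$. For $(H,U)\in\mathfrak E_{\mathrm b}$ let $$\Upsilon_{(H,U)}:(H/U)^{\mathrm{ab}}\to C(H)/\mathrm{ind}^C_{H,U}C(U),\qquad \bar h\bmod[H/U,H/U]\mapsto\mathrm{ind}^C_{H,\Sigma_{h,H|U}}\big(\pi_h^{P'(d_H(h))}\big)\bmod\mathrm{ind}^C_{H,U}C(U),$$ where $h\in\mathrm{Frob}_H$ is a Frobenius lift of $\bar h\in H/U$ and $\pi_h\in C(\Sigma_{h,H|U})$ is a prime element; this is the unique morphism induced by the group morphism $\Upsilon'_{(H,U)}:H/U\to C(H)/\mathrm{ind}^C_{H,U}C(U)$ given by the same formula, which is independent of the choices of $h$ and $\pi_h$. Then the family $\Upsilon=\{\Upsilon_{(H,U)}\mid(H,U)\in\mathfrak E_{\mathrm b}\}$ is a canonical morphism $\Upsilon:\pi_{\mathfrak K}\to\widehat{\mathrm H}^0_{\mathfrak E}(C)$ in $\mathsf{Fct}(\mathfrak E,\mathsf{TAb})$. Moreover, this morphism is an extension of the Fesenko--Neukirch reciprocity morphism for $(C,v)$ on the unramified part of $\mathfrak E$: if $(H,U)\in\mathfrak E_{\mathrm b}$ with $U\in\mathcal E^{\mathrm{ur}}(H)$,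 then $\Upsilon_{(H,U)}(\varphi_{H|U}^k)=\pi_H^k\bmod\mathrm{ind}^C_{H,U}C(U)$ for every $k\in\mathbb Z$ and every prime element $\pi_H\in C(H)$.
   Context: $\mathsf{TAb}$ is the category of topological abelian groups; abelian groups without given topology are regarded as discrete. ${}^gH=gHg^{-1}$, $H^g=g^{-1}Hg$; $\langle h\rangle_{\mathrm c}$ is the closure of $\langle h\rangle$. For a topological group $Q$, $[Q,Q]$ is the abstract commutator subgroup and $Q^{\mathrm{ab}}$ is the quotient of $Q$ by the closure of $[Q,Q]$. RIC-functors. A RIC-domain $\mathfrak D$ consists of a non-empty set $\mathfrak D_{\mathrm b}$ with a left action $(g,x)\mapsto{}^gx$ of a group $G$ and, for each $x\in\mathfrak D_{\mathrm b}$, subsets $\mathfrak D_{\mathrm r}(x),\mathfrak D_{\mathrm i}(x)\subseteq\mathfrak D_{\mathrm b}$ such that for $\star\in\{\mathrm r,\mathrm i\}$: $x\in\mathfrak D_\star(x)$; $y\in\mathfrak D_\star(x)$ implies $\mathfrak D_\star(y)\subseteq\mathfrak D_\star(x)$; ${}^g\mathfrak D_\star(x)=\mathfrak D_\star({}^gx)$. A RIC-functor $\Phi:\mathfrak D\to\mathcal C$ consists of objects $\Phi(x)$ and morphisms $\mathrm{res}_{y,x}:\Phi(x)\to\Phi(y)$ ($y\in\mathfrak D_{\mathrm r}(x)$), $\mathrm{ind}_{x,y}:\Phi(y)\to\Phi(x)$ ($y\in\mathfrak D_{\mathrm i}(x)$), $\mathrm{con}_{g,x}:\Phi(x)\to\Phi({}^gx)$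 such that $\mathrm{res}_{x,x}=\mathrm{ind}_{x,x}=\mathrm{con}_{1,x}=\mathrm{id}$; $\mathrm{res}_{z,y}\mathrm{res}_{y,x}=\mathrm{res}_{z,x}$, $\mathrm{ind}_{x,y}\mathrm{ind}_{y,z}=\mathrm{ind}_{x,z}$, $\mathrm{con}_{g',{}^gx}\mathrm{con}_{g,x}=\mathrm{con}_{g'g,x}$; $\mathrm{con}_{g,y}\mathrm{res}_{y,x}=\mathrm{res}_{{}^gy,{}^gx}\mathrm{con}_{g,x}$ and $\mathrm{con}_{g,x}\mathrm{ind}_{x,y}=\mathrm{ind}_{{}^gx,{}^gy}\mathrm{con}_{g,y}$. Morphisms are families $(\varphi_x)$ commuting with res, ind, con; the category is $\mathsf{Fct}(\mathfrak D,\mathcal C)$. Subgroup systems and Mackey functors. A $G$-subgroup system is a RIC-domain $\mathfrak S$ where $\mathfrak S_{\mathrm b}$ is a set of subgroups of $G$ with the conjugation action and $I\le H$ for $I\in\mathfrak S_\star(H)$; $\mathfrak S'\le\mathfrak S$ means $\mathfrak S'_{\mathrm b}\subseteq\mathfrak S_{\mathrm b}$, $\mathfrak S'_\star(H)\subseteq\mathfrak S_\star(H)$. It is arithmetic if $\mathfrak S_{\mathrm r}(H)$ and $\mathfrak S_{\mathrm i}(H)$ contain all open subgroups of $H$ for each $H\in\mathfrak S_{\mathrm b}$. It is a $G$-Mackey system if for $I\in\mathfrak S_{\mathrm r}(H)$, $J\in\mathfrak S_{\mathrm i}(H)$ the set $I\backslash H/J$ is finite, $I\cap J\in\mathfrak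 S_{\mathrm r}(J)$ and $I\cap J\in\mathfrak S_{\mathrm i}(I)$. A cohomological Mackey functor $C:\mathfrak M\to\mathsf{Ab}$ on a Mackey system is a RIC-functor with $\mathrm{con}_{h,H}=\mathrm{id}$ for $h\in H$, $\mathrm{res}_{I,H}\mathrm{ind}_{H,J}=\sum_{h}\mathrm{ind}_{I,I\cap{}^hJ}\,\mathrm{con}_{h,I^h\cap J}\,\mathrm{res}_{I^h\cap J,J}$ ($h$ over representatives of $I\backslash H/J$), and $\mathrm{ind}_{H,I}\mathrm{res}_{I,H}=[H:I]\,\mathrm{id}$ for $I\in\mathfrak M_{\mathrm r}(H)\cap\mathfrak M_{\mathrm i}(H)$. Groups $C(H)$ are written multiplicatively. Ramification. For closed subgroups $K\le H$ of $G$: $I_H=H\cap\ker d$, $f_{H|K}=[d(H):d(K)]$, $f_H=f_{G|H}$, $e_{H|K}=[I_H:I_K]$. $H$ is inertially finite if closed with $f_H<\infty$; then $d(H)=f_H\Omega$ and $d_H=\frac1{f_H}d|_H:H\to\Omega$ is surjective with kernel $I_H$. For a closed subgroup $H$, $\mathcal E^{\mathrm{ur}}(H)$ is the set of open normal subgroups $U$ of $H$ with $I_H\le U$; for $H$ inertially finite and $U\in\mathcal E^{\mathrm{ur}}(H)$ the Frobenius element $\varphi_{H|U}\in H/U$ is the image of any $h\in H$ with $d_H(h)=\omega$; it generates the cyclic group $H/U$. A $G$-subgroup system is inertially finite if all members are inertially finite closed subgroups and $[H:I]<\infty$ for $I\in\mathfrak S_{\mathrm r}(H)$. Frobenius groups.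 $\Omega^+=\{n\omega:n\in\mathbb N_{>0}\}$; for $x\in\Omega^+$, $\mathrm{mult}(x)$ is the unique $n\in\mathbb N_{>0}$ with $x=n\omega$. For $n=\prod_pp^{n(p)}$ put $P(n)=\prod_{p\in P}p^{n(p)}$, $P'(n)=\prod_{p\notin P}p^{n(p)}$. For $H$ inertially finite, $\mathrm{Frob}_H=\{h\in H:d_H(h)\in\Omega^+\}$, a sub-semigroup of $H$; for $h\in\mathrm{Frob}_H$ write $P(d_H(h))=P(\mathrm{mult}(d_H(h)))$ and $P'(d_H(h))=P'(\mathrm{mult}(d_H(h)))$. A Frobenius lift of $\bar h\in H/U$ is an element of $\mathrm{Frob}_H$ mapping to $\bar h$ (it exists when $U$ is open in $H$). For $(H,U)\in\mathfrak E_{\mathrm b}$ and $h\in\mathrm{Frob}_H$, $\Sigma_{h,H|U}=\langle h\rangle_{\mathrm c}\cdot I_U$; when $U$ is open in $H$ this is the Frobenius group for $h$ relative to $U$, i.e. the unique open subgroup $\Sigma$ of $H$ with $h\in\Sigma$, $f_{H|\Sigma}=P(d_H(h))$ and $I_\Sigma=I_U$. Spectra. A two-dimensional $G$-subgroup system is a RIC-domain $\mathfrak E$ with $\mathfrak E_{\mathrm b}$ a set of pairs $(H,U)$ ($H$ closed subgroup of $G$, $U$ closed normal subgroup of $H$) with componentwise conjugation and $I\le H$, $V\le U$ for $(I,V)\in\mathfrak E_\star(H,U)$. $\mathfrak E^\flat_{\mathrm b}$ is the set of first components of $\mathfrak E_{\mathrm b}$, $\mathrm{Ext}(\mathfrak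 E,H)=\{U:(H,U)\in\mathfrak E_{\mathrm b}\}$, $\mathfrak E^\flat_\star(H)$ the set of first components of $\bigcup_U\mathfrak E_\star(H,U)$. $\mathfrak E$ is a $G$-spectrum if $\mathfrak E^\flat$ is a $G$-subgroup system, $(I,V)\in\mathfrak E_{\mathrm r}(H,U)$ implies $V=U$, and $[H:I]<\infty$ for $I\in\mathfrak E^\flat_{\mathrm r}(H)$. A Mackey cover of $\mathfrak E$ is a $G$-Mackey system $\mathfrak M$ with $\mathfrak E^\flat\le\mathfrak M$, $\mathrm{Ext}(\mathfrak E,H)\subseteq\mathfrak M_{\mathrm i}(H)$, and $V\in\mathfrak M_{\mathrm i}(U)$ whenever $(I,V)\in\mathfrak E_{\mathrm i}(H,U)$. Valuations. For inertially finite $\mathfrak M$ let $\boldsymbol\Omega_d\in\mathsf{Fct}(\mathfrak M,\mathsf{Ab})$ be: $\boldsymbol\Omega_d(H)=\Omega$, con $=\mathrm{id}$, $\mathrm{res}_{K,H}$ = multiplication by $e_{H|K}$, $\mathrm{ind}_{H,K}$ = multiplication by $f_{H|K}$. $\mathrm{Val}_d^{\Omega,\omega}(C)$ is the set of morphisms $v:C\to\boldsymbol\Omega_d$ with $\omega\in\mathrm{im}(v_H)$ for all $H\in\mathfrak M_{\mathrm b}$. A prime element of $C(H)$ is $\pi\in C(H)$ with $v_H(\pi)=\omega$. Fesenko--Neukirch datum on $\mathfrak E$: a pair $(C,v)$ with $C:\mathfrak M\to\mathsf{Ab}$ a cohomological Mackey functor on an arithmetic and inertially finite Mackey cover $\mathfrak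 M$ of $\mathfrak E$ and $v\in\mathrm{Val}_d^{\Omega,\omega}(C)$ such that (1) for each $(H,U)\in\mathfrak E_{\mathrm b}$ with $U\in\mathcal E^{\mathrm{ur}}(H)$: $\mathrm{im}(v_H)/[H:U]\,\mathrm{im}(v_U)$ has order $[H:U]$ and is generated by the image of $\omega$; $\mathrm{ind}^C_{H,U}:\ker(v_U)\to\ker(v_H)$ is surjective; $|C(H)/\mathrm{ind}^C_{H,U}C(U)|\le[H:U]$; (2) for each open subgroup $U$ of a group $H\in\mathfrak E^\flat_{\mathrm b}$ and each $V\in\mathcal E^{\mathrm{ur}}(U)$ the sequence $1\to\ker(v_U)\xrightarrow{\mathrm{res}_{V,U}}\ker(v_V)\xrightarrow{\mathrm{con}_{\varphi-1,V}}\ker(v_V)\xrightarrow{\mathrm{ind}_{U,V}}\ker(v_U)\to1$ is exact, where $\varphi=\varphi_{U|V}$ and $\mathrm{con}_{\varphi-1,V}(x)=\mathrm{con}_{\tilde\varphi,V}(x)x^{-1}$ for any representative $\tilde\varphi\in U$ of $\varphi$. Functors on $\mathfrak E$. $\pi_{\mathfrak K}(H,U)=(H/U)^{\mathrm{ab}}$, con induced by conjugation, $\mathrm{ind}_{(H,U),(I,V)}$ induced by the inclusion $I\to H$, $\mathrm{res}_{(I,U),(H,U)}:(H/U)^{\mathrm{ab}}\to(I/U)^{\mathrm{ab}}$ the group-theoretic transfer. $\widehat{\mathrm H}^0_{\mathfrak E}(C)(H,U)=C(H)/\mathrm{ind}^C_{H,U}C(U)$ with structure maps induced by those of $C$ on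 first components (well defined).
   Formalization: The claims about Υ are made for the pairs (H,U) of the spectrum with U open in H; for U merely closed, C(Σ_{h,H|U}) may be undefined, and Υ need not be continuous into the discrete target (e.g. for a Lubin–Tate tower). *)

theory Defs
  imports
    "HOL-Algebra.Exact_Sequence"
    "HOL-Algebra.FiniteProduct"
    "HOL-Algebra.Product_Groups"
    "HOL-Computational_Algebra.Primes"
    "HOL-Analysis.Analysis"
begin

section \<open>Topological groups and their quotients\<close>

text \<open>All groups, including \<open>\<Omega>\<close>, are written multiplicatively.\<close>

record 'a tgroup = "'a monoid" +
  topo :: "'a topology"

locale topological_group = group G for G :: "'a tgroup" (structure) +
  assumes topspace_topo: "topspace (topo G) = carrier G"
    and continuous_mult:
      "continuous_map (prod_topology (topo G) (topo G)) (topo G) (\<lambda>(x, y). x \<otimes> y)"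
    and continuous_inv: "continuous_map (topo G) (topo G) (m_inv G)"

definition tgroup_hom :: "'a tgroup \<Rightarrow> 'b tgroup \<Rightarrow> ('a \<Rightarrow> 'b) set" where
  "tgroup_hom A B = {f \<in> hom A B. continuous_map (topo A) (topo B) f}"

definition tgroup_isomorphic :: "'a tgroup \<Rightarrow> 'b tgroup \<Rightarrow> bool" where
  "tgroup_isomorphic A B \<longleftrightarrow> (\<exists>f \<in> iso A B. homeomorphic_map (topo A) (topo B) f)"

definition with_topology :: "('a, 'z) monoid_scheme \<Rightarrow> 'a topology \<Rightarrow> 'a tgroup" where
  "with_topology A T =
    \<lparr>carrier = carrier A, monoid.mult = monoid.mult A, one = one A, topo = T\<rparr>"

definition discrete_tgroup :: "('a, 'z) monoid_scheme \<Rightarrow> 'a tgroup" where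
  "discrete_tgroup A = with_topology A (discrete_topology (carrier A))"

definition sub_tgroup :: "'a tgroup \<Rightarrow> 'a set \<Rightarrow> 'a tgroup" where
  "sub_tgroup G H = G\<lparr>carrier := H, topo := subtopology (topo G) H\<rparr>"

definition quotient_topology :: "'a topology \<Rightarrow> ('a \<Rightarrow> 'b) \<Rightarrow> 'b topology" where
  "quotient_topology X f =
    topology (\<lambda>S. S \<subseteq> f ` topspace X \<and> openin X {x \<in> topspace X. f x \<in> S})"

lemma openin_quotient_topology:
  "openin (quotient_topology X f) S \<longleftrightarrow>
    S \<subseteq> f ` topspace X \<and> openin X {x \<in> topspace X. f x \<in> S}"
proof -
  have 1: "{x \<in> topspace X. f x \<in> S \<inter> T} =
      {x \<in> topspace X. f x \<in> S} \<inter> {x \<in> topspace X. f x \<in> T}" for S T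
    by auto
  have 2: "{x \<in> topspace X. f x \<in> \<Union>K} = \<Union>((\<lambda>S. {x \<in> topspace X. f x \<in> S}) ` K)" for K
    by auto
  have "istopology (\<lambda>S. S \<subseteq> f ` topspace X \<and> openin X {x \<in> topspace X. f x \<in> S})"
    unfolding istopology_def 1 2 by (auto intro!: openin_Int openin_Union)
  then show ?thesis
    by (simp add: quotient_topology_def topology_inverse')
qed

lemma quotient_map_quotient_topology: "quotient_map X (quotient_topology X f) f"
proof -
  have "openin X {x \<in> topspace X. f x \<in> f ` topspace X}"
    by (metis (no_types, lifting) Collect_cong Collect_mem_eq imageI openin_topspace)
  then have "topspace (quotient_topology X f) = f ` topspace X"
    by (metis openin_quotient_topology openin_subset openin_topspace subset_antisym subset_refl)
  then show ?thesis
    by (auto simp: quotient_map_def openin_quotient_topology)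
qed

definition tquotient :: "'a tgroup \<Rightarrow> 'a set \<Rightarrow> 'a set tgroup" where
  "tquotient G N = with_topology (G Mod N) (quotient_topology (topo G) (\<lambda>x. N #>\<^bsub>G\<^esub> x))"

text \<open>The map \<open>A/M \<rightarrow> B/N\<close> induced by a map \<open>f : A \<rightarrow> B\<close>: the coset \<open>X\<close> goes to
  the coset \<open>N f(X)\<close>.\<close>

definition quotient_fun :: "('b, 'z) monoid_scheme \<Rightarrow> 'b set \<Rightarrow> ('a \<Rightarrow> 'b) \<Rightarrow> 'a set \<Rightarrow> 'b set" where
  "quotient_fun B N f X = N <#>\<^bsub>B\<^esub> (f ` X)"

definition closed_commutator :: "'a tgroup \<Rightarrow> 'a set" where
  "closed_commutator Q = topo Q closure_of derived Q (carrier Q)"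

definition abelianization :: "'a tgroup \<Rightarrow> 'a set tgroup" where
  "abelianization Q = tquotient Q (closed_commutator Q)"

definition closed_subgroup :: "'a tgroup \<Rightarrow> 'a set \<Rightarrow> bool" where
  "closed_subgroup G H \<longleftrightarrow> subgroup H G \<and> closedin (topo G) H"

definition open_in_group :: "'a tgroup \<Rightarrow> 'a set \<Rightarrow> 'a set \<Rightarrow> bool" where
  "open_in_group G H U \<longleftrightarrow> subgroup U G \<and> U \<subseteq> H \<and> openin (subtopology (topo G) H) U"

definition normal_in :: "'a tgroup \<Rightarrow> 'a set \<Rightarrow> 'a set \<Rightarrow> bool" where
  "normal_in G H U \<longleftrightarrow> U \<lhd> (G\<lparr>carrier := H\<rparr>)"

definition finite_index :: "('a, 'z) monoid_scheme \<Rightarrow> 'a set \<Rightarrow> 'a set \<Rightarrow> bool" where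
  "finite_index G H K \<longleftrightarrow> finite (rcosets\<^bsub>G\<lparr>carrier := H\<rparr>\<^esub> K)"

definition index :: "('a, 'z) monoid_scheme \<Rightarrow> 'a set \<Rightarrow> 'a set \<Rightarrow> nat" where
  "index G H K = card (rcosets\<^bsub>G\<lparr>carrier := H\<rparr>\<^esub> K)"

definition conj_set :: "('a, 'z) monoid_scheme \<Rightarrow> 'a \<Rightarrow> 'a set \<Rightarrow> 'a set" where
  "conj_set G g H = g <#\<^bsub>G\<^esub> H #>\<^bsub>G\<^esub> inv\<^bsub>G\<^esub> g"

definition double_cosets :: "('a, 'z) monoid_scheme \<Rightarrow> 'a set \<Rightarrow> 'a set \<Rightarrow> 'a set \<Rightarrow> 'a set set" where
  "double_cosets G H I J = (\<lambda>h. I #>\<^bsub>G\<^esub> h <#>\<^bsub>G\<^esub> J) ` H"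


section \<open>Pro-\<open>P\<close> groups and \<open>\<int>\<^sub>P\<close>\<close>

definition profinite_group :: "'a tgroup \<Rightarrow> bool" where
  "profinite_group G \<longleftrightarrow> topological_group G \<and> compact_space (topo G) \<and> Hausdorff_space (topo G) \<and>
    (\<forall>S. connectedin (topo G) S \<longrightarrow> (\<exists>a. S \<subseteq> {a}))"

definition pro_group :: "nat set \<Rightarrow> 'a tgroup \<Rightarrow> bool" where
  "pro_group P G \<longleftrightarrow> profinite_group G \<and>
    (\<forall>N. N \<lhd> G \<and> openin (topo G) N \<longrightarrow>
      (\<forall>p. prime p \<and> p dvd index G (carrier G) N \<longrightarrow> p \<in> P))"

text \<open>\<open>\<int>\<^sub>p\<close> as the inverse limit of the groups \<open>\<int>/p\<^sup>n\<close>, with residues represented in \<open>{0..<p\<^sup>n}\<close>.\<close>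

definition padic_integers :: "nat \<Rightarrow> (nat \<Rightarrow> int) tgroup" where
  "padic_integers p =
    (let Z = {x \<in> carrier (product_group UNIV (\<lambda>n. integer_mod_group (p ^ n))).
                \<forall>n. x (Suc n) mod int (p ^ n) = x n}
     in with_topology ((product_group UNIV (\<lambda>n. integer_mod_group (p ^ n)))\<lparr>carrier := Z\<rparr>)
          (subtopology (product_topology (\<lambda>n. discrete_topology UNIV) UNIV) Z))"

definition Z_P :: "nat set \<Rightarrow> (nat \<Rightarrow> nat \<Rightarrow> int) tgroup" where
  "Z_P P = with_topology (product_group P padic_integers)
             (product_topology (\<lambda>p. topo (padic_integers p)) P)"

definition topological_generator :: "'w tgroup \<Rightarrow> 'w \<Rightarrow> bool" where
  "topological_generator \<Omega> \<omega> \<longleftrightarrow>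
    \<omega> \<in> carrier \<Omega> \<and> topo \<Omega> closure_of generate \<Omega> {\<omega>} = carrier \<Omega>"

definition P'_part :: "nat set \<Rightarrow> nat \<Rightarrow> nat" where
  "P'_part P n = (\<Prod>p \<in> prime_factors n - P. p ^ multiplicity p n)"


section \<open>RIC-domains and RIC-functors\<close>

text \<open>The group and its action are separate arguments of the predicates below, since
  all domains of interest use conjugation.\<close>

record 'x ric_dom =
  base :: "'x set"
  rdom :: "'x \<Rightarrow> 'x set"
  idom :: "'x \<Rightarrow> 'x set"

locale ric_domain =
  fixes G :: "'g tgroup" and act :: "'g \<Rightarrow> 'x \<Rightarrow> 'x" and D :: "'x ric_dom"
  assumes base_nonempty: "base D \<noteq> {}"
    and act_closed: "\<lbrakk>g \<in> carrier G; x \<in> base D\<rbrakk> \<Longrightarrow> act g x \<in> base D"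
    and act_one: "x \<in> base D \<Longrightarrow> act \<one>\<^bsub>G\<^esub> x = x"
    and act_mult: "\<lbrakk>g \<in> carrier G; g' \<in> carrier G; x \<in> base D\<rbrakk> \<Longrightarrow>
      act (g' \<otimes>\<^bsub>G\<^esub> g) x = act g' (act g x)"
    and rdom_sub: "x \<in> base D \<Longrightarrow> rdom D x \<subseteq> base D"
    and idom_sub: "x \<in> base D \<Longrightarrow> idom D x \<subseteq> base D"
    and rdom_refl: "x \<in> base D \<Longrightarrow> x \<in> rdom D x"
    and idom_refl: "x \<in> base D \<Longrightarrow> x \<in> idom D x"
    and rdom_trans: "\<lbrakk>x \<in> base D; y \<in> rdom D x\<rbrakk> \<Longrightarrow> rdom D y \<subseteq> rdom D x"
    and idom_trans: "\<lbrakk>x \<in> base D; y \<in> idom D x\<rbrakk> \<Longrightarrow> idom D y \<subseteq> idom D x"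
    and rdom_act: "\<lbrakk>g \<in> carrier G; x \<in> base D\<rbrakk> \<Longrightarrow> act g ` rdom D x = rdom D (act g x)"
    and idom_act: "\<lbrakk>g \<in> carrier G; x \<in> base D\<rbrakk> \<Longrightarrow> act g ` idom D x = idom D (act g x)"

text \<open>\<open>Res \<Phi> y x : \<Phi>(x) \<rightarrow> \<Phi>(y)\<close>, \<open>Ind \<Phi> x y : \<Phi>(y) \<rightarrow> \<Phi>(x)\<close> and
  \<open>Con \<Phi> g x : \<Phi>(x) \<rightarrow> \<Phi>(act g x)\<close>; equality of morphisms is equality on the carrier of the source.\<close>

record ('g, 'x, 'c) ric_fun =
  Obj :: "'x \<Rightarrow> 'c tgroup"
  Res :: "'x \<Rightarrow> 'x \<Rightarrow> 'c \<Rightarrow> 'c"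
  Ind :: "'x \<Rightarrow> 'x \<Rightarrow> 'c \<Rightarrow> 'c"
  Con :: "'g \<Rightarrow> 'x \<Rightarrow> 'c \<Rightarrow> 'c"

locale TAb_functor =
  fixes G :: "'g tgroup" and act :: "'g \<Rightarrow> 'x \<Rightarrow> 'x" and D :: "'x ric_dom"
    and \<Phi> :: "('g, 'x, 'c) ric_fun"
  assumes Obj_topological_group: "x \<in> base D \<Longrightarrow> topological_group (Obj \<Phi> x)"
    and Obj_comm_group: "x \<in> base D \<Longrightarrow> comm_group (Obj \<Phi> x)"
    and Res_hom: "\<lbrakk>x \<in> base D; y \<in> rdom D x\<rbrakk> \<Longrightarrow> Res \<Phi> y x \<in> tgroup_hom (Obj \<Phi> x) (Obj \<Phi> y)"
    and Ind_hom: "\<lbrakk>x \<in> base D; y \<in> idom D x\<rbrakk> \<Longrightarrow> Ind \<Phi> x y \<in> tgroup_hom (Obj \<Phi> y) (Obj \<Phi> x)"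
    and Con_hom: "\<lbrakk>g \<in> carrier G; x \<in> base D\<rbrakk> \<Longrightarrow>
      Con \<Phi> g x \<in> tgroup_hom (Obj \<Phi> x) (Obj \<Phi> (act g x))"
    and Res_id: "\<lbrakk>x \<in> base D; a \<in> carrier (Obj \<Phi> x)\<rbrakk> \<Longrightarrow> Res \<Phi> x x a = a"
    and Ind_id: "\<lbrakk>x \<in> base D; a \<in> carrier (Obj \<Phi> x)\<rbrakk> \<Longrightarrow> Ind \<Phi> x x a = a"
    and Con_id: "\<lbrakk>x \<in> base D; a \<in> carrier (Obj \<Phi> x)\<rbrakk> \<Longrightarrow> Con \<Phi> \<one>\<^bsub>G\<^esub> x a = a"
    and Res_Res: "\<lbrakk>x \<in> base D; y \<in> rdom D x; z \<in> rdom D y; a \<in> carrier (Obj \<Phi> x)\<rbrakk> \<Longrightarrow>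
      Res \<Phi> z y (Res \<Phi> y x a) = Res \<Phi> z x a"
    and Ind_Ind: "\<lbrakk>x \<in> base D; y \<in> idom D x; z \<in> idom D y; a \<in> carrier (Obj \<Phi> z)\<rbrakk> \<Longrightarrow>
      Ind \<Phi> x y (Ind \<Phi> y z a) = Ind \<Phi> x z a"
    and Con_Con: "\<lbrakk>g \<in> carrier G; g' \<in> carrier G; x \<in> base D; a \<in> carrier (Obj \<Phi> x)\<rbrakk> \<Longrightarrow>
      Con \<Phi> g' (act g x) (Con \<Phi> g x a) = Con \<Phi> (g' \<otimes>\<^bsub>G\<^esub> g) x a"
    and Con_Res: "\<lbrakk>g \<in> carrier G; x \<in> base D; y \<in> rdom D x; a \<in> carrier (Obj \<Phi> x)\<rbrakk> \<Longrightarrow>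
      Con \<Phi> g y (Res \<Phi> y x a) = Res \<Phi> (act g y) (act g x) (Con \<Phi> g x a)"
    and Con_Ind: "\<lbrakk>g \<in> carrier G; x \<in> base D; y \<in> idom D x; a \<in> carrier (Obj \<Phi> y)\<rbrakk> \<Longrightarrow>
      Con \<Phi> g x (Ind \<Phi> x y a) = Ind \<Phi> (act g x) (act g y) (Con \<Phi> g y a)"

text \<open>A functor to abelian groups is a functor to topological abelian groups with discrete values.\<close>

definition Ab_functor ::
  "'g tgroup \<Rightarrow> ('g \<Rightarrow> 'x \<Rightarrow> 'x) \<Rightarrow> 'x ric_dom \<Rightarrow> ('g, 'x, 'c) ric_fun \<Rightarrow> bool" where
  "Ab_functor G act D \<Phi> \<longleftrightarrow> TAb_functor G act D \<Phi> \<and>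
    (\<forall>x \<in> base D. topo (Obj \<Phi> x) = discrete_topology (carrier (Obj \<Phi> x)))"

text \<open>The morphisms \<open>\<Phi> \<rightarrow> \<Psi>\<close> in \<open>Fct(D, TAb)\<close>; this includes that \<open>\<Phi>\<close> and \<open>\<Psi>\<close> are RIC-functors.\<close>

definition Fct_hom ::
  "'g tgroup \<Rightarrow> ('g \<Rightarrow> 'x \<Rightarrow> 'x) \<Rightarrow> 'x ric_dom \<Rightarrow> ('g, 'x, 'b) ric_fun \<Rightarrow> ('g, 'x, 'c) ric_fun
    \<Rightarrow> ('x \<Rightarrow> 'b \<Rightarrow> 'c) set" where
  "Fct_hom G act D \<Phi> \<Psi> = {\<phi>. TAb_functor G act D \<Phi> \<and> TAb_functor G act D \<Psi> \<and>
    (\<forall>x \<in> base D. \<phi> x \<in> tgroup_hom (Obj \<Phi> x) (Obj \<Psi> x)) \<and>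
    (\<forall>x \<in> base D. \<forall>y \<in> rdom D x. \<forall>a \<in> carrier (Obj \<Phi> x).
      \<phi> y (Res \<Phi> y x a) = Res \<Psi> y x (\<phi> x a)) \<and>
    (\<forall>x \<in> base D. \<forall>y \<in> idom D x. \<forall>a \<in> carrier (Obj \<Phi> y).
      \<phi> x (Ind \<Phi> x y a) = Ind \<Psi> x y (\<phi> y a)) \<and>
    (\<forall>g \<in> carrier G. \<forall>x \<in> base D. \<forall>a \<in> carrier (Obj \<Phi> x).
      \<phi> (act g x) (Con \<Phi> g x a) = Con \<Psi> g x (\<phi> x a))}"


section \<open>Subgroup systems and Mackey functors\<close>

definition subgroup_system :: "'g tgroup \<Rightarrow> 'g set ric_dom \<Rightarrow> bool" where
  "subgroup_system G S \<longleftrightarrow> ric_domain G (conj_set G) S \<and>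
    (\<forall>H \<in> base S. subgroup H G \<and> (\<forall>I \<in> rdom S H \<union> idom S H. I \<subseteq> H))"

definition subsystem :: "'g set ric_dom \<Rightarrow> 'g set ric_dom \<Rightarrow> bool" where
  "subsystem S' S \<longleftrightarrow> base S' \<subseteq> base S \<and>
    (\<forall>H \<in> base S'. rdom S' H \<subseteq> rdom S H \<and> idom S' H \<subseteq> idom S H)"

definition arithmetic :: "'g tgroup \<Rightarrow> 'g set ric_dom \<Rightarrow> bool" where
  "arithmetic G S \<longleftrightarrow>
    (\<forall>H \<in> base S. \<forall>I. open_in_group G H I \<longrightarrow> I \<in> rdom S H \<and> I \<in> idom S H)"

definition mackey_system :: "'g tgroup \<Rightarrow> 'g set ric_dom \<Rightarrow> bool" where
  "mackey_system G M \<longleftrightarrow> subgroup_system G M \<and>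
    (\<forall>H \<in> base M. \<forall>I \<in> rdom M H. \<forall>J \<in> idom M H.
      finite (double_cosets G H I J) \<and> I \<inter> J \<in> rdom M J \<and> I \<inter> J \<in> idom M I)"

text \<open>In the double coset formula \<open>R\<close> is an arbitrary set of representatives of \<open>I\H/J\<close>.\<close>

definition cohomological_mackey_functor ::
  "'g tgroup \<Rightarrow> 'g set ric_dom \<Rightarrow> ('g, 'g set, 'c) ric_fun \<Rightarrow> bool" where
  "cohomological_mackey_functor G M C \<longleftrightarrow> Ab_functor G (conj_set G) M C \<and>
    (\<forall>H \<in> base M. \<forall>h \<in> H. \<forall>x \<in> carrier (Obj C H). Con C h H x = x) \<and>
    (\<forall>H \<in> base M. \<forall>I \<in> rdom M H. \<forall>J \<in> idom M H. \<forall>x \<in> carrier (Obj C J).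
      \<forall>R \<subseteq> H. bij_betw (\<lambda>h. I #>\<^bsub>G\<^esub> h <#>\<^bsub>G\<^esub> J) R (double_cosets G H I J) \<longrightarrow>
        Res C I H (Ind C H J x) =
          (\<Otimes>\<^bsub>Obj C I\<^esub> h \<in> R.
            Ind C I (I \<inter> conj_set G h J)
              (Con C h (conj_set G (inv\<^bsub>G\<^esub> h) I \<inter> J)
                (Res C (conj_set G (inv\<^bsub>G\<^esub> h) I \<inter> J) J x)))) \<and>
    (\<forall>H \<in> base M. \<forall>I \<in> rdom M H \<inter> idom M H. \<forall>x \<in> carrier (Obj C H).
      Ind C H I (Res C I H x) = x [^]\<^bsub>Obj C H\<^esub> index G H I)"


section \<open>Ramification and Frobenius elements\<close>

definition inertia :: "'g tgroup \<Rightarrow> 'w tgroup \<Rightarrow> ('g \<Rightarrow> 'w) \<Rightarrow> 'g set \<Rightarrow> 'g set" where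
  "inertia G \<Omega> d H = H \<inter> kernel G \<Omega> d"

definition rel_inertia_deg :: "'w tgroup \<Rightarrow> ('g \<Rightarrow> 'w) \<Rightarrow> 'g set \<Rightarrow> 'g set \<Rightarrow> nat" where
  "rel_inertia_deg \<Omega> d H K = index \<Omega> (d ` H) (d ` K)"

definition inertia_deg :: "'g tgroup \<Rightarrow> 'w tgroup \<Rightarrow> ('g \<Rightarrow> 'w) \<Rightarrow> 'g set \<Rightarrow> nat" where
  "inertia_deg G \<Omega> d H = rel_inertia_deg \<Omega> d (carrier G) H"

definition rel_ram_index :: "'g tgroup \<Rightarrow> 'w tgroup \<Rightarrow> ('g \<Rightarrow> 'w) \<Rightarrow> 'g set \<Rightarrow> 'g set \<Rightarrow> nat" where
  "rel_ram_index G \<Omega> d H K = index G (inertia G \<Omega> d H) (inertia G \<Omega> d K)"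

definition inertially_finite :: "'g tgroup \<Rightarrow> 'w tgroup \<Rightarrow> ('g \<Rightarrow> 'w) \<Rightarrow> 'g set \<Rightarrow> bool" where
  "inertially_finite G \<Omega> d H \<longleftrightarrow>
    closed_subgroup G H \<and> finite_index \<Omega> (d ` carrier G) (d ` H)"

definition inertially_finite_system ::
  "'g tgroup \<Rightarrow> 'w tgroup \<Rightarrow> ('g \<Rightarrow> 'w) \<Rightarrow> 'g set ric_dom \<Rightarrow> bool" where
  "inertially_finite_system G \<Omega> d S \<longleftrightarrow>
    (\<forall>H \<in> base S. inertially_finite G \<Omega> d H \<and> (\<forall>I \<in> rdom S H. finite_index G H I))"

text \<open>\<open>d\<^sub>H = d/f\<^sub>H\<close>; division by \<open>f\<^sub>H\<close> is unique because \<open>\<Omega>\<close> is torsion-free.\<close>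

definition d_rel :: "'g tgroup \<Rightarrow> 'w tgroup \<Rightarrow> ('g \<Rightarrow> 'w) \<Rightarrow> 'g set \<Rightarrow> 'g \<Rightarrow> 'w" where
  "d_rel G \<Omega> d H h = (THE y. y \<in> carrier \<Omega> \<and> y [^]\<^bsub>\<Omega>\<^esub> inertia_deg G \<Omega> d H = d h)"

definition unramified :: "'g tgroup \<Rightarrow> 'w tgroup \<Rightarrow> ('g \<Rightarrow> 'w) \<Rightarrow> 'g set \<Rightarrow> 'g set set" where
  "unramified G \<Omega> d H =
    {U. open_in_group G H U \<and> normal_in G H U \<and> inertia G \<Omega> d H \<subseteq> U}"

definition frobenius ::
  "'g tgroup \<Rightarrow> 'w tgroup \<Rightarrow> 'w \<Rightarrow> ('g \<Rightarrow> 'w) \<Rightarrow> 'g set \<Rightarrow> 'g set \<Rightarrow> 'g set" where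
  "frobenius G \<Omega> \<omega> d H U = (THE c. \<exists>h \<in> H. d_rel G \<Omega> d H h = \<omega> \<and> c = U #>\<^bsub>G\<^esub> h)"

definition Omega_plus :: "'w tgroup \<Rightarrow> 'w \<Rightarrow> 'w set" where
  "Omega_plus \<Omega> \<omega> = {\<omega> [^]\<^bsub>\<Omega>\<^esub> n | n :: nat. n > 0}"

definition mult_of :: "'w tgroup \<Rightarrow> 'w \<Rightarrow> 'w \<Rightarrow> nat" where
  "mult_of \<Omega> \<omega> x = (THE n. n > 0 \<and> x = \<omega> [^]\<^bsub>\<Omega>\<^esub> n)"

definition Frob :: "'g tgroup \<Rightarrow> 'w tgroup \<Rightarrow> 'w \<Rightarrow> ('g \<Rightarrow> 'w) \<Rightarrow> 'g set \<Rightarrow> 'g set" where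
  "Frob G \<Omega> \<omega> d H = {h \<in> H. d_rel G \<Omega> d H h \<in> Omega_plus \<Omega> \<omega>}"

definition frobenius_group ::
  "'g tgroup \<Rightarrow> 'w tgroup \<Rightarrow> ('g \<Rightarrow> 'w) \<Rightarrow> 'g \<Rightarrow> 'g set \<Rightarrow> 'g set" where
  "frobenius_group G \<Omega> d h U =
    (topo G closure_of generate G {h}) <#>\<^bsub>G\<^esub> inertia G \<Omega> d U"


section \<open>Spectra\<close>

type_synonym 'g pair_dom = "('g set \<times> 'g set) ric_dom"

definition conj_pair :: "'g tgroup \<Rightarrow> 'g \<Rightarrow> 'g set \<times> 'g set \<Rightarrow> 'g set \<times> 'g set" where
  "conj_pair G g = map_prod (conj_set G g) (conj_set G g)"

definition two_dim_system :: "'g tgroup \<Rightarrow> 'g pair_dom \<Rightarrow> bool" where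
  "two_dim_system G E \<longleftrightarrow> ric_domain G (conj_pair G) E \<and>
    (\<forall>(H, U) \<in> base E. closed_subgroup G H \<and> closed_subgroup G U \<and> normal_in G H U \<and>
      (\<forall>(I, V) \<in> rdom E (H, U) \<union> idom E (H, U). I \<subseteq> H \<and> V \<subseteq> U))"

definition Ext :: "'g pair_dom \<Rightarrow> 'g set \<Rightarrow> 'g set set" where
  "Ext E H = {U. (H, U) \<in> base E}"

definition flat :: "'g pair_dom \<Rightarrow> 'g set ric_dom" where
  "flat E = \<lparr>base = fst ` base E,
    rdom = (\<lambda>H. fst ` (\<Union>U \<in> Ext E H. rdom E (H, U))),
    idom = (\<lambda>H. fst ` (\<Union>U \<in> Ext E H. idom E (H, U)))\<rparr>"

definition spectrum :: "'g tgroup \<Rightarrow> 'g pair_dom \<Rightarrow> bool" where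
  "spectrum G E \<longleftrightarrow> two_dim_system G E \<and> subgroup_system G (flat E) \<and>
    (\<forall>(H, U) \<in> base E. \<forall>(I, V) \<in> rdom E (H, U). V = U) \<and>
    (\<forall>H \<in> base (flat E). \<forall>I \<in> rdom (flat E) H. finite_index G H I)"

definition mackey_cover :: "'g tgroup \<Rightarrow> 'g pair_dom \<Rightarrow> 'g set ric_dom \<Rightarrow> bool" where
  "mackey_cover G E M \<longleftrightarrow> mackey_system G M \<and> subsystem (flat E) M \<and>
    (\<forall>H \<in> base (flat E). Ext E H \<subseteq> idom M H) \<and>
    (\<forall>(H, U) \<in> base E. \<forall>(I, V) \<in> idom E (H, U). V \<in> idom M U)"

text \<open>The part of \<open>E\<close> consisting of the pairs \<open>(H, U)\<close> with \<open>U\<close> open in \<open>H\<close>. If \<open>U\<close> is only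
  closed, then \<open>\<langle>h\<rangle>\<^sub>c I\<^sub>U\<close> need not be open in \<open>H\<close> and need not belong to the Mackey cover, and \<open>H/U\<close>
  may be infinite while the target of the reciprocity map is discrete.\<close>

definition open_pairs :: "'g tgroup \<Rightarrow> ('g set \<times> 'g set) set" where
  "open_pairs G = {(H, U). open_in_group G H U}"

definition open_part :: "'g tgroup \<Rightarrow> 'g pair_dom \<Rightarrow> 'g pair_dom" where
  "open_part G E = \<lparr>base = base E \<inter> open_pairs G,
    rdom = (\<lambda>x. rdom E x \<inter> open_pairs G), idom = (\<lambda>x. idom E x \<inter> open_pairs G)\<rparr>"

lemma Fct_hom_open_part:
  assumes E: "ric_domain G (conj_pair G) E" and sub: "base E \<subseteq> open_pairs G"
  shows "Fct_hom G (conj_pair G) (open_part G E) \<Phi> \<Psi> = Fct_hom G (conj_pair G) E \<Phi> \<Psi>"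
proof -
  interpret ric_domain G "conj_pair G" E by fact
  have b: "base (open_part G E) = base E"
    using sub by (auto simp: open_part_def)
  have r: "rdom (open_part G E) x = rdom E x" if "x \<in> base E" for x
    using sub rdom_sub[OF that] by (auto simp: open_part_def)
  have i: "idom (open_part G E) x = idom E x" if "x \<in> base E" for x
    using sub idom_sub[OF that] by (auto simp: open_part_def)
  have T: "TAb_functor G (conj_pair G) (open_part G E) X = TAb_functor G (conj_pair G) E X"
    for X :: "('a, 'a set \<times> 'a set, 'c) ric_fun"
    unfolding TAb_functor_def b
    using r i rdom_sub idom_sub by (smt (verit, ccfv_threshold) subsetD)
  have T': "TAb_functor G (conj_pair G) (open_part G E) X = TAb_functor G (conj_pair G) E X"
    for X :: "('a, 'a set \<times> 'a set, 'b) ric_fun"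
    unfolding TAb_functor_def b
    using r i rdom_sub idom_sub by (smt (verit, ccfv_threshold) subsetD)
  show ?thesis
    unfolding Fct_hom_def T T' b by (simp add: r i cong: ball_cong)
qed


section \<open>Valuations and Fesenko--Neukirch data\<close>

definition Omega_functor ::
  "'g tgroup \<Rightarrow> 'w tgroup \<Rightarrow> ('g \<Rightarrow> 'w) \<Rightarrow> ('g, 'g set, 'w) ric_fun" where
  "Omega_functor G \<Omega> d = \<lparr>Obj = (\<lambda>H. discrete_tgroup \<Omega>),
    Res = (\<lambda>K H x. x [^]\<^bsub>\<Omega>\<^esub> rel_ram_index G \<Omega> d H K),
    Ind = (\<lambda>H K x. x [^]\<^bsub>\<Omega>\<^esub> rel_inertia_deg \<Omega> d H K),
    Con = (\<lambda>g H x. x)\<rparr>"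

definition valuations ::
  "'g tgroup \<Rightarrow> 'w tgroup \<Rightarrow> 'w \<Rightarrow> ('g \<Rightarrow> 'w) \<Rightarrow> 'g set ric_dom \<Rightarrow> ('g, 'g set, 'c) ric_fun
    \<Rightarrow> ('g set \<Rightarrow> 'c \<Rightarrow> 'w) set" where
  "valuations G \<Omega> \<omega> d M C = {v \<in> Fct_hom G (conj_set G) M C (Omega_functor G \<Omega> d).
    \<forall>H \<in> base M. \<omega> \<in> v H ` carrier (Obj C H)}"

definition prime_elements ::
  "'w \<Rightarrow> ('g, 'g set, 'c) ric_fun \<Rightarrow> ('g set \<Rightarrow> 'c \<Rightarrow> 'w) \<Rightarrow> 'g set \<Rightarrow> 'c set" where
  "prime_elements \<omega> C v H = {\<pi> \<in> carrier (Obj C H). v H \<pi> = \<omega>}"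

definition ind_image :: "('g, 'g set, 'c) ric_fun \<Rightarrow> 'g set \<Rightarrow> 'g set \<Rightarrow> 'c set" where
  "ind_image C H U = Ind C H U ` carrier (Obj C U)"

definition val_image ::
  "('g, 'g set, 'c) ric_fun \<Rightarrow> ('g set \<Rightarrow> 'c \<Rightarrow> 'w) \<Rightarrow> 'g set \<Rightarrow> 'w set" where
  "val_image C v H = v H ` carrier (Obj C H)"

definition val_kernel ::
  "'w tgroup \<Rightarrow> ('g, 'g set, 'c) ric_fun \<Rightarrow> ('g set \<Rightarrow> 'c \<Rightarrow> 'w) \<Rightarrow> 'g set \<Rightarrow> 'c monoid" where
  "val_kernel \<Omega> C v H = \<lparr>carrier = kernel (Obj C H) \<Omega> (v H),
    monoid.mult = monoid.mult (Obj C H), one = one (Obj C H)\<rparr>"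

definition FN_unramified_condition ::
  "'g tgroup \<Rightarrow> 'w tgroup \<Rightarrow> 'w \<Rightarrow> ('g, 'g set, 'c) ric_fun \<Rightarrow> ('g set \<Rightarrow> 'c \<Rightarrow> 'w)
    \<Rightarrow> 'g set \<Rightarrow> 'g set \<Rightarrow> bool" where
  "FN_unramified_condition G \<Omega> \<omega> C v H U \<longleftrightarrow>
    (let n = index G H U;
         N = (\<lambda>x. x [^]\<^bsub>\<Omega>\<^esub> n) ` val_image C v U;
         Q = (\<Omega>\<lparr>carrier := val_image C v H\<rparr>) Mod N;
         B = Obj C H Mod ind_image C H U
     in Coset.order Q = n \<and> carrier Q = generate Q {N #>\<^bsub>\<Omega>\<^esub> \<omega>} \<and>
        Ind C H U ` carrier (val_kernel \<Omega> C v U) = carrier (val_kernel \<Omega> C v H) \<and>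
        finite (carrier B) \<and> Coset.order B \<le> n)"

text \<open>\<open>exact_seq\<close> lists groups and maps from right to left.\<close>

definition FN_exactness_condition ::
  "'g tgroup \<Rightarrow> 'w tgroup \<Rightarrow> 'w \<Rightarrow> ('g \<Rightarrow> 'w) \<Rightarrow> ('g, 'g set, 'c) ric_fun
    \<Rightarrow> ('g set \<Rightarrow> 'c \<Rightarrow> 'w) \<Rightarrow> 'g set \<Rightarrow> 'g set \<Rightarrow> bool" where
  "FN_exactness_condition G \<Omega> \<omega> d C v U V \<longleftrightarrow>
    (\<forall>\<phi> \<in> frobenius G \<Omega> \<omega> d U V.
      exact_seq
        ([singleton_group \<one>\<^bsub>Obj C U\<^esub>, val_kernel \<Omega> C v U, val_kernel \<Omega> C v V,
          val_kernel \<Omega> C v V, val_kernel \<Omega> C v U, singleton_group \<one>\<^bsub>Obj C U\<^esub>],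
         [\<lambda>_. \<one>\<^bsub>Obj C U\<^esub>, Ind C U V,
          \<lambda>x. Con C \<phi> V x \<otimes>\<^bsub>Obj C V\<^esub> inv\<^bsub>Obj C V\<^esub> x,
          Res C V U, \<lambda>_. \<one>\<^bsub>Obj C U\<^esub>]))"

definition FN_datum ::
  "'g tgroup \<Rightarrow> 'w tgroup \<Rightarrow> 'w \<Rightarrow> ('g \<Rightarrow> 'w) \<Rightarrow> 'g pair_dom \<Rightarrow> 'g set ric_dom
    \<Rightarrow> ('g, 'g set, 'c) ric_fun \<Rightarrow> ('g set \<Rightarrow> 'c \<Rightarrow> 'w) \<Rightarrow> bool" where
  "FN_datum G \<Omega> \<omega> d E M C v \<longleftrightarrow>
    mackey_cover G E M \<and> arithmetic G M \<and> inertially_finite_system G \<Omega> d M \<and>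
    cohomological_mackey_functor G M C \<and> v \<in> valuations G \<Omega> \<omega> d M C \<and>
    (\<forall>(H, U) \<in> base E. U \<in> unramified G \<Omega> d H \<longrightarrow> FN_unramified_condition G \<Omega> \<omega> C v H U) \<and>
    (\<forall>H \<in> base (flat E). \<forall>U V. open_in_group G H U \<and> V \<in> unramified G \<Omega> d U \<longrightarrow>
      FN_exactness_condition G \<Omega> \<omega> d C v U V)"


section \<open>The functors \<open>\<pi>\<^sub>K\<close> and \<open>H\<^sup>0\<close>\<close>

definition right_transversal :: "('q, 'z) monoid_scheme \<Rightarrow> 'q set \<Rightarrow> 'q set \<Rightarrow> bool" where
  "right_transversal Q R T \<longleftrightarrow> T \<subseteq> carrier Q \<and> bij_betw (\<lambda>t. R #>\<^bsub>Q\<^esub> t) T (rcosets\<^bsub>Q\<^esub> R)"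

text \<open>The transfer \<open>Q\<^sup>a\<^sup>b \<rightarrow> R\<^sup>a\<^sup>b\<close> for a subgroup \<open>R\<close> of finite index in \<open>Q\<close>: with a right
  transversal \<open>T\<close> and \<open>t q = r t'\<close>, where \<open>t' \<in> T\<close> and \<open>r \<in> R\<close>, the class of \<open>q\<close> is sent to the
  product over \<open>t \<in> T\<close> of the classes of the elements \<open>r\<close>. The result depends on neither choice.\<close>

definition transfer_elem :: "'q tgroup \<Rightarrow> 'q tgroup \<Rightarrow> 'q set \<Rightarrow> 'q \<Rightarrow> 'q set" where
  "transfer_elem Q R T q =
    (\<Otimes>\<^bsub>abelianization R\<^esub> t \<in> T. closed_commutator R #>\<^bsub>R\<^esub>
      (THE r. r \<in> carrier R \<and> (\<exists>t' \<in> T. t \<otimes>\<^bsub>Q\<^esub> q = r \<otimes>\<^bsub>Q\<^esub> t')))"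

definition transfer_map :: "'q tgroup \<Rightarrow> 'q tgroup \<Rightarrow> 'q set \<Rightarrow> 'q set" where
  "transfer_map Q R X =
    transfer_elem Q R (SOME T. right_transversal Q (carrier R) T) (SOME q. q \<in> X)"

definition quot :: "'g tgroup \<Rightarrow> 'g set \<times> 'g set \<Rightarrow> 'g set tgroup" where
  "quot G = (\<lambda>(H, U). tquotient (sub_tgroup G H) U)"

definition pi_K :: "'g tgroup \<Rightarrow> ('g, 'g set \<times> 'g set, 'g set set) ric_fun" where
  "pi_K G = \<lparr>Obj = (\<lambda>x. abelianization (quot G x)),
    Res = (\<lambda>y x. transfer_map (quot G x) (quot G y)),
    Ind = (\<lambda>x y. quotient_fun (quot G x) (closed_commutator (quot G x))
             (\<lambda>c. snd x <#>\<^bsub>G\<^esub> c)),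
    Con = (\<lambda>g x. quotient_fun (quot G (conj_pair G g x))
             (closed_commutator (quot G (conj_pair G g x))) (conj_set G g))\<rparr>"

definition H0 ::
  "'g tgroup \<Rightarrow> ('g, 'g set, 'c) ric_fun \<Rightarrow> ('g, 'g set \<times> 'g set, 'c set) ric_fun" where
  "H0 G C = \<lparr>Obj = (\<lambda>(H, U). discrete_tgroup (Obj C H Mod ind_image C H U)),
    Res = (\<lambda>(I, V) (H, U). quotient_fun (Obj C I) (ind_image C I V) (Res C I H)),
    Ind = (\<lambda>(H, U) (I, V). quotient_fun (Obj C H) (ind_image C H U) (Ind C H I)),
    Con = (\<lambda>g (H, U). quotient_fun (Obj C (conj_set G g H))
             (ind_image C (conj_set G g H) (conj_set G g U)) (Con C g H))\<rparr>"


section \<open>The reciprocity map\<close>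

text \<open>For a Frobenius lift \<open>h\<close>, a prime element \<open>\<pi>\<close> of \<open>C(\<Sigma>)\<close> and \<open>n = P'(d\<^sub>H(h))\<close>, this is the class
  of \<open>ind (\<pi>\<^sup>n)\<close>. The maps below pick \<open>h\<close> and \<open>\<pi>\<close> by choice; the value is independent of them.\<close>

definition recip_value ::
  "nat set \<Rightarrow> 'g tgroup \<Rightarrow> 'w tgroup \<Rightarrow> 'w \<Rightarrow> ('g \<Rightarrow> 'w) \<Rightarrow> ('g, 'g set, 'c) ric_fun
    \<Rightarrow> 'g set \<Rightarrow> 'g set \<Rightarrow> 'g \<Rightarrow> 'c \<Rightarrow> 'c set" where
  "recip_value P G \<Omega> \<omega> d C H U h \<pi> =
    (let \<Sigma> = frobenius_group G \<Omega> d h U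
     in ind_image C H U #>\<^bsub>Obj C H\<^esub>
          Ind C H \<Sigma> (\<pi> [^]\<^bsub>Obj C \<Sigma>\<^esub> P'_part P (mult_of \<Omega> \<omega> (d_rel G \<Omega> d H h))))"

definition Upsilon' ::
  "nat set \<Rightarrow> 'g tgroup \<Rightarrow> 'w tgroup \<Rightarrow> 'w \<Rightarrow> ('g \<Rightarrow> 'w) \<Rightarrow> ('g, 'g set, 'c) ric_fun
    \<Rightarrow> ('g set \<Rightarrow> 'c \<Rightarrow> 'w) \<Rightarrow> 'g set \<times> 'g set \<Rightarrow> 'g set \<Rightarrow> 'c set" where
  "Upsilon' P G \<Omega> \<omega> d C v = (\<lambda>(H, U) c.
    (let h = (SOME h. h \<in> Frob G \<Omega> \<omega> d H \<and> U #>\<^bsub>G\<^esub> h = c);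
         \<pi> = (SOME \<pi>. \<pi> \<in> prime_elements \<omega> C v (frobenius_group G \<Omega> d h U))
     in recip_value P G \<Omega> \<omega> d C H U h \<pi>))"

definition Upsilon ::
  "nat set \<Rightarrow> 'g tgroup \<Rightarrow> 'w tgroup \<Rightarrow> 'w \<Rightarrow> ('g \<Rightarrow> 'w) \<Rightarrow> ('g, 'g set, 'c) ric_fun
    \<Rightarrow> ('g set \<Rightarrow> 'c \<Rightarrow> 'w) \<Rightarrow> 'g set \<times> 'g set \<Rightarrow> 'g set set \<Rightarrow> 'c set" where
  "Upsilon P G \<Omega> \<omega> d C v x X = Upsilon' P G \<Omega> \<omega> d C v x (SOME c. c \<in> X)"

definition ab_class :: "'g tgroup \<Rightarrow> 'g set \<times> 'g set \<Rightarrow> 'g set \<Rightarrow> 'g set set" where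
  "ab_class G x c = closed_commutator (quot G x) #>\<^bsub>quot G x\<^esub> c"

end

theory Submission
  imports Defs "HOL-Algebra.Sylow" "HOL-Algebra.Multiplicative_Group" "HOL-Number_Theory.Cong"
begin

text \<open>Let \<open>V\<^sub>m = {h \<in> H. d h \<in> \<Omega>\<^bsup>fm\<^esup>}\<close> with \<open>f = f\<^sub>H\<close>, let \<open>W\<^sub>m = U \<inter> V\<^sub>m\<close>, and let \<open>\<phi> \<in> H\<close> be a Frobenius lift with
  \<open>d \<phi> = \<omega>\<^bsup>f\<^esup>\<close>. If \<open>d h = \<omega>\<^bsup>fn\<^esup>\<close>, \<open>\<Sigma>\<close> is the Frobenius group of \<open>h\<close> and \<open>m\<close> is a multiple of \<open>n [H:U]\<close>, then
  \<open>\<Sigma> \<inter> V\<^sub>m = W\<^sub>m\<close>, and the double coset formula with representatives \<open>\<phi>\<^bsup>i\<^esup>\<close> expresses the restriction to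
  \<open>V\<^sub>m\<close> of the reciprocity value as the norm from \<open>W\<^sub>m\<close> of the power sum \<open>(1 + \<phi> + \<dots> + \<phi>\<^bsup>n-1\<^esup>) \<pi>\<close>. All
  reciprocity values can thus be compared inside \<open>C(W\<^sub>m)\<close>. For Frobenius lifts \<open>h\<^sub>1\<close>, \<open>h\<^sub>2\<close>, \<open>h\<^sub>1 h\<^sub>2\<close> the
  discrepancy is the norm of a unit \<open>u\<close> for which \<open>(\<phi> - 1) u\<close> is a combination of elements
  \<open>(t - 1) u'\<close> with \<open>t\<close> inertial and \<open>u'\<close> a unit; exactness of the unramified sequences shows that such a
  norm is the restriction of a unit in \<open>ind C(U)\<close>. Hence the reciprocity map is a homomorphism, and
  independent of all choices. Naturality is then checked on Frobenius lifts; for restrictions, the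
  double cosets \<open>I\H/\<Sigma>\<close> in the formula for \<open>C\<close> are the \<open>h\<close>-orbits on \<open>I\H\<close> that compute the transfer.\<close>

section \<open>Topological and profinite groups\<close>

text \<open>The classical argument compares elements over the maximal unramified extension. This is
  not possible here: the inertia group of \<open>H\<close> need neither be open in \<open>H\<close>
  nor belong to \<open>M\<close>, and \<open>C\<close> lives on \<open>M\<close> alone. Identities
  in C(H) are therefore tested at a finite level: a quotient of the two sides with trivial valuation
  is a unit, and restriction to \<open>ur_sub H m\<close> is injective on units. Hence the
  valuations of both sides must agree first, and this is the origin of the exponent
  \<open>P'(n)\<close>. Primes outside \<open>P\<close> are invertible on \<Omega>, so \<Sigma> only
  has relative inertia degree \<open>P(n)\<close>; raising \<pi> to the power \<open>P'(n)\<close>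
  brings the valuation to \<omega>^n, which is multiplicative in h. The case of empty
  \<open>P\<close> stands apart, since \<Omega> is then trivial and exponents of \<omega> are not
  unique.\<close>

lemma (in group) inv_mult_cancel:
  "\<lbrakk>x \<in> carrier G; y \<in> carrier G\<rbrakk> \<Longrightarrow> inv x \<otimes> (x \<otimes> y) = y"
  by (simp flip: m_assoc)

lemma (in group) mult_inv_cancel:
  "\<lbrakk>x \<in> carrier G; y \<in> carrier G\<rbrakk> \<Longrightarrow> x \<otimes> (inv x \<otimes> y) = y"
  by (simp flip: m_assoc)

text \<open>With these rules inverses are pushed to the letters, products are nested to the right
  and adjacent inverse letters cancel, so that \<open>simp\<close> proves identities between group
  words.\<close>

lemmas (in group) group_norm = m_assoc inv_mult_group inv_mult_cancel mult_inv_cancel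

context topological_group
begin

lemma topspace [simp]: "topspace (topo G) = carrier G"
  by (rule topspace_topo)

lemma continuous_map_mult:
  assumes "continuous_map X (topo G) f" "continuous_map X (topo G) g"
  shows "continuous_map X (topo G) (\<lambda>x. f x \<otimes> g x)"
proof -
  have "continuous_map X (prod_topology (topo G) (topo G)) (\<lambda>x. (f x, g x))"
    using assms by (simp add: continuous_map_pairwise o_def)
  from continuous_map_compose[OF this continuous_mult] show ?thesis
    by (simp add: o_def)
qed

lemma continuous_map_inv:
  assumes "continuous_map X (topo G) f"
  shows "continuous_map X (topo G) (\<lambda>x. inv (f x))"
  using continuous_map_compose[OF assms continuous_inv] by (simp add: o_def)

lemma continuous_map_lmult: "a \<in> carrier G \<Longrightarrow> continuous_map (topo G) (topo G) (\<lambda>x. a \<otimes> x)"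
  by (intro continuous_map_mult) auto

lemma continuous_map_rmult: "a \<in> carrier G \<Longrightarrow> continuous_map (topo G) (topo G) (\<lambda>x. x \<otimes> a)"
  by (intro continuous_map_mult) auto

lemma openin_l_coset:
  assumes "a \<in> carrier G" "openin (topo G) S"
  shows "openin (topo G) (a <#\<^bsub>G\<^esub> S)"
proof -
  have S: "S \<subseteq> carrier G" using openin_subset[OF assms(2)] by simp
  have "a <#\<^bsub>G\<^esub> S = {x \<in> topspace (topo G). inv a \<otimes> x \<in> S}"
  proof
    show "a <#\<^bsub>G\<^esub> S \<subseteq> {x \<in> topspace (topo G). inv a \<otimes> x \<in> S}"
      using S assms(1) by (auto simp: l_coset_def inv_mult_cancel)
    show "{x \<in> topspace (topo G). inv a \<otimes> x \<in> S} \<subseteq> a <#\<^bsub>G\<^esub> S"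
    proof
      fix x assume "x \<in> {x \<in> topspace (topo G). inv a \<otimes> x \<in> S}"
      then have "inv a \<otimes> x \<in> S" "x = a \<otimes> (inv a \<otimes> x)"
        using assms(1) by (auto simp: mult_inv_cancel)
      then show "x \<in> a <#\<^bsub>G\<^esub> S" unfolding l_coset_def by blast
    qed
  qed
  then show ?thesis
    using openin_continuous_map_preimage[OF continuous_map_lmult[of "inv a"] assms(2)] assms(1) by simp
qed

lemma openin_r_coset:
  assumes "a \<in> carrier G" "openin (topo G) S"
  shows "openin (topo G) (S #> a)"
proof -
  have S: "S \<subseteq> carrier G" using openin_subset[OF assms(2)] by simp
  have "S #> a = {x \<in> topspace (topo G). x \<otimes> inv a \<in> S}"
  proof
    show "S #> a \<subseteq> {x \<in> topspace (topo G). x \<otimes> inv a \<in> S}"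
      using S assms(1) by (auto simp: r_coset_def m_assoc)
    show "{x \<in> topspace (topo G). x \<otimes> inv a \<in> S} \<subseteq> S #> a"
    proof
      fix x assume "x \<in> {x \<in> topspace (topo G). x \<otimes> inv a \<in> S}"
      then have "x \<otimes> inv a \<in> S" "x = x \<otimes> inv a \<otimes> a"
        using assms(1) by (auto simp: m_assoc)
      then show "x \<in> S #> a" unfolding r_coset_def by blast
    qed
  qed
  then show ?thesis
    using openin_continuous_map_preimage[OF continuous_map_rmult[of "inv a"] assms(2)] assms(1) by simp
qed

text \<open>Translating \<open>V\<close> by the elements of \<open>K\<close> stays inside the
  subgroup and gives a neighbourhood of each of them.\<close>

lemma openin_subgroup:
  assumes "subgroup K G" "openin (topo G) V" "\<one> \<in> V" "V \<subseteq> K"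
  shows "openin (topo G) K"
proof (subst openin_subopen, intro ballI)
  fix x assume x: "x \<in> K"
  then have xc: "x \<in> carrier G" using assms(1) by (meson subgroup.mem_carrier)
  have "x \<in> x <#\<^bsub>G\<^esub> V" using assms(3) xc by (force simp: l_coset_def)
  moreover have "x <#\<^bsub>G\<^esub> V \<subseteq> K"
    using x assms(1,4) by (auto simp: l_coset_def intro: subgroup.m_closed)
  ultimately show "\<exists>T. openin (topo G) T \<and> x \<in> T \<and> T \<subseteq> K"
    using openin_l_coset[OF xc assms(2)] by blast
qed

lemma subgroup_closure_of:
  assumes "subgroup K G"
  shows "subgroup (topo G closure_of K) G"
proof -
  interpret K: subgroup K G by fact
  let ?c = "topo G closure_of K"
  have sub: "?c \<subseteq> carrier G"
    using closure_of_subset_topspace[of "topo G" K] by simp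
  have Kc: "K \<subseteq> ?c" by (simp add: closure_of_subset K.subset)
  have img: "f ` ?c \<subseteq> topo G closure_of S"
    if "continuous_map (topo G) (topo G) f" "f ` K \<subseteq> S" for f S
    using continuous_map_image_closure_subset[OF that(1), of K] closure_of_mono[OF that(2)] by blast
  \<comment> \<open>Continuity of translations is used twice: first with one factor in
    \<open>K\<close>, then, by means of \<open>1\<close>, with both factors in the closure.\<close>
  have 1: "x \<otimes> y \<in> ?c" if x: "x \<in> ?c" and y: "y \<in> K" for x y
    using img[OF continuous_map_rmult[OF K.mem_carrier[OF y]], of K] x y by auto
  have 2: "x \<otimes> y \<in> ?c" if x: "x \<in> ?c" and y: "y \<in> ?c" for x y
    using img[OF continuous_map_lmult[of x], of ?c] x y sub 1 by auto
  have 3: "inv x \<in> ?c" if "x \<in> ?c" for x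
    using img[OF continuous_inv, of K] that by auto
  show ?thesis
    by (rule subgroup.intro) (use sub 2 3 Kc in auto)
qed

lemma Hausdorff_if_closed_one: "Hausdorff_space (topo G) \<Longrightarrow> closedin (topo G) {\<one>}"
  by (simp add: closedin_Hausdorff_singleton)

text \<open>The stabiliser \<open>{x. A x = A}\<close> of a clopen neighbourhood \<open>A\<close> of the identity is an open
  subgroup contained in \<open>A\<close>.\<close>

lemma open_subgroup_in_nbhd:
  assumes pf: "profinite_group G" and W: "openin (topo G) W" "\<one> \<in> W"
  shows "\<exists>S. subgroup S G \<and> openin (topo G) S \<and> S \<subseteq> W"
proof -
  have cpt: "compact_space (topo G)" and Hd: "Hausdorff_space (topo G)"
    and td: "\<And>S. connectedin (topo G) S \<Longrightarrow> \<exists>a. S \<subseteq> {a}"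
    using pf by (auto simp: profinite_group_def)
  \<comment> \<open>Connected sets have at most one point, so none of them meets both closed sets;
    in a compact Hausdorff space the two sets can then be separated by a clopen set.\<close>
  have "separated_between (topo G) {\<one>} (topspace (topo G) - W)"
  proof (rule cut_wire_fence_theorem[OF cpt Hd])
    show "closedin (topo G) {\<one>}" using Hd by (rule Hausdorff_if_closed_one)
    show "closedin (topo G) (topspace (topo G) - W)" using W by blast
    show "disjnt C {\<one>} \<or> disjnt C (topspace (topo G) - W)" if "connectedin (topo G) C" for C
      using td[OF that] W by (auto simp: disjnt_def)
  qed
  then obtain A where A: "closedin (topo G) A" "openin (topo G) A" "\<one> \<in> A"
    and AW: "carrier G - W \<subseteq> carrier G - A"
    unfolding separated_between by auto
  have Ac: "A \<subseteq> carrier G" using openin_subset[OF A(2)] by simp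
  then have "A \<subseteq> W" using AW by blast
  note A = A this
  have cA: "compactin (topo G) A" using A(1) cpt by (simp add: closedin_compact_space)
  let ?PA = "{p \<in> topspace (prod_topology (topo G) (topo G)). (\<lambda>(x, y). x \<otimes> y) p \<in> A}"
  have "openin (prod_topology (topo G) (topo G)) ?PA"
    by (rule openin_continuous_map_preimage[OF continuous_mult A(2)])
  moreover have "A \<times> {\<one>} \<subseteq> ?PA" using Ac by auto
  \<comment> \<open>By compactness of \<open>A\<close>, a single neighbourhood \<open>V\<close> of
    the identity satisfies a y \<in> A for all a in \<open>A\<close> and all y in
    \<open>V\<close>.\<close>
  ultimately obtain U V where UV: "openin (topo G) V" "A \<subseteq> U" "\<one> \<in> V" "U \<times> V \<subseteq> ?PA"
    using tube_lemma_left[OF _ cA, of "topo G" ?PA \<one>] by auto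
  define S where "S = {x \<in> carrier G. A #> x = A}"
  have S: "subgroup S G"
  proof (rule subgroup.intro)
    show "S \<subseteq> carrier G" "\<one> \<in> S" using Ac by (auto simp: S_def)
    show "x \<otimes> y \<in> S" if "x \<in> S" "y \<in> S" for x y
      using that coset_mult_assoc[OF Ac, of x y] by (auto simp: S_def)
    show "inv x \<in> S" if "x \<in> S" for x
      using that coset_mult_assoc[OF Ac, of x "inv x"] Ac by (auto simp: S_def)
  qed
  \<comment> \<open>Stabilising \<open>A\<close> requires translation by x and by its inverse to map
    \<open>A\<close> into itself, hence the symmetric neighbourhood.\<close>
  define V' where "V' = V \<inter> {x \<in> topspace (topo G). inv x \<in> V}"
  have Vc: "V \<subseteq> carrier G" using openin_subset[OF UV(1)] by simp
  have V': "openin (topo G) V'"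
    unfolding V'_def using openin_continuous_map_preimage[OF continuous_inv UV(1)] UV(1) by blast
  have "V' \<subseteq> S"
  proof
    fix x assume x: "x \<in> V'"
    then have xc: "x \<in> carrier G" and xV: "x \<in> V" "inv x \<in> V" by (auto simp: V'_def)
    have av: "a \<otimes> y \<in> A" if "a \<in> A" "y \<in> V" for a y
    proof -
      have "(a, y) \<in> U \<times> V" using UV that by auto
      then show ?thesis using UV(4) by auto
    qed
    have "A \<subseteq> A #> x"
    proof
      fix a assume "a \<in> A"
      then have "a \<otimes> inv x \<in> A" "a = a \<otimes> inv x \<otimes> x" using av xV xc Ac by (auto simp: m_assoc)
      then show "a \<in> A #> x" unfolding r_coset_def by blast
    qed
    moreover have "A #> x \<subseteq> A" using av xV by (auto simp: r_coset_def)
    ultimately show "x \<in> S" using xc by (simp add: S_def)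
  qed
  moreover have "\<one> \<in> V'" using UV by (simp add: V'_def)
  ultimately have "openin (topo G) S" using openin_subgroup[OF S V'] by blast
  moreover have "S \<subseteq> A"
  proof
    fix x assume "x \<in> S"
    then have "x \<in> carrier G" "A #> x = A" by (auto simp: S_def)
    then show "x \<in> A" using A(3) by (force simp: r_coset_def)
  qed
  ultimately show ?thesis using S A(4) by blast
qed

text \<open>The normal core of an open subgroup is open: by compactness of \<open>G\<close>, a
  single neighbourhood of the identity is conjugated into \<open>S\<close> by all elements at
  once.\<close>

lemma open_normal_subgroup_in_nbhd:
  assumes pf: "profinite_group G" and W: "openin (topo G) W" "\<one> \<in> W"
  shows "\<exists>N. N \<lhd> G \<and> openin (topo G) N \<and> N \<subseteq> W"
proof -
  obtain S where S: "subgroup S G" "openin (topo G) S" "S \<subseteq> W"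
    using open_subgroup_in_nbhd[OF assms] by blast
  interpret S: subgroup S G by fact
  define N where "N = {x \<in> carrier G. \<forall>g\<in>carrier G. g \<otimes> x \<otimes> inv g \<in> S}"
  have N1: "subgroup N G"
  proof (rule subgroup.intro)
    show "N \<subseteq> carrier G" "\<one> \<in> N" by (auto simp: N_def)
    show "x \<otimes> y \<in> N" if xy: "x \<in> N" "y \<in> N" for x y
    proof -
      have xyc: "x \<in> carrier G" "y \<in> carrier G" using xy by (auto simp: N_def)
      have "g \<otimes> (x \<otimes> y) \<otimes> inv g \<in> S" if g: "g \<in> carrier G" for g
      proof -
        have "g \<otimes> (x \<otimes> y) \<otimes> inv g = (g \<otimes> x \<otimes> inv g) \<otimes> (g \<otimes> y \<otimes> inv g)"
          using g xyc by (simp add: group_norm)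
        then show ?thesis using xy g by (auto simp: N_def)
      qed
      then show ?thesis using xyc by (auto simp: N_def)
    qed
    show "inv x \<in> N" if x: "x \<in> N" for x
    proof -
      have xc: "x \<in> carrier G" using x by (auto simp: N_def)
      have "g \<otimes> inv x \<otimes> inv g \<in> S" if g: "g \<in> carrier G" for g
      proof -
        have "g \<otimes> inv x \<otimes> inv g = inv (g \<otimes> x \<otimes> inv g)"
          using g xc by (simp add: group_norm)
        then show ?thesis using x g by (auto simp: N_def)
      qed
      then show ?thesis using xc by (auto simp: N_def)
    qed
  qed
  have N2: "N \<lhd> G"
  proof (subst normal_inv_iff, intro conjI ballI N1)
    fix x h assume xh: "x \<in> carrier G" "h \<in> N"
    then have hc: "h \<in> carrier G" by (simp add: N_def)
    have "g \<otimes> (x \<otimes> h \<otimes> inv x) \<otimes> inv g \<in> S" if g: "g \<in> carrier G" for g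
    proof -
      have "g \<otimes> (x \<otimes> h \<otimes> inv x) \<otimes> inv g = (g \<otimes> x) \<otimes> h \<otimes> inv (g \<otimes> x)"
        using g xh hc by (simp add: group_norm)
      then show ?thesis using xh g by (auto simp: N_def)
    qed
    then show "x \<otimes> h \<otimes> inv x \<in> N" using xh hc by (auto simp: N_def)
  qed
  let ?T = "prod_topology (topo G) (topo G)"
  have "continuous_map ?T (topo G) (\<lambda>p. fst p \<otimes> snd p \<otimes> inv (fst p))"
    by (intro continuous_map_mult continuous_map_inv continuous_map_fst continuous_map_snd)
  from openin_continuous_map_preimage[OF this S(2)]
  have o: "openin ?T {p \<in> topspace ?T. fst p \<otimes> snd p \<otimes> inv (fst p) \<in> S}" .
  have "compactin (topo G) (carrier G)" using pf by (simp add: profinite_group_def compact_space_def)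
  moreover have "carrier G \<times> {\<one>} \<subseteq> {p \<in> topspace ?T. fst p \<otimes> snd p \<otimes> inv (fst p) \<in> S}"
    by auto
  ultimately obtain U V where UV: "openin (topo G) V" "carrier G \<subseteq> U" "\<one> \<in> V"
      "U \<times> V \<subseteq> {p \<in> topspace ?T. fst p \<otimes> snd p \<otimes> inv (fst p) \<in> S}"
    using tube_lemma_left[OF o, of "carrier G" \<one>] by fastforce
  have "V \<subseteq> N"
  proof
    fix x assume x: "x \<in> V"
    then have "g \<otimes> x \<otimes> inv g \<in> S" if "g \<in> carrier G" for g
      using UV(2,4) that by fastforce
    then show "x \<in> N" using x openin_subset[OF UV(1)] by (auto simp: N_def)
  qed
  then have "openin (topo G) N" using openin_subgroup[OF N1 UV(1,3)] by blast
  moreover have "N \<subseteq> S" unfolding N_def by (auto dest!: bspec[of _ _ \<one>])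
  ultimately show ?thesis using N2 S(3) by blast
qed

text \<open>A compact \<open>H\<close> is covered by finitely many translates of an open set
  \<open>O'\<close> that cuts \<open>U\<close> out of \<open>H\<close>. Although \<open>O'\<close>
  need not be a subgroup, its translate by x in \<open>H\<close> meets \<open>H\<close> exactly in
  the coset of x, so the finitely many centres represent all cosets.\<close>

lemma finite_rcosets_open:
  assumes H: "subgroup H G" "compactin (topo G) H" and U: "open_in_group G H U"
  shows "finite (rcosets\<^bsub>G\<lparr>carrier := H\<rparr>\<^esub> U)"
proof -
  have Us: "subgroup U G" "U \<subseteq> H" and "openin (subtopology (topo G) H) U"
    using U by (auto simp: open_in_group_def)
  then obtain O' where O': "openin (topo G) O'" "U = O' \<inter> H" by (auto simp: openin_subtopology)
  interpret H: subgroup H G by fact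
  interpret U: subgroup U G by fact
  let ?C = "(\<lambda>x. O' #> x) ` H"
  have "\<exists>\<F>. finite \<F> \<and> \<F> \<subseteq> ?C \<and> H \<subseteq> \<Union>\<F>"
  proof (rule compactinD[OF H(2)])
    show "openin (topo G) T" if "T \<in> ?C" for T using that openin_r_coset O' by auto
    show "H \<subseteq> \<Union>?C"
    proof
      fix x assume x: "x \<in> H"
      have "\<one> \<in> O'" using U.one_closed O' by blast
      then have "x \<in> O' #> x" using x by (force simp: r_coset_def)
      then show "x \<in> \<Union>?C" using x by blast
    qed
  qed
  then obtain D where D: "finite D" "D \<subseteq> H" "H \<subseteq> (\<Union>x\<in>D. O' #> x)"
    by (metis finite_subset_image)
  have "rcosets\<^bsub>G\<lparr>carrier := H\<rparr>\<^esub> U \<subseteq> (\<lambda>x. U #> x) ` D"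
  proof
    fix X assume "X \<in> rcosets\<^bsub>G\<lparr>carrier := H\<rparr>\<^esub> U"
    then obtain h where h: "h \<in> H" "X = U #> h" by (auto simp: RCOSETS_def)
    then obtain x where x: "x \<in> D" "h \<in> O' #> x" using D by blast
    then obtain y where y: "y \<in> O'" "h = y \<otimes> x" unfolding r_coset_def by blast
    have "y = h \<otimes> inv x" using y x D h openin_subset[OF O'(1)]
      by (metis H.mem_carrier inv_solve_right subsetD topspace)
    then have "y \<in> U" using O' y h x D
      by (metis H.m_closed H.m_inv_closed IntI subsetD)
    then have "h \<in> U #> x" using y unfolding r_coset_def by blast
    then have "U #> x = U #> h" using repr_independence[of h U x] x D Us by auto
    then show "X \<in> (\<lambda>x. U #> x) ` D" using h x by auto
  qed
  then show ?thesis using D(1) finite_surj by blast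
qed

end

section \<open>Parts and divisibility of natural numbers relative to a set of primes\<close>

definition P_part :: "nat set \<Rightarrow> nat \<Rightarrow> nat" where
  "P_part P n = (\<Prod>p \<in> prime_factors n \<inter> P. p ^ multiplicity p n)"

definition P_number :: "nat set \<Rightarrow> nat \<Rightarrow> bool" where
  "P_number P n \<longleftrightarrow> n > 0 \<and> prime_factors n \<subseteq> P"

text \<open>For positive \<open>k\<close> this is divisibility of \<open>i\<close> by
  \<open>k\<close> in Z_P, where primes outside \<open>P\<close> are units.\<close>

definition P_dvd :: "nat set \<Rightarrow> nat \<Rightarrow> nat \<Rightarrow> bool" where
  "P_dvd P k i \<longleftrightarrow> (\<forall>p \<in> P. p ^ multiplicity p k dvd i)"

lemma P_part_mult_P'_part: "n > 0 \<Longrightarrow> P_part P n * P'_part P n = n"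
proof -
  assume n: "n > 0"
  have "prime_factors n = (prime_factors n \<inter> P) \<union> (prime_factors n - P)" by auto
  then have "(\<Prod>p\<in>prime_factors n. p ^ multiplicity p n) = P_part P n * P'_part P n"
    unfolding P_part_def P'_part_def
    by (metis (no_types, lifting) Diff_disjoint Int_Diff finite_Diff finite_Int finite_set_mset
        inf.commute inf_bot_right prod.union_disjoint)
  then show ?thesis using n prod_prime_factors[of n] by simp
qed

lemma P_number_mult: "P_number P a \<Longrightarrow> P_number P b \<Longrightarrow> P_number P (a * b)"
  by (auto simp: P_number_def prime_factorization_mult)

lemma P_number_dvd: "P_number P b \<Longrightarrow> a dvd b \<Longrightarrow> P_number P a"
  unfolding P_number_def using dvd_prime_factors[of b a] by (metis dvd_pos_nat not_gr_zero order_trans)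

lemma multiplicity_P_part:
  assumes "\<And>p. p \<in> P \<Longrightarrow> prime p" "n > 0" "prime p"
  shows "multiplicity p (P_part P n) = (if p \<in> P then multiplicity p n else 0)"
proof -
  have "multiplicity p (P_part P n) = (if p \<in> prime_factors n \<inter> P then multiplicity p n else 0)"
    unfolding P_part_def using assms
    by (subst multiplicity_prod_prime_powers) auto
  then show ?thesis using assms by (auto simp: prime_factors_multiplicity)
qed

lemma P_part_pos: "n > 0 \<Longrightarrow> P_part P n > 0"
  using P_part_mult_P'_part by (metis gr0I mult_is_0)

lemma P_number_P_part:
  assumes "\<And>p. p \<in> P \<Longrightarrow> prime p" "n > 0"
  shows "P_number P (P_part P n)"
  using multiplicity_P_part[OF assms] P_part_pos[OF assms(2)] 
  by (auto simp: P_number_def prime_factors_multiplicity split: if_splits)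

lemma P_dvd_iff:
  assumes P: "\<And>p. p \<in> P \<Longrightarrow> prime p" and n: "n > 0"
  shows "P_dvd P n i \<longleftrightarrow> P_part P n dvd i"
proof (cases "i = 0")
  case False
  then have "P_part P n dvd i \<longleftrightarrow> (\<forall>p. prime p \<longrightarrow> multiplicity p (P_part P n) \<le> multiplicity p i)"
    using multiplicity_le_imp_dvd[of "P_part P n" i] P_part_pos[OF n] dvd_imp_multiplicity_le
    by (metis less_not_refl)
  also have "\<dots> \<longleftrightarrow> (\<forall>p\<in>P. multiplicity p n \<le> multiplicity p i)"
    using P n by (auto simp: multiplicity_P_part)
  finally show ?thesis
    unfolding P_dvd_def using power_dvd_iff_le_multiplicity P False
    by (metis not_prime_unit)
qed (simp add: P_dvd_def)

lemma P_part_P_number: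
  assumes "P_number P n"
  shows "P_part P n = n"
proof -
  have "prime_factors n \<inter> P = prime_factors n" using assms by (auto simp: P_number_def)
  then show ?thesis using assms prod_prime_factors[of n] by (simp add: P_part_def P_number_def)
qed

lemma P_part_mult:
  assumes P: "\<And>p. p \<in> P \<Longrightarrow> prime p" and "a > 0" "b > 0"
  shows "P_part P (a * b) = P_part P a * P_part P b"
proof (rule multiplicity_eq_nat)
  show "P_part P (a * b) > 0" "P_part P a * P_part P b > 0"
    using assms by (auto simp: P_part_pos)
  fix p :: nat assume p: "prime p"
  have "P_part P a > 0" "P_part P b > 0" using assms by (auto simp: P_part_pos)
  then show "multiplicity p (P_part P (a * b)) = multiplicity p (P_part P a * P_part P b)"
    using assms p by (simp add: multiplicity_P_part prime_elem_multiplicity_mult_distrib)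
qed

lemma P'_part_mult:
  assumes P: "\<And>p. p \<in> P \<Longrightarrow> prime p" and "a > 0" "b > 0"
  shows "P'_part P (a * b) = P'_part P a * P'_part P b"
proof -
  have "P_part P (a * b) * P'_part P (a * b) = P_part P (a * b) * (P'_part P a * P'_part P b)"
    using P_part_mult_P'_part[of "a * b" P] P_part_mult_P'_part[of a P] P_part_mult_P'_part[of b P] assms
    by (simp add: P_part_mult) (metis mult.assoc mult.left_commute)
  then show ?thesis using P_part_pos[of "a * b" P] assms by simp
qed

lemma P'_part_P_number: "P_number P n \<Longrightarrow> P'_part P n = 1"
  using P_part_mult_P'_part[of n P] P_part_P_number[of P n] by (simp add: P_number_def)

lemma P_dvd_P_number:
  "(\<And>p. p \<in> P \<Longrightarrow> prime p) \<Longrightarrow> P_number P n \<Longrightarrow> P_dvd P n i \<longleftrightarrow> n dvd i"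
  by (simp add: P_dvd_iff P_part_P_number P_number_def)

text \<open>\<open>pro_group\<close> only speaks about open normal subgroups of the whole group. If
  p divides [H:U], some element of H/U has order divisible by p; an open normal \<open>N\<close> of
  \<open>G\<close> with N \<inter> H inside \<open>U\<close> forces this order to divide [G:N], so p
  lies in \<open>P\<close>.\<close>

lemma pro_group_P_number_index:
  fixes G :: "'g tgroup" (structure)
  assumes G: "pro_group P G" and H: "closed_subgroup G H"
    and U: "open_in_group G H U" "normal_in G H U"
  shows "P_number P (index G H U)"
proof -
  interpret topological_group G using G by (simp add: pro_group_def profinite_group_def)
  have pf: "profinite_group G" using G by (simp add: pro_group_def)
  then have cG: "compact_space (topo G)" by (simp add: profinite_group_def)
  have Hs: "subgroup H G" and Hc: "compactin (topo G) H"
    using H cG by (auto simp: closed_subgroup_def closedin_compact_space)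
  interpret H: subgroup H G by fact
  let ?H = "G\<lparr>carrier := H\<rparr>"
  interpret U: normal U ?H using U by (simp add: normal_in_def)
  let ?Q = "?H Mod U"
  interpret Q: group ?Q by (rule U.factorgroup_is_group)
  have fin: "finite (carrier ?Q)" and ord: "Coset.order ?Q = index G H U"
    using finite_rcosets_open[OF Hs Hc U(1)] by (simp_all add: FactGroup_def index_def Coset.order_def)
  have pos: "index G H U > 0" using fin Q.order_gt_0_iff_finite by (simp add: ord)
  have "p \<in> P" if p: "prime p" "p dvd index G H U" for p
  proof -
    obtain O' where O': "openin (topo G) O'" "U = O' \<inter> H"
      using U(1) by (auto simp: open_in_group_def openin_subtopology)
    have "\<one> \<in> O'" using subgroup.one_closed[OF U.subgroup_axioms] O' by auto
    then obtain N where N: "normal N G" "openin (topo G) N" "N \<subseteq> O'"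
      using open_normal_subgroup_in_nbhd[OF pf O'(1)] by blast
    interpret N: normal N G by fact
    let ?a = "multiplicity p (index G H U)"
    obtain m where m: "index G H U = p ^ ?a * m"
      using multiplicity_dvd[of p "index G H U"] by (auto elim: dvdE)
    have a: "?a > 0" using p pos by (simp add: prime_multiplicity_gt_zero_iff)
    \<comment> \<open>A nontrivial element of a Sylow p-subgroup of H/U has order a positive power
      of p; this does the work of Cauchy's theorem.\<close>
    obtain S where S: "subgroup S ?Q" "card S = p ^ ?a"
      using sylow_thm[OF p(1) U.factorgroup_is_group _ fin, of ?a m] ord m by auto
    have "card S > 1" using S a one_less_power[OF prime_gt_1_nat[OF p(1)] a] by simp
    then obtain x where x: "x \<in> S" "x \<noteq> \<one>\<^bsub>?Q\<^esub>"
      by (metis card_1_singleton_iff card_mono card.infinite finite.emptyI finite_insert leD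
          less_numeral_extra(3) not_one_less_zero subsetI singletonI One_nat_def card.empty card_insert_disjoint empty_iff)
    have xc: "x \<in> carrier ?Q" using S x subgroup.mem_carrier by metis
    interpret S: group "?Q\<lparr>carrier := S\<rparr>"
      using S(1) Q.subgroup_imp_group by blast
    have "x [^]\<^bsub>?Q\<^esub> card S = \<one>\<^bsub>?Q\<^esub>"
      using S.pow_order_eq_1[of x] x by (simp add: Coset.order_def Q.nat_pow_consistent[symmetric])
    then have "Q.ord x dvd p ^ ?a" using Q.pow_eq_id[OF xc] S(2) by simp
    moreover have "Q.ord x \<noteq> 1" using Q.ord_eq_1[OF xc] x by simp
    ultimately have po: "p dvd Q.ord x" using p(1)
      by (metis divides_primepow_nat dvd_power gr0I power_0)
    obtain h where h: "h \<in> H" "x = U #>\<^bsub>?H\<^esub> h" using xc by (auto simp: carrier_FactGroup)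
    let ?o = "index G (carrier G) N"
    interpret GN: group "G Mod N" by (rule N.factorgroup_is_group)
    have hc: "h \<in> carrier G" using h by simp
    have "(N #> h) [^]\<^bsub>G Mod N\<^esub> Coset.order (G Mod N) = \<one>\<^bsub>G Mod N\<^esub>"
      using hc by (intro GN.pow_order_eq_1) (auto simp: carrier_FactGroup)
    moreover have "Coset.order (G Mod N) = ?o" by (simp add: Coset.order_def index_def FactGroup_def)
    ultimately have "N #> (h [^] ?o) = N"
      using N.FactGroup_pow[OF hc, of ?o] by simp
    then have "h [^] ?o \<in> N" using rcos_self[of "h [^] ?o" N] hc N.subgroup_axioms by simp
    moreover have "h [^]\<^bsub>?H\<^esub> ?o \<in> H" using monoid.nat_pow_closed[OF group.is_monoid[OF H.subgroup_is_group[OF is_group]], of h ?o] h by simp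
    ultimately have "h [^]\<^bsub>?H\<^esub> ?o \<in> U" using N O' by (auto simp: nat_pow_consistent[symmetric])
    then have "x [^]\<^bsub>?Q\<^esub> ?o = \<one>\<^bsub>?Q\<^esub>"
      using h U.FactGroup_pow[of h ?o] U.rcos_const[OF H.subgroup_is_group[OF is_group]] by simp
    then have "p dvd ?o" using Q.pow_eq_id[OF xc] po dvd_trans by blast
    then show "p \<in> P" using G N p(1) by (auto simp: pro_group_def)
  qed
  then show ?thesis using pos by (auto simp: P_number_def)
qed

section \<open>Procyclic groups\<close>

definition pow_image :: "('a, 'z) monoid_scheme \<Rightarrow> nat \<Rightarrow> 'a set" where
  "pow_image A k = (\<lambda>x. x [^]\<^bsub>A\<^esub> k) ` carrier A"

section \<open>Residue computations in \<open>Z_P\<close>\<close>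

lemma carrier_padic_integers:
  "x \<in> carrier (padic_integers p) \<longleftrightarrow>
    (\<forall>n. 0 \<le> x n \<and> x n < int (p ^ n) \<and> x (Suc n) mod int (p ^ n) = x n)" if "p > 0"
  using that by (auto simp: padic_integers_def with_topology_def Let_def carrier_integer_mod_group PiE_iff)

lemma mult_padic_integers:
  "x \<otimes>\<^bsub>padic_integers p\<^esub> y = (\<lambda>n. (x n + y n) mod int (p ^ n))"
  by (simp add: padic_integers_def with_topology_def Let_def fun_eq_iff)

lemma one_padic_integers: "\<one>\<^bsub>padic_integers p\<^esub> = (\<lambda>n. 0)"
  by (simp add: padic_integers_def with_topology_def Let_def fun_eq_iff)

lemma carrier_Z_P: "carrier (Z_P P) = (\<Pi>\<^sub>E p\<in>P. carrier (padic_integers p))"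
  by (simp add: Z_P_def with_topology_def)

lemma mult_Z_P: "x \<otimes>\<^bsub>Z_P P\<^esub> y = (\<lambda>p\<in>P. \<lambda>n. (x p n + y p n) mod int (p ^ n))"
  by (simp add: Z_P_def with_topology_def mult_padic_integers)

lemma one_Z_P: "\<one>\<^bsub>Z_P P\<^esub> = (\<lambda>p\<in>P. \<lambda>n. 0)"
  by (simp add: Z_P_def with_topology_def one_padic_integers)

lemma nat_pow_Z_P:
  "p \<in> P \<Longrightarrow> (x [^]\<^bsub>Z_P P\<^esub> (k::nat)) p n = (int k * x p n) mod int (p ^ n)"
proof (induction k)
  case 0
  then show ?case by (simp add: nat_pow_def one_Z_P)
next
  case (Suc k)
  then show ?case
    by (simp add: nat_pow_def mult_Z_P mod_add_right_eq algebra_simps)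
qed

lemma nat_pow_Z_P_undefined:
  "x \<in> carrier (Z_P P) \<Longrightarrow> x [^]\<^bsub>Z_P P\<^esub> (k::nat) \<in> extensional P"
  by (cases k) (simp_all add: nat_pow_def one_Z_P mult_Z_P)

lemma topo_Z_P: "topo (Z_P P) = product_topology (\<lambda>p. topo (padic_integers p)) P"
  by (simp add: Z_P_def with_topology_def)

lemma topo_padic_integers:
  "topo (padic_integers p) =
    subtopology (product_topology (\<lambda>n. discrete_topology UNIV) UNIV) (carrier (padic_integers p))"
  by (simp add: padic_integers_def with_topology_def Let_def)

lemma topspace_padic_integers [simp]: "topspace (topo (padic_integers p)) = carrier (padic_integers p)"
  by (simp add: topo_padic_integers)

lemma topspace_Z_P [simp]: "topspace (topo (Z_P P)) = carrier (Z_P P)"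
  by (simp add: topo_Z_P carrier_Z_P)

lemma Hausdorff_Z_P: "Hausdorff_space (topo (Z_P P))"
  unfolding topo_Z_P topo_padic_integers
  by (simp add: Hausdorff_space_product_topology Hausdorff_space_subtopology)

context
  fixes P :: "nat set"
  assumes prime_P: "\<And>p. p \<in> P \<Longrightarrow> prime p"
begin

lemma Z_P_bounds:
  assumes "x \<in> carrier (Z_P P)" "p \<in> P"
  shows "0 \<le> x p n" "x p n < int (p ^ n)" "x p (Suc n) mod int (p ^ n) = x p n"
proof -
  have "x p \<in> carrier (padic_integers p)" using assms by (auto simp: carrier_Z_P)
  then show "0 \<le> x p n" "x p n < int (p ^ n)" "x p (Suc n) mod int (p ^ n) = x p n"
    using carrier_padic_integers[of p "x p"] prime_gt_0_nat[OF prime_P[OF assms(2)]] by auto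
qed

lemma Z_P_mod:
  assumes "x \<in> carrier (Z_P P)" "p \<in> P"
  shows "x p (n + m) mod int (p ^ n) = x p n"
proof (induction m)
  case 0
  then show ?case using Z_P_bounds[OF assms, of n] by simp
next
  case (Suc m)
  have "x p (n + Suc m) mod int (p ^ n) = x p (Suc (n + m)) mod int (p ^ (n + m)) mod int (p ^ n)"
    by (simp add: mod_mod_cancel power_add)
  then show ?case using Z_P_bounds(3)[OF assms, of "n + m"] Suc by simp
qed

lemma decompose_prime_power:
  assumes "p \<in> P" "(k::nat) > 0"
  obtains u where "k = p ^ multiplicity p k * u" "coprime (int u) (int p ^ n)"
proof -
  have "k = p ^ multiplicity p k * (k div p ^ multiplicity p k)"
    using multiplicity_dvd[of p k] by simp
  moreover have "\<not> p dvd k div p ^ multiplicity p k"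
    using assms prime_P[OF assms(1)] multiplicity_decompose[of k p] not_prime_unit by blast
  then have "coprime p (k div p ^ multiplicity p k)"
    using prime_P[OF assms(1)] prime_imp_coprime by blast
  ultimately show ?thesis using that by (metis coprime_commute coprime_int_iff coprime_power_right_iff of_nat_power)
qed

text \<open>Write k = p^v u with u prime to p. If k x vanishes modulo p^(n+v), then x vanishes
  modulo p^n; reading the relation v levels higher compensates for the division by p^v.\<close>

lemma Z_P_torsion_free:
  assumes x: "x \<in> carrier (Z_P P)" and k: "k > 0" and eq: "x [^]\<^bsub>Z_P P\<^esub> (k::nat) = \<one>\<^bsub>Z_P P\<^esub>"
  shows "x = \<one>\<^bsub>Z_P P\<^esub>"
proof -
  have "x p n = 0" if p: "p \<in> P" for p n
  proof -
    let ?v = "multiplicity p k"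
    obtain u where u: "k = p ^ ?v * u" "coprime (int u) (int p ^ n)"
      using decompose_prime_power[OF p k] by blast
    have p0: "p > 0" using prime_P[OF p] prime_gt_0_nat by blast
    have "(x [^]\<^bsub>Z_P P\<^esub> k) p (n + ?v) = 0" by (simp add: eq one_Z_P p)
    then have "int (p ^ (n + ?v)) dvd int k * x p (n + ?v)" using nat_pow_Z_P[OF p, of x k] by auto
    then have "int (p ^ ?v) * int p ^ n dvd int (p ^ ?v) * (int u * x p (n + ?v))"
      by (subst (asm) u(1)) (simp add: power_add mult.commute mult.left_commute)
    then have "int p ^ n dvd int u * x p (n + ?v)" using p0 by simp
    then have "int p ^ n dvd x p (n + ?v)" using u(2)
      by (metis coprime_commute coprime_dvd_mult_right_iff)
    then show ?thesis using Z_P_mod[OF x p, of n ?v] by simp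
  qed
  moreover have "x \<in> extensional P" using x by (auto simp: carrier_Z_P PiE_iff)
  ultimately show ?thesis
    by (intro extensionalityI[of x P]) (auto simp: one_Z_P)
qed

text \<open>In the p-component \<open>k\<close> is a unit times p^v with v =
  \<open>multiplicity p k\<close>, so being a multiple of \<open>k\<close> is a condition on the
  single residue modulo p^v. Both openness and the divisibility criterion are read off from
  this.\<close>

lemma pow_image_Z_P:
  assumes k: "k > 0"
  shows "pow_image (Z_P P) k = {x \<in> carrier (Z_P P). \<forall>p\<in>P. x p (multiplicity p k) = 0}"
    (is "_ = ?S")
proof
  show "pow_image (Z_P P) k \<subseteq> ?S"
  proof
    fix y assume "y \<in> pow_image (Z_P P) k"
    then obtain x where x: "x \<in> carrier (Z_P P)" "y = x [^]\<^bsub>Z_P P\<^esub> k" by (auto simp: pow_image_def)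
    have 1: "y p n = (int k * x p n) mod int (p ^ n)" if "p \<in> P" for p n
      using that nat_pow_Z_P x by simp
    have "y p \<in> carrier (padic_integers p)" if p: "p \<in> P" for p
    proof -
      have p0: "p > 0" using prime_P[OF p] prime_gt_0_nat by blast
      have "y p (Suc n) mod int (p ^ n) = y p n" for n
      proof -
        have "y p (Suc n) mod int (p ^ n) = (int k * x p (Suc n)) mod int (p ^ n)"
          using 1[OF p] by (simp add: mod_mod_cancel)
        also have "\<dots> = (int k * (x p (Suc n) mod int (p ^ n))) mod int (p ^ n)" by (simp add: mod_mult_right_eq)
        finally show ?thesis using Z_P_bounds(3)[OF x(1) p] 1[OF p] by simp
      qed
      then show ?thesis using 1[OF p] p0 by (simp add: carrier_padic_integers)
    qed
    moreover have "y \<in> extensional P" using nat_pow_Z_P_undefined[OF x(1)] x(2) by simp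
    moreover have "y p (multiplicity p k) = 0" if p: "p \<in> P" for p
      using 1[OF p] multiplicity_dvd[of p k]
      by (metis dvd_imp_mod_0 dvd_mult2 of_nat_dvd_iff)
    ultimately show "y \<in> ?S" by (auto simp: carrier_Z_P PiE_iff)
  qed
  show "?S \<subseteq> pow_image (Z_P P) k"
  proof
    fix x assume "x \<in> ?S"
    then have x: "x \<in> carrier (Z_P P)" and x0: "\<And>p. p \<in> P \<Longrightarrow> x p (multiplicity p k) = 0" by auto
    have "\<exists>y\<in>carrier (padic_integers p). \<forall>n. (int k * y n) mod int (p ^ n) = x p n" if p: "p \<in> P" for p
    proof -
      let ?v = "multiplicity p k"
      have p0: "p > 0" using prime_P[OF p] prime_gt_0_nat by blast
      obtain u where u: "k = p ^ ?v * u" using multiplicity_dvd[of p k] by (auto elim: dvdE)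
      have cop: "coprime (int u) (int p ^ n)" for n
      proof -
        obtain u' where u': "k = p ^ ?v * u'" "coprime (int u') (int p ^ n)"
          using decompose_prime_power[OF p k] by blast
        have "p ^ ?v * u = p ^ ?v * u'" using u u'(1) by metis
        then have "u = u'" using p0 by simp
        then show ?thesis using u' by simp
      qed
      have "\<exists>c. [int u * c = 1] (mod int p ^ n)" for n
        using cop[of n] by (simp add: coprime_iff_invertible_int)
      then obtain c where c: "\<And>n. [int u * c n = 1] (mod int p ^ n)" by metis
      \<comment> \<open>\<open>z\<close> divides x by p^v, at the price of reading x at level n + v.
        The inverses \<open>c n\<close> of u are chosen independently for each n; uniqueness of
        inverses modulo p^n makes them compatible, and with them \<open>y\<close>.\<close>
      define z where "z n = x p (n + ?v) div int (p ^ ?v)" for n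
      have z: "int p ^ ?v * z n = x p (n + ?v)" for n
      proof -
        have "x p (?v + n) mod int (p ^ ?v) = 0" using Z_P_mod[OF x p, of ?v n] x0[OF p] by simp
        then show ?thesis by (auto simp: z_def add.commute)
      qed
      have z_Suc: "[z (Suc n) = z n] (mod int p ^ n)" for n
      proof -
        have "x p (Suc (n + ?v)) mod int (p ^ (n + ?v)) = x p (n + ?v)" by (rule Z_P_bounds(3)[OF x p])
        then have "[x p (Suc n + ?v) = x p (n + ?v)] (mod int p ^ (n + ?v))"
          using Z_P_bounds(1,2)[OF x p, of "n + ?v"] by (simp add: cong_def)
        then have "[int p ^ ?v * z (Suc n) = int p ^ ?v * z n] (mod int p ^ ?v * int p ^ n)"
          unfolding z by (simp add: power_add mult.commute)
        then have "int p ^ ?v * int p ^ n dvd int p ^ ?v * (z (Suc n) - z n)"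
          by (simp add: cong_iff_dvd_diff right_diff_distrib)
        then show ?thesis using p0 by (simp add: cong_iff_dvd_diff)
      qed
      define y where "y n = (z n * c n) mod int p ^ n" for n
      have c_Suc: "[c (Suc n) = c n] (mod int p ^ n)" for n
      proof -
        have "[int u * c (Suc n) = 1] (mod int p ^ n)"
          using c[of "Suc n"] by (rule cong_dvd_modulus) (simp add: le_imp_power_dvd)
        then have "[int u * c (Suc n) = int u * c n] (mod int p ^ n)"
          using c[of n] cong_sym cong_trans by blast
        then show ?thesis using cop[of n] cong_mult_lcancel by blast
      qed
      have "y (Suc n) mod int p ^ n = y n" for n
      proof -
        have "[z (Suc n) * c (Suc n) = z n * c n] (mod int p ^ n)"
          by (intro cong_mult z_Suc c_Suc)
        then show ?thesis by (simp add: y_def cong_def mod_mod_cancel)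
      qed
      then have "y \<in> carrier (padic_integers p)"
        using p0 by (simp add: carrier_padic_integers y_def)
      moreover have "(int k * y n) mod int (p ^ n) = x p n" for n
      proof -
        have "int k = int p ^ ?v * int u" using arg_cong[OF u, of int] by simp
        moreover have "[int p ^ ?v * int u * y n = int p ^ ?v * int u * (z n * c n)] (mod int p ^ n)"
          by (intro cong_mult cong_refl) (simp add: y_def cong_def)
        ultimately have "[int k * y n = int p ^ ?v * z n * (int u * c n)] (mod int p ^ n)"
          by (simp add: mult_ac)
        also have "[int p ^ ?v * z n * (int u * c n) = int p ^ ?v * z n * 1] (mod int p ^ n)"
          by (intro cong_mult cong_refl c)
        finally show ?thesis unfolding cong_def z using Z_P_mod[OF x p, of n ?v] z by simp
      qed
      ultimately show ?thesis by blast
    qed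
    then obtain y where y: "\<And>p. p \<in> P \<Longrightarrow> y p \<in> carrier (padic_integers p)"
      "\<And>p n. p \<in> P \<Longrightarrow> (int k * y p n) mod int (p ^ n) = x p n" by metis
    let ?y = "\<lambda>p\<in>P. y p"
    have yc: "?y \<in> carrier (Z_P P)" using y(1) by (simp add: carrier_Z_P)
    have "x = ?y [^]\<^bsub>Z_P P\<^esub> k"
    proof (rule extensionalityI[of _ P])
      show "x \<in> extensional P" using x by (auto simp: carrier_Z_P PiE_iff)
      show "x p = (?y [^]\<^bsub>Z_P P\<^esub> k) p" if "p \<in> P" for p
        using that y(2) by (auto simp: nat_pow_Z_P)
    qed (rule nat_pow_Z_P_undefined[OF yc])
    then show "x \<in> pow_image (Z_P P) k" using yc by (auto simp: pow_image_def)
  qed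
qed

text \<open>A residue modulo p^0 vanishes, so only the finitely many primes of \<open>P\<close>
  dividing \<open>k\<close> impose a condition.\<close>

lemma openin_pow_image_Z_P:
  assumes k: "k > 0"
  shows "openin (topo (Z_P P)) (pow_image (Z_P P) k)"
proof -
  let ?F = "P \<inter> prime_factors k"
  have "continuous_map (topo (Z_P P)) (discrete_topology UNIV) (\<lambda>x. x p n)" if "p \<in> P" for p n
  proof -
    have "continuous_map (topo (Z_P P)) (topo (padic_integers p)) (\<lambda>x. x p)"
      unfolding topo_Z_P using that by (rule continuous_map_product_projection)
    moreover have "continuous_map (topo (padic_integers p)) (discrete_topology UNIV) (\<lambda>x. x n)"
      unfolding topo_padic_integers
      by (intro continuous_map_from_subtopology continuous_map_product_projection) simp
    ultimately show ?thesis using continuous_map_compose by (fastforce simp: o_def)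
  qed
  from openin_continuous_map_preimage[OF this, of _ "{0}"]
  have "openin (topo (Z_P P)) {x \<in> topspace (topo (Z_P P)). x p n \<in> {0}}" if "p \<in> P" for p n
    using that by simp
  then have "openin (topo (Z_P P)) {x \<in> carrier (Z_P P). x p n = 0}" if "p \<in> P" for p n
    using that by simp
  then have "openin (topo (Z_P P)) ((\<Inter>p\<in>?F. {x \<in> carrier (Z_P P). x p (multiplicity p k) = 0}) \<inter> topspace (topo (Z_P P)))"
    using openin_topspace[of "topo (Z_P P)"]
    by (cases "?F = {}") (auto intro!: openin_Int openin_INT simp del: openin_topspace)
  moreover have "pow_image (Z_P P) k = (\<Inter>p\<in>?F. {x \<in> carrier (Z_P P). x p (multiplicity p k) = 0}) \<inter> topspace (topo (Z_P P))"
  proof -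
    have "x p (multiplicity p k) = 0" if "x \<in> carrier (Z_P P)" "p \<in> P" "p \<notin> prime_factors k" for x p
      using that Z_P_bounds[of x p 0] prime_P[of p] k by (simp add: prime_factors_multiplicity)
    then show ?thesis by (auto simp: pow_image_Z_P[OF k])
  qed
  ultimately show ?thesis by simp
qed

lemma pow_in_pow_image_Z_P:
  assumes "k > 0" "x \<in> carrier (Z_P P)" "P_dvd P k i" "i > 0"
  shows "x [^]\<^bsub>Z_P P\<^esub> i \<in> pow_image (Z_P P) k"
proof -
  have "x [^]\<^bsub>Z_P P\<^esub> i \<in> carrier (Z_P P)"
    using assms(2) pow_image_Z_P[OF assms(4)] by (auto simp: pow_image_def)
  moreover have "(x [^]\<^bsub>Z_P P\<^esub> i) p (multiplicity p k) = 0" if "p \<in> P" for p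
  proof -
    have "int (p ^ multiplicity p k) dvd int i" using assms(3) that unfolding P_dvd_def of_nat_dvd_iff by blast
    then show ?thesis using that by (simp add: nat_pow_Z_P)
  qed
  ultimately show ?thesis by (simp add: pow_image_Z_P[OF assms(1)])
qed

text \<open>The witness is the element 1 of Z_P. A topological generator need not correspond to it,
  so divisibility is tested here first and carried over to \<omega> by density.\<close>

lemma Z_P_unit:
  "\<exists>e \<in> carrier (Z_P P). \<forall>i k. k > 0 \<longrightarrow> e [^]\<^bsub>Z_P P\<^esub> (i::nat) \<in> pow_image (Z_P P) k \<longrightarrow> P_dvd P k i"
proof (intro bexI allI impI)
  let ?e = "\<lambda>p\<in>P. \<lambda>n. 1 mod int (p ^ n)"
  show "?e \<in> carrier (Z_P P)"
    using prime_gt_0_nat[OF prime_P] by (auto simp: carrier_Z_P carrier_padic_integers mod_mod_cancel)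
  fix i k :: nat assume k: "k > 0" and "?e [^]\<^bsub>Z_P P\<^esub> i \<in> pow_image (Z_P P) k"
  then have "(?e [^]\<^bsub>Z_P P\<^esub> i) p (multiplicity p k) = 0" if "p \<in> P" for p
    using that by (simp add: pow_image_Z_P[OF k])
  then have "int i mod int (p ^ multiplicity p k) = 0" if "p \<in> P" for p
    using that by (simp add: nat_pow_Z_P mod_mult_right_eq)
  then show "P_dvd P k i" unfolding P_dvd_def by (metis mod_0_imp_dvd of_nat_dvd_iff)
qed

end

text \<open>The locale collects what is used about Z_P, so that the isomorphism with
  \<open>Z_P P\<close> is needed only once, in \<open>procyclicI\<close>.\<close>

locale procyclic = topological_group \<Omega> for \<Omega> :: "'w tgroup" (structure) +
  fixes P :: "nat set" and \<omega> :: 'w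
  assumes prime_P: "p \<in> P \<Longrightarrow> prime p"
    and comm: "comm_group \<Omega>"
    and Hausdorff: "Hausdorff_space (topo \<Omega>)"
    and torsion_free: "\<lbrakk>x \<in> carrier \<Omega>; k > 0; x [^] k = \<one>\<rbrakk> \<Longrightarrow> x = \<one>"
    and openin_pow_image: "k > 0 \<Longrightarrow> openin (topo \<Omega>) (pow_image \<Omega> k)"
    and pow_in_pow_image_iff: "k > 0 \<Longrightarrow> \<omega> [^] (i :: nat) \<in> pow_image \<Omega> k \<longleftrightarrow> P_dvd P k i"
    and generator: "topological_generator \<Omega> \<omega>"
begin

sublocale comm_group \<Omega> by (rule comm)

lemma omega_closed [simp]: "\<omega> \<in> carrier \<Omega>"
  using generator by (simp add: topological_generator_def)

lemma subgroup_pow_image: "subgroup (pow_image \<Omega> k) \<Omega>"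
proof (rule subgroup.intro)
  show "x \<otimes> y \<in> pow_image \<Omega> k" if "x \<in> pow_image \<Omega> k" "y \<in> pow_image \<Omega> k" for x y
    using that by (auto simp: pow_image_def nat_pow_distrib[symmetric])
  show "\<one> \<in> pow_image \<Omega> k" unfolding pow_image_def by (rule image_eqI[of _ _ \<one>]) auto
  show "inv x \<in> pow_image \<Omega> k" if "x \<in> pow_image \<Omega> k" for x
    using that by (auto simp: pow_image_def nat_pow_inv[symmetric])
qed (auto simp: pow_image_def)

lemma pow_image_mult_subset: "pow_image \<Omega> (a * b) \<subseteq> pow_image \<Omega> a"
proof
  fix y assume "y \<in> pow_image \<Omega> (a * b)"
  then obtain x where "x \<in> carrier \<Omega>" "y = (x [^] b) [^] a"
    by (auto simp: pow_image_def nat_pow_pow mult.commute)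
  then show "y \<in> pow_image \<Omega> a" by (auto simp: pow_image_def)
qed

lemma pow_inj:
  assumes "x \<in> carrier \<Omega>" "y \<in> carrier \<Omega>" "k > 0" "x [^] (k::nat) = y [^] k"
  shows "x = y"
proof -
  have "(x \<otimes> inv y) [^] k = \<one>" using assms by (simp add: nat_pow_distrib nat_pow_inv)
  then have "x \<otimes> inv y = \<one>" using torsion_free[of "x \<otimes> inv y" k] assms by simp
  then show ?thesis using assms by (metis inv_equality inv_inv inv_closed)
qed

lemma in_closure_generate:
  assumes "openin (topo \<Omega>) S" "x \<in> S"
  shows "\<exists>z::int. \<omega> [^] z \<in> S"
proof -
  have "x \<in> topo \<Omega> closure_of generate \<Omega> {\<omega>}"
    using assms openin_subset[OF assms(1)] generator by (auto simp: topological_generator_def)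
  then obtain y where "y \<in> S" "y \<in> generate \<Omega> {\<omega>}" using assms by (auto simp: in_closure_of)
  then show ?thesis using generate_pow[of \<omega>] by auto
qed

text \<open>Integer powers of \<omega> are dense and the coset of x modulo k-th powers is open. A
  possibly negative exponent z is replaced by z + N k, which is positive since N exceeds |z| and k
  is positive; this changes the power only by a k-th power. Positive exponents are what Frobenius
  lifts require.\<close>

lemma eq_omega_pow_mult:
  assumes x: "x \<in> carrier \<Omega>" and k: "k > 0"
  obtains j y where "j > 0" "y \<in> pow_image \<Omega> k" "x = \<omega> [^] (j::nat) \<otimes> y"
proof -
  interpret K: subgroup "pow_image \<Omega> k" \<Omega> by (rule subgroup_pow_image)
  have "openin (topo \<Omega>) (pow_image \<Omega> k #> x)" using openin_r_coset[OF x openin_pow_image[OF k]] .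
  moreover have "x \<in> pow_image \<Omega> k #> x" by (rule rcos_self[OF x subgroup_pow_image])
  ultimately obtain z :: int where "\<omega> [^] z \<in> pow_image \<Omega> k #> x" using in_closure_generate by blast
  then obtain y where y: "y \<in> pow_image \<Omega> k" "\<omega> [^] z = y \<otimes> x" by (auto simp: r_coset_def)
  define N where "N = nat \<bar>z\<bar> + 1"
  define j where "j = nat (z + int (N * k))"
  have "z + int (N * k) > 0"
  proof -
    have "int N * 1 \<le> int N * int k" using k by (intro mult_left_mono) auto
    moreover have "int N = \<bar>z\<bar> + 1" by (simp add: N_def)
    moreover have "int (N * k) = int N * int k" by simp
    ultimately show ?thesis by linarith
  qed
  then have j: "j > 0" "int j = z + int (N * k)" by (auto simp: j_def)
  have "\<omega> [^] j = \<omega> [^] (int j)" by (simp add: int_pow_int)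
  also have "\<dots> = \<omega> [^] z \<otimes> \<omega> [^] (N * k)" unfolding j(2) by (simp add: int_pow_mult flip: int_pow_int)
  also have "\<dots> = y \<otimes> x \<otimes> (\<omega> [^] N) [^] k" by (simp add: y nat_pow_pow)
  finally have jw: "\<omega> [^] j = y \<otimes> x \<otimes> (\<omega> [^] N) [^] k" .
  let ?y = "inv (y \<otimes> (\<omega> [^] N) [^] k)"
  have "?y \<in> pow_image \<Omega> k" using y by (intro K.m_inv_closed K.m_closed) (auto simp: pow_image_def)
  moreover have "x = \<omega> [^] j \<otimes> ?y"
  proof -
    have yc: "y \<in> carrier \<Omega>" using y by simp
    have "\<omega> [^] j = x \<otimes> (y \<otimes> (\<omega> [^] N) [^] k)" unfolding jw using yc x by (simp add: m_ac)
    then show ?thesis using yc x by (simp add: m_assoc)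
  qed
  ultimately show ?thesis using that j(1) by blast
qed

text \<open>If \<omega>^(j-i) is trivial, it is a p^j-th power for some p in \<open>P\<close>, so
  p^j divides j - i; but 0 < j - i < p^j. For empty \<open>P\<close> there is no such p, and
  \<Omega> is trivial.\<close>

lemma omega_pow_inj:
  assumes "P \<noteq> {}" and "\<omega> [^] (i::nat) = \<omega> [^] (j::nat)"
  shows "i = j"
proof -
  have *: "i = j" if le: "i \<le> j" and eq: "\<omega> [^] (i::nat) = \<omega> [^] (j::nat)" for i j
  proof (rule ccontr)
    assume "i \<noteq> j"
    obtain p where p: "p \<in> P" using assms(1) by blast
    have "\<omega> [^] i \<otimes> \<omega> [^] (j - i) = \<omega> [^] i \<otimes> \<one>" 
      using le eq by (subst nat_pow_mult) auto
    then have 1: "\<omega> [^] (j - i) = \<one>" using Units_l_cancel[of "\<omega> [^] i"] by simp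
    have pp: "p > 1" using prime_gt_1_nat[OF prime_P[OF p]] .
    have "\<omega> [^] (j - i) \<in> pow_image \<Omega> (p ^ j)"
      unfolding 1 by (rule subgroup.one_closed[OF subgroup_pow_image])
    then have "p ^ multiplicity p (p ^ j) dvd j - i"
      using pow_in_pow_image_iff[of "p ^ j" "j - i"] p pp by (auto simp: P_dvd_def)
    then have "p ^ j dvd j - i" using pp prime_P[OF p] by (simp add: not_prime_unit)
    moreover have "j - i > 0" using \<open>i \<noteq> j\<close> le by simp
    ultimately have "p ^ j \<le> j - i" by (rule dvd_imp_le)
    moreover have "j < p ^ j" using pp by (simp add: power_gt_expt)
    ultimately show False by simp
  qed
  show ?thesis using *[of i j] *[of j i] assms(2) by fastforce
qed

text \<open>The elements whose k-th power lies in \<open>D\<close> form a closed set containing all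
  powers of \<omega>, hence everything.\<close>

lemma pow_image_subset_closed:
  assumes D: "subgroup D \<Omega>" "closedin (topo \<Omega>) D" and k: "\<omega> [^] (k::nat) \<in> D"
  shows "pow_image \<Omega> k \<subseteq> D"
proof -
  interpret D: subgroup D \<Omega> by fact
  have cont: "continuous_map (topo \<Omega>) (topo \<Omega>) (\<lambda>x. x [^] n)" for n :: nat
    by (induction n) (auto intro!: continuous_map_mult)
  let ?S = "{x \<in> topspace (topo \<Omega>). x [^] k \<in> D}"
  have cl: "closedin (topo \<Omega>) ?S" by (rule closedin_continuous_map_preimage[OF cont D(2)])
  have "generate \<Omega> {\<omega>} \<subseteq> ?S"
  proof
    fix x assume "x \<in> generate \<Omega> {\<omega>}"
    then obtain z :: int where z: "x = \<omega> [^] z" using generate_pow[of \<omega>] by auto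
    have "x [^] k = (\<omega> [^] k) [^] z"
      by (simp add: z int_pow_int[symmetric] int_pow_pow mult.commute)
    moreover have "(\<omega> [^] k) [^] z \<in> D" using D(1) k by (rule subgroup_int_pow_closed)
    ultimately show "x \<in> ?S" by (simp add: z)
  qed
  then have "topo \<Omega> closure_of generate \<Omega> {\<omega>} \<subseteq> ?S" by (rule closure_of_minimal[OF _ cl])
  then show ?thesis using generator by (auto simp: topological_generator_def pow_image_def)
qed

text \<open>The quotient by \<open>D\<close> is finite and, by density, generated by the class of
  \<omega>. Let f be its order: f-th powers lie in \<open>D\<close>, and \<omega>^i lies in
  \<open>D\<close> only if f divides i. Primes outside \<open>P\<close> being invertible, \<omega>
  raised to the \<open>P\<close>-part of f is already an f-th power, so f equals its
  \<open>P\<close>-part.\<close>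

lemma finite_index_eq_pow_image:
  assumes D: "subgroup D \<Omega>" "finite (rcosets D)"
  shows "P_number P (card (rcosets D))" "D = pow_image \<Omega> (card (rcosets D))"
proof -
  let ?f = "card (rcosets D)"
  interpret D: subgroup D \<Omega> by fact
  interpret D: normal D \<Omega> using D(1) by (rule subgroup_imp_normal)
  let ?Q = "\<Omega> Mod D"
  interpret Q: group ?Q by (rule D.factorgroup_is_group)
  have fin: "finite (carrier ?Q)" using D by (simp add: FactGroup_def)
  have ordQ: "Coset.order ?Q = ?f" by (simp add: Coset.order_def FactGroup_def)
  have f0: "?f > 0" using fin Q.order_gt_0_iff_finite by (simp add: ordQ)
  have Qeq: "(D #> x = \<one>\<^bsub>?Q\<^esub>) \<longleftrightarrow> x \<in> D" if "x \<in> carrier \<Omega>" for x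
    using that D.rcos_const[of x] rcos_self[OF that D(1)] by auto
  have sub: "pow_image \<Omega> ?f \<subseteq> D"
  proof
    fix y assume "y \<in> pow_image \<Omega> ?f"
    then obtain x where x: "x \<in> carrier \<Omega>" "y = x [^] ?f" by (auto simp: pow_image_def)
    have "(D #> x) [^]\<^bsub>?Q\<^esub> Coset.order ?Q = \<one>\<^bsub>?Q\<^esub>"
      using x by (intro Q.pow_order_eq_1) (auto simp: carrier_FactGroup)
    then show "y \<in> D" using x Qeq[of y] by (simp add: ordQ D.FactGroup_pow)
  qed
  let ?a = "D #> \<omega>"
  have ac: "?a \<in> carrier ?Q" by (auto simp: carrier_FactGroup)
  have decomp: "\<exists>j::nat. \<exists>y \<in> D. x = \<omega> [^] j \<otimes> y \<and> y \<in> pow_image \<Omega> ?f" if "x \<in> carrier \<Omega>" for x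
    using eq_omega_pow_mult[OF that f0] sub by (metis subsetD)
  have "carrier ?Q \<subseteq> generate ?Q {?a}"
  proof
    fix X assume "X \<in> carrier ?Q"
    then obtain x where x: "x \<in> carrier \<Omega>" "X = D #> x" by (auto simp: carrier_FactGroup)
    obtain j :: nat and y where j: "y \<in> D" "x = \<omega> [^] j \<otimes> y" using decomp[OF x(1)] by blast
    have "X = D #> (y \<otimes> \<omega> [^] j)" using x j by (simp add: m_comm)
    also have "\<dots> = D #> \<omega> [^] j" using j D.rcos_const[OF _ j(1)] is_group
      by (metis D.mem_carrier D.subset coset_mult_assoc nat_pow_closed omega_closed)
    also have "\<dots> = ?a [^]\<^bsub>?Q\<^esub> j" by (simp add: D.FactGroup_pow)
    finally show "X \<in> generate ?Q {?a}"
      using Q.generate_pow_nat[OF _ ] Q.generate_pow[OF ac] int_pow_int by (metis (mono_tags, lifting) UNIV_I mem_Collect_eq)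
  qed
  then have "generate ?Q {?a} = carrier ?Q" using Q.generate_in_carrier[of "{?a}"] ac by auto
  then have orda: "Q.ord ?a = ?f" using Q.generate_pow_card[OF ac] ordQ by (simp add: Coset.order_def)
  have memD: "\<omega> [^] i \<in> D \<longleftrightarrow> ?f dvd i" for i :: nat
    using Q.pow_eq_id[OF ac, of i] Qeq[of "\<omega> [^] i"] by (simp add: orda D.FactGroup_pow)
  have "\<omega> [^] P_part P ?f \<in> pow_image \<Omega> ?f"
    using pow_in_pow_image_iff[OF f0] P_dvd_iff[OF prime_P f0] by simp
  then have "?f dvd P_part P ?f" using memD sub by blast
  moreover have "P_part P ?f dvd ?f" by (rule dvdI) (rule P_part_mult_P'_part[OF f0, symmetric])
  ultimately have PF: "P_part P ?f = ?f" by (rule dvd_antisym[rotated])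
  have "P_number P (P_part P ?f)" by (rule P_number_P_part[OF _ f0]) (rule prime_P)
  then show Pf: "P_number P ?f" by (subst (asm) PF)
  have "D \<subseteq> pow_image \<Omega> ?f"
  proof
    fix x assume x: "x \<in> D"
    obtain j :: nat and y where j: "y \<in> D" "x = \<omega> [^] j \<otimes> y" "y \<in> pow_image \<Omega> ?f"
      using decomp[OF D.mem_carrier[OF x]] by blast
    have "\<omega> [^] j = x \<otimes> inv y" using j x by (simp add: m_assoc)
    then have "\<omega> [^] j \<in> D" using D.m_closed[OF x D.m_inv_closed[OF j(1)]] by metis
    then have "?f dvd j" using memD by blast
    then have "\<omega> [^] j \<in> pow_image \<Omega> ?f" using pow_in_pow_image_iff[OF f0] P_dvd_P_number[OF prime_P Pf] by simp
    then show "x \<in> pow_image \<Omega> ?f" using j subgroup.m_closed[OF subgroup_pow_image] by blast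
  qed
  then show "D = pow_image \<Omega> ?f" using sub by blast
qed

end

lemma procyclicI:
  assumes P: "\<And>p. p \<in> P \<Longrightarrow> prime p"
    and tg: "topological_group \<Omega>" and iso: "tgroup_isomorphic \<Omega> (Z_P P)"
    and gen: "topological_generator \<Omega> \<omega>"
  shows "procyclic \<Omega> P \<omega>"
proof -
  interpret topological_group \<Omega> by fact
  obtain f where f: "f \<in> iso \<Omega> (Z_P P)" and hf: "homeomorphic_map (topo \<Omega>) (topo (Z_P P)) f"
    using iso by (auto simp: tgroup_isomorphic_def)
  let ?Z = "Z_P P"
  have fh: "f \<in> hom \<Omega> ?Z" and fb: "bij_betw f (carrier \<Omega>) (carrier ?Z)" using f by (auto simp: iso_def)
  have fi: "inj_on f (carrier \<Omega>)" and fim: "f ` carrier \<Omega> = carrier ?Z" using fb by (auto simp: bij_betw_def)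
  have fc: "f x \<in> carrier ?Z" if "x \<in> carrier \<Omega>" for x using that fim by blast
  have fm: "f (x \<otimes>\<^bsub>\<Omega>\<^esub> y) = f x \<otimes>\<^bsub>?Z\<^esub> f y" if "x \<in> carrier \<Omega>" "y \<in> carrier \<Omega>" for x y
    using fh that by (auto simp: hom_def)
  have Zc: "x \<otimes>\<^bsub>?Z\<^esub> y = y \<otimes>\<^bsub>?Z\<^esub> x" for x y by (simp add: mult_Z_P add.commute)
  have Zone: "\<one>\<^bsub>?Z\<^esub> \<in> carrier ?Z" "\<one>\<^bsub>?Z\<^esub> \<otimes>\<^bsub>?Z\<^esub> y = y" if "y \<in> carrier ?Z" for y
  proof -
    show "\<one>\<^bsub>?Z\<^esub> \<in> carrier ?Z"
      using prime_gt_0_nat[OF P] by (auto simp: one_Z_P carrier_Z_P carrier_padic_integers)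
    then have "\<one>\<^bsub>?Z\<^esub> \<otimes>\<^bsub>?Z\<^esub> y \<in> extensional P" by (simp add: mult_Z_P)
    then show "\<one>\<^bsub>?Z\<^esub> \<otimes>\<^bsub>?Z\<^esub> y = y"
    proof (rule extensionalityI[of _ P])
      show "y \<in> extensional P" using that by (auto simp: carrier_Z_P PiE_iff)
      show "(\<one>\<^bsub>?Z\<^esub> \<otimes>\<^bsub>?Z\<^esub> y) p = y p" if "p \<in> P" for p
        using that Z_P_bounds(1,2)[OF P \<open>y \<in> carrier ?Z\<close> that] by (simp add: mult_Z_P one_Z_P)
    qed
  qed
  have comm: "comm_group \<Omega>"
  proof (rule group.group_comm_groupI)
    show "x \<otimes>\<^bsub>\<Omega>\<^esub> y = y \<otimes>\<^bsub>\<Omega>\<^esub> x" if "x \<in> carrier \<Omega>" "y \<in> carrier \<Omega>" for x y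
      using that fm[of x y] fm[of y x] Zc inj_onD[OF fi, of "x \<otimes>\<^bsub>\<Omega>\<^esub> y" "y \<otimes>\<^bsub>\<Omega>\<^esub> x"] by simp
  qed (rule is_group)
  have f1: "f \<one>\<^bsub>\<Omega>\<^esub> = \<one>\<^bsub>?Z\<^esub>"
  proof -
    obtain u where u: "u \<in> carrier \<Omega>" "f u = \<one>\<^bsub>?Z\<^esub>" using Zone(1)[OF fc[OF one_closed]] fim by (metis imageE)
    have "f (u \<otimes>\<^bsub>\<Omega>\<^esub> \<one>\<^bsub>\<Omega>\<^esub>) = f \<one>\<^bsub>\<Omega>\<^esub>" using u fc Zone(2) by (subst fm) auto
    then show ?thesis using u by simp
  qed
  have Zp: "y [^]\<^bsub>?Z\<^esub> (0::nat) = \<one>\<^bsub>?Z\<^esub>" "y [^]\<^bsub>?Z\<^esub> Suc k = y [^]\<^bsub>?Z\<^esub> k \<otimes>\<^bsub>?Z\<^esub> y" for y k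
    by (simp_all add: nat_pow_def)
  have fp: "f (x [^]\<^bsub>\<Omega>\<^esub> (k::nat)) = f x [^]\<^bsub>?Z\<^esub> k" if "x \<in> carrier \<Omega>" for x k
    by (induction k) (use that f1 fm Zp in auto)
  have pim: "f ` pow_image \<Omega> k = pow_image ?Z k" for k
    unfolding pow_image_def image_image fim[symmetric] by (auto simp: fp)
  have pc: "pow_image \<Omega> k \<subseteq> carrier \<Omega>" for k by (auto simp: pow_image_def)
  have mem: "x \<in> pow_image \<Omega> k \<longleftrightarrow> f x \<in> pow_image ?Z k" if "x \<in> carrier \<Omega>" for x k
    using that fi pc[of k] unfolding pim[symmetric] by (auto simp: inj_on_def)
  have Hd: "Hausdorff_space (topo \<Omega>)"
    using Hausdorff_Z_P homeomorphic_Hausdorff_space homeomorphic_map_imp_homeomorphic_space[OF hf] by blast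
  have op: "openin (topo \<Omega>) (pow_image \<Omega> k)" if "k > 0" for k
  proof -
    have "openin (topo ?Z) (f ` pow_image \<Omega> k)" unfolding pim by (rule openin_pow_image_Z_P[OF P that])
    then show ?thesis using homeomorphic_map_openness[OF hf, of "pow_image \<Omega> k"] pc by simp
  qed
  have tf: "x = \<one>\<^bsub>\<Omega>\<^esub>" if "x \<in> carrier \<Omega>" "k > 0" "x [^]\<^bsub>\<Omega>\<^esub> (k::nat) = \<one>\<^bsub>\<Omega>\<^esub>" for x k
  proof -
    have "f x [^]\<^bsub>?Z\<^esub> k = \<one>\<^bsub>?Z\<^esub>" using that fp f1 by metis
    then have "f x = f \<one>\<^bsub>\<Omega>\<^esub>" using Z_P_torsion_free[OF P fc[OF that(1)] that(2)] f1 by simp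
    then show ?thesis using fi that(1) by (auto simp: inj_on_def)
  qed
  have pi0: "\<omega> [^]\<^bsub>\<Omega>\<^esub> i \<in> pow_image \<Omega> k \<longleftrightarrow> P_dvd P k i" if k: "k > 0" for k i :: nat
  proof
    have wc: "\<omega> \<in> carrier \<Omega>" using gen by (simp add: topological_generator_def)
    interpret comm_group \<Omega> by (rule comm)
    have sg: "subgroup (pow_image \<Omega> k) \<Omega>"
    proof (rule subgroup.intro)
      show "x \<otimes>\<^bsub>\<Omega>\<^esub> y \<in> pow_image \<Omega> k" if "x \<in> pow_image \<Omega> k" "y \<in> pow_image \<Omega> k" for x y
        using that by (auto simp: pow_image_def nat_pow_distrib[symmetric])
      show "\<one>\<^bsub>\<Omega>\<^esub> \<in> pow_image \<Omega> k" unfolding pow_image_def by (rule image_eqI[of _ _ "\<one>\<^bsub>\<Omega>\<^esub>"]) auto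
      show "inv\<^bsub>\<Omega>\<^esub> x \<in> pow_image \<Omega> k" if "x \<in> pow_image \<Omega> k" for x
        using that by (auto simp: pow_image_def nat_pow_inv[symmetric])
    qed (auto simp: pow_image_def)
    show "\<omega> [^]\<^bsub>\<Omega>\<^esub> i \<in> pow_image \<Omega> k" if "P_dvd P k i"
    proof (cases "i = 0")
      case True
      then show ?thesis using subgroup.one_closed[OF sg] by simp
    next
      case False
      then show ?thesis using pow_in_pow_image_Z_P[OF P k fc[OF wc] that] mem fp wc by simp
    qed
    \<comment> \<open>For the element e of \<open>Z_P_unit\<close> the criterion is known. By
      density its preimage e' equals a power of \<omega> up to a k-th power, so e'^i is a k-th power
      whenever \<omega>^i is.\<close>
    assume wi: "\<omega> [^]\<^bsub>\<Omega>\<^esub> i \<in> pow_image \<Omega> k"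
    obtain e where e: "e \<in> carrier ?Z" "e [^]\<^bsub>?Z\<^esub> i \<in> pow_image ?Z k \<Longrightarrow> P_dvd P k i"
      using Z_P_unit[OF P] k by metis
    have "e \<in> f ` carrier \<Omega>" using e(1) fim by simp
    then obtain e' where e': "e' \<in> carrier \<Omega>" "f e' = e" by blast
    have "openin (topo \<Omega>) (pow_image \<Omega> k #>\<^bsub>\<Omega>\<^esub> e')" using openin_r_coset[OF e'(1) op[OF k]] .
    moreover have "e' \<in> pow_image \<Omega> k #>\<^bsub>\<Omega>\<^esub> e'" by (rule rcos_self[OF e'(1) sg])
    moreover have "e' \<in> topo \<Omega> closure_of generate \<Omega> {\<omega>}"
      using e' gen by (simp add: topological_generator_def)
    ultimately obtain y where "y \<in> generate \<Omega> {\<omega>}" "y \<in> pow_image \<Omega> k #>\<^bsub>\<Omega>\<^esub> e'"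
      unfolding in_closure_of by blast
    then obtain z :: int where "\<omega> [^]\<^bsub>\<Omega>\<^esub> z \<in> pow_image \<Omega> k #>\<^bsub>\<Omega>\<^esub> e'"
      using generate_pow[OF wc] by auto
    then obtain y where y: "y \<in> pow_image \<Omega> k" "\<omega> [^]\<^bsub>\<Omega>\<^esub> z = y \<otimes>\<^bsub>\<Omega>\<^esub> e'"
      unfolding r_coset_def by blast
    have yc: "y \<in> carrier \<Omega>" using y pc by blast
    have "e' = \<omega> [^]\<^bsub>\<Omega>\<^esub> z \<otimes>\<^bsub>\<Omega>\<^esub> inv\<^bsub>\<Omega>\<^esub> y" using y yc e' by (simp add: m_ac)
    then have "e' [^]\<^bsub>\<Omega>\<^esub> i = (\<omega> [^]\<^bsub>\<Omega>\<^esub> z) [^]\<^bsub>\<Omega>\<^esub> i \<otimes>\<^bsub>\<Omega>\<^esub> (inv\<^bsub>\<Omega>\<^esub> y) [^]\<^bsub>\<Omega>\<^esub> i"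
      using yc wc by (simp add: nat_pow_distrib)
    also have "(\<omega> [^]\<^bsub>\<Omega>\<^esub> z) [^]\<^bsub>\<Omega>\<^esub> i = (\<omega> [^]\<^bsub>\<Omega>\<^esub> i) [^]\<^bsub>\<Omega>\<^esub> z"
      using wc by (simp add: int_pow_int[symmetric] int_pow_pow mult.commute)
    finally have "e' [^]\<^bsub>\<Omega>\<^esub> i \<in> pow_image \<Omega> k"
      using sg subgroup_int_pow_closed[OF sg wi, of z] subgroup.m_inv_closed[OF sg y(1)]
        subgroup_int_pow_closed[OF sg, of "inv\<^bsub>\<Omega>\<^esub> y" "int i"] 
      by (simp add: int_pow_int subgroup.m_closed)
    then show "P_dvd P k i" using e e' mem fp by simp
  qed
  show ?thesis
    by (rule procyclic.intro[OF tg procyclic_axioms.intro])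
      (assumption | rule P comm Hd tf op pi0 gen)+
qed

section \<open>Ramification\<close>

lemma (in group) conj_set_eq:
  assumes "K \<subseteq> carrier G" "g \<in> carrier G"
  shows "conj_set G g K = (\<lambda>x. g \<otimes> x \<otimes> inv g) ` K"
  by (auto simp: conj_set_def l_coset_def r_coset_def)

lemma (in group) conj_mult:
  "\<lbrakk>g \<in> carrier G; x \<in> carrier G; y \<in> carrier G\<rbrakk> \<Longrightarrow>
    g \<otimes> (x \<otimes> y) \<otimes> inv g = (g \<otimes> x \<otimes> inv g) \<otimes> (g \<otimes> y \<otimes> inv g)"
  by (simp add: group_norm)

lemma (in topological_group) normal_in_iff:
  assumes "subgroup K G"
  shows "normal_in G K N \<longleftrightarrow> subgroup N G \<and> N \<subseteq> K \<and> (\<forall>g\<in>K. \<forall>x\<in>N. g \<otimes> x \<otimes> inv g \<in> N)"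
proof -
  interpret K: subgroup K G by fact
  interpret GK: group "G\<lparr>carrier := K\<rparr>" by (rule K.subgroup_is_group[OF is_group])
  have inv: "inv\<^bsub>G\<lparr>carrier := K\<rparr>\<^esub> g = inv g" if "g \<in> K" for g
    using that m_inv_consistent[OF assms] by simp
  have "subgroup N (G\<lparr>carrier := K\<rparr>) \<longleftrightarrow> subgroup N G \<and> N \<subseteq> K"
  proof
    assume N: "subgroup N (G\<lparr>carrier := K\<rparr>)"
    show "subgroup N G \<and> N \<subseteq> K"
      using incl_subgroup[OF assms N] subgroup.subset[OF N] by simp
  next
    assume "subgroup N G \<and> N \<subseteq> K"
    then show "subgroup N (G\<lparr>carrier := K\<rparr>)" using subgroup_incl[OF _ assms] by blast
  qed
  then show ?thesis
    unfolding normal_in_def GK.normal_inv_iff using inv by auto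
qed

lemma (in topological_group) conj_set_normal:
  assumes "subgroup K G" "normal_in G K N" "g \<in> K"
  shows "conj_set G g N = N"
proof -
  interpret K: subgroup K G by fact
  have N: "subgroup N G" "N \<subseteq> K" "\<And>g x. g \<in> K \<Longrightarrow> x \<in> N \<Longrightarrow> g \<otimes> x \<otimes> inv g \<in> N"
    using assms(2) unfolding normal_in_iff[OF assms(1)] by blast+
  interpret N: subgroup N G by fact
  have g: "g \<in> carrier G" using assms by simp
  have "N \<subseteq> (\<lambda>x. g \<otimes> x \<otimes> inv g) ` N"
  proof
    fix x assume x: "x \<in> N"
    have "inv g \<otimes> x \<otimes> inv (inv g) \<in> N" using N(3)[of "inv g" x] assms x by simp
    moreover have "x = g \<otimes> (inv g \<otimes> x \<otimes> inv (inv g)) \<otimes> inv g"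
      using g N.mem_carrier[OF x] by (simp add: group_norm)
    ultimately show "x \<in> (\<lambda>x. g \<otimes> x \<otimes> inv g) ` N" by blast
  qed
  moreover have "(\<lambda>x. g \<otimes> x \<otimes> inv g) ` N \<subseteq> N" using N(3)[OF assms(3)] by (rule image_subsetI)
  ultimately show ?thesis unfolding conj_set_eq[OF N.subset g] by (rule equalityI[rotated])
qed

lemma index_self: "subgroup K G \<Longrightarrow> group G \<Longrightarrow> index G K K = 1"
proof -
  assume K: "subgroup K G" "group G"
  interpret group G by fact
  interpret K: subgroup K G by fact
  interpret GK: group "G\<lparr>carrier := K\<rparr>" by (rule K.subgroup_is_group[OF is_group])
  have "K \<noteq> {}" using subgroup.one_closed[OF K(1)] by blast
  then have "rcosets\<^bsub>G\<lparr>carrier := K\<rparr>\<^esub> K = {K}"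
    using K.rcos_const[OF is_group] by (auto simp: RCOSETS_def)
  then show ?thesis by (simp add: index_def)
qed

section \<open>Inertia degrees and unramified subgroups\<close>

locale fn_setting =
  fixes P :: "nat set" and G :: "'g tgroup" (structure) and \<Omega> :: "'w tgroup" and \<omega> :: 'w
    and d :: "'g \<Rightarrow> 'w" and E :: "'g pair_dom" and M :: "'g set ric_dom"
    and C :: "('g, 'g set, 'c) ric_fun" and v :: "'g set \<Rightarrow> 'c \<Rightarrow> 'w"
  assumes primes: "\<And>p. p \<in> P \<Longrightarrow> prime p"
    and pro_P: "pro_group P G"
    and Omega: "topological_group \<Omega>" "tgroup_isomorphic \<Omega> (Z_P P)" "topological_generator \<Omega> \<omega>"
    and d: "d \<in> tgroup_hom G \<Omega>" "d ` carrier G = carrier \<Omega>"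
    and spectrum: "spectrum G E"
    and datum: "FN_datum G \<Omega> \<omega> d E M C v"
begin

sublocale topological_group G
  using pro_P by (simp add: pro_group_def profinite_group_def)

sublocale Om: procyclic \<Omega> P \<omega>
  using procyclicI[OF primes Omega] .

lemma P_dvd_iff': "n > 0 \<Longrightarrow> P_dvd P n i \<longleftrightarrow> P_part P n dvd i"
  using P_dvd_iff primes by blast

lemma P_dvd_P_number': "P_number P n \<Longrightarrow> P_dvd P n i \<longleftrightarrow> n dvd i"
  using P_dvd_P_number primes by blast

lemma P_part_mult': "a > 0 \<Longrightarrow> b > 0 \<Longrightarrow> P_part P (a * b) = P_part P a * P_part P b"
  using P_part_mult primes by blast

lemma P'_part_mult': "a > 0 \<Longrightarrow> b > 0 \<Longrightarrow> P'_part P (a * b) = P'_part P a * P'_part P b"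
  using P'_part_mult primes by blast

lemma d_hom: "d \<in> hom G \<Omega>" and d_cont: "continuous_map (topo G) (topo \<Omega>) d"
  using d by (auto simp: tgroup_hom_def)

sublocale d: group_hom G \<Omega> d
  by unfold_locales (rule d_hom)

lemma compact_G: "compact_space (topo G)"
  using pro_P by (simp add: pro_group_def profinite_group_def)

abbreviation "fd \<equiv> inertia_deg G \<Omega> d"

lemma mackey_M: "mackey_system G M" and arith_M: "arithmetic G M"
  and inertially_finite_M: "inertially_finite_system G \<Omega> d M"
  and mackey_C: "cohomological_mackey_functor G M C" and val_v: "v \<in> valuations G \<Omega> \<omega> d M C"
  and cover_M: "mackey_cover G E M"
  using datum by (auto simp: FN_datum_def mackey_cover_def)

sublocale M: ric_domain G "conj_set G" M
  using mackey_M by (simp add: mackey_system_def subgroup_system_def)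

lemma M_closed_subgroup: "H \<in> base M \<Longrightarrow> closed_subgroup G H"
  using inertially_finite_M by (simp add: inertially_finite_system_def inertially_finite_def)

lemma M_subgroup: "H \<in> base M \<Longrightarrow> subgroup H G"
  using M_closed_subgroup by (simp add: closed_subgroup_def)

lemma M_carrier: "H \<in> base M \<Longrightarrow> h \<in> H \<Longrightarrow> h \<in> carrier G"
  using M_subgroup by (meson subgroup.mem_carrier)

lemma M_closedin: "H \<in> base M \<Longrightarrow> closedin (topo G) H"
  using M_closed_subgroup by (simp add: closed_subgroup_def)

lemma M_compact: "H \<in> base M \<Longrightarrow> compactin (topo G) H"
  using M_closedin compact_G by (simp add: closedin_compact_space)

lemma open_rdom: "H \<in> base M \<Longrightarrow> open_in_group G H I \<Longrightarrow> I \<in> rdom M H"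
  and open_idom: "H \<in> base M \<Longrightarrow> open_in_group G H I \<Longrightarrow> I \<in> idom M H"
  using arith_M by (auto simp: arithmetic_def)

lemma open_base: "H \<in> base M \<Longrightarrow> open_in_group G H I \<Longrightarrow> I \<in> base M"
  using open_idom M.idom_sub by blast

lemma rdom_idom_subset: "H \<in> base M \<Longrightarrow> I \<in> rdom M H \<union> idom M H \<Longrightarrow> I \<subseteq> H"
  using mackey_M by (auto simp: mackey_system_def subgroup_system_def)

lemma subgroup_d_image: "subgroup K G \<Longrightarrow> subgroup (d ` K) \<Omega>"
  by (rule d.subgroup_img_is_subgroup)

lemma closedin_d_image: "H \<in> base M \<Longrightarrow> closedin (topo \<Omega>) (d ` H)"
  using image_compactin[OF M_compact d_cont] compactin_imp_closedin[OF Om.Hausdorff] by blast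

lemma fd_eq: "fd H = card (rcosets\<^bsub>\<Omega>\<^esub> (d ` H))"
  by (simp add: inertia_deg_def rel_inertia_deg_def index_def d)

lemma
  assumes "H \<in> base M"
  shows P_number_fd: "P_number P (fd H)" and d_image: "d ` H = pow_image \<Omega> (fd H)"
proof -
  have "finite (rcosets\<^bsub>\<Omega>\<^esub> (d ` H))"
    using inertially_finite_M assms
    by (auto simp: inertially_finite_system_def inertially_finite_def finite_index_def d)
  from Om.finite_index_eq_pow_image[OF subgroup_d_image[OF M_subgroup[OF assms]] this]
  show "P_number P (fd H)" "d ` H = pow_image \<Omega> (fd H)" by (simp_all add: fd_eq)
qed

lemma fd_pos: "H \<in> base M \<Longrightarrow> fd H > 0"
  using P_number_fd by (auto simp: P_number_def)

lemma omega_in_fd: "H \<in> base M \<Longrightarrow> \<omega> [^]\<^bsub>\<Omega>\<^esub> (i::nat) \<in> d ` H \<longleftrightarrow> fd H dvd i"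
  using Om.pow_in_pow_image_iff[OF fd_pos] P_dvd_P_number'[OF P_number_fd] d_image by metis

text \<open>Which powers of \<omega> lie in the image of \<open>H\<close> determines both numbers up
  to mutual divisibility. The \<open>P\<close>-part appears because k-th powers in \<Omega> do not
  see primes outside \<open>P\<close>.\<close>

lemma fd_eqI:
  assumes H: "H \<in> base M" and k: "k > 0" "d ` H = pow_image \<Omega> k"
  shows "fd H = P_part P k"
proof -
  have "fd H dvd i \<longleftrightarrow> P_part P k dvd i" for i
    using omega_in_fd[OF H, of i] Om.pow_in_pow_image_iff[OF k(1), of i] P_dvd_iff'[OF k(1), of i] k(2)
    by simp
  then show ?thesis by (metis dvd_antisym dvd_refl)
qed

lemma finite_rcosets_pow_image: "k > 0 \<Longrightarrow> finite (rcosets\<^bsub>\<Omega>\<^esub> (pow_image \<Omega> k))"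
proof -
  assume k: "k > 0"
  have "compactin (topo \<Omega>) (carrier \<Omega>)"
    using image_compactin[OF _ d_cont, of "carrier G"] compact_G d(2) by (simp add: compact_space_def)
  moreover have "open_in_group \<Omega> (carrier \<Omega>) (pow_image \<Omega> k)"
    using Om.subgroup_pow_image Om.openin_pow_image[OF k] subgroup.subset[OF Om.subgroup_pow_image]
    by (simp add: open_in_group_def openin_subtopology) (metis inf.absorb1)
  ultimately show ?thesis
    using Om.finite_rcosets_open[OF Om.subgroup_self] by simp
qed

lemma card_rcosets_pow_image:
  assumes k: "k > 0"
  shows "card (rcosets\<^bsub>\<Omega>\<^esub> (pow_image \<Omega> k)) = P_part P k"
proof -
  let ?c = "card (rcosets\<^bsub>\<Omega>\<^esub> (pow_image \<Omega> k))"
  note * = Om.finite_index_eq_pow_image[OF Om.subgroup_pow_image finite_rcosets_pow_image[OF k]]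
  have c: "?c > 0" using *(1) by (simp add: P_number_def)
  have "?c dvd i \<longleftrightarrow> P_part P k dvd i" for i
  proof -
    have "\<omega> [^]\<^bsub>\<Omega>\<^esub> i \<in> pow_image \<Omega> ?c \<longleftrightarrow> \<omega> [^]\<^bsub>\<Omega>\<^esub> i \<in> pow_image \<Omega> k" using *(2) by metis
    then show ?thesis
      using Om.pow_in_pow_image_iff[OF c, of i] Om.pow_in_pow_image_iff[OF k, of i]
        P_dvd_iff'[OF k, of i] P_dvd_P_number'[OF *(1), of i] by simp
  qed
  then show ?thesis by (metis dvd_antisym dvd_refl)
qed

text \<open>Taking f-th powers is injective since \<Omega> is torsion-free, so it carries the cosets
  of \<open>pow_image \<Omega> k\<close> in \<Omega> bijectively to the cosets in question.\<close>

lemma index_pow_image: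
  assumes f: "f > 0" and k: "k > 0"
  shows "index \<Omega> (pow_image \<Omega> f) (pow_image \<Omega> (f * k)) = P_part P k"
proof -
  let ?\<phi> = "\<lambda>x. x [^]\<^bsub>\<Omega>\<^esub> f"
  have inj: "inj_on ?\<phi> (carrier \<Omega>)" using Om.pow_inj[OF _ _ f] by (auto simp: inj_on_def)
  have im: "pow_image \<Omega> (f * k) = ?\<phi> ` pow_image \<Omega> k"
    by (auto simp: pow_image_def image_image Om.nat_pow_pow mult.commute[of k])
  have pc: "pow_image \<Omega> k \<subseteq> carrier \<Omega>" by (auto simp: pow_image_def)
  have coset: "pow_image \<Omega> (f * k) #>\<^bsub>\<Omega>\<^esub> ?\<phi> a = ?\<phi> ` (pow_image \<Omega> k #>\<^bsub>\<Omega>\<^esub> a)" if "a \<in> carrier \<Omega>" for a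
  proof -
    have "?\<phi> x \<otimes>\<^bsub>\<Omega>\<^esub> ?\<phi> a = ?\<phi> (x \<otimes>\<^bsub>\<Omega>\<^esub> a)" if "x \<in> pow_image \<Omega> k" for x
      using that pc \<open>a \<in> carrier \<Omega>\<close> Om.nat_pow_distrib[of x a f] by auto
    then show ?thesis unfolding im r_coset_def by auto
  qed
  have "rcosets\<^bsub>\<Omega>\<lparr>carrier := pow_image \<Omega> f\<rparr>\<^esub> (pow_image \<Omega> (f * k)) = (\<lambda>X. ?\<phi> ` X) ` (rcosets\<^bsub>\<Omega>\<^esub> (pow_image \<Omega> k))"
    using coset by (auto simp: RCOSETS_def pow_image_def[of \<Omega> f])
  moreover have "inj_on (\<lambda>X. ?\<phi> ` X) (rcosets\<^bsub>\<Omega>\<^esub> (pow_image \<Omega> k))"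
  proof (rule inj_onI)
    fix X Y assume XY: "X \<in> rcosets\<^bsub>\<Omega>\<^esub> (pow_image \<Omega> k)" "Y \<in> rcosets\<^bsub>\<Omega>\<^esub> (pow_image \<Omega> k)" "?\<phi> ` X = ?\<phi> ` Y"
    then have "X \<subseteq> carrier \<Omega>" "Y \<subseteq> carrier \<Omega>"
      using Om.rcosets_part_G[OF Om.subgroup_pow_image[of k]] by blast+
    then show "X = Y" using inj_on_image_eq_iff[OF inj] XY(3) by blast
  qed
  ultimately show ?thesis by (simp add: index_def card_image card_rcosets_pow_image[OF k])
qed

lemma fd_dvd:
  assumes "H \<in> base M" "I \<in> base M" "I \<subseteq> H"
  shows "fd H dvd fd I"
proof -
  have "\<omega> [^]\<^bsub>\<Omega>\<^esub> fd I \<in> d ` I" using omega_in_fd[OF assms(2), of "fd I"] by simp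
  then have "\<omega> [^]\<^bsub>\<Omega>\<^esub> fd I \<in> d ` H" using assms(3) by blast
  then show ?thesis using omega_in_fd[OF assms(1)] by blast
qed

lemma rel_inertia_deg_eq:
  assumes "H \<in> base M" "I \<in> base M" "I \<subseteq> H"
  shows "rel_inertia_deg \<Omega> d H I = fd I div fd H"
proof -
  obtain s where s: "fd I = fd H * s" using fd_dvd[OF assms] by (auto elim: dvdE)
  then have s0: "s > 0" using fd_pos[OF assms(2)] by (auto intro: gr0I)
  have "P_number P s" using P_number_dvd[OF P_number_fd[OF assms(2)]] s by simp
  then show ?thesis
    using index_pow_image[OF fd_pos[OF assms(1)] s0] s P_part_P_number fd_pos[OF assms(1)]
    by (simp add: rel_inertia_deg_def d_image assms)
qed

lemma d_rel_eqI:
  assumes "H \<in> base M" "y \<in> carrier \<Omega>" "y [^]\<^bsub>\<Omega>\<^esub> fd H = d h"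
  shows "d_rel G \<Omega> d H h = y"
  unfolding d_rel_def using assms Om.pow_inj[OF _ _ fd_pos[OF assms(1)]] by (intro the_equality) auto

text \<open>A Frobenius element together with its exponent, kept as a relation: for empty
  \<open>P\<close> the exponent is not determined by h, so that \<open>mult_of\<close> could not
  recover it.\<close>

definition frob_exp :: "'g set \<Rightarrow> 'g \<Rightarrow> nat \<Rightarrow> bool" where
  "frob_exp H h n \<longleftrightarrow> h \<in> H \<and> n > 0 \<and> d h = \<omega> [^]\<^bsub>\<Omega>\<^esub> (fd H * n)"

lemma d_rel_frob: "H \<in> base M \<Longrightarrow> frob_exp H h n \<Longrightarrow> d_rel G \<Omega> d H h = \<omega> [^]\<^bsub>\<Omega>\<^esub> n"
  by (rule d_rel_eqI) (simp_all add: frob_exp_def Om.nat_pow_pow mult.commute)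

lemma Frob_iff: "H \<in> base M \<Longrightarrow> h \<in> Frob G \<Omega> \<omega> d H \<longleftrightarrow> (\<exists>n. frob_exp H h n)"
proof
  assume H: "H \<in> base M"
  show "\<exists>n. frob_exp H h n \<Longrightarrow> h \<in> Frob G \<Omega> \<omega> d H"
    using d_rel_frob[OF H] by (auto simp: Frob_def Omega_plus_def frob_exp_def)
  assume h: "h \<in> Frob G \<Omega> \<omega> d H"
  then obtain n where n: "h \<in> H" "n > 0" "d_rel G \<Omega> d H h = \<omega> [^]\<^bsub>\<Omega>\<^esub> (n::nat)"
    by (auto simp: Frob_def Omega_plus_def)
  have "d h \<in> pow_image \<Omega> (fd H)" using d_image[OF H] n by blast
  then obtain y where y: "y \<in> carrier \<Omega>" "d h = y [^]\<^bsub>\<Omega>\<^esub> fd H" by (auto simp: pow_image_def)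
  then have "y = \<omega> [^]\<^bsub>\<Omega>\<^esub> n" using d_rel_eqI[OF H y(1)] n by simp
  then show "\<exists>n. frob_exp H h n" using n y by (auto simp: frob_exp_def Om.nat_pow_pow mult.commute)
qed

lemma frobenius_exists:
  assumes H: "H \<in> base M"
  obtains \<phi> where "frob_exp H \<phi> 1"
proof -
  have "\<omega> [^]\<^bsub>\<Omega>\<^esub> fd H \<in> d ` H" using omega_in_fd[OF H, of "fd H"] by simp
  then obtain \<phi> where "\<phi> \<in> H" "\<omega> [^]\<^bsub>\<Omega>\<^esub> fd H = d \<phi>" by auto
  then have "frob_exp H \<phi> 1" by (simp add: frob_exp_def)
  then show ?thesis using that by blast
qed

lemma d_pow: "x \<in> carrier G \<Longrightarrow> d (x [^] (n::nat)) = d x [^]\<^bsub>\<Omega>\<^esub> n"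
  by (rule d.hom_nat_pow)

lemma d_conj: "\<lbrakk>g \<in> carrier G; x \<in> carrier G\<rbrakk> \<Longrightarrow> d (g \<otimes> x \<otimes> inv g) = d x"
  by (simp add: Om.m_comm[of _ "inv\<^bsub>\<Omega>\<^esub> d g"] Om.inv_mult_cancel flip: Om.m_assoc)

definition ur_sub :: "'g set \<Rightarrow> nat \<Rightarrow> 'g set" where
  "ur_sub H m = {h \<in> H. d h \<in> pow_image \<Omega> (fd H * m)}"

lemma
  assumes H: "H \<in> base M" and m: "m > 0"
  shows subgroup_ur_sub: "subgroup (ur_sub H m) G"
    and ur_sub_subset: "ur_sub H m \<subseteq> H"
    and open_ur_sub: "open_in_group G H (ur_sub H m)"
    and normal_ur_sub: "normal_in G H (ur_sub H m)"
    and inertia_ur_sub: "inertia G \<Omega> d H \<subseteq> ur_sub H m"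
proof -
  interpret H: subgroup H G by (rule M_subgroup[OF H])
  interpret k: subgroup "pow_image \<Omega> (fd H * m)" \<Omega> by (rule Om.subgroup_pow_image)
  show s: "subgroup (ur_sub H m) G"
    by (rule subgroup.intro) (auto simp: ur_sub_def)
  show sub: "ur_sub H m \<subseteq> H" by (auto simp: ur_sub_def)
  have "fd H * m > 0" using fd_pos[OF H] m by simp
  then have "openin (topo G) {x \<in> topspace (topo G). d x \<in> pow_image \<Omega> (fd H * m)}"
    by (rule openin_continuous_map_preimage[OF d_cont Om.openin_pow_image])
  moreover have "ur_sub H m = {x \<in> topspace (topo G). d x \<in> pow_image \<Omega> (fd H * m)} \<inter> H"
    by (auto simp: ur_sub_def)
  ultimately have "openin (subtopology (topo G) H) (ur_sub H m)"
    unfolding openin_subtopology by blast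
  then show "open_in_group G H (ur_sub H m)" using s sub by (simp add: open_in_group_def)
  have "g \<otimes> x \<otimes> inv g \<in> ur_sub H m" if "g \<in> H" "x \<in> ur_sub H m" for g x
    using that d_conj[of g x] by (simp add: ur_sub_def del: d.hom_mult)
  then show "normal_in G H (ur_sub H m)"
    unfolding normal_in_iff[OF M_subgroup[OF H]] using s sub by simp
  show "inertia G \<Omega> d H \<subseteq> ur_sub H m"
    by (auto simp: inertia_def ur_sub_def kernel_def)
qed

lemma d_ur_sub:
  assumes H: "H \<in> base M"
  shows "d ` ur_sub H m = pow_image \<Omega> (fd H * m)"
proof -
  have "pow_image \<Omega> (fd H * m) \<subseteq> d ` H" using Om.pow_image_mult_subset d_image[OF H] by simp
  then show ?thesis by (auto simp: ur_sub_def)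
qed

lemma ur_sub_base: "H \<in> base M \<Longrightarrow> m > 0 \<Longrightarrow> ur_sub H m \<in> base M"
  using open_base open_ur_sub by blast

lemma fd_ur_sub: "H \<in> base M \<Longrightarrow> m > 0 \<Longrightarrow> fd (ur_sub H m) = fd H * P_part P m"
  using fd_eqI[OF ur_sub_base _ d_ur_sub] fd_pos[of H]
  by (simp add: P_part_mult' P_part_P_number[OF P_number_fd])

lemma open_in_group_subset:
  assumes "open_in_group G H J" "J \<subseteq> I" "I \<subseteq> H"
  shows "open_in_group G I J"
proof -
  obtain T where "openin (topo G) T" "J = T \<inter> H"
    using assms by (auto simp: open_in_group_def openin_subtopology)
  then have "openin (topo G) T" "J = T \<inter> I" using assms by auto
  then show ?thesis using assms unfolding open_in_group_def openin_subtopology by blast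
qed

lemma open_in_group_Int:
  assumes "open_in_group G H J" "open_in_group G H I"
  shows "open_in_group G H (J \<inter> I)"
proof -
  have "subgroup (J \<inter> I) G" using assms by (intro subgroups_Inter_pair) (simp_all add: open_in_group_def)
  moreover have "openin (subtopology (topo G) H) (J \<inter> I)"
    using assms by (intro openin_Int) (simp_all add: open_in_group_def)
  moreover have "J \<inter> I \<subseteq> H" using assms by (auto simp: open_in_group_def)
  ultimately show ?thesis by (simp add: open_in_group_def)
qed

text \<open>If \<open>T\<close> is open with T \<inter> H = \<open>J\<close>, then \<open>I\<close>
  is the union of the relatively open sets x T \<inter> H with x in \<open>I\<close>.\<close>

lemma open_in_group_mono:
  assumes "open_in_group G H J" "J \<subseteq> I" "I \<subseteq> H" "subgroup I G" "subgroup H G"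
  shows "open_in_group G H I"
proof -
  have "subgroup J G" "J \<subseteq> H" and oJ: "openin (subtopology (topo G) H) J" using assms by (auto simp: open_in_group_def)
  interpret J: subgroup J G by fact
  interpret I: subgroup I G by fact
  interpret H: subgroup H G by fact
  obtain T where T: "openin (topo G) T" "J = T \<inter> H" using oJ by (auto simp: openin_subtopology)
  have "openin (subtopology (topo G) H) I"
  proof (subst openin_subopen, intro ballI)
    fix x assume x: "x \<in> I"
    have xc: "x \<in> carrier G" using x by simp
    have "openin (subtopology (topo G) H) ((x <#\<^bsub>G\<^esub> T) \<inter> H)"
      using openin_l_coset[OF xc T(1)] unfolding openin_subtopology by blast
    moreover have "x \<in> (x <#\<^bsub>G\<^esub> T) \<inter> H"
    proof -
      have "\<one> \<in> T" using T subgroup.one_closed[OF J.subgroup_axioms] by blast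
      moreover have "x = x \<otimes> \<one>" using xc by simp
      ultimately show ?thesis using x assms(3) unfolding l_coset_def by blast
    qed
    moreover have "(x <#\<^bsub>G\<^esub> T) \<inter> H \<subseteq> I"
    proof
      fix y assume y: "y \<in> (x <#\<^bsub>G\<^esub> T) \<inter> H"
      then obtain t where t: "t \<in> T" "y = x \<otimes> t" unfolding l_coset_def by blast
      have tc: "t \<in> carrier G" using t openin_subset[OF T(1)] by auto
      have "t = inv x \<otimes> y" using t xc tc by (simp add: inv_mult_cancel)
      then have "t \<in> H" using x y assms(3) H.m_closed[of "inv x" y] H.m_inv_closed[of x] by blast
      then have "t \<in> I" using t T assms(2) by blast
      then show "y \<in> I" using x t by simp
    qed
    ultimately show "\<exists>S. openin (subtopology (topo G) H) S \<and> x \<in> S \<and> S \<subseteq> I" by blast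
  qed
  then show ?thesis using assms by (simp add: open_in_group_def)
qed

end

section \<open>Frobenius groups\<close>

text \<open>Here \<open>k\<close> may contain primes outside \<open>P\<close>, as the exponent of a
  Frobenius lift can, so it is cancelled prime by prime.\<close>

lemma P_dvd_mult_cancel:
  assumes P: "\<And>p. p \<in> P \<Longrightarrow> prime p" and r: "P_number P r" and k: "k > 0" and dvd: "P_dvd P (k * r) (k * i)"
  shows "r dvd i"
proof (cases "i = 0")
  case False
  have r0: "r > 0" using r by (simp add: P_number_def)
  have "P_dvd P r i"
    unfolding P_dvd_def
  proof
    fix p assume p: "p \<in> P"
    have pe: "prime_elem p" using P[OF p] by simp
    have "p ^ multiplicity p (k * r) dvd k * i" using dvd p by (simp add: P_dvd_def)
    then have "multiplicity p (k * r) \<le> multiplicity p (k * i)"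
      using k False P[OF p] by (subst (asm) power_dvd_iff_le_multiplicity) (auto simp: not_prime_unit)
    then have "multiplicity p r \<le> multiplicity p i"
      using k r0 False pe by (simp add: prime_elem_multiplicity_mult_distrib)
    then show "p ^ multiplicity p r dvd i" by (rule multiplicity_dvd')
  qed
  then show ?thesis using P_dvd_P_number[OF P r] by blast
qed simp

context topological_group
begin

lemma closedin_l_coset:
  assumes "a \<in> carrier G" "closedin (topo G) S"
  shows "closedin (topo G) (a <#\<^bsub>G\<^esub> S)"
proof -
  have S: "S \<subseteq> carrier G" using closedin_subset[OF assms(2)] by simp
  have "a <#\<^bsub>G\<^esub> S = {x \<in> topspace (topo G). inv a \<otimes> x \<in> S}"
  proof
    show "a <#\<^bsub>G\<^esub> S \<subseteq> {x \<in> topspace (topo G). inv a \<otimes> x \<in> S}"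
      using S assms(1) by (auto simp: l_coset_def inv_mult_cancel)
    show "{x \<in> topspace (topo G). inv a \<otimes> x \<in> S} \<subseteq> a <#\<^bsub>G\<^esub> S"
    proof
      fix x assume "x \<in> {x \<in> topspace (topo G). inv a \<otimes> x \<in> S}"
      then have "inv a \<otimes> x \<in> S" "x = a \<otimes> (inv a \<otimes> x)"
        using assms(1) by (auto simp: mult_inv_cancel)
      then show "x \<in> a <#\<^bsub>G\<^esub> S" unfolding l_coset_def by blast
    qed
  qed
  then show ?thesis
    using closedin_continuous_map_preimage[OF continuous_map_lmult[of "inv a"] assms(2)] assms(1) by simp
qed

abbreviation "closed_generate h \<equiv> topo G closure_of generate G {h}"

lemma subgroup_closed_generate: "h \<in> carrier G \<Longrightarrow> subgroup (closed_generate h) G"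
  by (intro subgroup_closure_of generate_is_subgroup) simp

lemma closed_generate_self: "h \<in> carrier G \<Longrightarrow> h \<in> closed_generate h"
  using closure_of_subset[of "generate G {h}" "topo G"] generate_incl[of "{h}"] generate.incl[of h "{h}" G]
  by auto

lemma closed_generate_subset:
  assumes "subgroup K G" "closedin (topo G) K" "h \<in> K"
  shows "closed_generate h \<subseteq> K"
proof (rule closure_of_minimal[OF _ assms(2)])
  show "generate G {h} \<subseteq> K" using generate_subgroup_incl[of "{h}" K] assms by simp
qed

text \<open>The translates by h^i with i < r of the closed group generated by h^r are finitely many
  closed sets, and by division with remainder their union contains every power of h.\<close>

lemma closed_generate_decomp:
  assumes h: "h \<in> carrier G" and r: "r > 0" and x: "x \<in> closed_generate h"
  obtains i a where "i < r" "a \<in> closed_generate (h [^] r)" "x = h [^] (i::nat) \<otimes> a"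
proof -
  let ?A = "closed_generate (h [^] r)"
  let ?B = "\<Union>i\<in>{..<r}. h [^] i <#\<^bsub>G\<^esub> ?A"
  have hr: "h [^] r \<in> carrier G" using h by simp
  have "closedin (topo G) ?B" using h by (intro closedin_Union) (auto intro!: closedin_l_coset)
  moreover have "generate G {h} \<subseteq> ?B"
  proof
    fix y assume "y \<in> generate G {h}"
    then obtain z :: int where z: "y = h [^] z" using generate_pow[OF h] by auto
    define i where "i = nat (z mod int r)"
    have i: "int i = z mod int r" "i < r" using r by (auto simp: i_def nat_less_iff)
    have "z = int i + int r * (z div int r)" unfolding i by simp
    then have "y = h [^] (int i + int r * (z div int r))" using z by simp
    also have "\<dots> = h [^] i \<otimes> (h [^] r) [^] (z div int r)"
      using h by (simp add: int_pow_mult int_pow_pow[symmetric] int_pow_int)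
    finally have y: "y = h [^] i \<otimes> (h [^] r) [^] (z div int r)" .
    have "(h [^] r) [^] (z div int r) \<in> ?A"
      by (rule subgroup_int_pow_closed[OF subgroup_closed_generate[OF hr] closed_generate_self[OF hr]])
    then have "y \<in> h [^] i <#\<^bsub>G\<^esub> ?A" unfolding l_coset_def y by blast
    then show "y \<in> ?B" using i(2) by blast
  qed
  ultimately have "x \<in> ?B" using x closure_of_minimal by blast
  then obtain i where "i < r" "x \<in> h [^] i <#\<^bsub>G\<^esub> ?A" by blast
  then show ?thesis using that unfolding l_coset_def by blast
qed

end

lemma carrier_quot: "carrier (quot G (H, U)) = (\<lambda>g. U #>\<^bsub>G\<^esub> g) ` H"
  by (auto simp: quot_def tquotient_def with_topology_def FactGroup_def RCOSETS_def sub_tgroup_def r_coset_def)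

lemma mult_quot: "X \<otimes>\<^bsub>quot G (H, U)\<^esub> Y = X <#>\<^bsub>G\<^esub> Y"
  by (simp add: quot_def tquotient_def with_topology_def FactGroup_def sub_tgroup_def set_mult_def)

lemma one_quot: "\<one>\<^bsub>quot G (H, U)\<^esub> = U"
  by (simp add: quot_def tquotient_def with_topology_def FactGroup_def)

context fn_setting
begin

lemma inertia_subset: "inertia G \<Omega> d K \<subseteq> K"
  by (auto simp: inertia_def)

lemma in_inertia_iff: "K \<in> base M \<Longrightarrow> x \<in> inertia G \<Omega> d K \<longleftrightarrow> x \<in> K \<and> d x = \<one>\<^bsub>\<Omega>\<^esub>"
  using M_carrier by (auto simp: inertia_def kernel_def)

lemma frobenius_group_subset:
  assumes "K \<in> base M" "h \<in> K" "inertia G \<Omega> d U \<subseteq> K"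
  shows "frobenius_group G \<Omega> d h U \<subseteq> K"
  using closed_generate_subset[OF M_subgroup[OF assms(1)] M_closedin[OF assms(1)] assms(2)] assms(3)
    subgroup.m_closed[OF M_subgroup[OF assms(1)]]
  unfolding frobenius_group_def set_mult_def by blast

context
  fixes H U
  assumes H: "H \<in> base M" and U: "open_in_group G H U" "normal_in G H U"
begin

lemma U_base: "U \<in> base M" and U_subset: "U \<subseteq> H"
  using open_base[OF H U(1)] U by (auto simp: open_in_group_def)

lemma U_subgroup: "subgroup U G"
  by (rule M_subgroup[OF U_base])

lemma U_conj: "g \<in> H \<Longrightarrow> x \<in> U \<Longrightarrow> g \<otimes> x \<otimes> inv g \<in> U"
  using U(2) unfolding normal_in_iff[OF M_subgroup[OF H]] by blast

lemma P_number_index: "P_number P (index G H U)"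
  by (rule pro_group_P_number_index[OF pro_P M_closed_subgroup[OF H] U])

lemma index_pos: "index G H U > 0"
  using P_number_index by (simp add: P_number_def)

lemma nat_pow_in: "K \<in> base M \<Longrightarrow> h \<in> K \<Longrightarrow> h [^] (n::nat) \<in> K"
  using subgroup_int_pow_closed[OF M_subgroup, of K h "int n"] by (simp add: int_pow_int)

lemma pow_index_in: "h \<in> H \<Longrightarrow> h [^] index G H U \<in> U"
proof -
  assume h: "h \<in> H"
  let ?H = "G\<lparr>carrier := H\<rparr>"
  interpret HH: subgroup H G by (rule M_subgroup[OF H])
  interpret N: normal U ?H using U by (simp add: normal_in_def)
  interpret Q: group "?H Mod U" by (rule N.factorgroup_is_group)
  have o: "Coset.order (?H Mod U) = index G H U" by (simp add: Coset.order_def index_def FactGroup_def)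
  have "(U #>\<^bsub>?H\<^esub> h) [^]\<^bsub>?H Mod U\<^esub> index G H U = \<one>\<^bsub>?H Mod U\<^esub>"
    unfolding o[symmetric] by (rule Q.pow_order_eq_1) (use h in \<open>auto simp: carrier_FactGroup\<close>)
  then have "U #> (h [^] index G H U) = U"
    using N.FactGroup_pow[of h "index G H U"] h by (simp flip: nat_pow_consistent)
  then show ?thesis
    using rcos_self[OF _ U_subgroup, of "h [^] index G H U"] nat_pow_in[OF H h] h by simp
qed

abbreviation "W m \<equiv> U \<inter> ur_sub H m"

lemma
  assumes m: "m > 0"
  shows open_W: "open_in_group G H (W m)" and W_base: "W m \<in> base M"
    and W_normal: "normal_in G H (W m)" and W_subgroup: "subgroup (W m) G"
    and inertia_W: "inertia G \<Omega> d (W m) = inertia G \<Omega> d U"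
    and inertia_U_subset_W: "inertia G \<Omega> d U \<subseteq> W m"
proof -
  show o: "open_in_group G H (W m)" by (rule open_in_group_Int[OF U(1) open_ur_sub[OF H m]])
  show b: "W m \<in> base M" by (rule open_base[OF H o])
  show s: "subgroup (W m) G" by (rule M_subgroup[OF b])
  have sub: "W m \<subseteq> H" using U_subset by blast
  show "normal_in G H (W m)"
    using U(2) normal_ur_sub[OF H m] s sub unfolding normal_in_iff[OF M_subgroup[OF H]] by blast
  show i: "inertia G \<Omega> d U \<subseteq> W m"
    using inertia_ur_sub[OF H m] U_subset by (auto simp: inertia_def)
  then show "inertia G \<Omega> d (W m) = inertia G \<Omega> d U" by (auto simp: inertia_def)
qed

lemma W_antimono: "a > 0 \<Longrightarrow> W (a * b) \<subseteq> W a"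
  using Om.pow_image_mult_subset[of "fd H * a" b] by (auto simp: ur_sub_def mult.assoc)

text \<open>With r = [H:U] and f = f_H, split d(g) into a positive power of \<omega>^f and the r-th
  power of some d(k) with k in \<open>H\<close>. Since k^r lies in \<open>U\<close>, dividing g by
  it leaves the coset unchanged, and only the positive power remains.\<close>

lemma frob_lift_exists:
  assumes c: "c \<in> carrier (quot G (H, U))"
  obtains h n where "frob_exp H h n" "U #> h = c"
proof -
  let ?r = "index G H U"
  obtain g where g: "g \<in> H" "c = U #> g" using c by (auto simp: carrier_quot)
  have gc: "g \<in> carrier G" using M_carrier[OF H g(1)] .
  have "d g \<in> pow_image \<Omega> (fd H)" using g d_image[OF H] by blast
  then obtain y where y: "y \<in> carrier \<Omega>" "d g = y [^]\<^bsub>\<Omega>\<^esub> fd H" by (auto simp: pow_image_def)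
  obtain j y' where j: "j > 0" "y' \<in> pow_image \<Omega> ?r" "y = \<omega> [^]\<^bsub>\<Omega>\<^esub> (j::nat) \<otimes>\<^bsub>\<Omega>\<^esub> y'"
    using Om.eq_omega_pow_mult[OF y(1) index_pos] by blast
  obtain x where x: "x \<in> carrier \<Omega>" "y' = x [^]\<^bsub>\<Omega>\<^esub> ?r" using j(2) by (auto simp: pow_image_def)
  have "x [^]\<^bsub>\<Omega>\<^esub> fd H \<in> d ` H" unfolding d_image[OF H] using x by (auto simp: pow_image_def)
  then obtain k where k: "k \<in> H" "d k = x [^]\<^bsub>\<Omega>\<^esub> fd H" by auto
  have kc: "k \<in> carrier G" using M_carrier[OF H k(1)] .
  let ?u = "k [^] ?r"
  have u: "?u \<in> U" by (rule pow_index_in[OF k(1)])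
  have du: "d ?u = y' [^]\<^bsub>\<Omega>\<^esub> fd H"
    using k x kc by (simp add: d_pow Om.nat_pow_pow mult.commute)
  let ?h = "inv ?u \<otimes> g"
  have hH: "?h \<in> H" using u U_subset g subgroup.m_closed[OF M_subgroup[OF H]] subgroup.m_inv_closed[OF M_subgroup[OF H]] by blast
  have y'c: "y' \<in> carrier \<Omega>" using x by simp
  have "d ?h = inv\<^bsub>\<Omega>\<^esub> (y' [^]\<^bsub>\<Omega>\<^esub> fd H) \<otimes>\<^bsub>\<Omega>\<^esub> d g" using kc gc by (simp add: du)
  also have "d g = (\<omega> [^]\<^bsub>\<Omega>\<^esub> j) [^]\<^bsub>\<Omega>\<^esub> fd H \<otimes>\<^bsub>\<Omega>\<^esub> y' [^]\<^bsub>\<Omega>\<^esub> fd H"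
    using y j y'c by (simp add: Om.nat_pow_distrib)
  also have "\<dots> = y' [^]\<^bsub>\<Omega>\<^esub> fd H \<otimes>\<^bsub>\<Omega>\<^esub> (\<omega> [^]\<^bsub>\<Omega>\<^esub> j) [^]\<^bsub>\<Omega>\<^esub> fd H"
    using y'c by (intro Om.m_comm) simp_all
  also have "inv\<^bsub>\<Omega>\<^esub> (y' [^]\<^bsub>\<Omega>\<^esub> fd H) \<otimes>\<^bsub>\<Omega>\<^esub> \<dots> = \<omega> [^]\<^bsub>\<Omega>\<^esub> (fd H * j)"
    using y'c by (simp add: Om.inv_mult_cancel Om.nat_pow_pow mult.commute)
  finally have "frob_exp H ?h j" using hH j(1) by (simp add: frob_exp_def)
  moreover have "U #> ?h = c"
  proof -
    have "inv ?u \<in> U" using u by (rule subgroup.m_inv_closed[OF U_subgroup])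
    then have "U #> inv ?u = U" using subgroup.rcos_const[OF U_subgroup is_group] by blast
    then show ?thesis using coset_mult_assoc[OF subgroup.subset[OF U_subgroup], of "inv ?u" g] kc gc g by simp
  qed
  ultimately show ?thesis using that by blast
qed

context
  fixes h n
  assumes hn: "frob_exp H h n"
begin

lemma h_in: "h \<in> H" and h_carrier: "h \<in> carrier G" and n_pos: "n > 0"
  and d_h: "d h = \<omega> [^]\<^bsub>\<Omega>\<^esub> (fd H * n)"
  using hn M_carrier[OF H] by (auto simp: frob_exp_def)

abbreviation (input) "ix \<equiv> index G H U"
abbreviation (input) "\<Sigma> \<equiv> frobenius_group G \<Omega> d h U"

lemma nr_pos: "n * ix > 0"
  using n_pos index_pos by simp

lemma pow_h_W: "h [^] ix \<in> W (n * ix)"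
proof -
  have "h [^] ix \<in> U" by (rule pow_index_in[OF h_in])
  moreover have "d (h [^] ix) = \<omega> [^]\<^bsub>\<Omega>\<^esub> (fd H * (n * ix))"
    using h_carrier by (simp add: d_pow d_h Om.nat_pow_pow mult.assoc)
  ultimately show ?thesis using U_subset by (auto simp: ur_sub_def pow_image_def Om.nat_pow_pow mult.commute)
qed

lemma closed_generate_pow_subset: "closed_generate (h [^] ix) \<subseteq> W (n * ix)"
  by (rule closed_generate_subset[OF W_subgroup[OF nr_pos] M_closedin[OF W_base[OF nr_pos]] pow_h_W])

lemma closed_generate_pow_mono: "closed_generate (h [^] ix) \<subseteq> closed_generate h"
proof (rule closed_generate_subset[OF subgroup_closed_generate[OF h_carrier]])
  show "h [^] ix \<in> closed_generate h"
    using subgroup_int_pow_closed[OF subgroup_closed_generate closed_generate_self, of h "int ix"] h_carrier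
    by (simp add: int_pow_int)
qed simp

text \<open>The image under \<open>d\<close> of the compact group on the right is closed, so it
  suffices that it contains the one power d(h^\<open>ix\<close>) of \<omega>.\<close>

lemma pow_image_subset_d_closed_generate: "pow_image \<Omega> (fd H * (n * ix)) \<subseteq> d ` closed_generate (h [^] ix)"
proof (rule Om.pow_image_subset_closed)
  have hr: "h [^] ix \<in> carrier G" using h_carrier by simp
  show "subgroup (d ` closed_generate (h [^] ix)) \<Omega>"
    by (rule subgroup_d_image[OF subgroup_closed_generate[OF hr]])
  have "compactin (topo G) (closed_generate (h [^] ix))"
    by (rule closedin_compact_space[OF compact_G]) simp
  from image_compactin[OF this d_cont] show "closedin (topo \<Omega>) (d ` closed_generate (h [^] ix))"
    by (rule compactin_imp_closedin[OF Om.Hausdorff])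
  have "d (h [^] ix) = \<omega> [^]\<^bsub>\<Omega>\<^esub> (fd H * (n * ix))"
    using h_carrier by (simp add: d_pow d_h Om.nat_pow_pow mult.assoc)
  then show "\<omega> [^]\<^bsub>\<Omega>\<^esub> (fd H * (n * ix)) \<in> d ` closed_generate (h [^] ix)"
    using closed_generate_self[OF hr] by (metis imageI)
qed

text \<open>The topological closure is traded for the open group \<open>W\<close>: every element of
  \<open>W (n * ix)\<close> has the same image under \<open>d\<close> as some element of the closed
  group generated by h^\<open>ix\<close>, and the two differ by inertia of \<open>U\<close>. The
  elements of a Frobenius group can then be handled as words h^i u.\<close>

lemma in_frobenius_group_iff: "x \<in> \<Sigma> \<longleftrightarrow> (\<exists>i::nat. \<exists>u \<in> W (n * ix). x = h [^] i \<otimes> u)"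
proof
  assume "x \<in> \<Sigma>"
  then obtain c j where c: "c \<in> closed_generate h" "j \<in> inertia G \<Omega> d U" "x = c \<otimes> j"
    unfolding frobenius_group_def set_mult_def by blast
  obtain i a where i: "a \<in> closed_generate (h [^] ix)" "c = h [^] (i::nat) \<otimes> a"
    using closed_generate_decomp[OF h_carrier index_pos c(1)] by blast
  have a: "a \<in> W (n * ix)" and j: "j \<in> W (n * ix)"
    using i closed_generate_pow_subset c(2) inertia_U_subset_W[OF nr_pos] by blast+
  have "a \<otimes> j \<in> W (n * ix)" by (rule subgroup.m_closed[OF W_subgroup[OF nr_pos] a j])
  moreover have "x = h [^] i \<otimes> (a \<otimes> j)"
    using c i h_carrier subgroup.mem_carrier[OF W_subgroup[OF nr_pos] a] subgroup.mem_carrier[OF W_subgroup[OF nr_pos] j]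
    by (simp add: m_assoc)
  ultimately show "\<exists>i::nat. \<exists>u \<in> W (n * ix). x = h [^] i \<otimes> u" by blast
next
  assume "\<exists>i::nat. \<exists>u \<in> W (n * ix). x = h [^] i \<otimes> u"
  then obtain i :: nat and u where u: "u \<in> W (n * ix)" "x = h [^] i \<otimes> u" by blast
  have uc: "u \<in> carrier G" by (rule subgroup.mem_carrier[OF W_subgroup[OF nr_pos] u(1)])
  have "d u \<in> pow_image \<Omega> (fd H * (n * ix))" using u(1) by (simp add: ur_sub_def)
  then obtain a where a: "a \<in> closed_generate (h [^] ix)" "d u = d a"
    using pow_image_subset_d_closed_generate by blast
  have aW: "a \<in> W (n * ix)" using a closed_generate_pow_subset by blast
  have ac: "a \<in> carrier G" by (rule subgroup.mem_carrier[OF W_subgroup[OF nr_pos] aW])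
  have aU: "a \<in> U" using aW by simp
  have "inv a \<otimes> u \<in> U" using u(1) subgroup.m_closed[OF U_subgroup subgroup.m_inv_closed[OF U_subgroup aU]] by blast
  moreover have "d (inv a \<otimes> u) = \<one>\<^bsub>\<Omega>\<^esub>" using ac uc a(2) by simp
  ultimately have j: "inv a \<otimes> u \<in> inertia G \<Omega> d U" using in_inertia_iff[OF U_base] by simp
  have cs: "subgroup (closed_generate h) G" by (rule subgroup_closed_generate[OF h_carrier])
  have "h [^] i \<in> closed_generate h"
    using subgroup_int_pow_closed[OF cs closed_generate_self[OF h_carrier], of "int i"] by (simp add: int_pow_int)
  then have "h [^] i \<otimes> a \<in> closed_generate h"
    using subgroup.m_closed[OF cs] a(1) closed_generate_pow_mono by blast
  moreover have "x = h [^] i \<otimes> a \<otimes> (inv a \<otimes> u)" using u ac uc h_carrier by (simp add: group_norm)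
  ultimately show "x \<in> \<Sigma>" using j unfolding frobenius_group_def set_mult_def by blast
qed

lemma subgroup_frobenius_group: "subgroup \<Sigma> G"
proof (rule subgroup.intro)
  let ?W = "W (n * ix)"
  interpret W: subgroup ?W G by (rule W_subgroup[OF nr_pos])
  have Wconj: "g \<otimes> x \<otimes> inv g \<in> ?W" if "g \<in> H" "x \<in> ?W" for g x
    using W_normal[OF nr_pos] that unfolding normal_in_iff[OF M_subgroup[OF H]] by blast
  have hi: "h [^] (i::nat) \<in> H" for i by (rule nat_pow_in[OF H h_in])
  have inv: "inv g \<in> H" if "g \<in> H" for g using that subgroup.m_inv_closed[OF M_subgroup[OF H]] by blast
  \<comment> \<open>Normality of \<open>W\<close> in \<open>H\<close> lets powers of h pass to the
    left, which turns products of words h^i u into words again.\<close>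
  have comm: "\<exists>u'\<in>?W. u \<otimes> h [^] j = h [^] j \<otimes> u'" if "u \<in> ?W" for u and j :: nat
  proof
    show "inv (h [^] j) \<otimes> u \<otimes> inv (inv (h [^] j)) \<in> ?W" by (rule Wconj[OF inv[OF hi] that])
    show "u \<otimes> h [^] j = h [^] j \<otimes> (inv (h [^] j) \<otimes> u \<otimes> inv (inv (h [^] j)))"
      using h_carrier W.mem_carrier[OF that] by (simp add: group_norm)
  qed
  show "\<Sigma> \<subseteq> carrier G"
    using h_carrier W.mem_carrier unfolding subset_iff in_frobenius_group_iff by auto
  show "\<one> \<in> \<Sigma>" unfolding in_frobenius_group_iff
    by (rule exI[of _ 0], rule bexI[of _ \<one>]) (auto simp: subgroup.one_closed[OF W.subgroup_axioms, simplified])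
  show "x \<otimes> y \<in> \<Sigma>" if xy: "x \<in> \<Sigma>" "y \<in> \<Sigma>" for x y
  proof -
    obtain i j :: nat and u u' where u: "u \<in> ?W" "x = h [^] i \<otimes> u" and u': "u' \<in> ?W" "y = h [^] j \<otimes> u'"
      using xy unfolding in_frobenius_group_iff by blast
    obtain w where w: "w \<in> ?W" "u \<otimes> h [^] j = h [^] j \<otimes> w" using comm[OF u(1)] by blast
    note cc = W.mem_carrier[OF u(1)] W.mem_carrier[OF u'(1)] W.mem_carrier[OF w(1)] h_carrier
    have "x \<otimes> y = h [^] i \<otimes> (u \<otimes> h [^] j) \<otimes> u'" using u u' cc by (simp add: m_assoc)
    also have "\<dots> = h [^] (i + j) \<otimes> (w \<otimes> u')" unfolding w(2) using cc by (simp add: m_assoc flip: nat_pow_mult)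
    finally show ?thesis unfolding in_frobenius_group_iff using W.m_closed[OF w(1) u'(1)] by blast
  qed
  show "inv x \<in> \<Sigma>" if x: "x \<in> \<Sigma>" for x
  proof -
    obtain i :: nat and u where u: "u \<in> ?W" "x = h [^] i \<otimes> u"
      using x unfolding in_frobenius_group_iff by blast
    \<comment> \<open>Only natural exponents occur in the description, so the inverse of h^i is
      written as h^(s i) times the inverse of (h^\<open>ix\<close>)^i, which lies in
      \<open>W\<close>.\<close>
    obtain s where s: "ix = Suc s" using index_pos by (cases ix) auto
    let ?w = "inv ((h [^] ix) [^] i)"
    have w: "?w \<in> ?W" by (rule W.m_inv_closed[OF nat_pow_in[OF W_base[OF nr_pos] pow_h_W]])
    have inv_u: "inv u \<in> ?W" by (rule W.m_inv_closed[OF u(1)])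
    obtain w' where w': "w' \<in> ?W" "inv u \<otimes> h [^] (s * i) = h [^] (s * i) \<otimes> w'" using comm[OF inv_u] by blast
    note cc = W.mem_carrier[OF u(1)] W.mem_carrier[OF w'(1)] h_carrier
    have hh: "(h [^] ix) [^] i = h [^] i \<otimes> h [^] (s * i)"
      unfolding nat_pow_pow[OF h_carrier] nat_pow_mult[OF h_carrier] s by simp
    have "h [^] (s * i) \<otimes> ?w = inv (h [^] i)" using h_carrier unfolding hh by (simp add: group_norm)
    then have "inv x = inv u \<otimes> (h [^] (s * i) \<otimes> ?w)" using u cc by (simp add: inv_mult_group)
    also have "\<dots> = h [^] (s * i) \<otimes> (w' \<otimes> ?w)"
      using w'(2) cc by (simp flip: m_assoc)
    finally show ?thesis unfolding in_frobenius_group_iff using W.m_closed[OF w'(1) w] by blast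
  qed
qed

lemma W_subset_frobenius_group: "W (n * ix) \<subseteq> \<Sigma>"
proof
  fix u assume u: "u \<in> W (n * ix)"
  then have "u = h [^] (0::nat) \<otimes> u" using subgroup.mem_carrier[OF W_subgroup[OF nr_pos] u] by simp
  then show "u \<in> \<Sigma>" using u unfolding in_frobenius_group_iff by blast
qed

lemma h_in_frobenius_group: "h \<in> \<Sigma>"
proof -
  have "h = h [^] (1::nat) \<otimes> \<one>" using h_carrier by simp
  then show ?thesis using subgroup.one_closed[OF W_subgroup[OF nr_pos]] unfolding in_frobenius_group_iff by blast
qed

lemma inertia_U_subset_frobenius_group: "inertia G \<Omega> d U \<subseteq> \<Sigma>"
  using W_subset_frobenius_group inertia_U_subset_W[OF nr_pos] by blast

lemma frobenius_group_subset_H: "\<Sigma> \<subseteq> H"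
  using frobenius_group_subset[OF H h_in] inertia_subset U_subset by blast

lemma open_frobenius_group: "open_in_group G H \<Sigma>"
  by (rule open_in_group_mono[OF open_W[OF nr_pos] W_subset_frobenius_group frobenius_group_subset_H
        subgroup_frobenius_group M_subgroup[OF H]])

lemma frobenius_group_base: "\<Sigma> \<in> base M"
  by (rule open_base[OF H open_frobenius_group])

text \<open>In a word h^i u the condition on \<open>d\<close> forces the index to divide i, because
  f_H n can be cancelled and the index is a \<open>P\<close>-number; then h^i lies in
  \<open>U\<close>. Both the inertia group of \<Sigma> and its intersections with
  \<open>ur_sub\<close> follow from this.\<close>

lemma frobenius_group_in_U:
  assumes x: "x \<in> \<Sigma>" and dx: "d x \<in> pow_image \<Omega> (fd H * (n * ix))"
  shows "x \<in> U"
proof -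
  obtain i :: nat and u where u: "u \<in> W (n * ix)" "x = h [^] i \<otimes> u"
    using x unfolding in_frobenius_group_iff by blast
  have uc: "u \<in> carrier G" by (rule subgroup.mem_carrier[OF W_subgroup[OF nr_pos] u(1)])
  have fn: "fd H * n > 0" "fd H * (n * ix) > 0" using fd_pos[OF H] n_pos nr_pos by auto
  interpret k: subgroup "pow_image \<Omega> (fd H * (n * ix))" \<Omega> by (rule Om.subgroup_pow_image)
  have "d x \<otimes>\<^bsub>\<Omega>\<^esub> inv\<^bsub>\<Omega>\<^esub> d u \<in> pow_image \<Omega> (fd H * (n * ix))"
    using u(1) dx by (intro k.m_closed k.m_inv_closed) (auto simp: ur_sub_def)
  moreover have "d x \<otimes>\<^bsub>\<Omega>\<^esub> inv\<^bsub>\<Omega>\<^esub> d u = \<omega> [^]\<^bsub>\<Omega>\<^esub> (fd H * n * i)"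
    using u(2) uc h_carrier by (simp add: d_pow d_h Om.nat_pow_pow Om.m_assoc)
  ultimately have "P_dvd P (fd H * n * ix) (fd H * n * i)"
    using Om.pow_in_pow_image_iff[OF fn(2)] by (simp add: mult.assoc)
  then have "ix dvd i" using P_dvd_mult_cancel[OF _ P_number_index fn(1)] primes by blast
  then obtain q where "i = ix * q" by (auto elim: dvdE)
  then have "h [^] i = (h [^] ix) [^] q" using h_carrier by (simp add: nat_pow_pow)
  then have "h [^] i \<in> U" using nat_pow_in[OF U_base pow_index_in[OF h_in]] by simp
  moreover have "u \<in> U" using u by simp
  ultimately show ?thesis unfolding u(2) by (rule subgroup.m_closed[OF U_subgroup])
qed

lemma inertia_frobenius_group: "inertia G \<Omega> d \<Sigma> = inertia G \<Omega> d U"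
proof
  show "inertia G \<Omega> d \<Sigma> \<subseteq> inertia G \<Omega> d U"
    using frobenius_group_in_U subgroup.one_closed[OF Om.subgroup_pow_image]
    by (auto simp: inertia_def kernel_def)
  show "inertia G \<Omega> d U \<subseteq> inertia G \<Omega> d \<Sigma>"
    using inertia_U_subset_frobenius_group by (auto simp: inertia_def)
qed

text \<open>From this level on the intersection no longer depends on h, which is what makes the
  values for different lifts comparable.\<close>

lemma frobenius_group_Int_ur_sub:
  assumes k: "k > 0"
  shows "ur_sub H (n * ix * k) \<inter> \<Sigma> = W (n * ix * k)"
proof
  show "ur_sub H (n * ix * k) \<inter> \<Sigma> \<subseteq> W (n * ix * k)"
    using frobenius_group_in_U Om.pow_image_mult_subset[of "fd H * (n * ix)" k]
    by (auto simp: ur_sub_def mult.assoc)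
  show "W (n * ix * k) \<subseteq> ur_sub H (n * ix * k) \<inter> \<Sigma>"
    using W_antimono[OF nr_pos, of k] W_subset_frobenius_group by blast
qed

lemma d_frobenius_group: "d ` \<Sigma> = pow_image \<Omega> (fd H * n)"
proof
  have "subgroup (d ` \<Sigma>) \<Omega>" "closedin (topo \<Omega>) (d ` \<Sigma>)"
    using subgroup_d_image[OF subgroup_frobenius_group] closedin_d_image[OF frobenius_group_base] by auto
  then show "pow_image \<Omega> (fd H * n) \<subseteq> d ` \<Sigma>"
    using Om.pow_image_subset_closed h_in_frobenius_group d_h by (metis imageI)
  interpret k: subgroup "pow_image \<Omega> (fd H * n)" \<Omega> by (rule Om.subgroup_pow_image)
  show "d ` \<Sigma> \<subseteq> pow_image \<Omega> (fd H * n)"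
  proof
    fix y assume "y \<in> d ` \<Sigma>"
    then obtain i :: nat and u where u: "u \<in> W (n * ix)" "y = d (h [^] i \<otimes> u)"
      unfolding image_iff Bex_def in_frobenius_group_iff by blast
    have uc: "u \<in> carrier G" by (rule subgroup.mem_carrier[OF W_subgroup[OF nr_pos] u(1)])
    have "d u \<in> pow_image \<Omega> (fd H * n)"
      using u(1) Om.pow_image_mult_subset[of "fd H * n" ix] by (auto simp: ur_sub_def mult.assoc)
    moreover have "(\<omega> [^]\<^bsub>\<Omega>\<^esub> i) [^]\<^bsub>\<Omega>\<^esub> (fd H * n) \<in> pow_image \<Omega> (fd H * n)" by (auto simp: pow_image_def)
    moreover have "y = (\<omega> [^]\<^bsub>\<Omega>\<^esub> i) [^]\<^bsub>\<Omega>\<^esub> (fd H * n) \<otimes>\<^bsub>\<Omega>\<^esub> d u"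
      using u(2) uc h_carrier by (simp add: d_pow d_h Om.nat_pow_pow mult.commute mult.left_commute)
    ultimately show "y \<in> pow_image \<Omega> (fd H * n)" using k.m_closed by simp
  qed
qed

lemma fd_frobenius_group: "fd \<Sigma> = fd H * P_part P n"
  using fd_eqI[OF frobenius_group_base _ d_frobenius_group] fd_pos[OF H] n_pos
  by (simp add: P_part_mult' P_part_P_number[OF P_number_fd[OF H]])

end

text \<open>Lifts of one coset with the same exponent differ by an element of \<open>U\<close>
  killed by \<open>d\<close>, that is, by inertia of \<open>U\<close>, which both groups
  contain.\<close>

lemma frobenius_group_cong:
  assumes h: "frob_exp H h n" and h': "frob_exp H h' n" and eq: "U #> h = U #> h'"
  shows "frobenius_group G \<Omega> d h U = frobenius_group G \<Omega> d h' U"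
proof -
  have *: "frobenius_group G \<Omega> d h' U \<subseteq> frobenius_group G \<Omega> d h U"
    if h: "frob_exp H h n" and h': "frob_exp H h' n" and eq: "U #> h = U #> h'" for h h'
  proof (rule frobenius_group_subset[OF frobenius_group_base[OF h] _ inertia_U_subset_frobenius_group[OF h]])
    have "h' \<in> U #> h" using eq rcos_self[OF h_carrier[OF h'] U_subgroup] by simp
    then obtain u where u: "u \<in> U" "h' = u \<otimes> h" unfolding r_coset_def by blast
    have uc: "u \<in> carrier G" using M_carrier[OF U_base u(1)] .
    have "d h' = d u \<otimes>\<^bsub>\<Omega>\<^esub> d h" using u uc h_carrier[OF h] by simp
    then have "d u \<otimes>\<^bsub>\<Omega>\<^esub> d h = d h" using d_h[OF h] d_h[OF h'] by simp
    then have "d u = \<one>\<^bsub>\<Omega>\<^esub>" using uc h_carrier[OF h] by simp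
    then have "u \<in> frobenius_group G \<Omega> d h U"
      using u in_inertia_iff[OF U_base] inertia_U_subset_frobenius_group[OF h] by blast
    then show "h' \<in> frobenius_group G \<Omega> d h U"
      using u subgroup.m_closed[OF subgroup_frobenius_group[OF h]] h_in_frobenius_group[OF h] by blast
  qed
  show ?thesis using *[OF h h' eq] *[OF h' h eq[symmetric]] by blast
qed

end

end

section \<open>Valuations and power sums\<close>

context comm_group
begin

lemma div_mult:
  "\<lbrakk>a \<in> carrier G; b \<in> carrier G; c \<in> carrier G; e \<in> carrier G\<rbrakk> \<Longrightarrow>
    (a \<otimes> inv b) \<otimes> (c \<otimes> inv e) = (a \<otimes> c) \<otimes> inv (b \<otimes> e)"
  by (simp add: inv_mult m_ac)

lemma div_div:
  "\<lbrakk>a \<in> carrier G; b \<in> carrier G; c \<in> carrier G; e \<in> carrier G\<rbrakk> \<Longrightarrow>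
    (a \<otimes> inv b) \<otimes> inv (c \<otimes> inv e) = (a \<otimes> e) \<otimes> inv (b \<otimes> c)"
  by (simp add: inv_mult m_ac)

lemma div_eq_iff:
  assumes "a \<in> carrier G" "b \<in> carrier G" "c \<in> carrier G" "e \<in> carrier G"
  shows "a \<otimes> inv b = c \<otimes> inv e \<longleftrightarrow> a \<otimes> e = c \<otimes> b"
proof
  assume eq: "a \<otimes> inv b = c \<otimes> inv e"
  have "a \<otimes> e = (a \<otimes> inv b) \<otimes> (b \<otimes> e)" using assms by (simp add: m_assoc inv_mult_cancel)
  also have "\<dots> = (c \<otimes> inv e) \<otimes> (e \<otimes> b)" using assms by (simp add: eq m_comm)
  finally show "a \<otimes> e = c \<otimes> b" using assms by (simp add: m_assoc inv_mult_cancel)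
next
  assume eq: "a \<otimes> e = c \<otimes> b"
  have "a \<otimes> inv b = (a \<otimes> e) \<otimes> (inv e \<otimes> inv b)" using assms by (simp add: m_assoc mult_inv_cancel)
  also have "\<dots> = (c \<otimes> b) \<otimes> (inv b \<otimes> inv e)" using assms by (simp add: eq m_comm)
  finally show "a \<otimes> inv b = c \<otimes> inv e" using assms by (simp add: m_assoc mult_inv_cancel)
qed

lemma div_eq_one_iff: "\<lbrakk>a \<in> carrier G; b \<in> carrier G\<rbrakk> \<Longrightarrow> a \<otimes> inv b = \<one> \<longleftrightarrow> a = b"
  using div_eq_iff[of a b \<one> \<one>] by simp

end

definition power_sum :: "('g, 'z) monoid_scheme \<Rightarrow> ('g, 'g set, 'c) ric_fun \<Rightarrow> 'g set \<Rightarrow> 'g \<Rightarrow> nat \<Rightarrow> 'c \<Rightarrow> 'c" where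
  "power_sum G C K \<phi> n a = (\<Otimes>\<^bsub>Obj C K\<^esub> i \<in> {..<n}. Con C (\<phi> [^]\<^bsub>G\<^esub> i) K a)"

section \<open>The Mackey functor, its valuation and the exact sequences\<close>

context fn_setting
begin

sublocale C: TAb_functor G "conj_set G" M C
  using mackey_C by (simp add: cohomological_mackey_functor_def Ab_functor_def)

lemma C_comm: "H \<in> base M \<Longrightarrow> comm_group (Obj C H)"
  by (rule C.Obj_comm_group)

lemma C_group: "H \<in> base M \<Longrightarrow> group (Obj C H)"
  using C_comm comm_group_def by blast

lemma group_hom_Res: "\<lbrakk>H \<in> base M; K \<in> rdom M H\<rbrakk> \<Longrightarrow> group_hom (Obj C H) (Obj C K) (Res C K H)"
  using C.Res_hom[of H K] C_group M.rdom_sub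
  by (auto intro!: group_hom.intro group_hom_axioms.intro simp: tgroup_hom_def)

lemma group_hom_Ind: "\<lbrakk>H \<in> base M; K \<in> idom M H\<rbrakk> \<Longrightarrow> group_hom (Obj C K) (Obj C H) (Ind C H K)"
  using C.Ind_hom[of H K] C_group M.idom_sub
  by (auto intro!: group_hom.intro group_hom_axioms.intro simp: tgroup_hom_def)

lemma group_hom_Con:
  "\<lbrakk>g \<in> carrier G; H \<in> base M\<rbrakk> \<Longrightarrow> group_hom (Obj C H) (Obj C (conj_set G g H)) (Con C g H)"
  using C.Con_hom[of g H] C_group M.act_closed
  by (auto intro!: group_hom.intro group_hom_axioms.intro simp: tgroup_hom_def)

lemmas Res_closed = group_hom.hom_closed[OF group_hom_Res]
  and Ind_closed = group_hom.hom_closed[OF group_hom_Ind]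
  and Con_closed = group_hom.hom_closed[OF group_hom_Con]

lemma Con_trivial: "\<lbrakk>H \<in> base M; h \<in> H; x \<in> carrier (Obj C H)\<rbrakk> \<Longrightarrow> Con C h H x = x"
  using mackey_C by (simp add: cohomological_mackey_functor_def)

lemma Ind_Res_pow:
  "\<lbrakk>H \<in> base M; K \<in> rdom M H; K \<in> idom M H; x \<in> carrier (Obj C H)\<rbrakk> \<Longrightarrow>
    Ind C H K (Res C K H x) = x [^]\<^bsub>Obj C H\<^esub> index G H K"
  using mackey_C by (simp add: cohomological_mackey_functor_def)

lemma mackey_formula:
  assumes "H \<in> base M" "I \<in> rdom M H" "J \<in> idom M H" "x \<in> carrier (Obj C J)" "R \<subseteq> H"
    and "bij_betw (\<lambda>h. I #> h <#> J) R (double_cosets G H I J)"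
  shows "Res C I H (Ind C H J x) = (\<Otimes>\<^bsub>Obj C I\<^esub> h \<in> R.
            Ind C I (I \<inter> conj_set G h J)
              (Con C h (conj_set G (inv h) I \<inter> J)
                (Res C (conj_set G (inv h) I \<inter> J) J x)))"
  using mackey_C assms unfolding cohomological_mackey_functor_def by blast

lemma v_Fct: "v \<in> Fct_hom G (conj_set G) M C (Omega_functor G \<Omega> d)"
  using val_v by (simp add: valuations_def)

lemma group_hom_v: "H \<in> base M \<Longrightarrow> group_hom (Obj C H) \<Omega> (v H)"
  using v_Fct C_group Om.is_group
  by (auto intro!: group_hom.intro group_hom_axioms.intro
      simp: Fct_hom_def tgroup_hom_def Omega_functor_def discrete_tgroup_def with_topology_def hom_def)

lemmas v_closed = group_hom.hom_closed[OF group_hom_v]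

lemma v_Res: "\<lbrakk>H \<in> base M; K \<in> rdom M H; x \<in> carrier (Obj C H)\<rbrakk> \<Longrightarrow>
    v K (Res C K H x) = v H x [^]\<^bsub>\<Omega>\<^esub> rel_ram_index G \<Omega> d H K"
  using v_Fct by (simp add: Fct_hom_def Omega_functor_def)

lemma v_Ind: "\<lbrakk>H \<in> base M; K \<in> idom M H; x \<in> carrier (Obj C K)\<rbrakk> \<Longrightarrow>
    v H (Ind C H K x) = v K x [^]\<^bsub>\<Omega>\<^esub> (fd K div fd H)"
  using v_Fct rel_inertia_deg_eq[of H K] M.idom_sub[of H] rdom_idom_subset[of H K]
  by (auto simp: Fct_hom_def Omega_functor_def)

lemma v_Con: "\<lbrakk>g \<in> carrier G; H \<in> base M; x \<in> carrier (Obj C H)\<rbrakk> \<Longrightarrow>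
    v (conj_set G g H) (Con C g H x) = v H x"
  using v_Fct by (simp add: Fct_hom_def Omega_functor_def)

lemma v_Res_same_inertia:
  assumes "H \<in> base M" "K \<in> rdom M H" "x \<in> carrier (Obj C H)" "inertia G \<Omega> d K = inertia G \<Omega> d H"
  shows "v K (Res C K H x) = v H x"
proof -
  have "subgroup (inertia G \<Omega> d H) G"
    unfolding inertia_def using M_subgroup[OF assms(1)] d.subgroup_kernel by (rule subgroups_Inter_pair)
  then have "rel_ram_index G \<Omega> d H K = 1"
    using assms(4) index_self[OF _ is_group] by (simp add: rel_ram_index_def)
  then show ?thesis using v_Res[OF assms(1-3)] v_closed[OF assms(1,3)] by simp
qed

lemma prime_exists: "H \<in> base M \<Longrightarrow> prime_elements \<omega> C v H \<noteq> {}"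
  using val_v by (fastforce simp: valuations_def prime_elements_def)

abbreviation "vker K \<equiv> kernel (Obj C K) \<Omega> (v K)"

lemma vker_iff: "x \<in> vker K \<longleftrightarrow> x \<in> carrier (Obj C K) \<and> v K x = \<one>\<^bsub>\<Omega>\<^esub>"
  by (auto simp: kernel_def)

lemma subgroup_vker: "K \<in> base M \<Longrightarrow> subgroup (vker K) (Obj C K)"
  by (rule group_hom.subgroup_kernel[OF group_hom_v])

text \<open>Elements with \<open>d_rel\<close> equal to \<omega> differ by inertia of
  \<open>K\<close>, which is contained in \<open>L\<close>; hence the description defining
  \<open>frobenius\<close> fits exactly one coset.\<close>

lemma frobenius_coset:
  assumes K: "K \<in> base M" and L: "L \<in> unramified G \<Omega> d K" and \<phi>: "frob_exp K \<phi> 1"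
  shows "frobenius G \<Omega> \<omega> d K L = L #> \<phi>"
  unfolding frobenius_def
proof (rule the_equality)
  show "\<exists>h\<in>K. d_rel G \<Omega> d K h = \<omega> \<and> L #> \<phi> = L #> h"
    using d_rel_frob[OF K \<phi>] \<phi> by (auto simp: frob_exp_def)
  fix c assume "\<exists>h\<in>K. d_rel G \<Omega> d K h = \<omega> \<and> c = L #> h"
  then obtain h where h: "h \<in> K" "d_rel G \<Omega> d K h = \<omega>" "c = L #> h" by blast
  have Ls: "subgroup L G" and LI: "inertia G \<Omega> d K \<subseteq> L" using L by (auto simp: unramified_def open_in_group_def)
  have "d h \<in> pow_image \<Omega> (fd K)" using h d_image[OF K] by blast
  then obtain y where y: "y \<in> carrier \<Omega>" "y [^]\<^bsub>\<Omega>\<^esub> fd K = d h" by (auto simp: pow_image_def)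
  have "y = \<omega>" using d_rel_eqI[OF K y] h(2) by simp
  then have "d h = \<omega> [^]\<^bsub>\<Omega>\<^esub> fd K" using y(2) by metis
  then have "d h = d \<phi>" using \<phi> by (simp add: frob_exp_def)
  have \<phi>K: "\<phi> \<in> K" using \<phi> by (simp add: frob_exp_def)
  have hc: "h \<in> carrier G" "\<phi> \<in> carrier G" using M_carrier[OF K] h \<phi>K by auto
  have "h \<otimes> inv \<phi> \<in> K" using h \<phi>K M_subgroup[OF K] by (simp add: subgroup.m_closed subgroup.m_inv_closed)
  moreover have "d (h \<otimes> inv \<phi>) = \<one>\<^bsub>\<Omega>\<^esub>" using hc \<open>d h = d \<phi>\<close> by simp
  ultimately have "h \<otimes> inv \<phi> \<in> L" using LI in_inertia_iff[OF K] by blast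
  moreover have "h = h \<otimes> inv \<phi> \<otimes> \<phi>" using hc by (simp add: m_assoc)
  ultimately have "h \<in> L #> \<phi>" unfolding r_coset_def by blast
  then show "c = L #> \<phi>" using repr_independence[OF _ _ Ls] hc h(3) by simp
qed

lemma
  assumes H: "H \<in> base (flat E)" and K: "open_in_group G H K" "K \<in> base M"
    and L: "L \<in> unramified G \<Omega> d K" and \<phi>: "frob_exp K \<phi> 1"
  shows exact_Res_inj: "\<lbrakk>x \<in> vker K; Res C L K x = \<one>\<^bsub>Obj C L\<^esub>\<rbrakk> \<Longrightarrow> x = \<one>\<^bsub>Obj C K\<^esub>"
    and exact_Res_image: "\<lbrakk>y \<in> vker L; Con C \<phi> L y = y\<rbrakk> \<Longrightarrow> \<exists>x \<in> vker K. y = Res C L K x"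
    and exact_Ind_kernel: "\<lbrakk>y \<in> vker L; Ind C K L y = \<one>\<^bsub>Obj C K\<^esub>\<rbrakk> \<Longrightarrow>
      \<exists>z \<in> vker L. y = Con C \<phi> L z \<otimes>\<^bsub>Obj C L\<^esub> inv\<^bsub>Obj C L\<^esub> z"
    and exact_Ind_surj: "y' \<in> vker K \<Longrightarrow> \<exists>z \<in> vker L. Ind C K L z = y'"
proof -
  have Lb: "L \<in> base M" using open_base[OF K(2)] L by (simp add: unramified_def)
  interpret L: comm_group "Obj C L" by (rule C_comm[OF Lb])
  have Ls: "subgroup L G" by (rule M_subgroup[OF Lb])
  have "\<phi> \<in> frobenius G \<Omega> \<omega> d K L"
    unfolding frobenius_coset[OF K(2) L \<phi>]
    using rcos_self[OF _ Ls] \<phi> M_carrier[OF K(2)] by (simp add: frob_exp_def)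
  moreover have "FN_exactness_condition G \<Omega> \<omega> d C v K L"
    using datum H K(1) L by (simp add: FN_datum_def)
  ultimately have "exact_seq
        ([singleton_group \<one>\<^bsub>Obj C K\<^esub>, val_kernel \<Omega> C v K, val_kernel \<Omega> C v L,
          val_kernel \<Omega> C v L, val_kernel \<Omega> C v K, singleton_group \<one>\<^bsub>Obj C K\<^esub>],
         [\<lambda>_. \<one>\<^bsub>Obj C K\<^esub>, Ind C K L,
          \<lambda>x. Con C \<phi> L x \<otimes>\<^bsub>Obj C L\<^esub> inv\<^bsub>Obj C L\<^esub> x,
          Res C L K, \<lambda>_. \<one>\<^bsub>Obj C K\<^esub>])"
    unfolding FN_exactness_condition_def by (rule bspec[rotated])
  note ex = this[unfolded exact_seq_cons_iff, THEN conjunct2]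
  have e: "kernel (val_kernel \<Omega> C v K) (singleton_group \<one>\<^bsub>Obj C K\<^esub>) (\<lambda>_. \<one>\<^bsub>Obj C K\<^esub>) = Ind C K L ` carrier (val_kernel \<Omega> C v L)"
      "kernel (val_kernel \<Omega> C v L) (val_kernel \<Omega> C v K) (Ind C K L) =
        (\<lambda>x. Con C \<phi> L x \<otimes>\<^bsub>Obj C L\<^esub> inv\<^bsub>Obj C L\<^esub> x) ` carrier (val_kernel \<Omega> C v L)"
      "kernel (val_kernel \<Omega> C v L) (val_kernel \<Omega> C v L) (\<lambda>x. Con C \<phi> L x \<otimes>\<^bsub>Obj C L\<^esub> inv\<^bsub>Obj C L\<^esub> x) =
        Res C L K ` carrier (val_kernel \<Omega> C v K)"
      "kernel (val_kernel \<Omega> C v K) (val_kernel \<Omega> C v L) (Res C L K) =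
        (\<lambda>_. \<one>\<^bsub>Obj C K\<^esub>) ` carrier (singleton_group \<one>\<^bsub>Obj C K\<^esub>)"
    using \<open>exact_seq _\<close> by simp_all
  have vk: "carrier (val_kernel \<Omega> C v X) = vker X" "\<one>\<^bsub>val_kernel \<Omega> C v X\<^esub> = \<one>\<^bsub>Obj C X\<^esub>" for X
    by (simp_all add: val_kernel_def)
  have vk': "x \<in> kernel (val_kernel \<Omega> C v X) (val_kernel \<Omega> C v Y) f \<longleftrightarrow> x \<in> vker X \<and> f x = \<one>\<^bsub>Obj C Y\<^esub>" for x X Y f
    by (simp add: kernel_def[of "val_kernel \<Omega> C v X"] vk)
  show "x = \<one>\<^bsub>Obj C K\<^esub>" if "x \<in> vker K" "Res C L K x = \<one>\<^bsub>Obj C L\<^esub>" for x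
  proof -
    have "x \<in> kernel (val_kernel \<Omega> C v K) (val_kernel \<Omega> C v L) (Res C L K)" using that vk' by blast
    then show ?thesis unfolding e by auto
  qed
  show "\<exists>x \<in> vker K. y = Res C L K x" if y: "y \<in> vker L" "Con C \<phi> L y = y" for y
  proof -
    have "y \<in> carrier (Obj C L)" using y vker_iff by blast
    then have "Con C \<phi> L y \<otimes>\<^bsub>Obj C L\<^esub> inv\<^bsub>Obj C L\<^esub> y = \<one>\<^bsub>Obj C L\<^esub>" using y by simp
    then have "y \<in> kernel (val_kernel \<Omega> C v L) (val_kernel \<Omega> C v L) (\<lambda>x. Con C \<phi> L x \<otimes>\<^bsub>Obj C L\<^esub> inv\<^bsub>Obj C L\<^esub> x)"
      using y(1) vk' by blast
    then show ?thesis unfolding e vk by blast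
  qed
  show "\<exists>z \<in> vker L. y = Con C \<phi> L z \<otimes>\<^bsub>Obj C L\<^esub> inv\<^bsub>Obj C L\<^esub> z" if "y \<in> vker L" "Ind C K L y = \<one>\<^bsub>Obj C K\<^esub>" for y
  proof -
    have "y \<in> kernel (val_kernel \<Omega> C v L) (val_kernel \<Omega> C v K) (Ind C K L)" using that vk' by blast
    then show ?thesis unfolding e vk by blast
  qed
  show "\<exists>z \<in> vker L. Ind C K L z = y'" if "y' \<in> vker K" for y'
  proof -
    have "y' \<in> kernel (val_kernel \<Omega> C v K) (singleton_group \<one>\<^bsub>Obj C K\<^esub>) (\<lambda>_. \<one>\<^bsub>Obj C K\<^esub>)"
      using that by (simp add: kernel_def[of "val_kernel \<Omega> C v K"] vk singleton_group_def)
    then show ?thesis unfolding e vk by blast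
  qed
qed

context
  fixes H
  assumes H: "H \<in> base M"
begin

context
  fixes K
  assumes K: "K \<in> base M" "normal_in G H K"
begin

lemma conj_K: "g \<in> H \<Longrightarrow> conj_set G g K = K"
  by (rule conj_set_normal[OF M_subgroup[OF H] K(2)])

lemma group_hom_act: "g \<in> H \<Longrightarrow> group_hom (Obj C K) (Obj C K) (Con C g K)"
  using group_hom_Con[OF M_carrier[OF H] K(1)] conj_K by fastforce

lemma act_closed: "g \<in> H \<Longrightarrow> a \<in> carrier (Obj C K) \<Longrightarrow> Con C g K a \<in> carrier (Obj C K)"
  using group_hom.hom_closed[OF group_hom_act] .

lemma act_act:
  assumes "g \<in> H" "g' \<in> H" "a \<in> carrier (Obj C K)"
  shows "Con C g K (Con C g' K a) = Con C (g \<otimes> g') K a"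
  using C.Con_Con[OF M_carrier[OF H assms(2)] M_carrier[OF H assms(1)] K(1) assms(3)] conj_K[OF assms(2)] by simp

lemma v_act: "g \<in> H \<Longrightarrow> a \<in> carrier (Obj C K) \<Longrightarrow> v K (Con C g K a) = v K a"
  using v_Con[OF M_carrier[OF H] K(1)] conj_K by fastforce

lemma act_vker: "g \<in> H \<Longrightarrow> a \<in> vker K \<Longrightarrow> Con C g K a \<in> vker K"
  using v_act act_closed by (simp add: vker_iff)

text \<open>Conjugation commutes with restriction, and an element of \<open>J\<close> acts trivially
  on C(J).\<close>

lemma act_Res:
  assumes J: "J \<in> base M" "K \<in> rdom M J" "g \<in> H" "g \<in> J" "a \<in> carrier (Obj C J)"
  shows "Con C g K (Res C K J a) = Res C K J a"
proof -
  have gc: "g \<in> carrier G" using M_carrier[OF H assms(3)] .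
  have "normal_in G J J" using M_subgroup[OF J(1)]
    by (simp add: normal_in_iff subgroup.m_closed subgroup.m_inv_closed)
  then have "conj_set G g J = J" using conj_set_normal[OF M_subgroup[OF J(1)] _ J(4)] by blast
  then show ?thesis
    using C.Con_Res[OF gc J(1,2,5)] conj_K[OF J(3)] Con_trivial[OF J(1,4,5)] by simp
qed

text \<open>The action of \<open>H\<close> on C(K) factors through H/K. In the applications
  \<open>K\<close> contains the inertia group of \<open>H\<close>, and elements with equal image
  under \<open>d\<close> are exchanged.\<close>

lemma act_eqI:
  assumes "g \<in> H" "g' \<in> H" "g \<otimes> inv g' \<in> K" "a \<in> carrier (Obj C K)"
  shows "Con C g K a = Con C g' K a"
proof -
  have gc: "g \<in> carrier G" "g' \<in> carrier G" using M_carrier[OF H] assms by auto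
  have gH: "g \<otimes> inv g' \<in> H" using assms M_subgroup[OF H] by (simp add: subgroup.m_closed subgroup.m_inv_closed)
  have "Con C (g \<otimes> inv g' \<otimes> g') K a = Con C (g \<otimes> inv g') K (Con C g' K a)"
    using act_act[OF gH assms(2,4)] by simp
  then show ?thesis using Con_trivial[OF K(1) assms(3) act_closed[OF assms(2,4)]] gc by (simp add: m_assoc)
qed

context
  fixes \<phi>
  assumes \<phi>: "\<phi> \<in> H"
begin

lemma phi_pow_in: "\<phi> [^] (i::nat) \<in> H"
  using subgroup_int_pow_closed[OF M_subgroup[OF H] \<phi>, of "int i"] by (simp add: int_pow_int)

abbreviation (input) "psum n a \<equiv> power_sum G C K \<phi> n a"

lemma power_sum_0: "psum 0 a = \<one>\<^bsub>Obj C K\<^esub>"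
  by (simp add: power_sum_def C_comm[OF K(1)] comm_monoid.finprod_empty comm_group.axioms(1))

lemma power_sum_Suc:
  assumes "a \<in> carrier (Obj C K)"
  shows "psum (Suc n) a = psum n a \<otimes>\<^bsub>Obj C K\<^esub> Con C (\<phi> [^] n) K a"
proof -
  interpret K: comm_group "Obj C K" by (rule C_comm[OF K(1)])
  have "(\<lambda>i::nat. Con C (\<phi> [^] i) K a) \<in> A \<rightarrow> carrier (Obj C K)" for A
    using act_closed[OF phi_pow_in assms] by blast
  then show ?thesis
    using act_closed[OF phi_pow_in assms] by (simp add: power_sum_def lessThan_Suc K.m_comm)
qed

lemma power_sum_closed: "a \<in> carrier (Obj C K) \<Longrightarrow> psum n a \<in> carrier (Obj C K)"
proof -
  interpret K: comm_group "Obj C K" by (rule C_comm[OF K(1)])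
  show "a \<in> carrier (Obj C K) \<Longrightarrow> psum n a \<in> carrier (Obj C K)"
    unfolding power_sum_def using act_closed[OF phi_pow_in] by (intro K.finprod_closed) auto
qed

text \<open>Telescoping of (\<phi> - 1)(1 + ... + \<phi>^(n-1)) = \<phi>^n - 1, with the inverses
  moved to the other side so that the induction only multiplies.\<close>

lemma act_power_sum:
  assumes a: "a \<in> carrier (Obj C K)"
  shows "Con C \<phi> K (psum n a) \<otimes>\<^bsub>Obj C K\<^esub> a = psum n a \<otimes>\<^bsub>Obj C K\<^esub> Con C (\<phi> [^] n) K a"
proof (induction n)
  interpret K: comm_group "Obj C K" by (rule C_comm[OF K(1)])
  interpret c: group_hom "Obj C K" "Obj C K" "Con C \<phi> K" by (rule group_hom_act[OF \<phi>])
  have \<phi>c: "\<phi> \<in> carrier G" using M_carrier[OF H \<phi>] .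
  {
    case 0
    show ?case using a C.Con_id[OF K(1) a] by (simp add: power_sum_0)
  next
    case (Suc n)
    have p: "psum n a \<in> carrier (Obj C K)" by (rule power_sum_closed[OF a])
    have q: "Con C (\<phi> [^] n) K a \<in> carrier (Obj C K)" by (rule act_closed[OF phi_pow_in a])
    have e: "Con C \<phi> K (Con C (\<phi> [^] n) K a) = Con C (\<phi> [^] Suc n) K a"
      using act_act[OF \<phi> phi_pow_in[of n] a] nat_pow_Suc2[OF \<phi>c] by simp
    have q': "Con C (\<phi> [^] Suc n) K a \<in> carrier (Obj C K)" by (rule act_closed[OF phi_pow_in a])
    have "Con C \<phi> K (psum (Suc n) a) \<otimes>\<^bsub>Obj C K\<^esub> a
        = (Con C \<phi> K (psum n a) \<otimes>\<^bsub>Obj C K\<^esub> a) \<otimes>\<^bsub>Obj C K\<^esub> Con C (\<phi> [^] Suc n) K a"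
      using p q q' a e by (simp add: power_sum_Suc[OF a] K.m_ac del: nat_pow_Suc)
    also have "\<dots> = psum (Suc n) a \<otimes>\<^bsub>Obj C K\<^esub> Con C (\<phi> [^] Suc n) K a"
      unfolding Suc power_sum_Suc[OF a] ..
    finally show ?case .
  }
qed

lemma act_power_sum_div:
  assumes a: "a \<in> carrier (Obj C K)"
  shows "Con C \<phi> K (psum n a) \<otimes>\<^bsub>Obj C K\<^esub> inv\<^bsub>Obj C K\<^esub> psum n a =
    Con C (\<phi> [^] n) K a \<otimes>\<^bsub>Obj C K\<^esub> inv\<^bsub>Obj C K\<^esub> a"
proof -
  interpret K: comm_group "Obj C K" by (rule C_comm[OF K(1)])
  show ?thesis
    using act_power_sum[OF a, of n] power_sum_closed[OF a, of n] act_closed[OF \<phi> power_sum_closed[OF a, of n]] act_closed[OF phi_pow_in a, of n] a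
    by (subst K.div_eq_iff) (auto simp: K.m_comm)
qed

lemma power_sum_hom:
  assumes a: "a \<in> carrier (Obj C K)" "b \<in> carrier (Obj C K)"
  shows "psum n (a \<otimes>\<^bsub>Obj C K\<^esub> b) = psum n a \<otimes>\<^bsub>Obj C K\<^esub> psum n b"
proof -
  interpret K: comm_group "Obj C K" by (rule C_comm[OF K(1)])
  have e: "Con C (\<phi> [^] i) K (a \<otimes>\<^bsub>Obj C K\<^esub> b) = Con C (\<phi> [^] i) K a \<otimes>\<^bsub>Obj C K\<^esub> Con C (\<phi> [^] i) K b" for i :: nat
    using a by (intro group_hom.hom_mult[OF group_hom_act[OF phi_pow_in]])
  show ?thesis unfolding power_sum_def e
    using act_closed[OF phi_pow_in] a by (intro K.finprod_multf) auto
qed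

lemma power_sum_pow:
  assumes a: "a \<in> carrier (Obj C K)"
  shows "psum n (a [^]\<^bsub>Obj C K\<^esub> (k::nat)) = psum n a [^]\<^bsub>Obj C K\<^esub> k"
proof (induction k)
  interpret K: comm_group "Obj C K" by (rule C_comm[OF K(1)])
  {
    case 0
    have "psum n \<one>\<^bsub>Obj C K\<^esub> \<otimes>\<^bsub>Obj C K\<^esub> psum n \<one>\<^bsub>Obj C K\<^esub> = psum n \<one>\<^bsub>Obj C K\<^esub>"
      using power_sum_hom[of "\<one>\<^bsub>Obj C K\<^esub>" "\<one>\<^bsub>Obj C K\<^esub>" n] by simp
    then show ?case using power_sum_closed[of "\<one>\<^bsub>Obj C K\<^esub>" n] by simp
  next
    case (Suc k)
    then show ?case using a by (simp add: power_sum_hom)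
  }
qed

text \<open>This absorbs the exponent \<open>P'(n)\<close> of a reciprocity value:
  \<open>P(n)\<close> summands repeated \<open>P'(n)\<close> times form a power sum of length
  n.\<close>

lemma power_sum_mult:
  assumes a: "a \<in> carrier (Obj C K)" and inv: "Con C (\<phi> [^] n) K a = a"
  shows "psum (n * k) a = psum n a [^]\<^bsub>Obj C K\<^esub> k"
proof -
  interpret K: comm_group "Obj C K" by (rule C_comm[OF K(1)])
  have \<phi>c: "\<phi> \<in> carrier G" using M_carrier[OF H \<phi>] .
  have f: "Con C (\<phi> [^] (n * k)) K a = a" for k
  proof (induction k)
    case 0
    then show ?case using C.Con_id[OF K(1) a] by simp
  next
    case (Suc k)
    have "Con C (\<phi> [^] (n * Suc k)) K a = Con C (\<phi> [^] (n * k)) K (Con C (\<phi> [^] n) K a)"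
      using act_act[OF phi_pow_in[of "n * k"] phi_pow_in[of n] a] \<phi>c by (simp add: nat_pow_mult add.commute)
    then show ?case using Suc inv by simp
  qed
  have g: "Con C (\<phi> [^] (n * k + i)) K a = Con C (\<phi> [^] i) K a" for k i
    using act_act[OF phi_pow_in[of i] phi_pow_in[of "n * k"] a] f[of k] \<phi>c by (simp add: nat_pow_mult add.commute)
  have s: "psum (n * k + i) a = psum (n * k) a \<otimes>\<^bsub>Obj C K\<^esub> psum i a" for k i
  proof (induction i)
    case 0
    then show ?case using power_sum_closed[OF a] by (simp add: power_sum_0)
  next
    case (Suc i)
    have "psum (n * k + Suc i) a = psum (n * k + i) a \<otimes>\<^bsub>Obj C K\<^esub> Con C (\<phi> [^] i) K a"
      using power_sum_Suc[OF a, of "n * k + i"] g[of k i] by simp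
    then show ?case unfolding Suc power_sum_Suc[OF a]
      using power_sum_closed[OF a] act_closed[OF phi_pow_in a] by (simp add: K.m_assoc)
  qed
  show ?thesis
  proof (induction k)
    case (Suc k)
    then show ?case using s[of k n] by (simp add: add.commute)
  qed (simp add: power_sum_0)
qed

lemma v_power_sum:
  assumes a: "a \<in> carrier (Obj C K)"
  shows "v K (psum n a) = v K a [^]\<^bsub>\<Omega>\<^esub> n"
proof (induction n)
  interpret v: group_hom "Obj C K" \<Omega> "v K" by (rule group_hom_v[OF K(1)])
  {
    case 0
    then show ?case by (simp add: power_sum_0)
  next
    case (Suc n)
    then show ?case
      using power_sum_closed[OF a] act_closed[OF phi_pow_in a] a by (simp add: power_sum_Suc v_act[OF phi_pow_in a])
  }
qed

lemma act_commute_power_sum: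
  assumes a: "a \<in> carrier (Obj C K)"
  shows "Con C (\<phi> [^] (k::nat)) K (psum n a) = psum n (Con C (\<phi> [^] k) K a)"
proof (induction n)
  interpret c: group_hom "Obj C K" "Obj C K" "Con C (\<phi> [^] k) K" by (rule group_hom_act[OF phi_pow_in])
  have \<phi>c: "\<phi> \<in> carrier G" using M_carrier[OF H \<phi>] .
  {
    case 0
    then show ?case by (simp add: power_sum_0)
  next
    case (Suc n)
    then show ?case
      using power_sum_closed[OF a] act_closed[OF phi_pow_in a] a \<phi>c
      by (simp add: power_sum_Suc act_act[OF phi_pow_in phi_pow_in a] nat_pow_mult add.commute)
  }
qed

end

end

lemma act_Ind:
  assumes K: "K \<in> base M" "normal_in G H K" and L: "L \<in> base M" "normal_in G H L" "L \<in> idom M K"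
    and g: "g \<in> H" and a: "a \<in> carrier (Obj C L)"
  shows "Con C g K (Ind C K L a) = Ind C K L (Con C g L a)"
  using C.Con_Ind[OF M_carrier[OF H g] K(1) L(3) a] conj_K[OF K g] conj_K[OF L(1,2) g] by simp

lemma Ind_power_sum:
  assumes K: "K \<in> base M" "normal_in G H K" and L: "L \<in> base M" "normal_in G H L" "L \<in> idom M K"
    and \<phi>: "\<phi> \<in> H" and a: "a \<in> carrier (Obj C L)"
  shows "Ind C K L (power_sum G C L \<phi> n a) = power_sum G C K \<phi> n (Ind C K L a)"
proof (induction n)
  interpret c: group_hom "Obj C L" "Obj C K" "Ind C K L" by (rule group_hom_Ind[OF K(1) L(3)])
  {
    case 0
    then show ?case by (simp add: power_sum_0[OF K \<phi>] power_sum_0[OF L(1,2) \<phi>])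
  next
    case (Suc n)
    then show ?case
      using a power_sum_closed[OF L(1,2) \<phi> a] act_closed[OF L(1,2) phi_pow_in[OF K \<phi>] a]
      by (simp add: power_sum_Suc[OF K \<phi>] power_sum_Suc[OF L(1,2) \<phi>] act_Ind[OF K L phi_pow_in[OF K \<phi>] a])
  }
qed

end

end

lemma (in group) conj_set_Int:
  assumes "A \<subseteq> carrier G" "B \<subseteq> carrier G" "g \<in> carrier G"
  shows "conj_set G g (A \<inter> B) = conj_set G g A \<inter> conj_set G g B"
proof -
  have "inj_on (\<lambda>x. g \<otimes> x \<otimes> inv g) (carrier G)"
    using assms(3) by (auto simp: inj_on_def)
  then have "(\<lambda>x. g \<otimes> x \<otimes> inv g) ` (A \<inter> B) = (\<lambda>x. g \<otimes> x \<otimes> inv g) ` A \<inter> (\<lambda>x. g \<otimes> x \<otimes> inv g) ` B"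
    using assms by (intro inj_on_image_Int)
  then show ?thesis
    using assms by (simp add: conj_set_eq conj_set_eq[of "A \<inter> B"] le_infI1)
qed

context group
begin

lemma subgroup_in_double_coset:
  assumes "subgroup V G" "subgroup J G" "g \<in> carrier G" "x \<in> V" "j \<in> J"
  shows "x \<otimes> g \<otimes> j \<in> V #> g <#> J"
  using assms unfolding set_mult_def r_coset_def by blast

lemma double_coset_eqI:
  assumes V: "subgroup V G" and J: "subgroup J G" and g: "g \<in> carrier G" and x: "x \<in> V" and j: "j \<in> J"
  shows "V #> (x \<otimes> g \<otimes> j) <#> J = V #> g <#> J"
proof -
  interpret V: subgroup V G by fact
  interpret J: subgroup J G by fact
  have xc: "x \<in> carrier G" "j \<in> carrier G" using x j by auto
  show ?thesis
  proof (intro equalityI subsetI)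
    fix y assume "y \<in> V #> (x \<otimes> g \<otimes> j) <#> J"
    then obtain v' j' where y: "v' \<in> V" "j' \<in> J" "y = v' \<otimes> (x \<otimes> g \<otimes> j) \<otimes> j'"
      unfolding set_mult_def r_coset_def by blast
    then have "y = (v' \<otimes> x) \<otimes> g \<otimes> (j \<otimes> j')" using xc g V.mem_carrier[OF y(1)] J.mem_carrier[OF y(2)] by (simp add: m_assoc)
    then show "y \<in> V #> g <#> J"
      using subgroup_in_double_coset[OF V J g V.m_closed[OF y(1) x] J.m_closed[OF j y(2)]] by simp
  next
    fix y assume "y \<in> V #> g <#> J"
    then obtain v' j' where y: "v' \<in> V" "j' \<in> J" "y = v' \<otimes> g \<otimes> j'"
      unfolding set_mult_def r_coset_def by blast
    then have "y = (v' \<otimes> inv x) \<otimes> (x \<otimes> g \<otimes> j) \<otimes> (inv j \<otimes> j')"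
      using xc g V.mem_carrier[OF y(1)] J.mem_carrier[OF y(2)] by (simp add: group_norm)
    then show "y \<in> V #> (x \<otimes> g \<otimes> j) <#> J"
      using subgroup_in_double_coset[OF V J _ V.m_closed[OF y(1) V.m_inv_closed[OF x]] J.m_closed[OF J.m_inv_closed[OF j] y(2)], of "x \<otimes> g \<otimes> j"] xc g
      by simp
  qed
qed

end

context fn_setting
begin

lemma open_in_group_self: "H \<in> base M \<Longrightarrow> open_in_group G H H"
proof -
  assume H: "H \<in> base M"
  have "H = topspace (topo G) \<inter> H" using M_carrier[OF H] by auto
  then have "openin (subtopology (topo G) H) H" unfolding openin_subtopology using openin_topspace by blast
  then show ?thesis using M_subgroup[OF H] by (simp add: open_in_group_def)
qed

text \<open>As \<open>V\<close> contains the inertia group of \<open>H\<close>, a double coset of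
  \<open>V\<close> and \<open>J\<close> in \<open>H\<close> is determined by the value of
  \<open>d\<close> modulo d(J). These values form a cyclic group of order s generated by d(\<phi>),
  so the powers \<phi>^i with i < s are representatives; normality of \<open>V\<close> and of V
  \<inter> J turns every term of the formula into a conjugate of one norm.\<close>

lemma mackey_power_sum:
  assumes H: "H \<in> base M" and \<phi>: "frob_exp H \<phi> 1"
    and V: "open_in_group G H V" "normal_in G H V" "inertia G \<Omega> d H \<subseteq> V"
    and J: "J \<in> idom M H" "P_number P s" "d ` J = pow_image \<Omega> (fd H * s)" "d ` V \<subseteq> d ` J"
    and W: "normal_in G H (V \<inter> J)" and a: "a \<in> carrier (Obj C J)"
  shows "Res C V H (Ind C H J a) =
    power_sum G C V \<phi> s (Ind C V (V \<inter> J) (Res C (V \<inter> J) J a))"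
proof -
  have Vb: "V \<in> base M" and Vr: "V \<in> rdom M H" using open_base[OF H V(1)] open_rdom[OF H V(1)] .
  have Jb: "J \<in> base M" using J(1) M.idom_sub[OF H] by blast
  have JH: "J \<subseteq> H" using rdom_idom_subset[OF H] J(1) by blast
  have Wr: "V \<inter> J \<in> rdom M J" and Wi: "V \<inter> J \<in> idom M V"
    using mackey_M H Vr J(1) by (auto simp: mackey_system_def)
  have Wb: "V \<inter> J \<in> base M" using Wr M.rdom_sub[OF Jb] by blast
  have Vs: "subgroup V G" and Js: "subgroup J G" and Hs: "subgroup H G" using M_subgroup Vb Jb H by auto
  have \<phi>H: "\<phi> \<in> H" and d\<phi>: "d \<phi> = \<omega> [^]\<^bsub>\<Omega>\<^esub> fd H" using \<phi> by (auto simp: frob_exp_def)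
  have \<phi>c: "\<phi> \<in> carrier G" using M_carrier[OF H \<phi>H] .
  note pH = phi_pow_in[OF H Vb V(2) \<phi>H]
  have s0: "s > 0" using J(2) by (simp add: P_number_def)
  have fs0: "fd H * s > 0" using fd_pos[OF H] s0 by simp
  have dpow: "d (\<phi> [^] (i::nat)) = \<omega> [^]\<^bsub>\<Omega>\<^esub> (fd H * i)" for i
    using \<phi>c by (simp add: d_pow d\<phi> Om.nat_pow_pow)
  interpret dJ: subgroup "d ` J" \<Omega> by (rule subgroup_d_image[OF Js])
  define DC where "DC g = V #> g <#> J" for g
  have DC_eqD: "\<exists>y \<in> d ` J. d g' = d g \<otimes>\<^bsub>\<Omega>\<^esub> y" if g: "g \<in> H" "g' \<in> H" "DC g = DC g'" for g g'
  proof -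
    have gc: "g \<in> carrier G" "g' \<in> carrier G" using g M_carrier[OF H] by auto
    have "\<one> \<otimes> g' \<otimes> \<one> \<in> DC g'" unfolding DC_def
      by (rule subgroup_in_double_coset[OF Vs Js gc(2)]) (use Vs Js subgroup.one_closed in auto)
    then have "g' \<in> DC g" using g gc by simp
    then obtain v' j where vj: "v' \<in> V" "j \<in> J" "g' = v' \<otimes> g \<otimes> j"
      unfolding DC_def set_mult_def r_coset_def by blast
    have vc: "v' \<in> carrier G" "j \<in> carrier G" using vj M_carrier Vb Jb by auto
    have "d g' = d g \<otimes>\<^bsub>\<Omega>\<^esub> (d v' \<otimes>\<^bsub>\<Omega>\<^esub> d j)" using vj vc gc by (simp add: Om.m_ac)
    moreover have "d v' \<otimes>\<^bsub>\<Omega>\<^esub> d j \<in> d ` J" using vj J(4) by (intro dJ.m_closed) auto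
    ultimately show ?thesis by blast
  qed
  have DC_eqI: "DC g' = DC g" if g: "g \<in> H" "g' \<in> H" "j \<in> J" "d g' = d g \<otimes>\<^bsub>\<Omega>\<^esub> d j" for g g' j
  proof -
    have gc: "g \<in> carrier G" "g' \<in> carrier G" "j \<in> carrier G" using g M_carrier H Jb by auto
    \<comment> \<open>g' and g j have the same image under \<open>d\<close>, so they differ by
      inertia, which lies in \<open>V\<close>.\<close>
    let ?x = "g' \<otimes> inv (g \<otimes> j)"
    have "?x \<in> H" using g JH Hs by (auto intro!: subgroup.m_closed subgroup.m_inv_closed)
    moreover have "d ?x = \<one>\<^bsub>\<Omega>\<^esub>" using g(4) gc by simp
    ultimately have "?x \<in> V" using in_inertia_iff[OF H] V(3) by blast
    moreover have "g' = ?x \<otimes> g \<otimes> j" using gc by (simp add: group_norm)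
    ultimately show ?thesis unfolding DC_def using double_coset_eqI[OF Vs Js gc(1) _ g(3)] by metis
  qed
  let ?R = "(\<lambda>i. \<phi> [^] i) ` {..<s}"
  have inj': "i = j" if ij: "i < s" "j < s" "DC (\<phi> [^] i) = DC (\<phi> [^] j)" for i j :: nat
  proof -
    have *: "i = j" if ij: "i \<le> j" "j < s" "DC (\<phi> [^] i) = DC (\<phi> [^] j)" for i j :: nat
    proof -
      obtain y where y: "y \<in> d ` J" "d (\<phi> [^] j) = d (\<phi> [^] i) \<otimes>\<^bsub>\<Omega>\<^esub> y" using DC_eqD[OF pH pH ij(3)] by blast
      have "fd H * i + fd H * (j - i) = fd H * j" using ij(1) by (simp flip: distrib_left)
      then have "\<omega> [^]\<^bsub>\<Omega>\<^esub> (fd H * i) \<otimes>\<^bsub>\<Omega>\<^esub> \<omega> [^]\<^bsub>\<Omega>\<^esub> (fd H * (j - i)) = \<omega> [^]\<^bsub>\<Omega>\<^esub> (fd H * j)"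
        by (simp add: Om.nat_pow_mult)
      then have "\<omega> [^]\<^bsub>\<Omega>\<^esub> (fd H * i) \<otimes>\<^bsub>\<Omega>\<^esub> \<omega> [^]\<^bsub>\<Omega>\<^esub> (fd H * (j - i)) = \<omega> [^]\<^bsub>\<Omega>\<^esub> (fd H * i) \<otimes>\<^bsub>\<Omega>\<^esub> y"
        using y(2) by (simp only: dpow)
      then have "\<omega> [^]\<^bsub>\<Omega>\<^esub> (fd H * (j - i)) = y" using dJ.mem_carrier[OF y(1)] by simp
      then have "P_dvd P (fd H * s) (fd H * (j - i))"
        using y(1) J(3) Om.pow_in_pow_image_iff[OF fs0] by metis
      then have "s dvd j - i" using P_dvd_mult_cancel[OF _ J(2) fd_pos[OF H]] primes by blast
      then show ?thesis using ij by (meson dvd_imp_le diff_is_0_eq le_antisym less_imp_diff_less linorder_not_less zero_less_diff)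
    qed
    show ?thesis using *[of i j] *[of j i] ij by (metis nat_le_linear)
  qed
  have surj: "\<exists>i<s. DC h = DC (\<phi> [^] i)" if h: "h \<in> H" for h
  proof -
    have "d h \<in> pow_image \<Omega> (fd H)" using h d_image[OF H] by blast
    then obtain y where y: "y \<in> carrier \<Omega>" "d h = y [^]\<^bsub>\<Omega>\<^esub> fd H" by (auto simp: pow_image_def)
    obtain k y' where k: "y' \<in> pow_image \<Omega> s" "y = \<omega> [^]\<^bsub>\<Omega>\<^esub> (k::nat) \<otimes>\<^bsub>\<Omega>\<^esub> y'"
      using Om.eq_omega_pow_mult[OF y(1) s0] by blast
    obtain x where x: "x \<in> carrier \<Omega>" "y' = x [^]\<^bsub>\<Omega>\<^esub> s" using k(1) by (auto simp: pow_image_def)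
    \<comment> \<open>The part s q of the exponent and the s-th power x^s are both realised in d(J),
      so only the remainder i matters.\<close>
    define i q where "i = k mod s" and "q = k div s"
    have ki: "k = i + s * q" by (simp add: i_def q_def)
    let ?z = "(\<omega> [^]\<^bsub>\<Omega>\<^esub> q \<otimes>\<^bsub>\<Omega>\<^esub> x) [^]\<^bsub>\<Omega>\<^esub> (fd H * s)"
    have "?z \<in> d ` J" unfolding J(3) using x by (auto simp: pow_image_def)
    then obtain j where j: "j \<in> J" "d j = ?z" by auto
    have "d h = (\<omega> [^]\<^bsub>\<Omega>\<^esub> (i + s * q) \<otimes>\<^bsub>\<Omega>\<^esub> x [^]\<^bsub>\<Omega>\<^esub> s) [^]\<^bsub>\<Omega>\<^esub> fd H"
      using y(2) k(2) x(2) ki by simp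
    also have "\<dots> = \<omega> [^]\<^bsub>\<Omega>\<^esub> (fd H * i) \<otimes>\<^bsub>\<Omega>\<^esub> ?z"
      using x(1) by (simp add: Om.nat_pow_distrib Om.nat_pow_pow Om.m_assoc algebra_simps flip: Om.nat_pow_mult)
    finally have "d h = d (\<phi> [^] i) \<otimes>\<^bsub>\<Omega>\<^esub> d j" by (simp only: dpow j(2))
    then have "DC h = DC (\<phi> [^] i)" by (rule DC_eqI[OF pH h j(1)])
    moreover have "i < s" using s0 by (simp add: i_def)
    ultimately show ?thesis by blast
  qed
  have bij: "bij_betw DC ?R (double_cosets G H V J)"
    unfolding bij_betw_def
  proof
    show "inj_on DC ?R" using inj' by (auto simp: inj_on_def)
    show "DC ` ?R = double_cosets G H V J"
    proof
      show "DC ` ?R \<subseteq> double_cosets G H V J" using pH by (auto simp: double_cosets_def DC_def)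
      show "double_cosets G H V J \<subseteq> DC ` ?R"
      proof
        fix X assume "X \<in> double_cosets G H V J"
        then obtain h where "h \<in> H" "X = DC h" by (auto simp: double_cosets_def DC_def)
        then show "X \<in> DC ` ?R" using surj[of h] by auto
      qed
    qed
  qed
  have inj: "inj_on (\<lambda>i::nat. \<phi> [^] i) {..<s}" using inj' by (auto simp: inj_on_def)
  let ?N = "Ind C V (V \<inter> J) (Res C (V \<inter> J) J a)"
  have Na: "Res C (V \<inter> J) J a \<in> carrier (Obj C (V \<inter> J))" by (rule Res_closed[OF Jb Wr a])
  have Nc: "?N \<in> carrier (Obj C V)" by (rule Ind_closed[OF Vb Wi Na])
  let ?t = "\<lambda>h. Ind C V (V \<inter> conj_set G h J)
              (Con C h (conj_set G (inv h) V \<inter> J)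
                (Res C (conj_set G (inv h) V \<inter> J) J a))"
  \<comment> \<open>Conjugation by elements of \<open>H\<close> fixes \<open>V\<close> and V
    \<inter> J, so all groups in the term at h are the same as in \<open>?N\<close>.\<close>
  have t: "?t h = Con C h V ?N" if h: "h \<in> H" for h
  proof -
    have hc: "h \<in> carrier G" using M_carrier[OF H h] .
    have ih: "inv h \<in> H" using h Hs by (simp add: subgroup.m_inv_closed)
    have "conj_set G h (V \<inter> J) = conj_set G h V \<inter> conj_set G h J"
      by (rule conj_set_Int[OF subgroup.subset[OF Vs] subgroup.subset[OF Js] hc])
    then have e: "V \<inter> conj_set G h J = V \<inter> J" "conj_set G (inv h) V = V"
      using conj_K[OF H Vb V(2)] conj_K[OF H Wb W] h ih by auto
    show ?thesis unfolding e using act_Ind[OF H Vb V(2) Wb W Wi h Na] by simp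
  qed
  interpret V: comm_group "Obj C V" by (rule C_comm[OF Vb])
  have "Res C V H (Ind C H J a) = (\<Otimes>\<^bsub>Obj C V\<^esub> h \<in> ?R. ?t h)"
    by (rule mackey_formula[OF H Vr J(1) a _ bij[unfolded DC_def]]) (use pH in auto)
  also have "\<dots> = (\<Otimes>\<^bsub>Obj C V\<^esub> h \<in> ?R. Con C h V ?N)"
    using pH act_closed[OF H Vb V(2) pH Nc] by (intro V.finprod_cong') (auto simp: t)
  also have "\<dots> = (\<Otimes>\<^bsub>Obj C V\<^esub> i \<in> {..<s}. Con C (\<phi> [^] i) V ?N)"
    by (rule V.finprod_reindex[OF _ inj]) (use act_closed[OF H Vb V(2) pH Nc] in auto)
  finally show ?thesis by (simp add: power_sum_def)
qed

text \<open>This replaces the descent of units along the maximal unramified extension: all relations are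
  lifted from the level \<open>m\<close> to the level \<open>m [H:U]\<close>, where norms kill the torsion defect.\<close>

lemma norm_of_unit_in_ind_image:
  assumes HE: "H \<in> base (flat E)" and H: "H \<in> base M" and U: "open_in_group G H U" "normal_in G H U"
    and m: "m > 0" "index G H U dvd m" and \<phi>: "frob_exp H \<phi> 1"
    and u: "u \<in> vker (W H U m)" "u1 \<in> vker (W H U m)" "u2 \<in> vker (W H U m)"
    and t: "t1 \<in> inertia G \<Omega> d H" "t2 \<in> inertia G \<Omega> d H"
    and eq: "Con C \<phi> (W H U m) u \<otimes>\<^bsub>Obj C (W H U m)\<^esub> inv\<^bsub>Obj C (W H U m)\<^esub> u =
      (Con C t1 (W H U m) u1 \<otimes>\<^bsub>Obj C (W H U m)\<^esub> inv\<^bsub>Obj C (W H U m)\<^esub> u1) \<otimes>\<^bsub>Obj C (W H U m)\<^esub>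
      (Con C t2 (W H U m) u2 \<otimes>\<^bsub>Obj C (W H U m)\<^esub> inv\<^bsub>Obj C (W H U m)\<^esub> u2)"
  shows "\<exists>X \<in> ind_image C H U. X \<in> vker H \<and> Ind C (ur_sub H m) (W H U m) u = Res C (ur_sub H m) H X"
proof -
  let ?r = "index G H U"
  define K where "K = W H U m"
  define V where "V = ur_sub H m"
  have r: "?r > 0" "P_number P ?r" using index_pos[OF H U] P_number_index[OF H U] .
  have m': "m * ?r > 0" using m r by simp
  define L where "L = W H U (m * ?r)"
  define V' where "V' = ur_sub H (m * ?r)"
  note Ko = open_W[OF H U m(1), folded K_def] and Kb = W_base[OF H U m(1), folded K_def]
    and Kn = W_normal[OF H U m(1), folded K_def]
  note Lo = open_W[OF H U m', folded L_def] and Lb = W_base[OF H U m', folded L_def]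
    and Ln = W_normal[OF H U m', folded L_def]
  note Vo = open_ur_sub[OF H m(1), folded V_def] and Vb = ur_sub_base[OF H m(1), folded V_def]
    and Vn = normal_ur_sub[OF H m(1), folded V_def]
  note V'o = open_ur_sub[OF H m', folded V'_def] and V'b = ur_sub_base[OF H m', folded V'_def]
    and V'n = normal_ur_sub[OF H m', folded V'_def]
  have LK: "L \<subseteq> K" using W_antimono[OF H U m(1), of ?r] by (simp add: L_def K_def)
  have V'V: "V' \<subseteq> V"
    using Om.pow_image_mult_subset[of "fd H * m" ?r] by (auto simp: V'_def V_def ur_sub_def mult.assoc)
  have sub: "K \<subseteq> V" "L \<subseteq> V'" "K \<subseteq> H" "V \<subseteq> H" "V' \<subseteq> H" "K \<subseteq> U" "L \<subseteq> U" "U \<subseteq> H"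
    using U_subset[OF H U] by (auto simp: K_def V_def L_def V'_def ur_sub_def)
  have LKo: "open_in_group G K L" by (rule open_in_group_subset[OF Lo LK sub(3)])
  have V'Vo: "open_in_group G V V'" by (rule open_in_group_subset[OF V'o V'V sub(4)])
  have KVo: "open_in_group G V K" by (rule open_in_group_subset[OF Ko sub(1,4)])
  have LV'o: "open_in_group G V' L" by (rule open_in_group_subset[OF Lo sub(2,5)])
  have LUo: "open_in_group G U L" by (rule open_in_group_subset[OF Lo sub(7,8)])
  have Ub: "U \<in> base M" by (rule U_base[OF H U])
  have normal_sub: "normal_in G A B" if "normal_in G H B" "A \<subseteq> H" "B \<subseteq> A" "subgroup A G" for A B
    using that unfolding normal_in_iff[OF M_subgroup[OF H]] normal_in_iff[OF that(4)] by blast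
  have LKu: "L \<in> unramified G \<Omega> d K"
    unfolding unramified_def
    using LKo normal_sub[OF Ln sub(3) LK M_subgroup[OF Kb]] inertia_W[OF H U m(1)] inertia_W[OF H U m'] inertia_subset[of L]
    by (auto simp: K_def L_def)
  have V'Hu: "V' \<in> unramified G \<Omega> d H"
    using V'o V'n inertia_ur_sub[OF H m'] by (simp add: unramified_def V'_def)
  interpret K: comm_group "Obj C K" by (rule C_comm[OF Kb])
  interpret L: comm_group "Obj C L" by (rule C_comm[OF Lb])
  interpret V: comm_group "Obj C V" by (rule C_comm[OF Vb])
  interpret V': comm_group "Obj C V'" by (rule C_comm[OF V'b])
  interpret CH: comm_group "Obj C H" by (rule C_comm[OF H])
  interpret KL: group_hom "Obj C L" "Obj C K" "Ind C K L" by (rule group_hom_Ind[OF Kb open_idom[OF Kb LKo]])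
  interpret V'L: group_hom "Obj C L" "Obj C V'" "Ind C V' L" by (rule group_hom_Ind[OF V'b open_idom[OF V'b LV'o]])
  interpret VV': group_hom "Obj C V'" "Obj C V" "Ind C V V'" by (rule group_hom_Ind[OF Vb open_idom[OF Vb V'Vo]])
  interpret vL: group_hom "Obj C L" \<Omega> "v L" by (rule group_hom_v[OF Lb])
  interpret vV': group_hom "Obj C V'" \<Omega> "v V'" by (rule group_hom_v[OF V'b])
  interpret uL: subgroup "vker L" "Obj C L" by (rule subgroup_vker[OF Lb])
  interpret uV': subgroup "vker V'" "Obj C V'" by (rule subgroup_vker[OF V'b])
  have \<phi>H: "\<phi> \<in> H" using \<phi> by (simp add: frob_exp_def)
  have tH: "t1 \<in> H" "t2 \<in> H" "t1 \<in> V'" "t2 \<in> V'"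
    using t inertia_subset[of H] inertia_ur_sub[OF H m'] by (auto simp: V'_def)
  obtain \<psi> where \<psi>: "frob_exp K \<psi> 1" using frobenius_exists[OF Kb] .
  have \<psi>K: "\<psi> \<in> K" and d\<psi>: "d \<psi> = \<omega> [^]\<^bsub>\<Omega>\<^esub> fd K" using \<psi> by (auto simp: frob_exp_def)
  have \<psi>H: "\<psi> \<in> H" using \<psi>K sub by blast
  note lift = exact_Ind_surj[OF HE Ko Kb LKu \<psi>]
  obtain w where w: "w \<in> vker L" "Ind C K L w = u" using lift[of u] u by (auto simp: K_def)
  obtain w1 where w1: "w1 \<in> vker L" "Ind C K L w1 = u1" using lift[of u1] u by (auto simp: K_def)
  obtain w2 where w2: "w2 \<in> vker L" "Ind C K L w2 = u2" using lift[of u2] u by (auto simp: K_def)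
  note wc = uL.mem_carrier[OF w(1)] uL.mem_carrier[OF w1(1)] uL.mem_carrier[OF w2(1)]
  define D where "D g x = Con C g L x \<otimes>\<^bsub>Obj C L\<^esub> inv\<^bsub>Obj C L\<^esub> x" for g x
  define D' where "D' g x = Con C g V' x \<otimes>\<^bsub>Obj C V'\<^esub> inv\<^bsub>Obj C V'\<^esub> x" for g x
  have D: "D g x \<in> vker L" if "g \<in> H" "x \<in> vker L" for g x
    unfolding D_def using act_vker[OF H Lb Ln that] that(2) by blast
  have indD: "Ind C K L (D g x) = Con C g K (Ind C K L x) \<otimes>\<^bsub>Obj C K\<^esub> inv\<^bsub>Obj C K\<^esub> Ind C K L x"
    if "g \<in> H" "x \<in> carrier (Obj C L)" for g x
    unfolding D_def using that act_closed[OF H Lb Ln that] act_Ind[OF H Kb Kn Lb Ln open_idom[OF Kb LKo] that] by simp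
  have indD': "Ind C V' L (D g x) = D' g (Ind C V' L x)" if "g \<in> H" "x \<in> carrier (Obj C L)" for g x
    unfolding D_def D'_def
    using that act_closed[OF H Lb Ln that] act_Ind[OF H V'b V'n Lb Ln open_idom[OF V'b LV'o] that] by simp
  \<comment> \<open>\<open>x\<close> is the amount by which the lifted units fail the relation. Its
    norm to \<open>K\<close> is one because the relation holds there, so x = (\<psi> - 1) y with a
    Frobenius element \<psi> of \<open>K\<close>.\<close>
  define x where "x = D \<phi> w \<otimes>\<^bsub>Obj C L\<^esub> inv\<^bsub>Obj C L\<^esub> (D t1 w1 \<otimes>\<^bsub>Obj C L\<^esub> D t2 w2)"
  have Dv: "D \<phi> w \<in> vker L" "D t1 w1 \<in> vker L" "D t2 w2 \<in> vker L"
    using D \<phi>H tH w(1) w1(1) w2(1) by auto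
  have xv: "x \<in> vker L" unfolding x_def using Dv by blast
  note Dc = uL.mem_carrier[OF Dv(1)] uL.mem_carrier[OF Dv(2)] uL.mem_carrier[OF Dv(3)]
  have "Ind C K L x = Ind C K L (D \<phi> w) \<otimes>\<^bsub>Obj C K\<^esub> inv\<^bsub>Obj C K\<^esub> (Ind C K L (D t1 w1) \<otimes>\<^bsub>Obj C K\<^esub> Ind C K L (D t2 w2))"
    unfolding x_def using Dc by simp
  also have "\<dots> = \<one>\<^bsub>Obj C K\<^esub>"
    using eq KL.hom_closed[OF Dc(1)] KL.hom_closed[OF Dc(2)] KL.hom_closed[OF Dc(3)]
    by (simp add: K.div_eq_one_iff indD \<phi>H tH wc w(2) w1(2) w2(2) K_def[symmetric])
  finally obtain y where y: "y \<in> vker L" "x = D \<psi> y"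
    using exact_Ind_kernel[OF HE Ko Kb LKu \<psi> xv] by (auto simp: D_def)
  have yc: "y \<in> carrier (Obj C L)" using uL.mem_carrier[OF y(1)] .
  \<comment> \<open>Taking norms to \<open>V'\<close> removes the two inertial terms, because t1 and
    t2 lie in \<open>V'\<close> and act trivially on C(V'). What remains is (\<phi> - 1) c = (\<psi>
    - 1) b.\<close>
  define b where "b = Ind C V' L y"
  define c where "c = Ind C V' L w"
  have vInd: "v V' (Ind C V' L z) = \<one>\<^bsub>\<Omega>\<^esub>" if "z \<in> vker L" for z
    using v_Ind[OF V'b open_idom[OF V'b LV'o]] that by (simp add: vker_iff)
  have b: "b \<in> vker V'" and c: "c \<in> vker V'"
    using vInd y(1) w(1) yc wc(1) by (auto simp: b_def c_def vker_iff)
  note bc = uV'.mem_carrier[OF b] uV'.mem_carrier[OF c]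
  have D't: "D' s z = \<one>\<^bsub>Obj C V'\<^esub>" if "s \<in> V'" "z \<in> carrier (Obj C V')" for s z
    unfolding D'_def using Con_trivial[OF V'b that] that(2) by simp
  have "D' \<phi> c = Ind C V' L (D \<phi> w)" unfolding c_def using indD'[OF \<phi>H wc(1)] by simp
  also have "D \<phi> w = x \<otimes>\<^bsub>Obj C L\<^esub> (D t1 w1 \<otimes>\<^bsub>Obj C L\<^esub> D t2 w2)"
    unfolding x_def using Dc by (simp add: L.m_assoc)
  also have "Ind C V' L \<dots> = Ind C V' L (D \<psi> y)"
    using Dc uL.mem_carrier[OF xv] indD'[OF tH(1) wc(2)] indD'[OF tH(2) wc(3)] D't tH wc y(2) by simp
  finally have D'c: "D' \<phi> c = D' \<psi> b" using indD'[OF \<psi>H yc] by (simp add: b_def)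
  \<comment> \<open>\<open>s\<close> is the relative inertia degree of \<open>V\<close> over
    \<open>H\<close> and, since [H:U] divides m, also that of \<open>K\<close>. Hence \<psi> and
    \<phi>^s agree modulo inertia, and telescoping rewrites (\<psi> - 1) b as \<phi> - 1 applied to
    a power sum of b.\<close>
  define s where "s = P_part P m"
  have sP: "P_number P s" unfolding s_def using P_number_P_part[of P m] primes m(1) by blast
  have pI: "pow_image \<Omega> (fd H * m) = d ` V" by (simp add: V_def d_ur_sub[OF H])
  have dV: "d ` V = pow_image \<Omega> (fd H * s)"
    using d_image[OF Vb] fd_ur_sub[OF H m(1)] by (simp add: V_def s_def)
  have dK: "d ` K = d ` V"
  proof
    show "d ` K \<subseteq> d ` V" using sub(1) by blast
    show "d ` V \<subseteq> d ` K"
    proof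
      fix z assume "z \<in> d ` V"
      then obtain q where q: "q \<in> carrier \<Omega>" "z = (q [^]\<^bsub>\<Omega>\<^esub> fd H) [^]\<^bsub>\<Omega>\<^esub> m"
        using pI by (auto simp: pow_image_def Om.nat_pow_pow)
      have "q [^]\<^bsub>\<Omega>\<^esub> fd H \<in> d ` H" unfolding d_image[OF H] using q by (auto simp: pow_image_def)
      then obtain k where k: "k \<in> H" "d k = q [^]\<^bsub>\<Omega>\<^esub> fd H" by auto
      obtain m'' where m'': "m = ?r * m''" using m(2) by (auto elim: dvdE)
      have kc: "k \<in> carrier G" using M_carrier[OF H k(1)] .
      have "(k [^] ?r) [^] m'' \<in> U" by (rule nat_pow_in[OF H U Ub pow_index_in[OF H U k(1)]])
      then have kU: "k [^] m \<in> U" using kc by (simp add: nat_pow_pow m'')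
      have dk: "d (k [^] m) = z" using kc k(2) q by (simp add: d_pow)
      have "k [^] m \<in> K" unfolding K_def ur_sub_def using kU dk nat_pow_in[OF H U H k(1)] pI \<open>z \<in> d ` V\<close> by simp
      then show "z \<in> d ` K" using dk by blast
    qed
  qed
  have "fd K = P_part P (fd H * s)"
    using fd_eqI[OF Kb, of "fd H * s"] dK dV fd_pos[OF H] sP by (simp add: P_number_def)
  then have fdK: "fd K = fd H * s" using P_part_P_number[OF P_number_mult[OF P_number_fd[OF H] sP]] by simp
  have \<phi>s: "\<phi> [^] s \<in> H" by (rule phi_pow_in[OF H Kb Kn \<phi>H])
  have \<phi>c: "\<phi> \<in> carrier G" "\<psi> \<in> carrier G" using M_carrier[OF H] \<phi>H \<psi>H by auto
  have "\<psi> \<otimes> inv (\<phi> [^] s) \<in> inertia G \<Omega> d H"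
    unfolding in_inertia_iff[OF H]
  proof
    show "\<psi> \<otimes> inv (\<phi> [^] s) \<in> H" using \<psi>H \<phi>s M_subgroup[OF H] by (simp add: subgroup.m_closed subgroup.m_inv_closed)
    have "d (\<phi> [^] s) = d \<psi>" using \<phi>c \<phi> by (simp add: d_pow frob_exp_def Om.nat_pow_pow d\<psi> fdK)
    then show "d (\<psi> \<otimes> inv (\<phi> [^] s)) = \<one>\<^bsub>\<Omega>\<^esub>" using \<phi>c by (simp del: d.hom_nat_pow)
  qed
  then have "\<psi> \<otimes> inv (\<phi> [^] s) \<in> V'" using inertia_ur_sub[OF H m'] by (auto simp: V'_def)
  then have "Con C \<psi> V' b = Con C (\<phi> [^] s) V' b" by (rule act_eqI[OF H V'b V'n \<psi>H \<phi>s _ bc(1)])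
  then have D'b: "D' \<psi> b = D' \<phi> (power_sum G C V' \<phi> s b)"
    unfolding D'_def using act_power_sum_div[OF H V'b V'n \<phi>H bc(1), of s] by simp
  let ?p = "power_sum G C V' \<phi> s b"
  have pc: "?p \<in> carrier (Obj C V')" by (rule power_sum_closed[OF H V'b V'n \<phi>H bc(1)])
  have pv: "?p \<in> vker V'" using pc v_power_sum[OF H V'b V'n \<phi>H bc(1), of s] b by (simp add: vker_iff)
  \<comment> \<open>\<open>c\<close> and the power sum have the same image under \<phi> - 1, so
    their quotient is fixed by \<phi> and descends to a unit \<open>z0\<close> of C(H).\<close>
  define z where "z = c \<otimes>\<^bsub>Obj C V'\<^esub> inv\<^bsub>Obj C V'\<^esub> ?p"
  have zv: "z \<in> vker V'" unfolding z_def using c pv by blast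
  interpret a: group_hom "Obj C V'" "Obj C V'" "Con C \<phi> V'" by (rule group_hom_act[OF H V'b V'n \<phi>H])
  have "Con C \<phi> V' z = z"
  proof -
    have 1: "Con C \<phi> V' z = Con C \<phi> V' c \<otimes>\<^bsub>Obj C V'\<^esub> inv\<^bsub>Obj C V'\<^esub> Con C \<phi> V' ?p"
      unfolding z_def using bc pc by simp
    have "Con C \<phi> V' c \<otimes>\<^bsub>Obj C V'\<^esub> inv\<^bsub>Obj C V'\<^esub> c = Con C \<phi> V' ?p \<otimes>\<^bsub>Obj C V'\<^esub> inv\<^bsub>Obj C V'\<^esub> ?p"
      using D'c D'b by (simp add: D'_def)
    then have "Con C \<phi> V' c \<otimes>\<^bsub>Obj C V'\<^esub> ?p = Con C \<phi> V' ?p \<otimes>\<^bsub>Obj C V'\<^esub> c"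
      using bc pc by (simp add: V'.div_eq_iff)
    then show ?thesis unfolding 1 unfolding z_def using bc pc by (simp add: V'.div_eq_iff V'.m_comm)
  qed
  then obtain z0 where z0: "z0 \<in> vker H" "z = Res C V' H z0"
    using exact_Res_image[OF HE open_in_group_self[OF H] H V'Hu \<phi> zv] by blast
  have z0c: "z0 \<in> carrier (Obj C H)" using z0 by (simp add: vker_iff)
  have czp: "c = z \<otimes>\<^bsub>Obj C V'\<^esub> ?p" unfolding z_def using bc pc by (simp add: V'.m_assoc)
  have zc: "z \<in> carrier (Obj C V')" using uV'.mem_carrier[OF zv] .
  have Nu: "Ind C V K u = Ind C V V' c"
    using C.Ind_Ind[OF Vb open_idom[OF Vb KVo] open_idom[OF Kb LKo] wc(1)]
      C.Ind_Ind[OF Vb open_idom[OF Vb V'Vo] open_idom[OF V'b LV'o] wc(1)] by (simp add: w(2) c_def)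
  have Vr: "V \<in> rdom M H" and V'r: "V' \<in> rdom M V" and V'i: "V' \<in> idom M V" and Vi: "V \<in> idom M H"
    using open_rdom[OF H Vo] open_rdom[OF Vb V'Vo] open_idom[OF Vb V'Vo] open_idom[OF H Vo] .
  have rz: "Res C V H z0 \<in> carrier (Obj C V)" by (rule Res_closed[OF H Vr z0c])
  \<comment> \<open>The index is read off from a prime element of C(V): the norm of its restriction
    has a valuation given once by the index and once by the inertia degree. For empty
    \<open>P\<close> exponents cannot be compared, but then [H:U] = 1 and \<open>V'\<close> =
    \<open>V\<close>.\<close>
  have idx: "index G V V' = ?r"
  proof (cases "P = {}")
    case True
    then have "?r = 1" using r P_part_P_number[of P ?r] by (simp add: P_part_def)
    moreover from this have "V' = V" by (simp add: V'_def V_def)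
    ultimately show ?thesis using index_self[OF M_subgroup[OF Vb] is_group] by simp
  next
    case False
    obtain \<pi> where \<pi>: "\<pi> \<in> carrier (Obj C V)" "v V \<pi> = \<omega>" using prime_exists[OF Vb] by (auto simp: prime_elements_def)
    interpret vV: group_hom "Obj C V" \<Omega> "v V" by (rule group_hom_v[OF Vb])
    have in_eq: "inertia G \<Omega> d V' = inertia G \<Omega> d V"
      using V'V inertia_ur_sub[OF H m'] sub(4) by (auto simp: inertia_def V'_def)
    have "v V (Ind C V V' (Res C V' V \<pi>)) = \<omega> [^]\<^bsub>\<Omega>\<^esub> index G V V'"
      unfolding Ind_Res_pow[OF Vb V'r V'i \<pi>(1)] using \<pi> by (simp add: vV.hom_nat_pow)
    moreover have "v V (Ind C V V' (Res C V' V \<pi>)) = \<omega> [^]\<^bsub>\<Omega>\<^esub> (fd V' div fd V)"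
      using v_Ind[OF Vb V'i Res_closed[OF Vb V'r \<pi>(1)]] v_Res_same_inertia[OF Vb V'r \<pi>(1) in_eq] \<pi>(2) by simp
    moreover have "fd V' div fd V = ?r"
      using fd_ur_sub[OF H m(1)] fd_ur_sub[OF H m'] fd_pos[OF H] fd_pos[OF Vb] m(1) r
      by (simp add: V_def V'_def P_part_mult' P_part_P_number)
    ultimately show ?thesis using Om.omega_pow_inj[OF False] by simp
  qed
  have Iz: "Ind C V V' z = Res C V H (z0 [^]\<^bsub>Obj C H\<^esub> ?r)"
  proof -
    interpret R: group_hom "Obj C H" "Obj C V" "Res C V H" by (rule group_hom_Res[OF H Vr])
    have "Ind C V V' z = Res C V H z0 [^]\<^bsub>Obj C V\<^esub> ?r"
      using z0(2) C.Res_Res[OF H Vr V'r z0c] Ind_Res_pow[OF Vb V'r V'i rz] idx by simp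
    then show ?thesis using z0c by (simp add: R.hom_nat_pow)
  qed
  \<comment> \<open>The norm of the power sum is the power sum of \<open>Ind C V L y\<close>, which
    the double coset formula with J = \<open>V\<close> recognises as a restriction from
    \<open>H\<close>.\<close>
  have Ip: "Ind C V V' ?p = Res C V H (Ind C H L y)"
  proof -
    have Ib: "Ind C V V' b = Ind C V L y"
      unfolding b_def using C.Ind_Ind[OF Vb V'i open_idom[OF V'b LV'o] yc] .
    have LVi: "L \<in> idom M V" using M.idom_trans[OF Vb V'i] open_idom[OF V'b LV'o] by blast
    have Iyc: "Ind C V L y \<in> carrier (Obj C V)" by (rule Ind_closed[OF Vb LVi yc])
    have "Res C V H (Ind C H V (Ind C V L y)) = power_sum G C V \<phi> s (Ind C V (V \<inter> V) (Res C (V \<inter> V) V (Ind C V L y)))"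
      by (rule mackey_power_sum[OF H \<phi> Vo Vn _ Vi sP dV _ _ Iyc])
        (use inertia_ur_sub[OF H m(1)] Vn in \<open>simp_all add: V_def\<close>)
    then have "Res C V H (Ind C H L y) = power_sum G C V \<phi> s (Ind C V L y)"
      using C.Ind_Ind[OF H Vi LVi yc] C.Res_id[OF Vb Iyc] C.Ind_id[OF Vb Iyc] by simp
    then show ?thesis using Ind_power_sum[OF H Vb Vn V'b V'n V'i \<phi>H bc(1), of s] Ib by simp
  qed
  have LHi: "L \<in> idom M H" and LUi: "L \<in> idom M U" and Ui: "U \<in> idom M H" and Ur: "U \<in> rdom M H"
    using open_idom[OF H Lo] open_idom[OF Ub LUo] open_idom[OF H U(1)] open_rdom[OF H U(1)] .
  \<comment> \<open>Here the level m [H:U] pays off: \<open>z0\<close> occurs with exponent [H:U],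
    and z0^[H:U] = Ind Res z0 is a norm from \<open>U\<close>. The other factor is induced from
    \<open>L\<close>, which lies in \<open>U\<close>.\<close>
  define X where "X = z0 [^]\<^bsub>Obj C H\<^esub> ?r \<otimes>\<^bsub>Obj C H\<^esub> Ind C H L y"
  have LHc: "Ind C H L y \<in> carrier (Obj C H)" by (rule Ind_closed[OF H LHi yc])
  have "Ind C V K u = Res C V H X"
  proof -
    interpret R: group_hom "Obj C H" "Obj C V" "Res C V H" by (rule group_hom_Res[OF H Vr])
    show ?thesis unfolding Nu czp X_def using zc pc z0c LHc Iz Ip by simp
  qed
  moreover have "X \<in> ind_image C H U"
  proof -
    interpret I: group_hom "Obj C U" "Obj C H" "Ind C H U" by (rule group_hom_Ind[OF H Ui])
    have ru: "Res C U H z0 \<in> carrier (Obj C U)" by (rule Res_closed[OF H Ur z0c])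
    have iy: "Ind C U L y \<in> carrier (Obj C U)" by (rule Ind_closed[OF Ub LUi yc])
    have "X = Ind C H U (Res C U H z0 \<otimes>\<^bsub>Obj C U\<^esub> Ind C U L y)"
      unfolding X_def using ru iy Ind_Res_pow[OF H Ur Ui z0c] C.Ind_Ind[OF H Ui LUi yc] by simp
    then show ?thesis unfolding ind_image_def using ru iy by blast
  qed
  moreover have "X \<in> vker H"
  proof -
    interpret vH: group_hom "Obj C H" \<Omega> "v H" by (rule group_hom_v[OF H])
    have "v H (Ind C H L y) = \<one>\<^bsub>\<Omega>\<^esub>" using v_Ind[OF H LHi yc] y(1) by (simp add: vker_iff)
    then show ?thesis unfolding X_def using z0 z0c LHc by (simp add: vker_iff vH.hom_nat_pow)
  qed
  ultimately show ?thesis by (auto simp: K_def V_def)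
qed

end

section \<open>Multiplicativity of the reciprocity map\<close>

context comm_group
begin

lemma div_mult_div:
  "\<lbrakk>a \<in> carrier G; b \<in> carrier G; c \<in> carrier G; a' \<in> carrier G; b' \<in> carrier G; c' \<in> carrier G\<rbrakk> \<Longrightarrow>
    (a \<otimes> inv (b \<otimes> c)) \<otimes> inv (a' \<otimes> inv (b' \<otimes> c')) =
    (a \<otimes> inv a') \<otimes> inv ((b \<otimes> inv b') \<otimes> (c \<otimes> inv c'))"
  by (simp add: inv_mult m_ac)

text \<open>The pattern of (t1 - 1)(b3 - b1) + (t4 - 1)(t1 b3 - b4) with a = b1, b = b4, c = b3, e =
  t1 b3, x = t1 b1, y = t4 b4 and z = t4 t1 b3; the terms in e cancel.\<close>

lemma div_mult_telescope:
  assumes "a \<in> carrier G" "b \<in> carrier G" "c \<in> carrier G" "e \<in> carrier G"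
    "x \<in> carrier G" "y \<in> carrier G" "z \<in> carrier G"
  shows "((e \<otimes> inv x) \<otimes> inv (c \<otimes> inv a)) \<otimes> ((z \<otimes> inv y) \<otimes> inv (e \<otimes> inv b)) =
    (z \<otimes> inv c) \<otimes> inv ((x \<otimes> inv a) \<otimes> (y \<otimes> inv b))"
proof -
  have l: "((e \<otimes> inv x) \<otimes> inv (c \<otimes> inv a)) \<otimes> ((z \<otimes> inv y) \<otimes> inv (e \<otimes> inv b)) =
      (e \<otimes> a \<otimes> (z \<otimes> b)) \<otimes> inv (x \<otimes> c \<otimes> (y \<otimes> e))"
    using assms by (simp only: div_div div_mult m_closed)
  have r: "(z \<otimes> inv c) \<otimes> inv ((x \<otimes> inv a) \<otimes> (y \<otimes> inv b)) = (z \<otimes> (a \<otimes> b)) \<otimes> inv (c \<otimes> (x \<otimes> y))"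
    using assms by (simp only: div_div div_mult m_closed)
  show ?thesis unfolding l r using assms by (subst div_eq_iff) (simp_all add: m_ac)
qed

end

context fn_setting
begin

lemma open_partD:
  assumes "(H, U) \<in> base (open_part G E)"
  shows "H \<in> base (flat E)" "H \<in> base M" "open_in_group G H U" "normal_in G H U" "(H, U) \<in> base E"
proof -
  show b: "(H, U) \<in> base E" and "open_in_group G H U"
    using assms by (auto simp: open_part_def open_pairs_def)
  show "normal_in G H U" using b spectrum by (auto simp: spectrum_def two_dim_system_def)
  show f: "H \<in> base (flat E)" using b by (force simp: flat_def)
  show "H \<in> base M" using f cover_M by (auto simp: mackey_cover_def subsystem_def)
qed

text \<open>A representative in C(H) of the reciprocity class, with the exponent n as an argument
  for the same reason as in \<open>frob_exp\<close>. Valuations and restrictions of representatives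
  can be compared in C itself, before passing to classes modulo norms.\<close>

definition recip_elem :: "'g set \<Rightarrow> 'g set \<Rightarrow> 'g \<Rightarrow> nat \<Rightarrow> 'c \<Rightarrow> 'c" where
  "recip_elem H U h n \<pi> = Ind C H (frobenius_group G \<Omega> d h U)
    (\<pi> [^]\<^bsub>Obj C (frobenius_group G \<Omega> d h U)\<^esub> P'_part P n)"

lemma frob_exp_mult:
  assumes "H \<in> base M" "frob_exp H h1 n1" "frob_exp H h2 n2"
  shows "frob_exp H (h1 \<otimes> h2) (n1 + n2)"
  using assms M_carrier[OF assms(1)] subgroup.m_closed[OF M_subgroup[OF assms(1)]]
  by (auto simp: frob_exp_def Om.nat_pow_mult distrib_left)

context
  fixes H U
  assumes HU: "(H, U) \<in> base (open_part G E)"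
begin

abbreviation (input) "N \<equiv> ind_image C H U"
abbreviation (input) "\<rho> \<equiv> recip_elem H U"
abbreviation (input) "primes_of h \<equiv> prime_elements \<omega> C v (frobenius_group G \<Omega> d h U)"

lemmas HE = open_partD(1)[OF HU] and H = open_partD(2)[OF HU]
  and U = open_partD(3)[OF HU] open_partD(4)[OF HU]

lemma recip_elem_closed:
  assumes "frob_exp H h n" "\<pi> \<in> primes_of h"
  shows "\<rho> h n \<pi> \<in> carrier (Obj C H)"
proof -
  have \<Sigma>: "\<Sigma> U h \<in> base M" by (rule frobenius_group_base[OF H U assms(1)])
  interpret S: comm_group "Obj C (\<Sigma> U h)" by (rule C_comm[OF \<Sigma>])
  show ?thesis unfolding recip_elem_def
    using assms(2) by (intro Ind_closed[OF H open_idom[OF H open_frobenius_group[OF H U assms(1)]]] S.nat_pow_closed)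
      (simp add: prime_elements_def)
qed

text \<open>The induction contributes the relative inertia degree \<open>P(n)\<close>, the exponent
  of \<pi> contributes \<open>P'(n)\<close>.\<close>

lemma v_recip_elem:
  assumes "frob_exp H h n" "\<pi> \<in> primes_of h"
  shows "v H (\<rho> h n \<pi>) = \<omega> [^]\<^bsub>\<Omega>\<^esub> n"
proof -
  have \<Sigma>: "\<Sigma> U h \<in> base M" by (rule frobenius_group_base[OF H U assms(1)])
  interpret v: group_hom "Obj C (\<Sigma> U h)" \<Omega> "v (\<Sigma> U h)" by (rule group_hom_v[OF \<Sigma>])
  have \<pi>: "\<pi> \<in> carrier (Obj C (\<Sigma> U h))" "v (\<Sigma> U h) \<pi> = \<omega>" using assms(2) by (auto simp: prime_elements_def)
  have "v H (\<rho> h n \<pi>) = (\<omega> [^]\<^bsub>\<Omega>\<^esub> P'_part P n) [^]\<^bsub>\<Omega>\<^esub> (fd (\<Sigma> U h) div fd H)"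
    unfolding recip_elem_def
    using v_Ind[OF H open_idom[OF H open_frobenius_group[OF H U assms(1)]]] \<pi> by (simp add: v.hom_nat_pow)
  also have "fd (\<Sigma> U h) div fd H = P_part P n"
    using fd_frobenius_group[OF H U assms(1)] fd_pos[OF H] by simp
  finally show ?thesis
    using P_part_mult_P'_part[OF n_pos[OF H U assms(1)], of P] by (simp add: Om.nat_pow_pow mult.commute)
qed

text \<open>Because n [H:U] divides m, \<Sigma> meets \<open>ur_sub H m\<close> in \<open>W\<close>,
  and \<open>b\<close> is the restriction of \<pi> to this group. The double coset formula yields a
  power sum with only \<open>P(n)\<close> terms, raised to the power \<open>P'(n)\<close>; these
  combine to length n.\<close>

lemma Res_recip_elem:
  assumes hn: "frob_exp H h n" and \<pi>: "\<pi> \<in> primes_of h"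
    and m: "m > 0" "n * index G H U dvd m" and \<phi>: "frob_exp H \<phi> 1"
  obtains b where "b \<in> carrier (Obj C (W H U m))" "v (W H U m) b = \<omega>" "Con C h (W H U m) b = b"
    "Res C (ur_sub H m) H (\<rho> h n \<pi>) = Ind C (ur_sub H m) (W H U m) (power_sum G C (W H U m) \<phi> n b)"
proof -
  let ?V = "ur_sub H m" and ?W = "W H U m"
  have So: "open_in_group G H (\<Sigma> U h)" by (rule open_frobenius_group[OF H U hn])
  have Sb: "\<Sigma> U h \<in> base M" and Si: "\<Sigma> U h \<in> idom M H" using open_base[OF H So] open_idom[OF H So] .
  note Vo = open_ur_sub[OF H m(1)] and Vb = ur_sub_base[OF H m(1)] and Vn = normal_ur_sub[OF H m(1)]
  note Wo = open_W[OF H U m(1)] and Wb = W_base[OF H U m(1)] and Wn = W_normal[OF H U m(1)]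
  obtain k where mk: "m = n * index G H U * k" using m(2) by (auto elim: dvdE)
  have VS: "?V \<inter> \<Sigma> U h = ?W" using frobenius_group_Int_ur_sub[OF H U hn, of k] m(1) mk by simp
  then have WS: "?W \<subseteq> \<Sigma> U h" by blast
  have SH: "\<Sigma> U h \<subseteq> H" by (rule frobenius_group_subset_H[OF H U hn])
  have WSo: "open_in_group G (\<Sigma> U h) ?W" by (rule open_in_group_subset[OF Wo WS SH])
  have WVo: "open_in_group G ?V ?W" by (rule open_in_group_subset[OF Wo _ ur_sub_subset[OF H m(1)]]) simp
  have WSr: "?W \<in> rdom M (\<Sigma> U h)" by (rule open_rdom[OF Sb WSo])
  have WVi: "?W \<in> idom M ?V" by (rule open_idom[OF Vb WVo])
  have \<pi>c: "\<pi> \<in> carrier (Obj C (\<Sigma> U h))" "v (\<Sigma> U h) \<pi> = \<omega>" using \<pi> by (auto simp: prime_elements_def)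
  define b where "b = Res C ?W (\<Sigma> U h) \<pi>"
  have bc: "b \<in> carrier (Obj C ?W)" unfolding b_def by (rule Res_closed[OF Sb WSr \<pi>c(1)])
  have vb: "v ?W b = \<omega>" unfolding b_def
    using v_Res_same_inertia[OF Sb WSr \<pi>c(1)] inertia_W[OF H U m(1)] inertia_frobenius_group[OF H U hn] \<pi>c(2) by simp
  have hH: "h \<in> H" by (rule h_in[OF H U hn])
  have inv: "Con C s ?W b = b" if "s \<in> \<Sigma> U h" for s
    unfolding b_def by (rule act_Res[OF H Wb Wn Sb WSr _ that \<pi>c(1)]) (use that SH in blast)
  have hb: "Con C h ?W b = b" by (rule inv[OF h_in_frobenius_group[OF H U hn]])
  have \<phi>H: "\<phi> \<in> H" and d\<phi>: "d \<phi> = \<omega> [^]\<^bsub>\<Omega>\<^esub> fd H" using \<phi> by (auto simp: frob_exp_def)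
  have n0: "n > 0" by (rule n_pos[OF H U hn])
  let ?s = "P_part P n" and ?e = "P'_part P n"
  have sP: "P_number P ?s" using P_number_P_part[of P n] primes n0 by blast
  have dS: "d ` \<Sigma> U h = pow_image \<Omega> (fd H * ?s)"
    using d_image[OF Sb] fd_frobenius_group[OF H U hn] by simp
  have dVS: "d ` ?V \<subseteq> d ` \<Sigma> U h"
    unfolding d_ur_sub[OF H] d_frobenius_group[OF H U hn]
    using Om.pow_image_mult_subset[of "fd H * n" "index G H U * k"] by (simp add: mk mult.assoc)
  interpret S: comm_group "Obj C (\<Sigma> U h)" by (rule C_comm[OF Sb])
  interpret V: comm_group "Obj C ?V" by (rule C_comm[OF Vb])
  interpret RS: group_hom "Obj C (\<Sigma> U h)" "Obj C ?W" "Res C ?W (\<Sigma> U h)" by (rule group_hom_Res[OF Sb WSr])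
  interpret IW: group_hom "Obj C ?W" "Obj C ?V" "Ind C ?V ?W" by (rule group_hom_Ind[OF Vb WVi])
  define c where "c = Ind C ?V ?W b"
  have cc: "c \<in> carrier (Obj C ?V)" unfolding c_def using bc by simp
  have "Res C ?V H (\<rho> h n \<pi>) = power_sum G C ?V \<phi> ?s
      (Ind C ?V (?V \<inter> \<Sigma> U h) (Res C (?V \<inter> \<Sigma> U h) (\<Sigma> U h) (\<pi> [^]\<^bsub>Obj C (\<Sigma> U h)\<^esub> ?e)))"
    unfolding recip_elem_def
    by (rule mackey_power_sum[OF H \<phi> Vo Vn inertia_ur_sub[OF H m(1)] Si sP dS dVS])
      (use VS Wn \<pi>c(1) in simp_all)
  also have "\<dots> = power_sum G C ?V \<phi> ?s (c [^]\<^bsub>Obj C ?V\<^esub> ?e)"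
    using VS \<pi>c(1) by (simp add: RS.hom_nat_pow IW.hom_nat_pow b_def c_def)
  also have "\<dots> = power_sum G C ?V \<phi> ?s c [^]\<^bsub>Obj C ?V\<^esub> ?e"
    by (rule power_sum_pow[OF H Vb Vn \<phi>H cc])
  \<comment> \<open>d(\<phi>^P(n)) lies in d(\<Sigma>), so modulo inertia \<phi>^P(n) agrees with an
    element of \<Sigma>; such an element fixes \<open>b\<close> and hence its norm
    \<open>c\<close>.\<close>
  also have "\<dots> = power_sum G C ?V \<phi> (?s * ?e) c"
  proof (rule power_sum_mult[OF H Vb Vn \<phi>H cc, symmetric])
    have \<phi>c: "\<phi> \<in> carrier G" using M_carrier[OF H \<phi>H] .
    have ps: "\<phi> [^] ?s \<in> H" by (rule phi_pow_in[OF H Vb Vn \<phi>H])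
    have "d (\<phi> [^] ?s) = \<omega> [^]\<^bsub>\<Omega>\<^esub> (fd H * ?s)" using \<phi>c by (simp add: d_pow d\<phi> Om.nat_pow_pow)
    also have "\<dots> = (\<omega> [^]\<^bsub>\<Omega>\<^esub> (1::nat)) [^]\<^bsub>\<Omega>\<^esub> (fd H * ?s)" by simp
    finally have "d (\<phi> [^] ?s) \<in> d ` \<Sigma> U h" unfolding dS by (auto simp: pow_image_def)
    then obtain s where s: "s \<in> \<Sigma> U h" "d (\<phi> [^] ?s) = d s" by blast
    have sH: "s \<in> H" and sc: "s \<in> carrier G" using s SH M_carrier[OF H] by auto
    have "\<phi> [^] ?s \<otimes> inv s \<in> inertia G \<Omega> d H"
      unfolding in_inertia_iff[OF H]
      using ps sH sc s(2) \<phi>c M_subgroup[OF H]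
      by (simp add: subgroup.m_closed subgroup.m_inv_closed del: d.hom_nat_pow)
    then have "\<phi> [^] ?s \<otimes> inv s \<in> ?V" using inertia_ur_sub[OF H m(1)] by blast
    then have "Con C (\<phi> [^] ?s) ?V c = Con C s ?V c" by (rule act_eqI[OF H Vb Vn ps sH _ cc])
    also have "\<dots> = c" unfolding c_def using act_Ind[OF H Vb Vn Wb Wn WVi sH bc] inv[OF s(1)] by simp
    finally show "Con C (\<phi> [^] ?s) ?V c = c" .
  qed
  also have "?s * ?e = n" by (rule P_part_mult_P'_part[OF n0])
  also have "power_sum G C ?V \<phi> n c = Ind C ?V ?W (power_sum G C ?W \<phi> n b)"
    unfolding c_def by (rule Ind_power_sum[OF H Vb Vn Wb Wn WVi \<phi>H bc, symmetric])
  finally show ?thesis using that bc vb hb by blast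
qed

text \<open>Write \<open>b\<^sub>i\<close> for the restriction of the prime element \<open>\<pi>\<^sub>i\<close>, \<open>[n] = 1 + \<phi> + \<dots> + \<phi>\<^bsup>n-1\<^esup>\<close>,
  \<open>n\<^sub>3 = n\<^sub>1 + n\<^sub>2\<close>, \<open>h\<^sub>3 = h\<^sub>1 h\<^sub>2\<close>, let \<open>h\<^sub>4, b\<^sub>4\<close> be the conjugates of \<open>h\<^sub>2, b\<^sub>2\<close> under \<open>\<phi>\<^bsup>n\<^sub>1\<^esup>\<close>, with \<open>n\<^sub>4 = n\<^sub>2\<close>, and
  put \<open>t\<^sub>i = \<phi>\<^bsup>n\<^sub>i\<^esup> h\<^sub>i\<^bsup>-1\<^esup>\<close>. These \<open>t\<^sub>i\<close> are inertial with \<open>t\<^sub>3 = t\<^sub>4 t\<^sub>1\<close>, and since \<open>h\<^sub>i\<close> fixes \<open>b\<^sub>i\<close>, the unit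
  \<open>u = [n\<^sub>3] b\<^sub>3 - [n\<^sub>1] b\<^sub>1 - [n\<^sub>2] b\<^sub>4\<close> satisfies (additively)
  \<open>(\<phi> - 1) u = (t\<^sub>1 - 1)(b\<^sub>3 - b\<^sub>1) + (t\<^sub>4 - 1)(t\<^sub>1 b\<^sub>3 - b\<^sub>4)\<close>.\<close>

lemma recip_elem_mult:
  assumes h1: "frob_exp H h1 n1" and h2: "frob_exp H h2 n2"
    and \<pi>: "\<pi>1 \<in> primes_of h1" "\<pi>2 \<in> primes_of h2" "\<pi>3 \<in> primes_of (h1 \<otimes> h2)"
  shows "\<exists>X \<in> N. \<rho> (h1 \<otimes> h2) (n1 + n2) \<pi>3 = \<rho> h1 n1 \<pi>1 \<otimes>\<^bsub>Obj C H\<^esub> \<rho> h2 n2 \<pi>2 \<otimes>\<^bsub>Obj C H\<^esub> X"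
proof -
  let ?r = "index G H U"
  \<comment> \<open>A common multiple of the three numbers n_i [H:U] brings all three values to the
    same level.\<close>
  define m where "m = n1 * n2 * (n1 + n2) * ?r"
  have n0: "n1 > 0" "n2 > 0" using n_pos[OF H U] h1 h2 by auto
  have m: "m > 0" "n1 * ?r dvd m" "n2 * ?r dvd m" "(n1 + n2) * ?r dvd m" "?r dvd m"
    using n0 index_pos[OF H U] by (auto simp: m_def)
  let ?V = "ur_sub H m" and ?W = "W H U m"
  note Vo = open_ur_sub[OF H m(1)] and Vb = ur_sub_base[OF H m(1)] and Vn = normal_ur_sub[OF H m(1)]
  note Wo = open_W[OF H U m(1)] and Wb = W_base[OF H U m(1)] and Wn = W_normal[OF H U m(1)]
  have WVo: "open_in_group G ?V ?W" by (rule open_in_group_subset[OF Wo _ ur_sub_subset[OF H m(1)]]) simp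
  have WVi: "?W \<in> idom M ?V" by (rule open_idom[OF Vb WVo])
  have Vr: "?V \<in> rdom M H" by (rule open_rdom[OF H Vo])
  obtain \<phi> where \<phi>: "frob_exp H \<phi> 1" using frobenius_exists[OF H] .
  have \<phi>H: "\<phi> \<in> H" and d\<phi>: "d \<phi> = \<omega> [^]\<^bsub>\<Omega>\<^esub> fd H" using \<phi> by (auto simp: frob_exp_def)
  have \<phi>c: "\<phi> \<in> carrier G" using M_carrier[OF H \<phi>H] .
  note h3 = frob_exp_mult[OF H h1 h2]
  obtain b1 where b1: "b1 \<in> carrier (Obj C ?W)" "v ?W b1 = \<omega>" "Con C h1 ?W b1 = b1"
    "Res C ?V H (\<rho> h1 n1 \<pi>1) = Ind C ?V ?W (power_sum G C ?W \<phi> n1 b1)"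
    by (rule Res_recip_elem[OF h1 \<pi>(1) m(1,2) \<phi>])
  obtain b2 where b2: "b2 \<in> carrier (Obj C ?W)" "v ?W b2 = \<omega>" "Con C h2 ?W b2 = b2"
    "Res C ?V H (\<rho> h2 n2 \<pi>2) = Ind C ?V ?W (power_sum G C ?W \<phi> n2 b2)"
    by (rule Res_recip_elem[OF h2 \<pi>(2) m(1,3) \<phi>])
  obtain b3 where b3: "b3 \<in> carrier (Obj C ?W)" "v ?W b3 = \<omega>" "Con C (h1 \<otimes> h2) ?W b3 = b3"
    "Res C ?V H (\<rho> (h1 \<otimes> h2) (n1 + n2) \<pi>3) = Ind C ?V ?W (power_sum G C ?W \<phi> (n1 + n2) b3)"
    by (rule Res_recip_elem[OF h3 \<pi>(3) m(1,4) \<phi>])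
  have hH: "h1 \<in> H" "h2 \<in> H" "h1 \<otimes> h2 \<in> H" using h1 h2 h3 by (auto simp: frob_exp_def)
  have hc: "h1 \<in> carrier G" "h2 \<in> carrier G" using hH M_carrier[OF H] by auto
  interpret HH: subgroup H G by (rule M_subgroup[OF H])
  interpret W: comm_group "Obj C ?W" by (rule C_comm[OF Wb])
  interpret V: comm_group "Obj C ?V" by (rule C_comm[OF Vb])
  interpret CH: comm_group "Obj C H" by (rule C_comm[OF H])
  interpret I: group_hom "Obj C ?W" "Obj C ?V" "Ind C ?V ?W" by (rule group_hom_Ind[OF Vb WVi])
  interpret R: group_hom "Obj C H" "Obj C ?V" "Res C ?V H" by (rule group_hom_Res[OF H Vr])
  interpret vW: group_hom "Obj C ?W" \<Omega> "v ?W" by (rule group_hom_v[OF Wb])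
  interpret vH: group_hom "Obj C H" \<Omega> "v H" by (rule group_hom_v[OF H])
  interpret a: group_hom "Obj C ?W" "Obj C ?W" "Con C \<phi> ?W" by (rule group_hom_act[OF H Wb Wn \<phi>H])
  let ?a = "\<lambda>g x. Con C g ?W x"
  note aa = act_act[OF H Wb Wn] and ac = act_closed[OF H Wb Wn]
  let ?p1 = "\<phi> [^] n1" and ?p2 = "\<phi> [^] n2"
  have pH: "?p1 \<in> H" "?p2 \<in> H" "\<phi> [^] (n1 + n2) \<in> H" using phi_pow_in[OF H Wb Wn \<phi>H] by auto
  have pc: "?p1 \<in> carrier G" "?p2 \<in> carrier G" using \<phi>c by auto
  \<comment> \<open>In \<phi>^(n1+n2) h2^-1 h1^-1 the factors are in the wrong order for a product
    of inertial elements; conjugating h2 by \<phi>^n1 moves \<phi>^n1 next to h1^-1 and yields t4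
    t1.\<close>
  define b4 where "b4 = ?a ?p1 b2"
  define h4 where "h4 = ?p1 \<otimes> h2 \<otimes> inv ?p1"
  have h4H: "h4 \<in> H" unfolding h4_def using pH hH by simp
  have h4c: "h4 \<in> carrier G" using M_carrier[OF H h4H] .
  have b4: "b4 \<in> carrier (Obj C ?W)" "v ?W b4 = \<omega>" "?a h4 b4 = b4"
  proof -
    show "b4 \<in> carrier (Obj C ?W)" unfolding b4_def by (rule ac[OF pH(1) b2(1)])
    show "v ?W b4 = \<omega>" unfolding b4_def using v_act[OF H Wb Wn pH(1) b2(1)] b2(2) by simp
    have "h4 \<otimes> ?p1 = ?p1 \<otimes> h2" unfolding h4_def using pc hc by (simp add: m_assoc)
    then show "?a h4 b4 = b4" unfolding b4_def
      using aa[OF h4H pH(1) b2(1)] aa[OF pH(1) hH(2) b2(1)] b2(3) by simp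
  qed
  define t1 where "t1 = ?p1 \<otimes> inv h1"
  define t4 where "t4 = ?p2 \<otimes> inv h4"
  have tH: "t1 \<in> H" "t4 \<in> H" unfolding t1_def t4_def using pH hH h4H by simp_all
  have dp: "d (\<phi> [^] (i::nat)) = \<omega> [^]\<^bsub>\<Omega>\<^esub> (fd H * i)" for i
    using \<phi>c by (simp add: d_pow d\<phi> Om.nat_pow_pow)
  have "d h4 = d h2" unfolding h4_def by (rule d_conj[OF pc(1) hc(2)])
  then have t: "t1 \<in> inertia G \<Omega> d H" "t4 \<in> inertia G \<Omega> d H"
    unfolding in_inertia_iff[OF H] using tH h1 h2 pc hc h4c dp[of n1] dp[of n2]
    by (simp_all add: t1_def t4_def frob_exp_def del: d.hom_nat_pow)
  have e1: "?a ?p1 b1 = ?a t1 b1"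
    using aa[OF tH(1) hH(1) b1(1)] b1(3) pc hc by (simp add: t1_def m_assoc)
  have e4: "?a ?p2 b4 = ?a t4 b4"
    using aa[OF tH(2) h4H b4(1)] b4(3) pc h4c by (simp add: t4_def m_assoc)
  have "t4 \<otimes> t1 \<otimes> (h1 \<otimes> h2) = ?p2 \<otimes> ?p1"
    unfolding t4_def t1_def h4_def using pc hc by (simp add: group_norm)
  then have "t4 \<otimes> t1 \<otimes> (h1 \<otimes> h2) = \<phi> [^] (n1 + n2)" using \<phi>c by (simp add: nat_pow_mult add.commute)
  then have e3: "?a (\<phi> [^] (n1 + n2)) b3 = ?a t4 (?a t1 b3)"
    using aa[OF _ hH(3) b3(1), of "t4 \<otimes> t1"] aa[OF tH(2,1) b3(1)] b3(3) tH by simp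
  let ?ps = "\<lambda>n b. power_sum G C ?W \<phi> n b"
  define Q1 Q3 Q4 where "Q1 = ?ps n1 b1" and "Q3 = ?ps (n1 + n2) b3" and "Q4 = ?ps n2 b4"
  note psc = power_sum_closed[OF H Wb Wn \<phi>H]
  have Qc: "Q1 \<in> carrier (Obj C ?W)" "Q3 \<in> carrier (Obj C ?W)" "Q4 \<in> carrier (Obj C ?W)"
    unfolding Q1_def Q3_def Q4_def using psc b1(1) b3(1) b4(1) by auto
  define u where "u = Q3 \<otimes>\<^bsub>Obj C ?W\<^esub> inv\<^bsub>Obj C ?W\<^esub> (Q1 \<otimes>\<^bsub>Obj C ?W\<^esub> Q4)"
  define u1 where "u1 = b3 \<otimes>\<^bsub>Obj C ?W\<^esub> inv\<^bsub>Obj C ?W\<^esub> b1"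
  define u2 where "u2 = ?a t1 b3 \<otimes>\<^bsub>Obj C ?W\<^esub> inv\<^bsub>Obj C ?W\<^esub> b4"
  have atc: "?a t1 b3 \<in> carrier (Obj C ?W)" "?a t1 b1 \<in> carrier (Obj C ?W)" "?a t4 b4 \<in> carrier (Obj C ?W)"
    "?a t4 (?a t1 b3) \<in> carrier (Obj C ?W)"
    using ac tH b1(1) b3(1) b4(1) by auto
  have uv: "u \<in> vker ?W" "u1 \<in> vker ?W" "u2 \<in> vker ?W"
  proof -
    have "v ?W Q1 = \<omega> [^]\<^bsub>\<Omega>\<^esub> n1" "v ?W Q3 = \<omega> [^]\<^bsub>\<Omega>\<^esub> (n1 + n2)" "v ?W Q4 = \<omega> [^]\<^bsub>\<Omega>\<^esub> n2"
      unfolding Q1_def Q3_def Q4_def using v_power_sum[OF H Wb Wn \<phi>H] b1 b3 b4 by auto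
    then show "u \<in> vker ?W" unfolding vker_iff u_def using Qc by (simp add: Om.nat_pow_mult)
    show "u1 \<in> vker ?W" unfolding vker_iff u1_def using b1 b3 by simp
    show "u2 \<in> vker ?W" unfolding vker_iff u2_def
      using b4 atc b3 v_act[OF H Wb Wn tH(1) b3(1)] by simp
  qed
  have eq: "?a \<phi> u \<otimes>\<^bsub>Obj C ?W\<^esub> inv\<^bsub>Obj C ?W\<^esub> u =
      (?a t1 u1 \<otimes>\<^bsub>Obj C ?W\<^esub> inv\<^bsub>Obj C ?W\<^esub> u1) \<otimes>\<^bsub>Obj C ?W\<^esub>
      (?a t4 u2 \<otimes>\<^bsub>Obj C ?W\<^esub> inv\<^bsub>Obj C ?W\<^esub> u2)"
  proof -
    interpret a1: group_hom "Obj C ?W" "Obj C ?W" "Con C t1 ?W" by (rule group_hom_act[OF H Wb Wn tH(1)])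
    interpret a4: group_hom "Obj C ?W" "Obj C ?W" "Con C t4 ?W" by (rule group_hom_act[OF H Wb Wn tH(2)])
    have aQ: "?a \<phi> Q1 \<in> carrier (Obj C ?W)" "?a \<phi> Q3 \<in> carrier (Obj C ?W)" "?a \<phi> Q4 \<in> carrier (Obj C ?W)"
      using Qc by simp_all
    have "?a \<phi> u = ?a \<phi> Q3 \<otimes>\<^bsub>Obj C ?W\<^esub> inv\<^bsub>Obj C ?W\<^esub> (?a \<phi> Q1 \<otimes>\<^bsub>Obj C ?W\<^esub> ?a \<phi> Q4)"
      unfolding u_def using Qc by simp
    then have l: "?a \<phi> u \<otimes>\<^bsub>Obj C ?W\<^esub> inv\<^bsub>Obj C ?W\<^esub> u =
        (?a \<phi> Q3 \<otimes>\<^bsub>Obj C ?W\<^esub> inv\<^bsub>Obj C ?W\<^esub> Q3) \<otimes>\<^bsub>Obj C ?W\<^esub> inv\<^bsub>Obj C ?W\<^esub>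
        ((?a \<phi> Q1 \<otimes>\<^bsub>Obj C ?W\<^esub> inv\<^bsub>Obj C ?W\<^esub> Q1) \<otimes>\<^bsub>Obj C ?W\<^esub> (?a \<phi> Q4 \<otimes>\<^bsub>Obj C ?W\<^esub> inv\<^bsub>Obj C ?W\<^esub> Q4))"
      unfolding u_def by (simp only: W.div_mult_div[OF aQ(2,1,3) Qc(2,1,3)])
    note dv = act_power_sum_div[OF H Wb Wn \<phi>H]
    have r: "(?a t1 u1 \<otimes>\<^bsub>Obj C ?W\<^esub> inv\<^bsub>Obj C ?W\<^esub> u1) \<otimes>\<^bsub>Obj C ?W\<^esub>
      (?a t4 u2 \<otimes>\<^bsub>Obj C ?W\<^esub> inv\<^bsub>Obj C ?W\<^esub> u2) =
      (?a t4 (?a t1 b3) \<otimes>\<^bsub>Obj C ?W\<^esub> inv\<^bsub>Obj C ?W\<^esub> b3) \<otimes>\<^bsub>Obj C ?W\<^esub> inv\<^bsub>Obj C ?W\<^esub>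
      ((?a t1 b1 \<otimes>\<^bsub>Obj C ?W\<^esub> inv\<^bsub>Obj C ?W\<^esub> b1) \<otimes>\<^bsub>Obj C ?W\<^esub> (?a t4 b4 \<otimes>\<^bsub>Obj C ?W\<^esub> inv\<^bsub>Obj C ?W\<^esub> b4))"
    proof -
      have "?a t1 u1 = ?a t1 b3 \<otimes>\<^bsub>Obj C ?W\<^esub> inv\<^bsub>Obj C ?W\<^esub> ?a t1 b1" unfolding u1_def using b1(1) b3(1) by simp
      moreover have "?a t4 u2 = ?a t4 (?a t1 b3) \<otimes>\<^bsub>Obj C ?W\<^esub> inv\<^bsub>Obj C ?W\<^esub> ?a t4 b4"
        unfolding u2_def using b4(1) atc by simp
      ultimately show ?thesis
        unfolding u1_def u2_def by (simp only: W.div_mult_telescope[OF b1(1) b4(1) b3(1) atc(1,2,3,4)])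
    qed
    show ?thesis unfolding l r unfolding Q1_def Q3_def Q4_def dv[OF b1(1)] dv[OF b3(1)] dv[OF b4(1)] e1 e3 e4 ..
  qed
  obtain X where X: "X \<in> N" "X \<in> vker H" "Ind C ?V ?W u = Res C ?V H X"
    using norm_of_unit_in_ind_image[OF HE H U m(1) m(5) \<phi> uv t eq] by blast
  have rc: "\<rho> h1 n1 \<pi>1 \<in> carrier (Obj C H)" "\<rho> h2 n2 \<pi>2 \<in> carrier (Obj C H)" "\<rho> (h1 \<otimes> h2) (n1 + n2) \<pi>3 \<in> carrier (Obj C H)"
    using recip_elem_closed h1 h2 h3 \<pi> by auto
  have Xc: "X \<in> carrier (Obj C H)" "v H X = \<one>\<^bsub>\<Omega>\<^esub>" using X(2) by (auto simp: vker_iff)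
  \<comment> \<open>Passing from \<open>b2\<close> to \<open>b4\<close> is harmless: conjugation by
    an element of \<open>H\<close> does not change a restriction from \<open>H\<close>.\<close>
  have IQ4: "Ind C ?V ?W Q4 = Res C ?V H (\<rho> h2 n2 \<pi>2)"
  proof -
    have "Q4 = ?a ?p1 (?ps n2 b2)" unfolding Q4_def b4_def
      by (rule act_commute_power_sum[OF H Wb Wn \<phi>H b2(1), symmetric])
    then have "Ind C ?V ?W Q4 = Con C ?p1 ?V (Ind C ?V ?W (?ps n2 b2))"
      using act_Ind[OF H Vb Vn Wb Wn WVi pH(1) psc[OF b2(1)]] by simp
    then show ?thesis unfolding b2(4)[symmetric] using act_Res[OF H Vb Vn H Vr pH(1) pH(1) rc(2)] by simp
  qed
  \<comment> \<open>\<open>Y\<close> is the defect of the asserted identity. It is a unit since the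
    valuations agree, and its restriction to level m is trivial, so it is one.\<close>
  define Y where "Y = \<rho> (h1 \<otimes> h2) (n1 + n2) \<pi>3 \<otimes>\<^bsub>Obj C H\<^esub> inv\<^bsub>Obj C H\<^esub> (\<rho> h1 n1 \<pi>1 \<otimes>\<^bsub>Obj C H\<^esub> \<rho> h2 n2 \<pi>2 \<otimes>\<^bsub>Obj C H\<^esub> X)"
  have "v H Y = \<one>\<^bsub>\<Omega>\<^esub>"
    unfolding Y_def using rc Xc v_recip_elem[OF h1 \<pi>(1)] v_recip_elem[OF h2 \<pi>(2)] v_recip_elem[OF h3 \<pi>(3)]
    by (simp add: Om.nat_pow_mult)
  then have Yv: "Y \<in> vker H" using rc Xc by (simp add: vker_iff Y_def)
  have "Ind C ?V ?W u = Ind C ?V ?W Q3 \<otimes>\<^bsub>Obj C ?V\<^esub> inv\<^bsub>Obj C ?V\<^esub> (Ind C ?V ?W Q1 \<otimes>\<^bsub>Obj C ?V\<^esub> Ind C ?V ?W Q4)"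
    unfolding u_def using Qc by simp
  then have RX: "Res C ?V H X = Res C ?V H (\<rho> (h1 \<otimes> h2) (n1 + n2) \<pi>3) \<otimes>\<^bsub>Obj C ?V\<^esub> inv\<^bsub>Obj C ?V\<^esub>
      (Res C ?V H (\<rho> h1 n1 \<pi>1) \<otimes>\<^bsub>Obj C ?V\<^esub> Res C ?V H (\<rho> h2 n2 \<pi>2))"
    unfolding X(3)[symmetric] b1(4) b3(4) IQ4[symmetric] Q1_def Q3_def .
  have "Res C ?V H Y = \<one>\<^bsub>Obj C ?V\<^esub>"
  proof -
    note Rc = R.hom_closed[OF rc(1)] R.hom_closed[OF rc(2)] R.hom_closed[OF rc(3)] R.hom_closed[OF Xc(1)]
    have "Res C ?V H (\<rho> h1 n1 \<pi>1) \<otimes>\<^bsub>Obj C ?V\<^esub> Res C ?V H (\<rho> h2 n2 \<pi>2) \<otimes>\<^bsub>Obj C ?V\<^esub> Res C ?V H X = Res C ?V H (\<rho> (h1 \<otimes> h2) (n1 + n2) \<pi>3)"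
      unfolding RX V.m_comm[OF Rc(3) V.inv_closed[OF V.m_closed[OF Rc(1,2)]]]
      by (rule V.mult_inv_cancel[OF V.m_closed[OF Rc(1,2)] Rc(3)])
    then show ?thesis unfolding Y_def using rc Xc(1) Rc by (simp add: V.div_eq_one_iff)
  qed
  moreover have "?V \<in> unramified G \<Omega> d H"
    using Vo Vn inertia_ur_sub[OF H m(1)] by (simp add: unramified_def)
  ultimately have "Y = \<one>\<^bsub>Obj C H\<^esub>"
    using exact_Res_inj[OF HE open_in_group_self[OF H] H _ \<phi> Yv] by blast
  then have "\<rho> (h1 \<otimes> h2) (n1 + n2) \<pi>3 = \<rho> h1 n1 \<pi>1 \<otimes>\<^bsub>Obj C H\<^esub> \<rho> h2 n2 \<pi>2 \<otimes>\<^bsub>Obj C H\<^esub> X"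
    unfolding Y_def using rc Xc(1) by (simp add: CH.div_eq_one_iff)
  then show ?thesis using X(1) by blast
qed

end

end

section \<open>Discrete groups, their quotients and abelianizations\<close>

lemma with_topology_simps [simp]:
  "carrier (with_topology A T) = carrier A" "monoid.mult (with_topology A T) = monoid.mult A"
  "one (with_topology A T) = one A" "topo (with_topology A T) = T"
  by (simp_all add: with_topology_def)

lemma group_with_topology: "group A \<Longrightarrow> group (with_topology A T)"
  by (rule groupI) (auto intro: group.l_inv_ex simp: group.is_monoid monoid.m_assoc monoid.m_closed monoid.l_one)

lemma comm_group_with_topology: "comm_group A \<Longrightarrow> comm_group (with_topology A T)"
  by (rule group.group_comm_groupI[OF group_with_topology])
    (auto simp: comm_group_def comm_monoid.m_comm)

definition discrete_group :: "'a tgroup \<Rightarrow> bool" where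
  "discrete_group Q \<longleftrightarrow> group Q \<and> topo Q = discrete_topology (carrier Q)"

lemma topological_group_discrete: "discrete_group Q \<Longrightarrow> topological_group Q"
  unfolding discrete_group_def
  by (auto intro!: topological_group.intro topological_group_axioms.intro
      simp: group.is_monoid monoid.m_closed group.inv_closed simp flip: prod_topology_discrete_topology)

lemma discrete_discrete_tgroup: "group A \<Longrightarrow> discrete_group (discrete_tgroup A)"
  by (simp add: discrete_group_def discrete_tgroup_def group_with_topology)

lemma tgroup_hom_discrete:
  "\<lbrakk>discrete_group A; discrete_group B\<rbrakk> \<Longrightarrow> f \<in> tgroup_hom A B \<longleftrightarrow> f \<in> hom A B"
  by (auto simp: tgroup_hom_def discrete_group_def hom_def)

lemma group_cong_tgroup:
  assumes "group A" "carrier B = carrier A" "monoid.mult B = monoid.mult A" "one B = one A"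
  shows "group B"
  by (rule groupI) (use assms in \<open>auto intro: group.l_inv_ex simp: group.is_monoid monoid.m_assoc monoid.m_closed monoid.l_one\<close>)

lemma discrete_tquotient:
  assumes Q: "discrete_group Q" and N: "normal N Q"
  shows "discrete_group (tquotient Q N)"
proof -
  interpret N: normal N Q by fact
  have "openin (quotient_topology (topo Q) (\<lambda>x. N #>\<^bsub>Q\<^esub> x)) {X}" if "X \<in> carrier (Q Mod N)" for X
    using that Q by (auto simp: openin_quotient_topology discrete_group_def carrier_FactGroup)
  moreover have "topspace (quotient_topology (topo Q) (\<lambda>x. N #>\<^bsub>Q\<^esub> x)) = carrier (Q Mod N)"
    using quotient_map_quotient_topology[of "topo Q" "\<lambda>x. N #>\<^bsub>Q\<^esub> x"] Q
    by (simp add: quotient_map_def discrete_group_def carrier_FactGroup)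
  ultimately have "quotient_topology (topo Q) (\<lambda>x. N #>\<^bsub>Q\<^esub> x) = discrete_topology (carrier (Q Mod N))"
    using discrete_topology_unique by metis
  then show ?thesis
    using group_with_topology[OF N.factorgroup_is_group]
    by (simp add: discrete_group_def tquotient_def)
qed

lemma (in group_hom) derived_subset_kernel:
  assumes "comm_group H"
  shows "derived G (carrier G) \<subseteq> kernel G H h"
proof -
  interpret CH: comm_group H by fact
  have "h (x \<otimes> y \<otimes> inv x \<otimes> inv y) = \<one>\<^bsub>H\<^esub>" if "x \<in> carrier G" "y \<in> carrier G" for x y
    using that CH.m_comm[of "h x" "h y"] by (simp add: H.m_assoc H.mult_inv_cancel)
  then have "(\<Union>x\<in>carrier G. \<Union>y\<in>carrier G. {x \<otimes> y \<otimes> inv x \<otimes> inv y}) \<subseteq> kernel G H h"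
    by (auto simp: kernel_def)
  then show ?thesis
    unfolding derived_def using G.generate_subgroup_incl subgroup_kernel by blast
qed

text \<open>This justifies definitions that pick an arbitrary representative of a class in the
  abelianization: homomorphisms to commutative groups do not depend on it.\<close>

lemma (in group_hom) eq_on_r_coset_derived:
  assumes "comm_group H" "c \<in> carrier G" "c' \<in> derived G (carrier G) #> c"
  shows "h c' = h c"
proof -
  obtain x where "x \<in> derived G (carrier G)" "c' = x \<otimes> c"
    using assms(3) unfolding r_coset_def by blast
  then show ?thesis using derived_subset_kernel[OF assms(1)] assms(2) by (auto simp: kernel_def)
qed

locale discrete_tgroup_loc = group Q for Q :: "'q tgroup" (structure) +
  assumes discrete: "discrete_group Q"
begin

abbreviation "D \<equiv> closed_commutator Q"
abbreviation "A \<equiv> abelianization Q"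

lemma closed_commutator_eq: "D = derived Q (carrier Q)"
proof -
  have "derived Q (carrier Q) \<subseteq> carrier Q" using derived_in_carrier by blast
  then show ?thesis using discrete by (simp add: closed_commutator_def discrete_group_def discrete_topology_closure_of Int_absorb1 inf.absorb2)
qed

lemma normal_D: "D \<lhd> Q"
  unfolding closed_commutator_eq by (rule derived_self_is_normal)

lemma discrete_A: "discrete_group A"
  unfolding abelianization_def by (rule discrete_tquotient[OF discrete normal_D])

lemma comm_group_A: "comm_group A"
  unfolding abelianization_def tquotient_def
  by (rule comm_group_with_topology) (simp add: closed_commutator_eq derived_quot_is_comm_group)

lemma carrier_A: "carrier A = (\<lambda>c. D #> c) ` carrier Q"
  by (simp add: abelianization_def tquotient_def carrier_FactGroup)

lemma class_closed: "c \<in> carrier Q \<Longrightarrow> D #> c \<in> carrier A"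
  by (simp add: carrier_A)

lemma class_mult: "c \<in> carrier Q \<Longrightarrow> c' \<in> carrier Q \<Longrightarrow> D #> (c \<otimes> c') = (D #> c) \<otimes>\<^bsub>A\<^esub> (D #> c')"
  using normal.rcos_sum[OF normal_D] by (simp add: abelianization_def tquotient_def)

lemma class_hom: "group_hom Q A (\<lambda>c. D #> c)"
  using is_group comm_group_A class_closed class_mult
  by (auto intro!: group_hom.intro group_hom_axioms.intro simp: hom_def comm_group_def)

lemma class_self: "c \<in> carrier Q \<Longrightarrow> c \<in> D #> c"
  by (rule rcos_self[OF _ normal_imp_subgroup[OF normal_D]])

lemma hom_class_eq:
  assumes "group_hom Q B f" "comm_group B" "c \<in> carrier Q" "c' \<in> D #> c"
  shows "f c' = f c"
  using group_hom.eq_on_r_coset_derived[OF assms(1,2,3)] assms(4) by (simp add: closed_commutator_eq)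

end

context fn_setting
begin

lemma group_quot:
  assumes "subgroup H G" "normal_in G H U"
  shows "group (quot G (H, U))"
proof -
  interpret N: normal U "G\<lparr>carrier := H\<rparr>" using assms by (simp add: normal_in_def)
  show ?thesis
    by (rule group_cong_tgroup[OF N.factorgroup_is_group])
      (auto simp: quot_def tquotient_def FactGroup_def RCOSETS_def sub_tgroup_def r_coset_def set_mult_def fun_eq_iff)
qed

text \<open>If \<open>S\<close> is open with S \<inter> H = \<open>U\<close>, the fibre over the
  coset of g is the relatively open set S g \<inter> H, so the points of the quotient are
  open.\<close>

lemma discrete_quot:
  assumes H: "H \<in> base M" and U: "open_in_group G H U" "normal_in G H U"
  shows "discrete_group (quot G (H, U))"
proof -
  let ?T = "subtopology (topo G) H"
  have Us: "subgroup U G" using U(1) by (auto simp: open_in_group_def)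
  interpret HH: subgroup H G by (rule M_subgroup[OF H])
  obtain S where S: "openin (topo G) S" "U = S \<inter> H" using U(1) by (auto simp: open_in_group_def openin_subtopology)
  have tH: "topspace ?T = H" using HH.subset by auto
  have "openin (quotient_topology ?T (\<lambda>x. U #> x)) {X}" if X: "X \<in> (\<lambda>x. U #> x) ` H" for X
  proof -
    obtain g where g: "g \<in> H" "X = U #> g" using X by blast
    have gc: "g \<in> carrier G" using g by simp
    have "{x \<in> H. U #> x = X} = (S #> g) \<inter> H"
    proof (intro equalityI subsetI)
      fix x assume "x \<in> {x \<in> H. U #> x = X}"
      then have x: "x \<in> H" "U #> x = U #> g" using g by auto
      then have "x \<in> U #> g" using rcos_self[OF HH.mem_carrier[OF x(1)] Us] by simp
      then show "x \<in> (S #> g) \<inter> H" using x(1) S(2) unfolding r_coset_def by blast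
    next
      fix x assume x: "x \<in> (S #> g) \<inter> H"
      then obtain s where s: "s \<in> S" "x = s \<otimes> g" unfolding r_coset_def by blast
      have sc: "s \<in> carrier G" using s openin_subset[OF S(1)] by auto
      have "s = x \<otimes> inv g" using s sc gc by (simp add: m_assoc)
      moreover have "x \<otimes> inv g \<in> H" using x g by simp
      ultimately have "s \<in> U" using S(2) s(1) by simp
      then have "x \<in> U #> g" using s unfolding r_coset_def by blast
      then have "U #> x = U #> g" using repr_independence[OF _ gc Us] by metis
      then show "x \<in> {x \<in> H. U #> x = X}" using x g by simp
    qed
    moreover have "openin ?T ((S #> g) \<inter> H)"
      using openin_r_coset[OF gc S(1)] unfolding openin_subtopology by blast
    ultimately show ?thesis using X tH by (simp add: openin_quotient_topology)
  qed
  moreover have "topspace (quotient_topology ?T (\<lambda>x. U #> x)) = (\<lambda>x. U #> x) ` H"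
    using quotient_map_quotient_topology[of ?T "\<lambda>x. U #> x"] tH by (simp add: quotient_map_def)
  ultimately have "quotient_topology ?T (\<lambda>x. U #> x) = discrete_topology ((\<lambda>x. U #> x) ` H)"
    using discrete_topology_unique by metis
  moreover have "topo (quot G (H, U)) = quotient_topology ?T (\<lambda>x. U #> x)"
    by (simp add: quot_def tquotient_def sub_tgroup_def r_coset_def)
  ultimately show ?thesis
    using group_quot[OF M_subgroup[OF H] U(2)] by (simp add: discrete_group_def carrier_quot)
qed

lemma rcos_sum_in:
  assumes "subgroup H G" "normal_in G H U" "x \<in> H" "y \<in> H"
  shows "(U #> x) <#> (U #> y) = U #> (x \<otimes> y)"
proof -
  interpret N: normal U "G\<lparr>carrier := H\<rparr>" using assms by (simp add: normal_in_def)
  show ?thesis using N.rcos_sum[of x y] assms(3,4) by simp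
qed

section \<open>The reciprocity map for a single pair\<close>

context
  fixes H U
  assumes HU: "(H, U) \<in> base (open_part G E)"
begin

interpretation Q: discrete_tgroup_loc "quot G (H, U)"
  using discrete_quot[OF H[OF HU] U[OF HU]] 
  by (simp add: discrete_tgroup_loc_def discrete_tgroup_loc_axioms_def discrete_group_def)

abbreviation (input) "N' \<equiv> ind_image C H U"

lemma U_idom: "U \<in> idom M H"
  by (rule open_idom[OF H[OF HU] U(1)[OF HU]])

lemma subgroup_ind_image: "subgroup N' (Obj C H)"
proof -
  interpret I: group_hom "Obj C U" "Obj C H" "Ind C H U" by (rule group_hom_Ind[OF H[OF HU] U_idom])
  show ?thesis unfolding ind_image_def by (rule I.img_is_subgroup)
qed

lemma normal_ind_image: "normal N' (Obj C H)"
  by (rule comm_group.subgroup_imp_normal[OF C_comm[OF H[OF HU]] subgroup_ind_image])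

lemma Obj_H0: "Obj (H0 G C) (H, U) = discrete_tgroup (Obj C H Mod N')"
  by (simp add: H0_def)

lemma group_Mod: "group (Obj C H Mod N')"
  by (rule normal.factorgroup_is_group[OF normal_ind_image])

lemma discrete_H0: "discrete_group (Obj (H0 G C) (H, U))"
  unfolding Obj_H0 by (rule discrete_discrete_tgroup[OF group_Mod])

lemma comm_group_H0: "comm_group (Obj (H0 G C) (H, U))"
  unfolding Obj_H0 discrete_tgroup_def
  by (intro comm_group_with_topology comm_group.abelian_FactGroup[OF C_comm[OF H[OF HU]] subgroup_ind_image])

lemma H0_simps:
  "carrier (Obj (H0 G C) (H, U)) = (\<lambda>x. N' #>\<^bsub>Obj C H\<^esub> x) ` carrier (Obj C H)"
  "X \<otimes>\<^bsub>Obj (H0 G C) (H, U)\<^esub> Y = X <#>\<^bsub>Obj C H\<^esub> Y"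
  "\<one>\<^bsub>Obj (H0 G C) (H, U)\<^esub> = N'"
  by (simp_all add: Obj_H0 discrete_tgroup_def carrier_FactGroup)

lemma H0_class_hom: "group_hom (Obj C H) (Obj (H0 G C) (H, U)) (\<lambda>x. N' #>\<^bsub>Obj C H\<^esub> x)"
  using C_group[OF H[OF HU]] comm_group_H0 normal.rcos_sum[OF normal_ind_image]
  by (auto intro!: group_hom.intro group_hom_axioms.intro simp: hom_def comm_group_def H0_simps)

lemma class_eq_mult_right:
  assumes "a \<in> carrier (Obj C H)" "x \<in> N'"
  shows "N' #>\<^bsub>Obj C H\<^esub> (a \<otimes>\<^bsub>Obj C H\<^esub> x) = N' #>\<^bsub>Obj C H\<^esub> a"
proof -
  interpret CH: comm_group "Obj C H" by (rule C_comm[OF H[OF HU]])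
  have xc: "x \<in> carrier (Obj C H)" using subgroup.mem_carrier[OF subgroup_ind_image assms(2)] .
  have "a \<otimes>\<^bsub>Obj C H\<^esub> x \<in> N' #>\<^bsub>Obj C H\<^esub> a" using assms xc CH.m_comm[of a x] unfolding r_coset_def by blast
  then show ?thesis using CH.repr_independence[OF _ assms(1) subgroup_ind_image] by metis
qed

text \<open>Two prime elements differ by a unit of C(\<Sigma>). As \<open>W\<close> at level n [H:U]
  is unramified in \<Sigma>, this unit is a norm from \<open>W\<close>, and \<open>W\<close> is
  contained in \<open>U\<close>; so the values differ by a norm from \<open>U\<close>.\<close>

lemma recip_class_cong_prime:
  assumes hn: "frob_exp H h n" and \<pi>: "\<pi> \<in> prime_elements \<omega> C v (\<Sigma> U h)" "\<pi>' \<in> prime_elements \<omega> C v (\<Sigma> U h)"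
  shows "N' #>\<^bsub>Obj C H\<^esub> recip_elem H U h n \<pi>' = N' #>\<^bsub>Obj C H\<^esub> recip_elem H U h n \<pi>"
proof -
  note Hb = H[OF HU] and Ub = U[OF HU]
  let ?S = "\<Sigma> U h" and ?m = "n * index G H U"
  have So: "open_in_group G H ?S" by (rule open_frobenius_group[OF Hb Ub hn])
  have Sb: "?S \<in> base M" and Si: "?S \<in> idom M H" using open_base[OF Hb So] open_idom[OF Hb So] .
  have m: "?m > 0" using n_pos[OF Hb Ub hn] index_pos[OF Hb Ub] by simp
  let ?W = "W H U ?m"
  have WS: "?W \<subseteq> ?S" by (rule W_subset_frobenius_group[OF Hb Ub hn])
  have SH: "?S \<subseteq> H" by (rule frobenius_group_subset_H[OF Hb Ub hn])
  have WSo: "open_in_group G ?S ?W" by (rule open_in_group_subset[OF open_W[OF Hb Ub m] WS SH])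
  have WUo: "open_in_group G U ?W" by (rule open_in_group_subset[OF open_W[OF Hb Ub m] _ U_subset[OF Hb Ub]]) simp
  have Wu: "?W \<in> unramified G \<Omega> d ?S"
    unfolding unramified_def
    using WSo W_normal[OF Hb Ub m] SH WS M_subgroup[OF Sb] inertia_frobenius_group[OF Hb Ub hn] inertia_U_subset_W[OF Hb Ub m]
    by (auto simp: normal_in_iff[OF M_subgroup[OF Hb]] normal_in_iff[OF M_subgroup[OF Sb]])
  interpret S: comm_group "Obj C ?S" by (rule C_comm[OF Sb])
  interpret CH: comm_group "Obj C H" by (rule C_comm[OF Hb])
  interpret vS: group_hom "Obj C ?S" \<Omega> "v ?S" by (rule group_hom_v[OF Sb])
  interpret I: group_hom "Obj C ?S" "Obj C H" "Ind C H ?S" by (rule group_hom_Ind[OF Hb Si])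
  have \<pi>c: "\<pi> \<in> carrier (Obj C ?S)" "\<pi>' \<in> carrier (Obj C ?S)" "v ?S \<pi> = \<omega>" "v ?S \<pi>' = \<omega>"
    using \<pi> by (auto simp: prime_elements_def)
  define \<epsilon> where "\<epsilon> = inv\<^bsub>Obj C ?S\<^esub> \<pi> \<otimes>\<^bsub>Obj C ?S\<^esub> \<pi>'"
  have \<epsilon>: "\<epsilon> \<in> vker ?S" using \<pi>c by (simp add: \<epsilon>_def vker_iff)
  have \<epsilon>c: "\<epsilon> \<in> carrier (Obj C ?S)" using \<epsilon> by (simp add: vker_iff)
  obtain \<psi> where \<psi>: "frob_exp ?S \<psi> 1" using frobenius_exists[OF Sb] .
  obtain z where z: "z \<in> vker ?W" "Ind C ?S ?W z = \<epsilon>" using exact_Ind_surj[OF HE[OF HU] So Sb Wu \<psi> \<epsilon>] by blast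
  have zc: "z \<in> carrier (Obj C ?W)" using z by (simp add: vker_iff)
  have "Ind C H ?S \<epsilon> = Ind C H U (Ind C U ?W z)"
    using C.Ind_Ind[OF Hb Si open_idom[OF Sb WSo] zc] C.Ind_Ind[OF Hb U_idom open_idom[OF U_base[OF Hb Ub] WUo] zc] z(2) by simp
  then have I\<epsilon>: "Ind C H ?S \<epsilon> \<in> N'"
    using Ind_closed[OF U_base[OF Hb Ub] open_idom[OF U_base[OF Hb Ub] WUo] zc] by (simp add: ind_image_def)
  let ?e = "P'_part P n"
  have "\<pi>' = \<pi> \<otimes>\<^bsub>Obj C ?S\<^esub> \<epsilon>" using \<pi>c by (simp add: \<epsilon>_def S.mult_inv_cancel)
  then have "recip_elem H U h n \<pi>' = recip_elem H U h n \<pi> \<otimes>\<^bsub>Obj C H\<^esub> Ind C H ?S \<epsilon> [^]\<^bsub>Obj C H\<^esub> ?e"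
    using \<pi>c \<epsilon>c by (simp add: recip_elem_def S.nat_pow_distrib I.hom_nat_pow)
  moreover have "Ind C H ?S \<epsilon> [^]\<^bsub>Obj C H\<^esub> ?e \<in> N'"
    using CH.subgroup_int_pow_closed[OF subgroup_ind_image I\<epsilon>, of "int ?e"] by (simp add: int_pow_int)
  ultimately show ?thesis using class_eq_mult_right[OF recip_elem_closed[OF HU hn \<pi>(1)]] by simp
qed

text \<open>If h lies in \<open>U\<close>, then so does its Frobenius group, and the induction to
  \<open>H\<close> factors through \<open>U\<close>.\<close>

lemma recip_elem_in_ind_image:
  assumes hn: "frob_exp H h n" and \<pi>: "\<pi> \<in> prime_elements \<omega> C v (\<Sigma> U h)" and hU: "h \<in> U"
  shows "recip_elem H U h n \<pi> \<in> N'"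
proof -
  note Hb = H[OF HU] and Ub = U[OF HU]
  let ?S = "\<Sigma> U h"
  have So: "open_in_group G H ?S" by (rule open_frobenius_group[OF Hb Ub hn])
  have SU: "?S \<subseteq> U" by (rule frobenius_group_subset[OF U_base[OF Hb Ub] hU inertia_subset])
  have SUo: "open_in_group G U ?S" by (rule open_in_group_subset[OF So SU U_subset[OF Hb Ub]])
  have SUi: "?S \<in> idom M U" by (rule open_idom[OF U_base[OF Hb Ub] SUo])
  interpret S: comm_group "Obj C ?S" by (rule C_comm[OF open_base[OF Hb So]])
  have c: "\<pi> [^]\<^bsub>Obj C ?S\<^esub> P'_part P n \<in> carrier (Obj C ?S)" using \<pi> by (auto simp: prime_elements_def)
  show ?thesis unfolding recip_elem_def ind_image_def
    using C.Ind_Ind[OF Hb U_idom SUi c] Ind_closed[OF U_base[OF Hb Ub] SUi c] by (metis imageI)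
qed

text \<open>For equal exponents the Frobenius groups coincide and only the prime element changes.
  Otherwise the lift with the larger exponent is the other one times a Frobenius element x of
  \<open>U\<close>; multiplicativity applies, and the value of x is a norm from
  \<open>U\<close>.\<close>

lemma recip_class_cong:
  assumes h: "frob_exp H h n" "frob_exp H h' n'" and eq: "U #> h = U #> h'"
    and \<pi>: "\<pi> \<in> prime_elements \<omega> C v (\<Sigma> U h)" "\<pi>' \<in> prime_elements \<omega> C v (\<Sigma> U h')"
  shows "N' #>\<^bsub>Obj C H\<^esub> recip_elem H U h n \<pi> = N' #>\<^bsub>Obj C H\<^esub> recip_elem H U h' n' \<pi>'"
proof -
  note Hb = H[OF HU] and Ub = U[OF HU]
  have *: "N' #>\<^bsub>Obj C H\<^esub> recip_elem H U h n \<pi> = N' #>\<^bsub>Obj C H\<^esub> recip_elem H U h' n' \<pi>'"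
    if h: "frob_exp H h n" "frob_exp H h' n'" and eq: "U #> h = U #> h'" and nn: "n \<le> n'"
      and \<pi>: "\<pi> \<in> prime_elements \<omega> C v (\<Sigma> U h)" "\<pi>' \<in> prime_elements \<omega> C v (\<Sigma> U h')"
    for h h' n n' \<pi> \<pi>'
  proof (cases "n = n'")
    case True
    have "\<Sigma> U h = \<Sigma> U h'" using frobenius_group_cong[OF Hb Ub h(1) _ eq] h(2) True by simp
    then show ?thesis
      using recip_class_cong_prime[OF h(1) \<pi>(1)] \<pi>(2) True by (simp add: recip_elem_def)
  next
    case False
    have hc: "h \<in> carrier G" "h' \<in> carrier G" "h \<in> H" "h' \<in> H" using h_carrier[OF Hb Ub] h_in[OF Hb Ub] h by auto
    define x where "x = inv h \<otimes> h'"
    have xh: "h' = h \<otimes> x" using hc by (simp add: x_def mult_inv_cancel)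
    interpret HH: subgroup H G by (rule M_subgroup[OF Hb])
    have xU: "x \<in> U"
    proof -
      have "h' \<in> U #> h" using eq rcos_self[OF hc(2) U_subgroup[OF Hb Ub]] by simp
      then obtain u where u: "u \<in> U" "h' = u \<otimes> h" unfolding r_coset_def by blast
      have "inv h \<otimes> u \<otimes> inv (inv h) \<in> U" by (rule U_conj[OF Hb Ub HH.m_inv_closed[OF hc(3)] u(1)])
      then show ?thesis unfolding x_def u(2) using hc M_carrier[OF U_base[OF Hb Ub] u(1)] by (simp add: m_assoc)
    qed
    have "d x = inv\<^bsub>\<Omega>\<^esub> \<omega> [^]\<^bsub>\<Omega>\<^esub> (fd H * n) \<otimes>\<^bsub>\<Omega>\<^esub> \<omega> [^]\<^bsub>\<Omega>\<^esub> (fd H * n')"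
      unfolding x_def using hc d_h[OF Hb Ub h(1)] d_h[OF Hb Ub h(2)] by (simp add: Om.nat_pow_inv)
    also have "fd H * n' = fd H * n + fd H * (n' - n)" using nn by (simp flip: distrib_left)
    also have "inv\<^bsub>\<Omega>\<^esub> \<omega> [^]\<^bsub>\<Omega>\<^esub> (fd H * n) \<otimes>\<^bsub>\<Omega>\<^esub> \<omega> [^]\<^bsub>\<Omega>\<^esub> (fd H * n + fd H * (n' - n)) = \<omega> [^]\<^bsub>\<Omega>\<^esub> (fd H * (n' - n))"
      by (simp add: Om.nat_pow_inv Om.inv_mult_cancel flip: Om.nat_pow_mult)
    finally have fx: "frob_exp H x (n' - n)"
      using False nn xU U_subset[OF Hb Ub] by (auto simp: frob_exp_def)
    obtain \<pi>x where \<pi>x: "\<pi>x \<in> prime_elements \<omega> C v (\<Sigma> U x)" using prime_exists[OF frobenius_group_base[OF Hb Ub fx]] by blast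
    have "n + (n' - n) = n'" using nn by simp
    then obtain X where X: "X \<in> N'" "recip_elem H U h' n' \<pi>' = recip_elem H U h n \<pi> \<otimes>\<^bsub>Obj C H\<^esub> recip_elem H U x (n' - n) \<pi>x \<otimes>\<^bsub>Obj C H\<^esub> X"
      using recip_elem_mult[OF HU h(1) fx \<pi>(1) \<pi>x, of \<pi>'] \<pi>(2) xh by auto
    interpret CH: comm_group "Obj C H" by (rule C_comm[OF Hb])
    have xN: "recip_elem H U x (n' - n) \<pi>x \<in> N'" by (rule recip_elem_in_ind_image[OF fx \<pi>x xU])
    have rc: "recip_elem H U h n \<pi> \<in> carrier (Obj C H)" by (rule recip_elem_closed[OF HU h(1) \<pi>(1)])
    have "recip_elem H U h n \<pi> \<otimes>\<^bsub>Obj C H\<^esub> recip_elem H U x (n' - n) \<pi>x \<in> carrier (Obj C H)"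
      using rc subgroup.mem_carrier[OF subgroup_ind_image xN] by simp
    then show ?thesis unfolding X(2) using class_eq_mult_right[OF _ X(1)] class_eq_mult_right[OF rc xN] by simp
  qed
  show ?thesis
  proof (cases "n \<le> n'")
    case True
    then show ?thesis by (rule *[OF h eq _ \<pi>])
  next
    case False
    then show ?thesis using *[OF h(2,1) eq[symmetric] _ \<pi>(2,1)] by simp
  qed
qed

lemma ind_image_trivial: "U = H \<Longrightarrow> N' = carrier (Obj C H)"
  using C.Ind_id[OF H[OF HU]] by (force simp: ind_image_def)

text \<open>For nonempty \<open>P\<close> the exponent is recovered by \<open>mult_of\<close>. For
  empty \<open>P\<close> it need not be, but then [H:U] = 1, every element of C(H) is a norm from
  \<open>U\<close> = \<open>H\<close>, and all classes are equal.\<close>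

lemma recip_value_eq:
  assumes hn: "frob_exp H h n" and \<pi>: "\<pi> \<in> prime_elements \<omega> C v (\<Sigma> U h)"
  shows "recip_value P G \<Omega> \<omega> d C H U h \<pi> = N' #>\<^bsub>Obj C H\<^esub> recip_elem H U h n \<pi>"
proof (cases "P = {}")
  case False
  have "Defs.mult_of \<Omega> \<omega> (d_rel G \<Omega> d H h) = n"
    unfolding Defs.mult_of_def d_rel_frob[OF H[OF HU] hn]
    using n_pos[OF H[OF HU] U[OF HU] hn] Om.omega_pow_inj[OF False] by (intro the_equality) auto
  then show ?thesis by (simp add: recip_value_def recip_elem_def Let_def)
next
  case True
  note Hb = H[OF HU] and Ub = U[OF HU]
  have "index G H U = 1"
    using P_number_index[OF Hb Ub] P_part_P_number[of P "index G H U"] True by (simp add: P_part_def)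
  then have "H \<subseteq> U" using pow_index_in[OF Hb Ub] M_carrier[OF Hb] by force
  then have "U = H" using U_subset[OF Hb Ub] by blast
  then have N: "N' = carrier (Obj C H)" by (rule ind_image_trivial)
  interpret CH: comm_group "Obj C H" by (rule C_comm[OF Hb])
  have all: "N' #>\<^bsub>Obj C H\<^esub> a = N'" if "a \<in> carrier (Obj C H)" for a
    using that subgroup_ind_image N by (simp add: CH.coset_join2)
  have So: "open_in_group G H (\<Sigma> U h)" by (rule open_frobenius_group[OF Hb Ub hn])
  interpret S: comm_group "Obj C (\<Sigma> U h)" by (rule C_comm[OF open_base[OF Hb So]])
  have "Ind C H (\<Sigma> U h) (\<pi> [^]\<^bsub>Obj C (\<Sigma> U h)\<^esub> k) \<in> carrier (Obj C H)" for k :: nat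
    by (rule Ind_closed[OF Hb open_idom[OF Hb So]]) (use \<pi> in \<open>auto simp: prime_elements_def\<close>)
  then show ?thesis using all by (simp add: recip_value_def recip_elem_def Let_def)
qed

lemma Upsilon'_eq:
  assumes hn: "frob_exp H h n" and \<pi>: "\<pi> \<in> prime_elements \<omega> C v (\<Sigma> U h)"
  shows "Upsilon' P G \<Omega> \<omega> d C v (H, U) (U #> h) = N' #>\<^bsub>Obj C H\<^esub> recip_elem H U h n \<pi>"
proof -
  note Hb = H[OF HU] and Ub = U[OF HU]
  define h' where "h' = (SOME h'. h' \<in> Frob G \<Omega> \<omega> d H \<and> U #> h' = U #> h)"
  have "h \<in> Frob G \<Omega> \<omega> d H \<and> U #> h = U #> h" using hn Frob_iff[OF Hb] by blast
  then have h': "h' \<in> Frob G \<Omega> \<omega> d H \<and> U #> h' = U #> h" unfolding h'_def by (rule someI)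
  then obtain n' where n': "frob_exp H h' n'" using Frob_iff[OF Hb] by blast
  define \<pi>' where "\<pi>' = (SOME \<pi>. \<pi> \<in> prime_elements \<omega> C v (\<Sigma> U h'))"
  have \<pi>': "\<pi>' \<in> prime_elements \<omega> C v (\<Sigma> U h')"
    unfolding \<pi>'_def using prime_exists[OF frobenius_group_base[OF Hb Ub n']] by (rule some_in_eq[THEN iffD2])
  have "Upsilon' P G \<Omega> \<omega> d C v (H, U) (U #> h) = recip_value P G \<Omega> \<omega> d C H U h' \<pi>'"
    by (simp add: Upsilon'_def Let_def h'_def \<pi>'_def)
  also have "\<dots> = N' #>\<^bsub>Obj C H\<^esub> recip_elem H U h n \<pi>"
    unfolding recip_value_eq[OF n' \<pi>'] using h' by (intro recip_class_cong[OF n' hn _ \<pi>' \<pi>]) simp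
  finally show ?thesis .
qed

lemma Upsilon'_hom: "Upsilon' P G \<Omega> \<omega> d C v (H, U) \<in> hom (quot G (H, U)) (Obj (H0 G C) (H, U))"
proof (rule homI)
  note Hb = H[OF HU] and Ub = U[OF HU]
  interpret c: group_hom "Obj C H" "Obj (H0 G C) (H, U)" "\<lambda>x. N' #>\<^bsub>Obj C H\<^esub> x" by (rule H0_class_hom)
  fix c1 assume c1: "c1 \<in> carrier (quot G (H, U))"
  obtain h1 n1 where h1: "frob_exp H h1 n1" "U #> h1 = c1" by (rule frob_lift_exists[OF Hb Ub c1])
  obtain \<pi>1 where \<pi>1: "\<pi>1 \<in> prime_elements \<omega> C v (\<Sigma> U h1)" using prime_exists[OF frobenius_group_base[OF Hb Ub h1(1)]] by blast
  note r1 = recip_elem_closed[OF HU h1(1) \<pi>1]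
  have e1: "Upsilon' P G \<Omega> \<omega> d C v (H, U) c1 = N' #>\<^bsub>Obj C H\<^esub> recip_elem H U h1 n1 \<pi>1"
    using Upsilon'_eq[OF h1(1) \<pi>1] h1(2) by simp
  then show "Upsilon' P G \<Omega> \<omega> d C v (H, U) c1 \<in> carrier (Obj (H0 G C) (H, U))" using r1 by simp
  fix c2 assume c2: "c2 \<in> carrier (quot G (H, U))"
  obtain h2 n2 where h2: "frob_exp H h2 n2" "U #> h2 = c2" by (rule frob_lift_exists[OF Hb Ub c2])
  obtain \<pi>2 where \<pi>2: "\<pi>2 \<in> prime_elements \<omega> C v (\<Sigma> U h2)" using prime_exists[OF frobenius_group_base[OF Hb Ub h2(1)]] by blast
  note r2 = recip_elem_closed[OF HU h2(1) \<pi>2]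
  note h3 = frob_exp_mult[OF Hb h1(1) h2(1)]
  obtain \<pi>3 where \<pi>3: "\<pi>3 \<in> prime_elements \<omega> C v (\<Sigma> U (h1 \<otimes> h2))" using prime_exists[OF frobenius_group_base[OF Hb Ub h3]] by blast
  obtain X where X: "X \<in> N'" "recip_elem H U (h1 \<otimes> h2) (n1 + n2) \<pi>3 = recip_elem H U h1 n1 \<pi>1 \<otimes>\<^bsub>Obj C H\<^esub> recip_elem H U h2 n2 \<pi>2 \<otimes>\<^bsub>Obj C H\<^esub> X"
    using recip_elem_mult[OF HU h1(1) h2(1) \<pi>1 \<pi>2 \<pi>3] by blast
  have "c1 \<otimes>\<^bsub>quot G (H, U)\<^esub> c2 = U #> (h1 \<otimes> h2)"
    unfolding mult_quot h1(2)[symmetric] h2(2)[symmetric]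
    by (rule rcos_sum_in[OF M_subgroup[OF Hb] Ub(2) h_in[OF Hb Ub h1(1)] h_in[OF Hb Ub h2(1)]])
  then have "Upsilon' P G \<Omega> \<omega> d C v (H, U) (c1 \<otimes>\<^bsub>quot G (H, U)\<^esub> c2) = N' #>\<^bsub>Obj C H\<^esub> (recip_elem H U h1 n1 \<pi>1 \<otimes>\<^bsub>Obj C H\<^esub> recip_elem H U h2 n2 \<pi>2)"
    using Upsilon'_eq[OF h3 \<pi>3] class_eq_mult_right[OF _ X(1)] X(2) r1 r2
    by (simp add: monoid.m_closed[OF group.is_monoid[OF C_group[OF Hb]]])
  also have "\<dots> = Upsilon' P G \<Omega> \<omega> d C v (H, U) c1 \<otimes>\<^bsub>Obj (H0 G C) (H, U)\<^esub> Upsilon' P G \<Omega> \<omega> d C v (H, U) c2"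
    using e1 Upsilon'_eq[OF h2(1) \<pi>2] h2(2) c.hom_mult[OF r1 r2] by simp
  finally show "Upsilon' P G \<Omega> \<omega> d C v (H, U) (c1 \<otimes>\<^bsub>quot G (H, U)\<^esub> c2) =
      Upsilon' P G \<Omega> \<omega> d C v (H, U) c1 \<otimes>\<^bsub>Obj (H0 G C) (H, U)\<^esub> Upsilon' P G \<Omega> \<omega> d C v (H, U) c2" .
qed

lemma group_hom_Upsilon': "group_hom (quot G (H, U)) (Obj (H0 G C) (H, U)) (Upsilon' P G \<Omega> \<omega> d C v (H, U))"
  using Upsilon'_hom Q.is_group comm_group_H0
  by (auto intro!: group_hom.intro group_hom_axioms.intro simp: comm_group_def)

lemma Obj_pi_K: "Obj (pi_K G) (H, U) = abelianization (quot G (H, U))"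
  by (simp add: pi_K_def)

lemma discrete_pi_K: "discrete_group (Obj (pi_K G) (H, U))"
  unfolding Obj_pi_K by (rule Q.discrete_A)

lemma comm_group_pi_K: "comm_group (Obj (pi_K G) (H, U))"
  unfolding Obj_pi_K by (rule Q.comm_group_A)

lemma Upsilon_ab_class:
  assumes "c \<in> carrier (quot G (H, U))"
  shows "Upsilon P G \<Omega> \<omega> d C v (H, U) (ab_class G (H, U) c) = Upsilon' P G \<Omega> \<omega> d C v (H, U) c"
proof -
  have "(SOME c'. c' \<in> ab_class G (H, U) c) \<in> ab_class G (H, U) c"
    using Q.class_self[OF assms] unfolding ab_class_def by (rule someI)
  then show ?thesis
    unfolding Upsilon_def ab_class_def
    by (rule Q.hom_class_eq[OF group_hom_Upsilon' comm_group_H0 assms])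
qed

lemma carrier_pi_K: "carrier (Obj (pi_K G) (H, U)) = ab_class G (H, U) ` carrier (quot G (H, U))"
  by (simp add: Obj_pi_K Q.carrier_A ab_class_def)

lemma ab_class_hom: "group_hom (quot G (H, U)) (Obj (pi_K G) (H, U)) (ab_class G (H, U))"
  using Q.class_hom by (simp add: Obj_pi_K ab_class_def[abs_def])

lemma Upsilon_hom: "Upsilon P G \<Omega> \<omega> d C v (H, U) \<in> tgroup_hom (Obj (pi_K G) (H, U)) (Obj (H0 G C) (H, U))"
proof -
  interpret a: group_hom "quot G (H, U)" "Obj (pi_K G) (H, U)" "ab_class G (H, U)" by (rule ab_class_hom)
  interpret u: group_hom "quot G (H, U)" "Obj (H0 G C) (H, U)" "Upsilon' P G \<Omega> \<omega> d C v (H, U)" by (rule group_hom_Upsilon')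
  have "Upsilon P G \<Omega> \<omega> d C v (H, U) \<in> hom (Obj (pi_K G) (H, U)) (Obj (H0 G C) (H, U))"
  proof (rule homI)
    fix X Y assume X: "X \<in> carrier (Obj (pi_K G) (H, U))" and Y: "Y \<in> carrier (Obj (pi_K G) (H, U))"
    obtain c c' where c: "c \<in> carrier (quot G (H, U))" "X = ab_class G (H, U) c"
        "c' \<in> carrier (quot G (H, U))" "Y = ab_class G (H, U) c'"
      using X Y unfolding carrier_pi_K by blast
    then have XY: "X \<otimes>\<^bsub>Obj (pi_K G) (H, U)\<^esub> Y = ab_class G (H, U) (c \<otimes>\<^bsub>quot G (H, U)\<^esub> c')" by simp
    show "Upsilon P G \<Omega> \<omega> d C v (H, U) (X \<otimes>\<^bsub>Obj (pi_K G) (H, U)\<^esub> Y) =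
        Upsilon P G \<Omega> \<omega> d C v (H, U) X \<otimes>\<^bsub>Obj (H0 G C) (H, U)\<^esub> Upsilon P G \<Omega> \<omega> d C v (H, U) Y"
      unfolding XY Upsilon_ab_class[OF Q.m_closed[OF c(1,3)]] using c by (simp add: Upsilon_ab_class)
  next
    fix X assume "X \<in> carrier (Obj (pi_K G) (H, U))"
    then show "Upsilon P G \<Omega> \<omega> d C v (H, U) X \<in> carrier (Obj (H0 G C) (H, U))"
      unfolding carrier_pi_K by (auto simp: Upsilon_ab_class)
  qed
  then show ?thesis using tgroup_hom_discrete[OF discrete_pi_K discrete_H0] by blast
qed

end

end

section \<open>The functors \<open>\<pi>\<^sub>K\<close> and \<open>H\<^sup>0\<close>\<close>

lemma finprod_group_hom:
  assumes f: "group_hom A B f" and A: "comm_group A" and B: "comm_group B"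
    and x: "finite T" "x \<in> T \<rightarrow> carrier A"
  shows "f (finprod A x T) = finprod B (\<lambda>t. f (x t)) T"
  using x
proof (induction T)
  interpret A: comm_group A by fact
  interpret B: comm_group B by fact
  interpret f: group_hom A B f by fact
  {
    case empty
    then show ?case by simp
  next
    case (insert a T)
    then have "x \<in> T \<rightarrow> carrier A" "x a \<in> carrier A" by auto
    moreover from this have "(\<lambda>t. f (x t)) \<in> T \<rightarrow> carrier B" "f (x a) \<in> carrier B" by (auto simp: Pi_iff)
    ultimately show ?case using insert by (simp add: A.finprod_closed)
  }
qed

section \<open>Transversals and the transfer inside one ambient group\<close>

context group
begin

definition transversal :: "'a set \<Rightarrow> 'a set \<Rightarrow> 'a set \<Rightarrow> bool" where
  "transversal H I T \<longleftrightarrow> T \<subseteq> H \<and> (\<forall>x \<in> H. \<exists>!t. t \<in> T \<and> x \<otimes> inv t \<in> I)"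

definition coset_rep :: "'a set \<Rightarrow> 'a set \<Rightarrow> 'a \<Rightarrow> 'a" where
  "coset_rep I T x = (THE t. t \<in> T \<and> x \<otimes> inv t \<in> I)"

text \<open>The transfer is formed on subgroups of one ambient group and composed with an arbitrary
  map \<theta> into a commutative group. This covers the map to an abelianization, and taking
  another transfer for \<theta> expresses transitivity.\<close>

definition transfer :: "'a set \<Rightarrow> 'a set \<Rightarrow> ('c, 'z) monoid_scheme \<Rightarrow> ('a \<Rightarrow> 'c) \<Rightarrow> 'a \<Rightarrow> 'c" where
  "transfer I T A \<theta> h = (\<Otimes>\<^bsub>A\<^esub> t \<in> T. \<theta> (t \<otimes> h \<otimes> inv (coset_rep I T (t \<otimes> h))))"

context
  fixes H I
  assumes H: "subgroup H G" and I: "subgroup I G" "I \<subseteq> H"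
begin

interpretation H: subgroup H G by (rule H)
interpretation I: subgroup I G by (rule I(1))

lemma coset_rep:
  assumes "transversal H I T" "x \<in> H"
  shows "coset_rep I T x \<in> T" "x \<otimes> inv (coset_rep I T x) \<in> I" "coset_rep I T x \<in> H"
proof -
  have "\<exists>!t. t \<in> T \<and> x \<otimes> inv t \<in> I" using assms by (simp add: transversal_def)
  then have "coset_rep I T x \<in> T \<and> x \<otimes> inv (coset_rep I T x) \<in> I"
    unfolding coset_rep_def by (rule theI')
  then show "coset_rep I T x \<in> T" "x \<otimes> inv (coset_rep I T x) \<in> I" "coset_rep I T x \<in> H"
    using assms(1) by (auto simp: transversal_def)
qed

lemma coset_rep_eqI:
  assumes "transversal H I T" "x \<in> H" "t \<in> T" "x \<otimes> inv t \<in> I"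
  shows "coset_rep I T x = t"
  using assms coset_rep[OF assms(1,2)] unfolding transversal_def by blast

lemma coset_rep_mult_right:
  assumes T: "transversal H I T" and x: "x \<in> H" and y: "y \<in> H"
  shows "coset_rep I T (coset_rep I T x \<otimes> y) = coset_rep I T (x \<otimes> y)"
proof (rule coset_rep_eqI[OF T])
  note r = coset_rep[OF T x] and r' = coset_rep[OF T H.m_closed[OF x y]]
  show "coset_rep I T x \<otimes> y \<in> H" using r y by simp
  show "coset_rep I T (x \<otimes> y) \<in> T" by (rule r'(1))
  have c: "x \<in> carrier G" "y \<in> carrier G" "coset_rep I T x \<in> carrier G" "coset_rep I T (x \<otimes> y) \<in> carrier G"
    using x y r(3) r'(3) by auto
  have "coset_rep I T x \<otimes> y \<otimes> inv (coset_rep I T (x \<otimes> y)) =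
      inv (x \<otimes> inv (coset_rep I T x)) \<otimes> (x \<otimes> y \<otimes> inv (coset_rep I T (x \<otimes> y)))"
    using c by (simp add: group_norm)
  then show "coset_rep I T x \<otimes> y \<otimes> inv (coset_rep I T (x \<otimes> y)) \<in> I"
    using r(2) r'(2) by simp
qed

lemma coset_rep_self:
  assumes T: "transversal H I T" and t: "t \<in> T"
  shows "coset_rep I T t = t"
  using assms by (intro coset_rep_eqI[OF T]) (auto simp: transversal_def)

lemma bij_coset_rep:
  assumes T: "transversal H I T" "finite T" and h: "h \<in> H"
  shows "inj_on (\<lambda>t. coset_rep I T (t \<otimes> h)) T" "(\<lambda>t. coset_rep I T (t \<otimes> h)) ` T = T"
proof -
  have TH: "t \<in> H" if "t \<in> T" for t using that T by (auto simp: transversal_def)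
  show inj: "inj_on (\<lambda>t. coset_rep I T (t \<otimes> h)) T"
  proof (rule inj_onI)
    fix t t' assume t: "t \<in> T" "t' \<in> T" "coset_rep I T (t \<otimes> h) = coset_rep I T (t' \<otimes> h)"
    have "coset_rep I T (coset_rep I T (x \<otimes> h) \<otimes> inv h) = x" if "x \<in> T" for x
      using coset_rep_mult_right[OF T(1) _ , of "x \<otimes> h" "inv h"] TH[OF that] h
        coset_rep_self[OF T(1) that] by (simp add: m_assoc)
    then show "t = t'" using t by metis
  qed
  have "(\<lambda>t. coset_rep I T (t \<otimes> h)) ` T \<subseteq> T" using coset_rep[OF T(1)] TH h by auto
  then show "(\<lambda>t. coset_rep I T (t \<otimes> h)) ` T = T" using endo_inj_surj[OF T(2) _ inj] by blast
qed

context
  fixes A :: "('c, 'z) monoid_scheme" and \<theta>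
  assumes A: "comm_group A" and \<theta>: "\<And>x. x \<in> I \<Longrightarrow> \<theta> x \<in> carrier A"
    "\<And>x y. x \<in> I \<Longrightarrow> y \<in> I \<Longrightarrow> \<theta> (x \<otimes> y) = \<theta> x \<otimes>\<^bsub>A\<^esub> \<theta> y"
begin

interpretation A: comm_group A by (rule A)

lemma transfer_factor_closed:
  assumes T: "transversal H I T" and h: "h \<in> H"
  shows "(\<lambda>t. \<theta> (t \<otimes> h \<otimes> inv (coset_rep I T (t \<otimes> h)))) \<in> T \<rightarrow> carrier A"
  using T h coset_rep(2)[OF T] \<theta>(1) by (auto simp: transversal_def subset_iff)

lemma transfer_closed: "transversal H I T \<Longrightarrow> h \<in> H \<Longrightarrow> transfer I T A \<theta> h \<in> carrier A"
  unfolding transfer_def by (rule A.finprod_closed[OF transfer_factor_closed])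

text \<open>The factors satisfy a cocycle relation: the factor of h h' at t is the factor of h at t
  times the factor of h' at the representative of t h. This representative runs through
  \<open>T\<close> as t does.\<close>

lemma transfer_mult:
  assumes T: "transversal H I T" "finite T" and h: "h \<in> H" "h' \<in> H"
  shows "transfer I T A \<theta> (h \<otimes> h') = transfer I T A \<theta> h \<otimes>\<^bsub>A\<^esub> transfer I T A \<theta> h'"
proof -
  let ?r = "\<lambda>t. coset_rep I T (t \<otimes> h)"
  let ?f = "\<lambda>h t. \<theta> (t \<otimes> h \<otimes> inv (coset_rep I T (t \<otimes> h)))"
  note b = bij_coset_rep[OF T h(1)] and f = transfer_factor_closed[OF T(1)]
  have TH: "t \<in> H" if "t \<in> T" for t using that T by (auto simp: transversal_def)
  have eq: "?f (h \<otimes> h') t = ?f h t \<otimes>\<^bsub>A\<^esub> ?f h' (?r t)" if t: "t \<in> T" for t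
  proof -
    have th: "t \<otimes> h \<in> H" using TH[OF t] h by simp
    note r = coset_rep[OF T(1) th]
    have rr: "coset_rep I T (?r t \<otimes> h') = coset_rep I T (t \<otimes> (h \<otimes> h'))"
      using coset_rep_mult_right[OF T(1) th h(2)] TH[OF t] h by (simp add: m_assoc)
    have thh: "t \<otimes> (h \<otimes> h') \<in> H" using TH[OF t] h by simp
    note r' = coset_rep[OF T(1) thh]
    have "?r t \<otimes> h' \<in> H" using r h by simp
    from coset_rep(2)[OF T(1) this] have i2: "?r t \<otimes> h' \<otimes> inv (coset_rep I T (t \<otimes> (h \<otimes> h'))) \<in> I" unfolding rr .
    have "t \<otimes> (h \<otimes> h') \<otimes> inv (coset_rep I T (t \<otimes> (h \<otimes> h'))) =
        (t \<otimes> h \<otimes> inv (?r t)) \<otimes> (?r t \<otimes> h' \<otimes> inv (coset_rep I T (t \<otimes> (h \<otimes> h'))))"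
      using TH[OF t] h r(3) r'(3) by (simp add: group_norm)
    then show ?thesis unfolding rr using \<theta>(2)[OF r(2) i2] by simp
  qed
  have fr: "(\<lambda>t. ?f h' (?r t)) \<in> T \<rightarrow> carrier A" using f[OF h(2)] b(2) by blast
  have "transfer I T A \<theta> (h \<otimes> h') = (\<Otimes>\<^bsub>A\<^esub> t \<in> T. ?f h t \<otimes>\<^bsub>A\<^esub> ?f h' (?r t))"
    unfolding transfer_def using f[OF h(1)] fr by (intro A.finprod_cong' refl eq) (auto simp: Pi_iff)
  also have "\<dots> = transfer I T A \<theta> h \<otimes>\<^bsub>A\<^esub> (\<Otimes>\<^bsub>A\<^esub> t \<in> T. ?f h' (?r t))"
    unfolding transfer_def by (rule A.finprod_multf[OF f[OF h(1)] fr])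
  also have "(\<Otimes>\<^bsub>A\<^esub> t \<in> T. ?f h' (?r t)) = finprod A (?f h') (?r ` T)"
    by (rule A.finprod_reindex[OF _ b(1), symmetric]) (simp add: b(2) f[OF h(2)])
  finally show ?thesis unfolding b(2) transfer_def[of I T A \<theta> h'] .
qed

text \<open>Changing the transversal changes the factor at t by a(r(t)) / a(t), where r is the
  permutation of \<open>T\<close> induced by h; the product of these over \<open>T\<close> is one.
  To avoid division, both sides are multiplied by the product \<open>?pa\<close> of all
  a(t).\<close>

lemma transfer_indep:
  assumes T: "transversal H I T" "finite T" and T': "transversal H I T'" and h: "h \<in> H"
  shows "transfer I T' A \<theta> h = transfer I T A \<theta> h"
proof -
  let ?s = "coset_rep I T'"
  let ?r = "\<lambda>t. coset_rep I T (t \<otimes> h)"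
  let ?f = "\<lambda>T t. \<theta> (t \<otimes> h \<otimes> inv (coset_rep I T (t \<otimes> h)))"
  let ?a = "\<lambda>t. \<theta> (t \<otimes> inv (?s t))"
  have TH: "t \<in> H" if "t \<in> T" for t using that T by (auto simp: transversal_def)
  have T'H: "t \<in> H" if "t \<in> T'" for t using that T' by (auto simp: transversal_def)
  have sinv: "coset_rep I T (?s t) = t" if "t \<in> T" for t
  proof (rule coset_rep_eqI[OF T(1) coset_rep(3)[OF T' TH[OF that]] that])
    have "?s t \<otimes> inv t = inv (t \<otimes> inv (?s t))" using TH[OF that] coset_rep(3)[OF T' TH[OF that]] by (simp add: group_norm)
    then show "?s t \<otimes> inv t \<in> I" using coset_rep(2)[OF T' TH[OF that]] by simp
  qed
  have inj: "inj_on ?s T" by (metis inj_onI sinv)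
  have im: "?s ` T = T'"
  proof
    show "?s ` T \<subseteq> T'" using coset_rep(1)[OF T'] TH by auto
    show "T' \<subseteq> ?s ` T"
    proof
      fix t assume t: "t \<in> T'"
      note c = coset_rep[OF T(1) T'H[OF t]]
      have "?s (coset_rep I T t) = t"
      proof (rule coset_rep_eqI[OF T' c(3) t])
        have "coset_rep I T t \<otimes> inv t = inv (t \<otimes> inv (coset_rep I T t))" using T'H[OF t] c(3) by (simp add: group_norm)
        then show "coset_rep I T t \<otimes> inv t \<in> I" using c(2) by simp
      qed
      then show "t \<in> ?s ` T" using c(1) by (metis imageI)
    qed
  qed
  note b = bij_coset_rep[OF T h] and f = transfer_factor_closed[OF T(1) h] and f' = transfer_factor_closed[OF T' h]
  have a: "?a \<in> T \<rightarrow> carrier A" using coset_rep(2)[OF T'] TH \<theta>(1) by auto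
  have ar: "(\<lambda>t. ?a (?r t)) \<in> T \<rightarrow> carrier A" using a b(2) by blast
  have fs: "(\<lambda>t. ?f T' (?s t)) \<in> T \<rightarrow> carrier A" using f' im by blast
  have eq: "?a t \<otimes>\<^bsub>A\<^esub> ?f T' (?s t) = ?f T t \<otimes>\<^bsub>A\<^esub> ?a (?r t)" if t: "t \<in> T" for t
  proof -
    note s = coset_rep[OF T' TH[OF t]]
    have th: "t \<otimes> h \<in> H" using TH[OF t] h by simp
    note r = coset_rep[OF T(1) th]
    note sr = coset_rep[OF T' r(3)]
    have sh: "?s t \<otimes> h \<in> H" using s h by simp
    have "?s (?s t \<otimes> h) = ?s (t \<otimes> h)" by (rule coset_rep_mult_right[OF T' TH[OF t] h])
    also have "\<dots> = ?s (?r t)"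
    proof (rule coset_rep_eqI[OF T' th sr(1)])
      have "t \<otimes> h \<otimes> inv (?s (?r t)) = (t \<otimes> h \<otimes> inv (?r t)) \<otimes> (?r t \<otimes> inv (?s (?r t)))"
        using TH[OF t] h r(3) sr(3) by (simp add: group_norm)
      then show "t \<otimes> h \<otimes> inv (?s (?r t)) \<in> I" using r(2) sr(2) by simp
    qed
    finally have e: "?s (?s t \<otimes> h) = ?s (?r t)" .
    have i: "?s t \<otimes> h \<otimes> inv (?s (?r t)) \<in> I" using coset_rep(2)[OF T' sh] unfolding e .
    have "(t \<otimes> inv (?s t)) \<otimes> (?s t \<otimes> h \<otimes> inv (?s (?r t))) = (t \<otimes> h \<otimes> inv (?r t)) \<otimes> (?r t \<otimes> inv (?s (?r t)))"
      using TH[OF t] h r(3) s(3) sr(3) by (simp add: group_norm)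
    then show ?thesis unfolding e using \<theta>(2)[OF s(2) i] \<theta>(2)[OF r(2) sr(2)] by simp
  qed
  let ?pa = "\<Otimes>\<^bsub>A\<^esub> t \<in> T. ?a t"
  have pa: "?pa \<in> carrier A" by (rule A.finprod_closed[OF a])
  have "?pa \<otimes>\<^bsub>A\<^esub> (\<Otimes>\<^bsub>A\<^esub> t \<in> T. ?f T' (?s t)) = (\<Otimes>\<^bsub>A\<^esub> t \<in> T. ?a t \<otimes>\<^bsub>A\<^esub> ?f T' (?s t))"
    by (rule A.finprod_multf[OF a fs, symmetric])
  also have "\<dots> = (\<Otimes>\<^bsub>A\<^esub> t \<in> T. ?f T t \<otimes>\<^bsub>A\<^esub> ?a (?r t))"
    using f ar by (intro A.finprod_cong' refl eq) (auto simp: Pi_iff)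
  also have "\<dots> = (\<Otimes>\<^bsub>A\<^esub> t \<in> T. ?f T t) \<otimes>\<^bsub>A\<^esub> (\<Otimes>\<^bsub>A\<^esub> t \<in> T. ?a (?r t))"
    by (rule A.finprod_multf[OF f ar])
  also have "(\<Otimes>\<^bsub>A\<^esub> t \<in> T. ?a (?r t)) = finprod A ?a (?r ` T)"
    by (rule A.finprod_reindex[OF _ b(1), symmetric]) (simp add: b(2) a)
  also have "(\<Otimes>\<^bsub>A\<^esub> t \<in> T. ?f T t) \<otimes>\<^bsub>A\<^esub> finprod A ?a (?r ` T) = ?pa \<otimes>\<^bsub>A\<^esub> (\<Otimes>\<^bsub>A\<^esub> t \<in> T. ?f T t)"
    unfolding b(2) by (rule A.m_comm[OF A.finprod_closed[OF f] pa])
  finally have "(\<Otimes>\<^bsub>A\<^esub> t \<in> T. ?f T' (?s t)) = (\<Otimes>\<^bsub>A\<^esub> t \<in> T. ?f T t)"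
    using A.Units_l_cancel[of ?pa] pa A.finprod_closed[OF fs] A.finprod_closed[OF f] by simp
  moreover have "(\<Otimes>\<^bsub>A\<^esub> t \<in> T. ?f T' (?s t)) = finprod A (?f T') (?s ` T)"
    by (rule A.finprod_reindex[OF _ inj, symmetric]) (simp add: im f')
  ultimately show ?thesis unfolding im transfer_def by simp
qed

end

end

text \<open>Splitting x first as i t with i in \<open>I\<close>, and then i as j s with j in
  \<open>J\<close>, gives x = j s t.\<close>

lemma transversal_mult:
  assumes H: "subgroup H G" and I: "subgroup I G" "I \<subseteq> H" and J: "subgroup J G" "J \<subseteq> I"
    and T: "transversal H I T" and S: "transversal I J S"
  shows "transversal H J (\<Union>t\<in>T. (\<lambda>s. s \<otimes> t) ` S)"
    and "x \<in> H \<Longrightarrow> coset_rep J (\<Union>t\<in>T. (\<lambda>s. s \<otimes> t) ` S) x =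
      coset_rep J S (x \<otimes> inv (coset_rep I T x)) \<otimes> coset_rep I T x"
proof -
  interpret H: subgroup H G by fact
  interpret I: subgroup I G by fact
  interpret J: subgroup J G by fact
  let ?ST = "\<Union>t\<in>T. (\<lambda>s. s \<otimes> t) ` S"
  note rT = coset_rep[OF H I T] and rS = coset_rep[OF I(1) J S]
  have TH: "t \<in> H" if "t \<in> T" for t using that T by (auto simp: transversal_def)
  have SI: "s \<in> I" if "s \<in> S" for s using that S by (auto simp: transversal_def)
  let ?q = "\<lambda>x. coset_rep J S (x \<otimes> inv (coset_rep I T x)) \<otimes> coset_rep I T x"
  have q: "?q x \<in> ?ST \<and> x \<otimes> inv (?q x) \<in> J" if x: "x \<in> H" for x
  proof
    note t = rT[OF x] and s = rS[OF rT(2)[OF x]]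
    show "?q x \<in> ?ST" using t(1) s(1) by blast
    have "x \<otimes> inv (?q x) = x \<otimes> inv (coset_rep I T x) \<otimes> inv (coset_rep J S (x \<otimes> inv (coset_rep I T x)))"
      using x t(3) s(3) by (simp add: group_norm)
    then show "x \<otimes> inv (?q x) \<in> J" using s(2) by simp
  qed
  have u: "y = ?q x" if x: "x \<in> H" and y: "y \<in> ?ST" "x \<otimes> inv y \<in> J" for x y
  proof -
    obtain t s where ts: "t \<in> T" "s \<in> S" "y = s \<otimes> t" using y(1) by blast
    note c = TH[OF ts(1)] SI[OF ts(2)]
    have "x \<otimes> inv t = (x \<otimes> inv y) \<otimes> s" using x c ts(3) by (simp add: group_norm)
    moreover have "x \<otimes> inv y \<in> I" using y(2) J(2) by blast
    ultimately have xt: "x \<otimes> inv t \<in> I" using c(2) by simp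
    then have t: "coset_rep I T x = t" by (rule coset_rep_eqI[OF H I T x ts(1)])
    have "x \<otimes> inv t \<otimes> inv s = x \<otimes> inv y" using x c ts(3) by (simp add: group_norm)
    then have "coset_rep J S (x \<otimes> inv t) = s" using y(2) by (intro coset_rep_eqI[OF I(1) J S xt ts(2)]) simp
    then show ?thesis using t ts(3) by simp
  qed
  show tr: "transversal H J ?ST"
    unfolding transversal_def
  proof
    show "?ST \<subseteq> H" using TH SI I(2) by auto
    show "\<forall>x\<in>H. \<exists>!t. t \<in> ?ST \<and> x \<otimes> inv t \<in> J"
    proof
      fix x assume x: "x \<in> H"
      show "\<exists>!t. t \<in> ?ST \<and> x \<otimes> inv t \<in> J" by (rule ex1I[of _ "?q x"]) (use q[OF x] u[OF x] in blast)+
    qed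
  qed
  show "coset_rep J ?ST x = ?q x" if "x \<in> H"
    using coset_rep_eqI[OF H J(1) _ tr that] q[OF that] I(2) J(2) by blast
qed

text \<open>In the coset representative of s t h the \<open>T\<close>-component depends on t alone,
  so the factors with fixed t make up the transfer from \<open>I\<close> to \<open>J\<close> of the
  factor at t.\<close>

lemma transfer_trans:
  assumes H: "subgroup H G" and I: "subgroup I G" "I \<subseteq> H" and J: "subgroup J G" "J \<subseteq> I"
    and T: "transversal H I T" "finite T" and S: "transversal I J S" "finite S" and h: "h \<in> H"
    and A: "comm_group A" and \<theta>: "\<And>x. x \<in> J \<Longrightarrow> \<theta> x \<in> carrier A"
  shows "transfer J (\<Union>t\<in>T. (\<lambda>s. s \<otimes> t) ` S) A \<theta> h = transfer I T A (transfer J S A \<theta>) h"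
proof -
  interpret H: subgroup H G by fact
  interpret I: subgroup I G by fact
  interpret A: comm_group A by fact
  let ?ST = "\<Union>t\<in>T. (\<lambda>s. s \<otimes> t) ` S"
  note tr = transversal_mult[OF H I J T(1) S(1)]
  note rT = coset_rep[OF H I T(1)] and rS = coset_rep[OF I(1) J S(1)]
  have TH: "t \<in> H" if "t \<in> T" for t using that T by (auto simp: transversal_def)
  have SI: "s \<in> I" if "s \<in> S" for s using that S by (auto simp: transversal_def)
  let ?f = "\<lambda>x. \<theta> (x \<otimes> h \<otimes> inv (coset_rep J ?ST (x \<otimes> h)))"
  let ?i = "\<lambda>t. t \<otimes> h \<otimes> inv (coset_rep I T (t \<otimes> h))"
  have JH: "J \<subseteq> H" using I J by blast
  have fc: "?f x \<in> carrier A" if "x \<in> ?ST" for x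
  proof -
    have "x \<in> H" using that TH SI I(2) by auto
    then show ?thesis using coset_rep(2)[OF H J(1) JH tr(1), of "x \<otimes> h"] \<theta> h by simp
  qed
  have eq: "?f (s \<otimes> t) = \<theta> (s \<otimes> ?i t \<otimes> inv (coset_rep J S (s \<otimes> ?i t)))" if t: "t \<in> T" and s: "s \<in> S" for s t
  proof -
    have th: "t \<otimes> h \<in> H" using TH[OF t] h by simp
    note r = rT[OF th]
    have sth: "s \<otimes> t \<otimes> h \<in> H" using TH[OF t] SI[OF s] I(2) h by auto
    have si: "s \<otimes> ?i t \<in> I" using r(2) SI[OF s] by simp
    note q = rS[OF si]
    have c: "s \<in> carrier G" "t \<in> carrier G" "h \<in> carrier G" using SI[OF s] TH[OF t] h by auto
    have e1: "s \<otimes> t \<otimes> h \<otimes> inv (coset_rep I T (t \<otimes> h)) = s \<otimes> ?i t" using c r(3) by (simp add: m_assoc)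
    have "coset_rep I T (s \<otimes> t \<otimes> h) = coset_rep I T (t \<otimes> h)"
      by (rule coset_rep_eqI[OF H I T(1) sth r(1)]) (use si e1 in simp)
    then have "coset_rep J ?ST (s \<otimes> t \<otimes> h) = coset_rep J S (s \<otimes> ?i t) \<otimes> coset_rep I T (t \<otimes> h)"
      using tr(2)[OF sth] e1 by simp
    moreover have "s \<otimes> t \<otimes> h \<otimes> inv (coset_rep J S (s \<otimes> ?i t) \<otimes> coset_rep I T (t \<otimes> h)) =
        s \<otimes> ?i t \<otimes> inv (coset_rep J S (s \<otimes> ?i t))"
      using c r(3) I.mem_carrier[OF q(3)] H.mem_carrier[OF r(3)] by (simp add: group_norm)
    ultimately show ?thesis by simp
  qed
  have inj: "inj_on (\<lambda>s. s \<otimes> t) S" if "t \<in> T" for t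
    using TH[OF that] SI by (auto simp: inj_on_def)
  have inner: "finprod A ?f ((\<lambda>s. s \<otimes> t) ` S) = transfer J S A \<theta> (?i t)" if t: "t \<in> T" for t
  proof -
    have "finprod A ?f ((\<lambda>s. s \<otimes> t) ` S) = (\<Otimes>\<^bsub>A\<^esub> s \<in> S. ?f (s \<otimes> t))"
      by (rule A.finprod_reindex[OF _ inj[OF t]]) (use fc t in auto)
    also have "\<dots> = transfer J S A \<theta> (?i t)"
      unfolding transfer_def
    proof (rule A.finprod_cong'[OF refl _ eq[OF t]])
      have "?i t \<in> I" using rT(2) TH[OF t] h by simp
      then show "(\<lambda>s. \<theta> (s \<otimes> ?i t \<otimes> inv (coset_rep J S (s \<otimes> ?i t)))) \<in> S \<rightarrow> carrier A"
        using rS(2) SI \<theta> by auto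
    qed
    finally show ?thesis .
  qed
  have "transfer J ?ST A \<theta> h = (\<Otimes>\<^bsub>A\<^esub> t \<in> T. finprod A ?f ((\<lambda>s. s \<otimes> t) ` S))"
    unfolding transfer_def
  proof (rule A.finprod_UN_disjoint[OF T(2)])
    show "pairwise (\<lambda>t t'. disjnt ((\<lambda>s. s \<otimes> t) ` S) ((\<lambda>s. s \<otimes> t') ` S)) T"
    proof (rule pairwiseI)
      fix t t' assume t: "t \<in> T" "t' \<in> T" "t \<noteq> t'"
      show "disjnt ((\<lambda>s. s \<otimes> t) ` S) ((\<lambda>s. s \<otimes> t') ` S)"
      proof (rule ccontr)
        assume "\<not> disjnt ((\<lambda>s. s \<otimes> t) ` S) ((\<lambda>s. s \<otimes> t') ` S)"
        then obtain s s' where s: "s \<in> S" "s' \<in> S" "s \<otimes> t = s' \<otimes> t'" by (auto simp: disjnt_def)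
        have c: "s \<in> carrier G" "s' \<in> carrier G" "t \<in> carrier G" "t' \<in> carrier G" using s t TH SI by auto
        have "t \<otimes> inv t' = inv s \<otimes> (s \<otimes> t) \<otimes> inv t'" using c by (simp add: group_norm)
        also have "\<dots> = inv s \<otimes> s'" unfolding s(3) using c by (simp add: group_norm)
        finally have "t \<otimes> inv t' \<in> I" using SI s by simp
        then have "coset_rep I T t = t'" using coset_rep_eqI[OF H I T(1) TH[OF t(1)] t(2)] by simp
        then show False using coset_rep_self[OF H I T(1) t(1)] t(3) by simp
      qed
    qed
    show "?f x \<in> carrier A" if "t \<in> T" "x \<in> (\<lambda>s. s \<otimes> t) ` S" for t x
      using that by (intro fc) blast
  qed (simp add: S(2))
  also have "\<dots> = (\<Otimes>\<^bsub>A\<^esub> t \<in> T. transfer J S A \<theta> (?i t))"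
  proof (rule A.finprod_cong'[OF refl _ inner])
    have "transfer J S A \<theta> (?i t) \<in> carrier A" if "t \<in> T" for t
      unfolding inner[OF that, symmetric]
    proof (intro A.finprod_closed Pi_I fc)
      show "x \<in> ?ST" if "x \<in> (\<lambda>s. s \<otimes> t) ` S" for x using that \<open>t \<in> T\<close> by blast
    qed
    then show "(\<lambda>t. transfer J S A \<theta> (?i t)) \<in> T \<rightarrow> carrier A" by blast
  qed
  finally show ?thesis unfolding transfer_def[of I] .
qed

end

text \<open>The product of a subgroup with any nonempty part of one of its right cosets is the whole
  coset, so it suffices to know that the image of \<open>X\<close> lies in a single coset.\<close>

lemma quotient_fun_eq:
  assumes "group B" "subgroup N B" "b \<in> carrier B" "f ` X \<subseteq> N #>\<^bsub>B\<^esub> b" "X \<noteq> {}"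
  shows "quotient_fun B N f X = N #>\<^bsub>B\<^esub> b"
proof -
  interpret B: group B by fact
  interpret N: subgroup N B by fact
  have "N <#>\<^bsub>B\<^esub> Y = N #>\<^bsub>B\<^esub> b" if Y: "Y \<subseteq> N #>\<^bsub>B\<^esub> b" "Y \<noteq> {}" for Y
  proof (intro equalityI subsetI)
    fix x assume "x \<in> N <#>\<^bsub>B\<^esub> Y"
    then obtain n y where n: "n \<in> N" "y \<in> Y" "x = n \<otimes>\<^bsub>B\<^esub> y" unfolding set_mult_def by blast
    then obtain n' where n': "n' \<in> N" "y = n' \<otimes>\<^bsub>B\<^esub> b" using Y unfolding r_coset_def by blast
    have "x = (n \<otimes>\<^bsub>B\<^esub> n') \<otimes>\<^bsub>B\<^esub> b" using n n' assms(3) by (simp add: B.m_assoc)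
    then show "x \<in> N #>\<^bsub>B\<^esub> b" using n n' unfolding r_coset_def by blast
  next
    fix x assume "x \<in> N #>\<^bsub>B\<^esub> b"
    then obtain n where n: "n \<in> N" "x = n \<otimes>\<^bsub>B\<^esub> b" unfolding r_coset_def by blast
    obtain y where y: "y \<in> Y" using Y(2) by blast
    then obtain n' where n': "n' \<in> N" "y = n' \<otimes>\<^bsub>B\<^esub> b" using Y unfolding r_coset_def by blast
    have "x = (n \<otimes>\<^bsub>B\<^esub> inv\<^bsub>B\<^esub> n') \<otimes>\<^bsub>B\<^esub> y" using n n' assms(3) by (simp add: B.group_norm)
    moreover have "n \<otimes>\<^bsub>B\<^esub> inv\<^bsub>B\<^esub> n' \<in> N" using n n' by simp
    ultimately show "x \<in> N <#>\<^bsub>B\<^esub> Y" using y unfolding set_mult_def by blast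
  qed
  then show ?thesis using assms(4,5) by (simp add: quotient_fun_def)
qed

lemma quotient_fun_coset:
  assumes f: "group_hom A B f" and K: "subgroup K A" and N: "subgroup N B" and KN: "f ` K \<subseteq> N"
    and a: "a \<in> carrier A"
  shows "quotient_fun B N f (K #>\<^bsub>A\<^esub> a) = N #>\<^bsub>B\<^esub> f a"
proof -
  interpret f: group_hom A B f by fact
  interpret K: subgroup K A by fact
  show ?thesis
  proof (rule quotient_fun_eq[OF f.H.is_group N f.hom_closed[OF a]])
    show "f ` (K #>\<^bsub>A\<^esub> a) \<subseteq> N #>\<^bsub>B\<^esub> f a"
    proof
      fix y assume "y \<in> f ` (K #>\<^bsub>A\<^esub> a)"
      then obtain k where "k \<in> K" "y = f (k \<otimes>\<^bsub>A\<^esub> a)" unfolding r_coset_def by blast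
      then have "f k \<in> N" "y = f k \<otimes>\<^bsub>B\<^esub> f a" using KN a by auto
      then show "y \<in> N #>\<^bsub>B\<^esub> f a" unfolding r_coset_def by blast
    qed
    show "K #>\<^bsub>A\<^esub> a \<noteq> {}" using f.G.rcos_self[OF a K] by blast
  qed
qed

text \<open>Composed with the projection to the abelianization of \<open>B\<close>, the map f kills
  commutators and so respects the classes.\<close>

lemma quotient_fun_commutator:
  assumes "discrete_tgroup_loc A" "discrete_tgroup_loc B" "group_hom A B f" "c \<in> carrier A"
  shows "quotient_fun B (closed_commutator B) f (closed_commutator A #>\<^bsub>A\<^esub> c) = closed_commutator B #>\<^bsub>B\<^esub> f c"
proof -
  interpret A: discrete_tgroup_loc A by fact
  interpret B: discrete_tgroup_loc B by fact
  interpret f: group_hom A B f by fact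
  interpret fc: group_hom A "abelianization B" "\<lambda>c. closed_commutator B #>\<^bsub>B\<^esub> f c"
    using f.hom_closed B.class_closed B.class_mult B.comm_group_A
    by (auto intro!: group_hom.intro group_hom_axioms.intro simp: hom_def comm_group_def)
  have "f ` closed_commutator A \<subseteq> closed_commutator B"
  proof
    fix y assume "y \<in> f ` closed_commutator A"
    then obtain x where x: "x \<in> closed_commutator A" "y = f x" by blast
    then have "x \<in> kernel A (abelianization B) (\<lambda>c. closed_commutator B #>\<^bsub>B\<^esub> f c)"
      using fc.derived_subset_kernel[OF B.comm_group_A] A.closed_commutator_eq by blast
    then have "x \<in> carrier A" "closed_commutator B #>\<^bsub>B\<^esub> f x = closed_commutator B"
      by (auto simp: kernel_def abelianization_def tquotient_def)
    then show "y \<in> closed_commutator B" using B.class_self[of "f x"] x(2) by simp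
  qed
  then show ?thesis
    by (rule quotient_fun_coset[OF assms(3) normal_imp_subgroup[OF A.normal_D] normal_imp_subgroup[OF B.normal_D] _ assms(4)])
qed

text \<open>This guarantees that the choice made in \<open>transfer_map\<close> hits a
  transversal.\<close>

lemma (in group) right_transversal_exists:
  assumes "subgroup R G"
  shows "\<exists>T. right_transversal G R T"
proof -
  interpret R: subgroup R G by fact
  define c where "c X = (SOME x. x \<in> X)" for X :: "'a set"
  have c: "c X \<in> X" if X: "X \<in> rcosets R" for X
  proof -
    obtain x where "x \<in> carrier G" "X = R #> x" using X by (auto simp: RCOSETS_def)
    then have "x \<in> X" using rcos_self assms by blast
    then show ?thesis unfolding c_def by (rule someI)
  qed
  have e: "c X \<in> carrier G \<and> R #> c X = X" if X: "X \<in> rcosets R" for X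
  proof -
    obtain x where x: "x \<in> carrier G" "X = R #> x" using X by (auto simp: RCOSETS_def)
    have cx: "c X \<in> R #> x" using c[OF X] x by simp
    have "c X \<in> carrier G" by (rule subsetD[OF r_coset_subset_G[OF R.subset x(1)] cx])
    moreover have "R #> c X = X" unfolding x(2)[symmetric] using repr_independence[OF cx x(1) assms] x(2) by metis
    ultimately show ?thesis ..
  qed
  have "bij_betw (\<lambda>t. R #> t) (c ` (rcosets R)) (rcosets R)"
    by (rule bij_betwI[of _ _ _ c]) (use e in auto)
  moreover have "c ` (rcosets R) \<subseteq> carrier G" using e by blast
  ultimately have "right_transversal G R (c ` (rcosets R))" by (simp add: right_transversal_def)
  then show ?thesis by blast
qed

section \<open>The functor \<open>pi_K\<close> in terms of elements of \<open>G\<close>\<close>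

context fn_setting
begin

lemma conj_set_comp:
  assumes "K \<subseteq> carrier G" "g \<in> carrier G" "h \<in> carrier G"
  shows "conj_set G g (conj_set G h K) = conj_set G (g \<otimes> h) K"
proof -
  have "g \<otimes> (h \<otimes> x \<otimes> inv h) \<otimes> inv g = g \<otimes> h \<otimes> x \<otimes> inv (g \<otimes> h)" if "x \<in> K" for x
    using assms that by (auto simp: group_norm)
  moreover have "conj_set G h K \<subseteq> carrier G" using assms by (auto simp: conj_set_eq)
  ultimately show ?thesis using assms by (auto simp: conj_set_eq image_image)
qed

lemma open_in_group_conj:
  assumes "open_in_group G H U" "subgroup H G" "g \<in> carrier G" "subgroup (conj_set G g U) G"
  shows "open_in_group G (conj_set G g H) (conj_set G g U)"
proof -
  obtain T where T: "openin (topo G) T" "U = T \<inter> H" using assms(1) by (auto simp: open_in_group_def openin_subtopology)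
  have Tc: "T \<subseteq> carrier G" using openin_subset[OF T(1)] by simp
  have "conj_set G g U = conj_set G g T \<inter> conj_set G g H"
    unfolding T(2) by (rule conj_set_Int[OF Tc subgroup.subset[OF assms(2)] assms(3)])
  moreover have "openin (topo G) (conj_set G g T)"
    unfolding conj_set_def using openin_r_coset[OF _ openin_l_coset[OF assms(3) T(1)], of "inv g"] assms(3) by simp
  moreover have "U \<subseteq> H" using assms(1) by (simp add: open_in_group_def)
  then have "conj_set G g U \<subseteq> conj_set G g H"
    using subgroup.subset[OF assms(2)] assms(3) by (auto simp: conj_set_eq)
  ultimately show ?thesis using assms(4) unfolding open_in_group_def openin_subtopology by blast
qed

abbreviation "EO \<equiv> open_part G E"

sublocale E: ric_domain G "conj_pair G" E
  using spectrum by (simp add: spectrum_def two_dim_system_def)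

lemma conj_pair_simp [simp]: "conj_pair G g (H, U) = (conj_set G g H, conj_set G g U)"
  by (simp add: conj_pair_def)

lemma EO_conj: "(H, U) \<in> base EO \<Longrightarrow> g \<in> carrier G \<Longrightarrow> (conj_set G g H, conj_set G g U) \<in> base EO"
proof -
  assume HU: "(H, U) \<in> base EO" and g: "g \<in> carrier G"
  note D = open_partD[OF HU]
  have "(conj_set G g H, conj_set G g U) \<in> base E" using E.act_closed[OF g D(5)] by simp
  moreover have "open_in_group G (conj_set G g H) (conj_set G g U)"
    using open_in_group_conj[OF D(3) M_subgroup[OF D(2)] g] M_subgroup[OF M.act_closed[OF g open_base[OF D(2,3)]]] .
  ultimately show ?thesis by (simp add: open_part_def open_pairs_def)
qed

lemma EO_rdom:
  assumes "(H, U) \<in> base EO" "(I, V) \<in> rdom EO (H, U)"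
  shows "(I, V) \<in> base EO" "V = U" "I \<subseteq> H" "I \<in> rdom M H" "(I, V) \<in> rdom E (H, U)"
proof -
  note D = open_partD[OF assms(1)]
  have IV: "(I, V) \<in> rdom E (H, U)" "open_in_group G I V" using assms(2) by (auto simp: open_part_def open_pairs_def)
  then show "(I, V) \<in> rdom E (H, U)" by blast
  have "(I, V) \<in> base E" using E.rdom_sub[OF D(5)] IV by blast
  then show "(I, V) \<in> base EO" using IV by (simp add: open_part_def open_pairs_def)
  have "\<forall>(H, U) \<in> base E. \<forall>(I, V) \<in> rdom E (H, U). V = U" using spectrum by (simp add: spectrum_def)
  then show "V = U" using D(5) IV by blast
  have "I \<in> rdom (flat E) H" using D(5) IV by (force simp: flat_def Ext_def)
  then show Ir: "I \<in> rdom M H" using cover_M D(1) by (auto simp: mackey_cover_def subsystem_def)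
  then show "I \<subseteq> H" using rdom_idom_subset[OF D(2)] by blast
qed

lemma EO_idom:
  assumes "(H, U) \<in> base EO" "(I, V) \<in> idom EO (H, U)"
  shows "(I, V) \<in> base EO" "V \<subseteq> U" "I \<subseteq> H" "I \<in> idom M H" "V \<in> idom M U" "(I, V) \<in> idom E (H, U)"
proof -
  note D = open_partD[OF assms(1)]
  have IV: "(I, V) \<in> idom E (H, U)" "open_in_group G I V" using assms(2) by (auto simp: open_part_def open_pairs_def)
  then show "(I, V) \<in> idom E (H, U)" by blast
  have "(I, V) \<in> base E" using E.idom_sub[OF D(5)] IV by blast
  then show "(I, V) \<in> base EO" using IV by (simp add: open_part_def open_pairs_def)
  have "I \<in> idom (flat E) H" using D(5) IV by (force simp: flat_def Ext_def)
  then show Ir: "I \<in> idom M H" using cover_M D(1) by (auto simp: mackey_cover_def subsystem_def)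
  then show "I \<subseteq> H" using rdom_idom_subset[OF D(2)] by blast
  have "\<forall>(H, U) \<in> base E. \<forall>(I, V) \<in> idom E (H, U). V \<in> idom M U" using cover_M by (simp add: mackey_cover_def)
  then show Vi: "V \<in> idom M U" using D(5) IV by blast
  then show "V \<subseteq> U" using rdom_idom_subset[OF open_base[OF D(2,3)]] by blast
qed

definition pi_class :: "'g set \<times> 'g set \<Rightarrow> 'g \<Rightarrow> 'g set set" where
  "pi_class x g = ab_class G x (snd x #> g)"

lemma quot_loc: "(H, U) \<in> base EO \<Longrightarrow> discrete_tgroup_loc (quot G (H, U))"
  using discrete_quot[OF open_partD(2-4)]
  by (simp add: discrete_tgroup_loc_def discrete_tgroup_loc_axioms_def discrete_group_def)

lemma pi_class_closed: "(H, U) \<in> base EO \<Longrightarrow> g \<in> H \<Longrightarrow> pi_class (H, U) g \<in> carrier (Obj (pi_K G) (H, U))"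
  by (simp add: pi_class_def carrier_pi_K carrier_quot)

lemma pi_class_mult:
  assumes "(H, U) \<in> base EO" "g \<in> H" "h \<in> H"
  shows "pi_class (H, U) (g \<otimes> h) = pi_class (H, U) g \<otimes>\<^bsub>Obj (pi_K G) (H, U)\<^esub> pi_class (H, U) h"
proof -
  note D = open_partD[OF assms(1)]
  interpret a: group_hom "quot G (H, U)" "Obj (pi_K G) (H, U)" "ab_class G (H, U)" by (rule ab_class_hom[OF assms(1)])
  have c: "U #> g \<in> carrier (quot G (H, U))" "U #> h \<in> carrier (quot G (H, U))" using assms by (auto simp: carrier_quot)
  show ?thesis
    unfolding pi_class_def snd_conv rcos_sum_in[OF M_subgroup[OF D(2)] D(4) assms(2,3), symmetric]
    using a.hom_mult[OF c] by (simp add: mult_quot)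
qed

lemma pi_class_cases:
  assumes "(H, U) \<in> base EO" "X \<in> carrier (Obj (pi_K G) (H, U))"
  obtains g where "g \<in> H" "X = pi_class (H, U) g"
  using assms by (auto simp: pi_class_def carrier_pi_K carrier_quot)

lemma pi_class_frob:
  assumes HU: "(H, U) \<in> base EO" and X: "X \<in> carrier (Obj (pi_K G) (H, U))"
  obtains h n where "frob_exp H h n" "X = pi_class (H, U) h"
proof -
  note D = open_partD[OF HU]
  obtain c where c: "c \<in> carrier (quot G (H, U))" "X = ab_class G (H, U) c" using X carrier_pi_K[OF HU] by auto
  obtain h n where "frob_exp H h n" "U #> h = c" by (rule frob_lift_exists[OF D(2-4) c(1)])
  then show ?thesis using that c(2) by (simp add: pi_class_def)
qed

lemma Upsilon_pi_class:
  assumes HU: "(H, U) \<in> base EO" and "frob_exp H h n" "\<pi> \<in> prime_elements \<omega> C v (\<Sigma> U h)"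
  shows "Upsilon P G \<Omega> \<omega> d C v (H, U) (pi_class (H, U) h) = ind_image C H U #>\<^bsub>Obj C H\<^esub> recip_elem H U h n \<pi>"
proof -
  note D = open_partD[OF HU]
  have "U #> h \<in> carrier (quot G (H, U))" using h_in[OF D(2-4) assms(2)] by (simp add: carrier_quot)
  then show ?thesis using Upsilon_ab_class[OF HU] Upsilon'_eq[OF HU assms(2,3)] by (simp add: pi_class_def)
qed

lemma group_hom_quot_Ind:
  assumes HU: "(H, U) \<in> base EO" and IV: "(I, V) \<in> base EO" and sub: "I \<subseteq> H" "V \<subseteq> U"
  shows "group_hom (quot G (I, V)) (quot G (H, U)) (\<lambda>c. U <#> c)"
    and "g \<in> I \<Longrightarrow> U <#> (V #> g) = U #> g"
proof -
  note D = open_partD[OF HU] and D' = open_partD[OF IV]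
  have Us: "subgroup U G" and Vs: "subgroup V G" using U_subgroup[OF D(2-4)] U_subgroup[OF D'(2-4)] .
  have e: "U <#> (V #> g) = U #> g" if g: "g \<in> I" for g
  proof (intro equalityI subsetI)
    have gc: "g \<in> carrier G" using M_carrier[OF D'(2) g] .
    fix x assume "x \<in> U <#> (V #> g)"
    then obtain u w where u: "u \<in> U" "w \<in> V" "x = u \<otimes> (w \<otimes> g)" unfolding set_mult_def r_coset_def by blast
    then have "x = (u \<otimes> w) \<otimes> g" using gc subgroup.mem_carrier[OF Us u(1)] subgroup.mem_carrier[OF Vs u(2)] by (simp add: m_assoc)
    moreover have "u \<otimes> w \<in> U" using u sub(2) subgroup.m_closed[OF Us] by blast
    ultimately show "x \<in> U #> g" unfolding r_coset_def by blast
  next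
    fix x assume "x \<in> U #> g"
    then obtain u where u: "u \<in> U" "x = u \<otimes> g" unfolding r_coset_def by blast
    have "g \<in> V #> g" by (rule rcos_self[OF M_carrier[OF D'(2) g] Vs])
    then show "x \<in> U <#> (V #> g)" using u unfolding set_mult_def by blast
  qed
  then show "g \<in> I \<Longrightarrow> U <#> (V #> g) = U #> g" by blast
  interpret Q: discrete_tgroup_loc "quot G (I, V)" by (rule quot_loc[OF IV])
  interpret Q': discrete_tgroup_loc "quot G (H, U)" by (rule quot_loc[OF HU])
  have "(\<lambda>c. U <#> c) \<in> hom (quot G (I, V)) (quot G (H, U))"
  proof (rule homI)
    fix c c' assume c: "c \<in> carrier (quot G (I, V))" "c' \<in> carrier (quot G (I, V))"
    then obtain g g' where g: "g \<in> I" "c = V #> g" "g' \<in> I" "c' = V #> g'" unfolding carrier_quot by blast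
    have gg: "g \<otimes> g' \<in> I" using g M_subgroup[OF D'(2)] by (simp add: subgroup.m_closed)
    show "U <#> (c \<otimes>\<^bsub>quot G (I, V)\<^esub> c') = (U <#> c) \<otimes>\<^bsub>quot G (H, U)\<^esub> (U <#> c')"
      unfolding mult_quot g(2,4) rcos_sum_in[OF M_subgroup[OF D'(2)] D'(4) g(1,3)] e[OF g(1)] e[OF g(3)] e[OF gg]
      using rcos_sum_in[OF M_subgroup[OF D(2)] D(4), of g g'] g sub(1) by auto
  next
    fix c assume "c \<in> carrier (quot G (I, V))"
    then show "U <#> c \<in> carrier (quot G (H, U))" using e sub(1) by (auto simp: carrier_quot)
  qed
  then show "group_hom (quot G (I, V)) (quot G (H, U)) (\<lambda>c. U <#> c)"
    by (intro group_hom.intro group_hom_axioms.intro Q.is_group Q'.is_group)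
qed

lemma pi_K_Ind:
  assumes HU: "(H, U) \<in> base EO" and IV: "(I, V) \<in> base EO" and sub: "I \<subseteq> H" "V \<subseteq> U" and g: "g \<in> I"
  shows "Ind (pi_K G) (H, U) (I, V) (pi_class (I, V) g) = pi_class (H, U) g"
proof -
  have "V #> g \<in> carrier (quot G (I, V))" using g by (simp add: carrier_quot)
  from quotient_fun_commutator[OF quot_loc[OF IV] quot_loc[OF HU] group_hom_quot_Ind(1)[OF HU IV sub] this]
  show ?thesis
    by (simp add: pi_K_def pi_class_def ab_class_def group_hom_quot_Ind(2)[OF HU IV sub g])
qed

lemma conj_r_coset:
  assumes "subgroup U G" "g \<in> carrier G" "h \<in> carrier G"
  shows "conj_set G g (U #> h) = conj_set G g U #> (g \<otimes> h \<otimes> inv g)"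
proof -
  interpret U: subgroup U G by fact
  have "U #> h \<subseteq> carrier G" using r_coset_subset_G[OF U.subset assms(3)] .
  moreover have "g \<otimes> (u \<otimes> h) \<otimes> inv g = (g \<otimes> u \<otimes> inv g) \<otimes> (g \<otimes> h \<otimes> inv g)" if "u \<in> U" for u
    by (rule conj_mult[OF assms(2) U.mem_carrier[OF that] assms(3)])
  ultimately show ?thesis
    by (simp add: conj_set_eq[OF _ assms(2)] U.subset)
      (simp add: r_coset_def UNION_singleton_eq_range image_image cong: image_cong)
qed

lemma group_hom_quot_Con:
  assumes HU: "(H, U) \<in> base EO" and g: "g \<in> carrier G"
  shows "group_hom (quot G (H, U)) (quot G (conj_set G g H, conj_set G g U)) (conj_set G g)"
proof -
  note D = open_partD[OF HU] and HU' = EO_conj[OF HU g]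
  note D' = open_partD[OF HU']
  have Us: "subgroup U G" using U_subgroup[OF D(2-4)] .
  interpret Q: discrete_tgroup_loc "quot G (H, U)" by (rule quot_loc[OF HU])
  interpret Q': discrete_tgroup_loc "quot G (conj_set G g H, conj_set G g U)" by (rule quot_loc[OF HU'])
  have gh: "g \<otimes> h \<otimes> inv g \<in> conj_set G g H" if "h \<in> H" for h
    using that g conj_set_eq[OF subgroup.subset[OF M_subgroup[OF D(2)]] g] by blast
  have "conj_set G g \<in> hom (quot G (H, U)) (quot G (conj_set G g H, conj_set G g U))"
  proof (rule homI)
    fix c c' assume c: "c \<in> carrier (quot G (H, U))" "c' \<in> carrier (quot G (H, U))"
    then obtain h h' where h: "h \<in> H" "c = U #> h" "h' \<in> H" "c' = U #> h'" unfolding carrier_quot by blast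
    have hc: "h \<in> carrier G" "h' \<in> carrier G" using h M_carrier[OF D(2)] by auto
    show "conj_set G g (c \<otimes>\<^bsub>quot G (H, U)\<^esub> c') = conj_set G g c \<otimes>\<^bsub>quot G (conj_set G g H, conj_set G g U)\<^esub> conj_set G g c'"
      unfolding mult_quot h(2,4) rcos_sum_in[OF M_subgroup[OF D(2)] D(4) h(1,3)]
        conj_r_coset[OF Us g hc(1)] conj_r_coset[OF Us g hc(2)] conj_r_coset[OF Us g m_closed[OF hc]]
        rcos_sum_in[OF M_subgroup[OF D'(2)] D'(4) gh[OF h(1)] gh[OF h(3)]] conj_mult[OF g hc] ..
  next
    fix c assume "c \<in> carrier (quot G (H, U))"
    then obtain h where h: "h \<in> H" "c = U #> h" unfolding carrier_quot by blast
    show "conj_set G g c \<in> carrier (quot G (conj_set G g H, conj_set G g U))"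
      unfolding h(2) conj_r_coset[OF Us g M_carrier[OF D(2) h(1)]] carrier_quot using gh[OF h(1)] by blast
  qed
  then show ?thesis by (intro group_hom.intro group_hom_axioms.intro Q.is_group Q'.is_group)
qed

lemma pi_K_Con:
  assumes HU: "(H, U) \<in> base EO" and g: "g \<in> carrier G" and h: "h \<in> H"
  shows "Con (pi_K G) g (H, U) (pi_class (H, U) h) = pi_class (conj_set G g H, conj_set G g U) (g \<otimes> h \<otimes> inv g)"
proof -
  note D = open_partD[OF HU]
  have "U #> h \<in> carrier (quot G (H, U))" using h by (simp add: carrier_quot)
  from quotient_fun_commutator[OF quot_loc[OF HU] quot_loc[OF EO_conj[OF HU g]] group_hom_quot_Con[OF HU g] this]
  show ?thesis
    by (simp add: pi_K_def pi_class_def ab_class_def conj_r_coset[OF U_subgroup[OF D(2-4)] g M_carrier[OF D(2) h]])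
qed

text \<open>\<open>transfer_map\<close> is defined in H/U by two arbitrary choices. As
  \<open>U\<close> lies in \<open>I\<close>, lifting the chosen transversal to \<open>H\<close>
  gives a transversal of \<open>I\<close> in \<open>H\<close>, and independence of the transversal
  then allows any \<open>T\<close>.\<close>

lemma pi_K_Res:
  assumes HU: "(H, U) \<in> base EO" and IU: "(I, U) \<in> base EO" and sub: "I \<subseteq> H"
    and T: "transversal H I T" and h: "h \<in> H"
  shows "Res (pi_K G) (I, U) (H, U) (pi_class (H, U) h) = transfer I T (Obj (pi_K G) (I, U)) (pi_class (I, U)) h"
proof -
  note D = open_partD[OF HU] and D' = open_partD[OF IU]
  let ?Q = "quot G (H, U)" and ?R = "quot G (I, U)"
  let ?A = "Obj (pi_K G) (I, U)" and ?\<theta> = "pi_class (I, U)"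
  interpret Q: discrete_tgroup_loc ?Q by (rule quot_loc[OF HU])
  interpret R: discrete_tgroup_loc ?R by (rule quot_loc[OF IU])
  interpret H: subgroup H G by (rule M_subgroup[OF D(2)])
  interpret I: subgroup I G by (rule M_subgroup[OF D'(2)])
  interpret U: subgroup U G by (rule U_subgroup[OF D(2-4)])
  have UI: "U \<subseteq> I" using D'(3) by (simp add: open_in_group_def)
  have A: "comm_group ?A" by (rule comm_group_pi_K[OF IU])
  interpret A: comm_group ?A by (rule A)
  have th: "?\<theta> x \<in> carrier ?A" "?\<theta> (x \<otimes> y) = ?\<theta> x \<otimes>\<^bsub>?A\<^esub> ?\<theta> y" if "x \<in> I" "y \<in> I" for x y
    using pi_class_closed[OF IU] pi_class_mult[OF IU] that by auto
  have sum: "(U #> x) <#> (U #> y) = U #> (x \<otimes> y)" if "x \<in> H" "y \<in> H" for x y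
    by (rule rcos_sum_in[OF H.subgroup_axioms D(4) that])
  have coset_eq: "U #> x = U #> y \<longleftrightarrow> x \<otimes> inv y \<in> U" if "x \<in> H" "y \<in> H" for x y
  proof
    have c: "x \<in> carrier G" "y \<in> carrier G" using that by auto
    assume "U #> x = U #> y"
    then have "x \<in> U #> y" using rcos_self[OF c(1) U.subgroup_axioms] by simp
    then obtain u where "u \<in> U" "x = u \<otimes> y" unfolding r_coset_def by blast
    then show "x \<otimes> inv y \<in> U" using c by (simp add: m_assoc)
  next
    have c: "x \<in> carrier G" "y \<in> carrier G" using that by auto
    assume "x \<otimes> inv y \<in> U"
    moreover have "x = x \<otimes> inv y \<otimes> y" using c by (simp add: m_assoc)
    ultimately have "x \<in> U #> y" unfolding r_coset_def by blast
    then show "U #> x = U #> y" using repr_independence[OF _ c(2) U.subgroup_axioms] by simp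
  qed
  have Rs: "subgroup (carrier ?R) ?Q"
  proof (rule Q.subgroupI)
    show "carrier ?R \<subseteq> carrier ?Q" using sub by (auto simp: carrier_quot)
    show "carrier ?R \<noteq> {}" using R.one_closed by blast
    show "inv\<^bsub>?Q\<^esub> a \<in> carrier ?R" if a: "a \<in> carrier ?R" for a
    proof -
      obtain x where x: "x \<in> I" "a = U #> x" using a by (auto simp: carrier_quot)
      have "inv\<^bsub>?Q\<^esub> a = U #> inv x"
      proof (rule Q.inv_equality)
        show "(U #> inv x) \<otimes>\<^bsub>?Q\<^esub> a = \<one>\<^bsub>?Q\<^esub>"
          unfolding mult_quot x(2) using sum[of "inv x" x] x(1) sub
          by (auto simp: one_quot coset_mult_one U.subset)
      qed (use x sub in \<open>auto simp: carrier_quot\<close>)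
      then show ?thesis using x by (simp add: carrier_quot)
    qed
    show "a \<otimes>\<^bsub>?Q\<^esub> b \<in> carrier ?R" if "a \<in> carrier ?R" "b \<in> carrier ?R" for a b
      using R.m_closed[OF that] by (simp add: mult_quot)
  qed
  define T' where "T' = (SOME T. right_transversal ?Q (carrier ?R) T)"
  have T': "right_transversal ?Q (carrier ?R) T'"
    unfolding T'_def using Q.right_transversal_exists[OF Rs] by (rule someI_ex)
  have T'c: "t \<in> carrier ?Q" if "t \<in> T'" for t using T' that by (auto simp: right_transversal_def)
  define \<tau> where "\<tau> t = (SOME g. g \<in> H \<and> U #> g = t)" for t
  have \<tau>: "\<tau> t \<in> H \<and> U #> \<tau> t = t" if "t \<in> T'" for t
  proof -
    have "\<exists>g. g \<in> H \<and> U #> g = t" using T'c[OF that] by (auto simp: carrier_quot)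
    then show ?thesis unfolding \<tau>_def by (rule someI_ex)
  qed
  have R_coset: "x \<otimes> inv (\<tau> t) \<in> I \<longleftrightarrow> carrier ?R #>\<^bsub>?Q\<^esub> (U #> x) = carrier ?R #>\<^bsub>?Q\<^esub> t" if x: "x \<in> H" and t: "t \<in> T'" for x t
  proof -
    have xq: "U #> x \<in> carrier ?Q" using x by (simp add: carrier_quot)
    have tH: "\<tau> t \<in> H" using \<tau>[OF t] by blast
    have c: "x \<in> carrier G" "\<tau> t \<in> carrier G" using x tH by auto
    show ?thesis
    proof
      assume i: "x \<otimes> inv (\<tau> t) \<in> I"
      have "U #> x = (U #> (x \<otimes> inv (\<tau> t))) <#> (U #> \<tau> t)"
        using sum[of "x \<otimes> inv (\<tau> t)" "\<tau> t"] x tH c by (simp add: m_assoc)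
      then have "U #> x = (U #> (x \<otimes> inv (\<tau> t))) \<otimes>\<^bsub>?Q\<^esub> t" using \<tau>[OF t] by (simp add: mult_quot)
      moreover have "U #> (x \<otimes> inv (\<tau> t)) \<in> carrier ?R" using i by (simp add: carrier_quot)
      ultimately have "U #> x \<in> carrier ?R #>\<^bsub>?Q\<^esub> t"
        using Q.rcosI[OF _ subgroup.subset[OF Rs] T'c[OF t]] by metis
      from Q.repr_independence[OF this T'c[OF t] Rs]
      show "carrier ?R #>\<^bsub>?Q\<^esub> (U #> x) = carrier ?R #>\<^bsub>?Q\<^esub> t" by (rule sym)
    next
      assume "carrier ?R #>\<^bsub>?Q\<^esub> (U #> x) = carrier ?R #>\<^bsub>?Q\<^esub> t"
      then have "U #> x \<in> carrier ?R #>\<^bsub>?Q\<^esub> t" using Q.rcos_self[OF xq Rs] by simp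
      then obtain Y where "Y \<in> carrier ?R" "U #> x = Y \<otimes>\<^bsub>?Q\<^esub> t" unfolding r_coset_def[of ?Q] by blast
      then obtain y where y: "y \<in> I" "U #> x = (U #> y) <#> (U #> \<tau> t)"
        using \<tau>[OF t] by (auto simp: mult_quot carrier_quot)
      then have "U #> x = U #> (y \<otimes> \<tau> t)" using sum[OF subsetD[OF sub y(1)] tH] by simp
      moreover have "y \<otimes> \<tau> t \<in> H" using y(1) sub tH by blast
      ultimately have xy: "x \<otimes> inv (y \<otimes> \<tau> t) \<in> U" using coset_eq[OF x] by blast
      have "x \<otimes> inv (\<tau> t) = x \<otimes> inv (y \<otimes> \<tau> t) \<otimes> y" using c I.mem_carrier[OF y(1)] by (simp add: group_norm)
      then show "x \<otimes> inv (\<tau> t) \<in> I" using xy y(1) UI by auto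
    qed
  qed
  have inj: "inj_on \<tau> T'" by (metis \<tau> inj_onI)
  have TT: "transversal H I (\<tau> ` T')"
    unfolding transversal_def
  proof (intro conjI ballI)
    show "\<tau> ` T' \<subseteq> H" using \<tau> by blast
    fix x assume x: "x \<in> H"
    have "carrier ?R #>\<^bsub>?Q\<^esub> (U #> x) \<in> rcosets\<^bsub>?Q\<^esub> carrier ?R"
      using x by (auto simp: RCOSETS_def carrier_quot)
    moreover have "(\<lambda>t. carrier ?R #>\<^bsub>?Q\<^esub> t) ` T' = rcosets\<^bsub>?Q\<^esub> carrier ?R"
      using T' by (simp add: right_transversal_def bij_betw_def)
    ultimately have "carrier ?R #>\<^bsub>?Q\<^esub> (U #> x) \<in> (\<lambda>t. carrier ?R #>\<^bsub>?Q\<^esub> t) ` T'" by simp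
    then obtain t where t: "t \<in> T'" "carrier ?R #>\<^bsub>?Q\<^esub> (U #> x) = carrier ?R #>\<^bsub>?Q\<^esub> t"
      by (rule imageE)
    show "\<exists>!t. t \<in> \<tau> ` T' \<and> x \<otimes> inv t \<in> I"
    proof (rule ex1I[of _ "\<tau> t"])
      show "\<tau> t \<in> \<tau> ` T' \<and> x \<otimes> inv (\<tau> t) \<in> I" using R_coset[OF x t(1)] t by blast
      fix s assume "s \<in> \<tau> ` T' \<and> x \<otimes> inv s \<in> I"
      then obtain t' where t': "t' \<in> T'" "s = \<tau> t'" "x \<otimes> inv (\<tau> t') \<in> I" by blast
      then have "carrier ?R #>\<^bsub>?Q\<^esub> t' = carrier ?R #>\<^bsub>?Q\<^esub> t" using R_coset[OF x t'(1)] t by simp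
      then have "t' = t" using T' t(1) t'(1) by (auto simp: right_transversal_def bij_betw_def inj_on_def)
      then show "s = \<tau> t" using t' by simp
    qed
  qed
  have finQ: "finite (carrier ?Q)"
    using finite_rcosets_open[OF H.subgroup_axioms M_compact[OF D(2)] D(3)]
    by (simp add: carrier_quot RCOSETS_def) (simp add: UNION_singleton_eq_range)
  have fT: "finite (\<tau> ` T')" using finite_subset[OF _ finQ, of T'] T'c by blast
  have elem: "transfer_elem ?Q ?R T' (U #> x) = transfer I (\<tau> ` T') ?A ?\<theta> x" if x: "x \<in> H" for x
  proof -
    let ?F = "\<lambda>t. ?\<theta> (t \<otimes> x \<otimes> inv (coset_rep I (\<tau> ` T') (t \<otimes> x)))"
    have F: "?F \<in> \<tau> ` T' \<rightarrow> carrier ?A"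
      by (rule transfer_factor_closed[OF H.subgroup_axioms I.subgroup_axioms sub A th TT x])
    have eq: "closed_commutator ?R #>\<^bsub>?R\<^esub> (THE r. r \<in> carrier ?R \<and> (\<exists>t'\<in>T'. t \<otimes>\<^bsub>?Q\<^esub> (U #> x) = r \<otimes>\<^bsub>?Q\<^esub> t')) = ?F (\<tau> t)"
      if t: "t \<in> T'" for t
    proof -
      have tH: "\<tau> t \<in> H" using \<tau>[OF t] by blast
      have txH: "\<tau> t \<otimes> x \<in> H" using tH x by simp
      note r = coset_rep[OF H.subgroup_axioms I.subgroup_axioms sub TT txH]
      obtain t1 where t1: "t1 \<in> T'" "coset_rep I (\<tau> ` T') (\<tau> t \<otimes> x) = \<tau> t1" using r(1) by blast
      have t1H: "\<tau> t1 \<in> H" using \<tau>[OF t1(1)] by blast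
      let ?i = "\<tau> t \<otimes> x \<otimes> inv (\<tau> t1)"
      have i: "?i \<in> I" using r(2) t1(2) by simp
      have tx: "t \<otimes>\<^bsub>?Q\<^esub> (U #> x) = U #> (\<tau> t \<otimes> x)" unfolding mult_quot using sum[OF tH x] \<tau>[OF t] by simp
      have iq: "U #> ?i \<in> carrier ?R" using i by (simp add: carrier_quot)
      have it: "(U #> ?i) \<otimes>\<^bsub>?Q\<^esub> t1 = U #> (\<tau> t \<otimes> x)"
        unfolding mult_quot using sum[of ?i "\<tau> t1"] \<tau>[OF t1(1)] i sub tH x t1H by (auto simp: m_assoc)
      have "(THE r. r \<in> carrier ?R \<and> (\<exists>t'\<in>T'. t \<otimes>\<^bsub>?Q\<^esub> (U #> x) = r \<otimes>\<^bsub>?Q\<^esub> t')) = U #> ?i"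
      proof (rule the_equality)
        show "U #> ?i \<in> carrier ?R \<and> (\<exists>t'\<in>T'. t \<otimes>\<^bsub>?Q\<^esub> (U #> x) = (U #> ?i) \<otimes>\<^bsub>?Q\<^esub> t')"
          using iq tx it t1(1) by metis
        fix r assume r: "r \<in> carrier ?R \<and> (\<exists>t'\<in>T'. t \<otimes>\<^bsub>?Q\<^esub> (U #> x) = r \<otimes>\<^bsub>?Q\<^esub> t')"
        then obtain t' where t': "t' \<in> T'" "U #> (\<tau> t \<otimes> x) = r \<otimes>\<^bsub>?Q\<^esub> t'" using tx by auto
        have "U #> (\<tau> t \<otimes> x) \<in> carrier ?R #>\<^bsub>?Q\<^esub> t'"
          unfolding t'(2) using r Q.rcosI[OF _ subgroup.subset[OF Rs] T'c[OF t'(1)]] by blast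
        from Q.repr_independence[OF this T'c[OF t'(1)] Rs]
        have "carrier ?R #>\<^bsub>?Q\<^esub> (U #> (\<tau> t \<otimes> x)) = carrier ?R #>\<^bsub>?Q\<^esub> t'" by (rule sym)
        then have "\<tau> t \<otimes> x \<otimes> inv (\<tau> t') \<in> I" using R_coset[OF txH t'(1)] by blast
        from coset_rep_eqI[OF H.subgroup_axioms I.subgroup_axioms sub TT txH imageI[OF t'(1)] this]
        have "\<tau> t' = \<tau> t1" using t1(2) by simp
        then have "t' = t1" using inj_onD[OF inj _ t'(1) t1(1)] by blast
        then have "r \<otimes>\<^bsub>?Q\<^esub> t1 = (U #> ?i) \<otimes>\<^bsub>?Q\<^esub> t1" using t'(2) it by simp
        then show "r = U #> ?i"
          using r iq subgroup.mem_carrier[OF Rs] T'c[OF t1(1)] by simp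
      qed
      then show ?thesis unfolding t1(2) by (simp add: pi_class_def ab_class_def)
    qed
    have "transfer_elem ?Q ?R T' (U #> x) = (\<Otimes>\<^bsub>?A\<^esub> t \<in> T'. ?F (\<tau> t))"
      unfolding transfer_elem_def Obj_pi_K[OF IU, symmetric]
      by (rule A.finprod_cong'[OF refl _ eq]) (use F in auto)
    also have "\<dots> = transfer I (\<tau> ` T') ?A ?\<theta> x"
      unfolding transfer_def by (rule A.finprod_reindex[OF _ inj, symmetric]) (use F in auto)
    finally show ?thesis .
  qed
  have tm: "transfer I (\<tau> ` T') ?A ?\<theta> (x \<otimes> y) = transfer I (\<tau> ` T') ?A ?\<theta> x \<otimes>\<^bsub>?A\<^esub> transfer I (\<tau> ` T') ?A ?\<theta> y"
    if "x \<in> H" "y \<in> H" for x y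
    by (rule transfer_mult[OF H.subgroup_axioms I.subgroup_axioms sub A th TT fT that])
  have tc: "transfer I (\<tau> ` T') ?A ?\<theta> x \<in> carrier ?A" if "x \<in> H" for x
    by (rule transfer_closed[OF H.subgroup_axioms I.subgroup_axioms sub A th TT that])
  \<comment> \<open>Once \<open>transfer_elem\<close> is a homomorphism to a commutative group, the
    representative chosen by \<open>transfer_map\<close> is immaterial.\<close>
  have "transfer_elem ?Q ?R T' \<in> hom ?Q ?A"
  proof (rule homI)
    fix X Y assume X: "X \<in> carrier ?Q" and Y: "Y \<in> carrier ?Q"
    obtain x where x: "x \<in> H" "X = U #> x" using X by (auto simp: carrier_quot)
    obtain y where y: "y \<in> H" "Y = U #> y" using Y by (auto simp: carrier_quot)
    show "transfer_elem ?Q ?R T' (X \<otimes>\<^bsub>?Q\<^esub> Y) = transfer_elem ?Q ?R T' X \<otimes>\<^bsub>?A\<^esub> transfer_elem ?Q ?R T' Y"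
      unfolding mult_quot x(2) y(2) sum[OF x(1) y(1)] using elem tm x y by simp
  next
    fix X assume X: "X \<in> carrier ?Q"
    obtain x where x: "x \<in> H" "X = U #> x" using X by (auto simp: carrier_quot)
    then show "transfer_elem ?Q ?R T' X \<in> carrier ?A" using elem tc by simp
  qed
  then have gh: "group_hom ?Q ?A (transfer_elem ?Q ?R T')"
    by (intro group_hom.intro group_hom_axioms.intro Q.is_group A.is_group)
  have hq: "U #> h \<in> carrier ?Q" using h by (simp add: carrier_quot)
  let ?X = "pi_class (H, U) h"
  have "(SOME q. q \<in> ?X) \<in> closed_commutator ?Q #>\<^bsub>?Q\<^esub> (U #> h)"
    using Q.class_self[OF hq] unfolding pi_class_def ab_class_def snd_conv by (rule someI)
  then have "transfer_elem ?Q ?R T' (SOME q. q \<in> ?X) = transfer I (\<tau> ` T') ?A ?\<theta> h"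
    using Q.hom_class_eq[OF gh A hq] elem[OF h] by simp
  also have "\<dots> = transfer I T ?A ?\<theta> h"
    by (rule transfer_indep[OF H.subgroup_axioms I.subgroup_axioms sub A th TT fT T h, symmetric])
  finally show ?thesis by (simp add: pi_K_def transfer_map_def T'_def)
qed

end

lemma (in group) transversal_exists:
  assumes H: "subgroup H G" and I: "subgroup I G" "I \<subseteq> H" and fin: "finite (rcosets\<^bsub>G\<lparr>carrier := H\<rparr>\<^esub> I)"
  obtains T where "transversal H I T" "finite T"
proof -
  interpret H: subgroup H G by fact
  interpret I: subgroup I G by fact
  define c where "c X = (SOME x. x \<in> X)" for X :: "'a set"
  let ?T = "(\<lambda>x. c (I #> x)) ` H"
  have c: "c (I #> x) \<in> I #> x" if "x \<in> H" for x
    using rcos_self[OF H.mem_carrier[OF that] I.subgroup_axioms] unfolding c_def by (rule someI)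
  have cH: "c (I #> x) \<in> H \<and> x \<otimes> inv (c (I #> x)) \<in> I" if x: "x \<in> H" for x
  proof -
    obtain i where i: "i \<in> I" "c (I #> x) = i \<otimes> x" using c[OF x] unfolding r_coset_def by blast
    have "x \<otimes> inv (i \<otimes> x) = inv i" using x i by (simp add: group_norm)
    moreover have "i \<otimes> x \<in> H" using i x I(2) by blast
    ultimately show ?thesis using i by simp
  qed
  have eq: "I #> x = I #> y" if "x \<in> H" "y \<in> H" "x \<otimes> inv y \<in> I" for x y
  proof -
    have "x = x \<otimes> inv y \<otimes> y" using that by (simp add: m_assoc)
    then have "x \<in> I #> y" using that(3) unfolding r_coset_def by blast
    then show ?thesis using repr_independence[OF _ H.mem_carrier[OF that(2)] I.subgroup_axioms] by metis
  qed
  have "transversal H I ?T"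
    unfolding transversal_def
  proof (intro conjI ballI)
    show "?T \<subseteq> H" using cH by blast
    fix x assume x: "x \<in> H"
    show "\<exists>!t. t \<in> ?T \<and> x \<otimes> inv t \<in> I"
    proof (rule ex1I[of _ "c (I #> x)"])
      show "c (I #> x) \<in> ?T \<and> x \<otimes> inv (c (I #> x)) \<in> I" using x cH by blast
      fix t assume t: "t \<in> ?T \<and> x \<otimes> inv t \<in> I"
      then obtain y where y: "y \<in> H" "t = c (I #> y)" by blast
      have tH: "t \<in> H" "y \<otimes> inv t \<in> I" using cH[OF y(1)] y(2) by auto
      have "I #> x = I #> t" by (rule eq[OF x tH(1)]) (use t in blast)
      also have "\<dots> = I #> y" by (rule eq[OF y(1) tH, symmetric])
      finally show "t = c (I #> x)" using y(2) by simp
    qed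
  qed
  moreover have "?T = c ` (rcosets\<^bsub>G\<lparr>carrier := H\<rparr>\<^esub> I)" by (auto simp: RCOSETS_def)
  then have "finite ?T" using fin by simp
  ultimately show ?thesis using that by blast
qed

lemma finprod_subgroup_closed:
  assumes A: "comm_group A" and N: "subgroup N A" and x: "x \<in> R \<rightarrow> N"
  shows "finprod A x R \<in> N"
  using x
proof (induction R rule: infinite_finite_induct)
  interpret A: comm_group A by fact
  interpret N: subgroup N A by fact
  {
    case (infinite R)
    then show ?case using subgroup.one_closed[OF N] by simp
  next
    case empty
    then show ?case using subgroup.one_closed[OF N] by simp
  next
    case (insert a R)
    then have "x a \<in> N" "x \<in> R \<rightarrow> N" by auto
    moreover from this have "x \<in> R \<rightarrow> carrier A" using subgroup.mem_carrier[OF N] by blast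
    ultimately show ?case using insert A.finprod_insert[of R a x] subgroup.mem_carrier[OF N] subgroup.m_closed[OF N] by simp
  }
qed

context fn_setting
begin

lemma EO_open:
  assumes "(H, U) \<in> base EO" "(I, U) \<in> base EO" "I \<subseteq> H"
  shows "open_in_group G H I"
proof -
  note D = open_partD[OF assms(1)] and D' = open_partD[OF assms(2)]
  have "U \<subseteq> I" using D'(3) by (simp add: open_in_group_def)
  then show ?thesis
    by (rule open_in_group_mono[OF D(3) _ assms(3) M_subgroup[OF D'(2)] M_subgroup[OF D(2)]])
qed

lemma EO_transversal:
  assumes "(H, U) \<in> base EO" "(I, U) \<in> base EO" "I \<subseteq> H"
  obtains T where "transversal H I T" "finite T"
  using transversal_exists[OF M_subgroup[OF open_partD(2)[OF assms(1)]] M_subgroup[OF open_partD(2)[OF assms(2)]] assms(3)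
    finite_rcosets_open[OF M_subgroup[OF open_partD(2)[OF assms(1)]] M_compact[OF open_partD(2)[OF assms(1)]] EO_open[OF assms]]]
  by blast

lemma pi_hom_class:
  assumes "(H, U) \<in> base EO" "x \<in> H" "y \<in> H"
  shows "pi_class (H, U) x \<in> carrier (Obj (pi_K G) (H, U))"
    and "pi_class (H, U) (x \<otimes> y) = pi_class (H, U) x \<otimes>\<^bsub>Obj (pi_K G) (H, U)\<^esub> pi_class (H, U) y"
  using pi_class_closed[OF assms(1,2)] pi_class_mult[OF assms] .

text \<open>Every class in the abelianization comes from an element of \<open>H\<close>, and
  continuity is automatic between discrete groups.\<close>

lemma pi_K_homI:
  assumes HU: "(H, U) \<in> base EO" and IV: "(I, V) \<in> base EO"
    and F: "\<And>h. h \<in> H \<Longrightarrow> f (pi_class (H, U) h) = F h"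
    and Fc: "\<And>h. h \<in> H \<Longrightarrow> F h \<in> carrier (Obj (pi_K G) (I, V))"
    and Fm: "\<And>h h'. h \<in> H \<Longrightarrow> h' \<in> H \<Longrightarrow> F (h \<otimes> h') = F h \<otimes>\<^bsub>Obj (pi_K G) (I, V)\<^esub> F h'"
  shows "f \<in> tgroup_hom (Obj (pi_K G) (H, U)) (Obj (pi_K G) (I, V))"
proof -
  have "f \<in> hom (Obj (pi_K G) (H, U)) (Obj (pi_K G) (I, V))"
  proof (rule homI)
    fix X Y assume X: "X \<in> carrier (Obj (pi_K G) (H, U))" and Y: "Y \<in> carrier (Obj (pi_K G) (H, U))"
    obtain h where h: "h \<in> H" "X = pi_class (H, U) h" by (rule pi_class_cases[OF HU X])
    obtain h' where h': "h' \<in> H" "Y = pi_class (H, U) h'" by (rule pi_class_cases[OF HU Y])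
    have hh: "h \<otimes> h' \<in> H" using h h' subgroup.m_closed[OF M_subgroup[OF open_partD(2)[OF HU]]] by blast
    show "f (X \<otimes>\<^bsub>Obj (pi_K G) (H, U)\<^esub> Y) = f X \<otimes>\<^bsub>Obj (pi_K G) (I, V)\<^esub> f Y"
      using F[OF hh] F[OF h(1)] F[OF h'(1)] Fm[OF h(1) h'(1)] pi_class_mult[OF HU h(1) h'(1)] h(2) h'(2) by simp
  next
    fix X assume X: "X \<in> carrier (Obj (pi_K G) (H, U))"
    obtain h where h: "h \<in> H" "X = pi_class (H, U) h" by (rule pi_class_cases[OF HU X])
    then show "f X \<in> carrier (Obj (pi_K G) (I, V))" using F Fc by simp
  qed
  then show ?thesis using tgroup_hom_discrete[OF discrete_pi_K[OF HU] discrete_pi_K[OF IV]] by blast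
qed

lemma pi_K_Res_hom:
  assumes HU: "(H, U) \<in> base EO" and IU: "(I, U) \<in> base EO" and sub: "I \<subseteq> H"
  shows "Res (pi_K G) (I, U) (H, U) \<in> tgroup_hom (Obj (pi_K G) (H, U)) (Obj (pi_K G) (I, U))"
proof -
  obtain T where T: "transversal H I T" "finite T" by (rule EO_transversal[OF assms])
  note Hs = M_subgroup[OF open_partD(2)[OF HU]] and Is = M_subgroup[OF open_partD(2)[OF IU]]
  note A = comm_group_pi_K[OF IU]
  show ?thesis
    by (rule pi_K_homI[OF HU IU pi_K_Res[OF HU IU sub T(1)]
          transfer_closed[OF Hs Is sub A pi_hom_class[OF IU] T(1)]
          transfer_mult[OF Hs Is sub A pi_hom_class[OF IU] T]])
qed

lemma conj_in: "K \<in> base M \<Longrightarrow> g \<in> carrier G \<Longrightarrow> x \<in> K \<Longrightarrow> g \<otimes> x \<otimes> inv g \<in> conj_set G g K"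
  using conj_set_eq[OF subgroup.subset[OF M_subgroup]] by blast

lemma in_conjE:
  assumes "K \<in> base M" "g \<in> carrier G" "y \<in> conj_set G g K"
  obtains x where "x \<in> K" "y = g \<otimes> x \<otimes> inv g"
  using assms conj_set_eq[OF subgroup.subset[OF M_subgroup[OF assms(1)]] assms(2)] by blast

lemma transversal_conj:
  assumes H: "H \<in> base M" and I: "I \<in> base M" "I \<subseteq> H" and T: "transversal H I T" and g: "g \<in> carrier G"
  shows "transversal (conj_set G g H) (conj_set G g I) ((\<lambda>t. g \<otimes> t \<otimes> inv g) ` T)" (is "transversal ?H ?I ?T")
    and "x \<in> H \<Longrightarrow> coset_rep (conj_set G g I) ((\<lambda>t. g \<otimes> t \<otimes> inv g) ` T) (g \<otimes> x \<otimes> inv g) = g \<otimes> coset_rep I T x \<otimes> inv g"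
proof -
  note Hs = M_subgroup[OF H] and Is = M_subgroup[OF I(1)]
  have TH: "t \<in> H" if "t \<in> T" for t using that T by (auto simp: transversal_def)
  have inj: "x = y" if "g \<otimes> x \<otimes> inv g = g \<otimes> y \<otimes> inv g" "x \<in> carrier G" "y \<in> carrier G" for x y
    using that g by simp
  have mem: "g \<otimes> x \<otimes> inv g \<in> ?I \<longleftrightarrow> x \<in> I" if x: "x \<in> carrier G" for x
  proof
    assume "g \<otimes> x \<otimes> inv g \<in> ?I"
    then obtain y where y: "y \<in> I" "g \<otimes> x \<otimes> inv g = g \<otimes> y \<otimes> inv g" by (rule in_conjE[OF I(1) g])
    then show "x \<in> I" using inj[OF y(2) x M_carrier[OF I(1) y(1)]] by simp
  qed (rule conj_in[OF I(1) g])
  have div: "(g \<otimes> x \<otimes> inv g) \<otimes> inv (g \<otimes> y \<otimes> inv g) = g \<otimes> (x \<otimes> inv y) \<otimes> inv g" if "x \<in> carrier G" "y \<in> carrier G" for x y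
    using that g by (simp add: group_norm)
  show tr: "transversal ?H ?I ?T"
    unfolding transversal_def
  proof (intro conjI ballI)
    show "?T \<subseteq> ?H" using conj_in[OF H g] TH by blast
    fix y assume "y \<in> ?H"
    then obtain x where x: "x \<in> H" "y = g \<otimes> x \<otimes> inv g" by (rule in_conjE[OF H g])
    have xc: "x \<in> carrier G" using M_carrier[OF H x(1)] .
    note r = coset_rep[OF Hs Is I(2) T x(1)]
    show "\<exists>!t. t \<in> ?T \<and> y \<otimes> inv t \<in> ?I"
    proof (rule ex1I[of _ "g \<otimes> coset_rep I T x \<otimes> inv g"])
      show "g \<otimes> coset_rep I T x \<otimes> inv g \<in> ?T \<and> y \<otimes> inv (g \<otimes> coset_rep I T x \<otimes> inv g) \<in> ?I"
        using r conj_in[OF I(1) g r(2)] div[OF xc M_carrier[OF H r(3)]] x(2) by auto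
      fix s assume s: "s \<in> ?T \<and> y \<otimes> inv s \<in> ?I"
      then obtain t where t: "t \<in> T" "s = g \<otimes> t \<otimes> inv g" by blast
      have tc: "t \<in> carrier G" using M_carrier[OF H TH[OF t(1)]] .
      have "g \<otimes> (x \<otimes> inv t) \<otimes> inv g \<in> ?I" using s unfolding t(2) x(2) div[OF xc tc] by blast
      then have "x \<otimes> inv t \<in> I" using mem[of "x \<otimes> inv t"] xc tc by simp
      then have "coset_rep I T x = t" by (rule coset_rep_eqI[OF Hs Is I(2) T x(1) t(1)])
      then show "s = g \<otimes> coset_rep I T x \<otimes> inv g" using t(2) by simp
    qed
  qed
  show "coset_rep ?I ?T (g \<otimes> x \<otimes> inv g) = g \<otimes> coset_rep I T x \<otimes> inv g" if x: "x \<in> H"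
  proof -
    note r = coset_rep[OF Hs Is I(2) T x]
    have IH: "?I \<subseteq> ?H" using I(2) M_carrier[OF H] g by (auto simp: conj_set_eq subset_iff M_carrier[OF H] M_carrier[OF I(1)] elim!: in_conjE[OF I(1) g] intro: conj_in[OF H g])
    show ?thesis
      by (rule coset_rep_eqI[OF M_subgroup[OF M.act_closed[OF g H]] M_subgroup[OF M.act_closed[OF g I(1)]] IH tr conj_in[OF H g x] imageI[OF r(1)]])
        (use conj_in[OF I(1) g r(2)] div[OF M_carrier[OF H x] M_carrier[OF H r(3)]] in simp)
  qed
qed

text \<open>All maps are computed on classes of elements. Transitivity of restriction is
  transitivity of the transfer along a product transversal, and compatibility of restriction with
  conjugation comes from conjugating the transversal.\<close>

lemma TAb_functor_pi_K: "TAb_functor G (conj_pair G) EO (pi_K G)"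
proof (rule TAb_functor.intro)
  fix x assume x: "x \<in> base EO"
  obtain H U where xe: "x = (H, U)" by (cases x)
  have HU: "(H, U) \<in> base EO" using x xe by simp
  note D = open_partD[OF HU] and A = comm_group_pi_K[OF HU]
  note Hs = M_subgroup[OF D(2)]
  show "topological_group (Obj (pi_K G) x)" unfolding xe by (rule topological_group_discrete[OF discrete_pi_K[OF HU]])
  show "comm_group (Obj (pi_K G) x)" unfolding xe by (rule A)
  {
    fix y assume "y \<in> rdom EO x"
    moreover obtain I V where "y = (I, V)" by (cases y)
    ultimately have "(I, V) \<in> rdom EO (H, U)" "y = (I, V)" using xe by auto
    note IV = EO_rdom[OF HU this(1)] this
    show "Res (pi_K G) y x \<in> tgroup_hom (Obj (pi_K G) x) (Obj (pi_K G) y)"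
      unfolding xe using IV pi_K_Res_hom[OF HU _ IV(3)] by simp
  }
  {
    fix y assume "y \<in> idom EO x"
    moreover obtain I V where "y = (I, V)" by (cases y)
    ultimately have "(I, V) \<in> idom EO (H, U)" and ye: "y = (I, V)" using xe by auto
    note IV = EO_idom[OF HU this(1)]
    show "Ind (pi_K G) x y \<in> tgroup_hom (Obj (pi_K G) y) (Obj (pi_K G) x)"
      unfolding xe ye
      by (rule pi_K_homI[where F = "pi_class (H, U)", OF IV(1) HU pi_K_Ind[OF HU IV(1,3,2)]])
        (use IV pi_hom_class[OF HU] in blast)+
    fix z a assume "z \<in> idom EO y" and a: "a \<in> carrier (Obj (pi_K G) z)"
    moreover obtain J L where "z = (J, L)" by (cases z)
    ultimately have "(J, L) \<in> idom EO (I, V)" and ze: "z = (J, L)" using ye by auto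
    note JW = EO_idom[OF IV(1) this(1)]
    obtain j where j: "j \<in> J" "a = pi_class (J, L) j" using pi_class_cases[OF JW(1)] a ze by blast
    have sub: "J \<subseteq> H" "L \<subseteq> U" "j \<in> I" using JW IV j by auto
    show "Ind (pi_K G) x y (Ind (pi_K G) y z a) = Ind (pi_K G) x z a"
      unfolding xe ye ze j(2) pi_K_Ind[OF IV(1) JW(1,3,2) j(1)] pi_K_Ind[OF HU IV(1,3,2) sub(3)]
        pi_K_Ind[OF HU JW(1) sub(1,2) j(1)] ..
  }
  {
    fix g assume g: "g \<in> carrier G"
    have e: "g \<otimes> (h \<otimes> h') \<otimes> inv g = (g \<otimes> h \<otimes> inv g) \<otimes> (g \<otimes> h' \<otimes> inv g)" if "h \<in> H" "h' \<in> H" for h h'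
      using that conj_mult[OF g] M_carrier[OF D(2)] by blast
    show "Con (pi_K G) g x \<in> tgroup_hom (Obj (pi_K G) x) (Obj (pi_K G) (conj_pair G g x))"
      unfolding xe conj_pair_simp
      by (rule pi_K_homI[where F = "\<lambda>h. pi_class (conj_set G g H, conj_set G g U) (g \<otimes> h \<otimes> inv g)", OF HU EO_conj[OF HU g] pi_K_Con[OF HU g]])
        (simp_all add: e pi_class_closed[OF EO_conj[OF HU g]] pi_class_mult[OF EO_conj[OF HU g]] conj_in[OF D(2) g])
  }
  {
    fix a assume "a \<in> carrier (Obj (pi_K G) x)"
    then obtain h where h: "h \<in> H" "a = pi_class (H, U) h" using pi_class_cases[OF HU] xe by blast
    have hc: "h \<in> carrier G" using M_carrier[OF D(2) h(1)] .
    interpret A: comm_group "Obj (pi_K G) (H, U)" by (rule A)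
    have T: "transversal H H {\<one>}" using Hs by (auto simp: transversal_def subgroup.one_closed M_carrier[OF D(2)])
    have "coset_rep H {\<one>} h = \<one>"
      by (rule coset_rep_eqI[OF Hs Hs subset_refl T h(1)]) (use h hc in auto)
    then show "Res (pi_K G) x x a = a"
      unfolding xe h(2) pi_K_Res[OF HU HU subset_refl T h(1)]
      using pi_class_closed[OF HU h(1)] hc by (simp add: transfer_def)
    show "Ind (pi_K G) x x a = a"
      unfolding xe h(2) by (rule pi_K_Ind[OF HU HU subset_refl subset_refl h(1)])
    have "conj_pair G \<one> (H, U) = (H, U)" using E.act_one[OF D(5)] .
    then show "Con (pi_K G) \<one> x a = a"
      unfolding xe h(2) pi_K_Con[OF HU one_closed h(1)] using hc by simp
    fix g g' assume g: "g \<in> carrier G" "g' \<in> carrier G"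
    have "g' \<otimes> (g \<otimes> h \<otimes> inv g) \<otimes> inv g' = (g' \<otimes> g) \<otimes> h \<otimes> inv (g' \<otimes> g)" using g hc by (simp add: group_norm)
    moreover have "conj_pair G (g' \<otimes> g) (H, U) = conj_pair G g' (conj_pair G g (H, U))" using E.act_mult[OF g D(5)] .
    ultimately show "Con (pi_K G) g' (conj_pair G g x) (Con (pi_K G) g x a) = Con (pi_K G) (g' \<otimes> g) x a"
      unfolding xe h(2) conj_pair_simp pi_K_Con[OF HU g(1) h(1)] pi_K_Con[OF HU m_closed[OF g(2,1)] h(1)]
        pi_K_Con[OF EO_conj[OF HU g(1)] g(2) conj_in[OF D(2) g(1) h(1)]] by simp
  }
  {
    fix y z a assume "y \<in> rdom EO x" "z \<in> rdom EO y" and a: "a \<in> carrier (Obj (pi_K G) x)"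
    moreover obtain I V J L where ye: "y = (I, V)" "z = (J, L)" by (cases y, cases z)
    ultimately have I': "(I, V) \<in> rdom EO (H, U)" and J': "(J, L) \<in> rdom EO (I, V)" using xe by auto
    note I0 = EO_rdom[OF HU I']
    have VU: "V = U" by (rule I0(2))
    note J0 = EO_rdom[OF I0(1) J']
    have WU: "L = U" using J0(2) VU by simp
    note IU = I0(1)[unfolded VU] and JU = J0(1)[unfolded WU]
    note Is = M_subgroup[OF open_partD(2)[OF IU]] and Js = M_subgroup[OF open_partD(2)[OF JU]]
    obtain h where h: "h \<in> H" "a = pi_class (H, U) h" using pi_class_cases[OF HU] a xe by blast
    obtain T where T: "transversal H I T" "finite T" by (rule EO_transversal[OF HU IU I0(3)])
    obtain S where S: "transversal I J S" "finite S" by (rule EO_transversal[OF IU JU J0(3)])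
    have JH: "J \<subseteq> H" using J0(3) I0(3) by blast
    let ?i = "\<lambda>t. t \<otimes> h \<otimes> inv (coset_rep I T (t \<otimes> h))"
    have i: "?i t \<in> I" if "t \<in> T" for t
    proof -
      have "t \<otimes> h \<in> H" using that T(1) h(1) subgroup.m_closed[OF Hs] by (auto simp: transversal_def)
      then show ?thesis by (rule coset_rep(2)[OF Hs Is I0(3) T(1)])
    qed
    note AI = comm_group_pi_K[OF IU] and AJ = comm_group_pi_K[OF JU]
    interpret AJ: comm_group "Obj (pi_K G) (J, U)" by (rule AJ)
    have R: "group_hom (Obj (pi_K G) (I, U)) (Obj (pi_K G) (J, U)) (Res (pi_K G) (J, U) (I, U))"
      using pi_K_Res_hom[OF IU JU J0(3)] AI AJ
      by (auto intro!: group_hom.intro group_hom_axioms.intro simp: tgroup_hom_def comm_group_def)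
    have "Res (pi_K G) (J, U) (I, U) (Res (pi_K G) (I, U) (H, U) (pi_class (H, U) h)) =
        (\<Otimes>\<^bsub>Obj (pi_K G) (J, U)\<^esub> t \<in> T. Res (pi_K G) (J, U) (I, U) (pi_class (I, U) (?i t)))"
      unfolding pi_K_Res[OF HU IU I0(3) T(1) h(1)] transfer_def
      by (rule finprod_group_hom[OF R AI AJ T(2)]) (use i pi_class_closed[OF IU] in blast)
    also have "\<dots> = transfer I T (Obj (pi_K G) (J, U)) (transfer J S (Obj (pi_K G) (J, U)) (pi_class (J, U))) h"
      unfolding transfer_def[of I]
      by (rule AJ.finprod_cong'[OF refl _ pi_K_Res[OF IU JU J0(3) S(1) i]])
        (use i transfer_closed[OF Is Js J0(3) AJ pi_hom_class[OF JU] S(1)] in \<open>auto simp: Pi_iff\<close>)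
    also have "\<dots> = transfer J (\<Union>t\<in>T. (\<lambda>s. s \<otimes> t) ` S) (Obj (pi_K G) (J, U)) (pi_class (J, U)) h"
      by (rule transfer_trans[OF Hs Is I0(3) Js J0(3) T S h(1) AJ pi_class_closed[OF JU], symmetric])
    also have "\<dots> = Res (pi_K G) (J, U) (H, U) (pi_class (H, U) h)"
      by (rule pi_K_Res[OF HU JU JH transversal_mult(1)[OF Hs Is I0(3) Js J0(3) T(1) S(1)] h(1), symmetric])
    finally show "Res (pi_K G) z y (Res (pi_K G) y x a) = Res (pi_K G) z x a"
      unfolding xe ye h(2) VU WU .
  }
  {
    fix g y a assume g: "g \<in> carrier G" and "y \<in> rdom EO x" and a: "a \<in> carrier (Obj (pi_K G) x)"
    moreover obtain I V where ye: "y = (I, V)" by (cases y)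
    ultimately have I': "(I, V) \<in> rdom EO (H, U)" using xe by auto
    note I0 = EO_rdom[OF HU I']
    have VU: "V = U" by (rule I0(2))
    note IU = I0(1)[unfolded VU]
    note D' = open_partD[OF IU]
    note Is = M_subgroup[OF D'(2)]
    note gH = EO_conj[OF HU g] and gI = EO_conj[OF IU g]
    have gsub: "conj_set G g I \<subseteq> conj_set G g H"
    proof
      fix z assume "z \<in> conj_set G g I"
      then obtain i where "i \<in> I" "z = g \<otimes> i \<otimes> inv g" by (rule in_conjE[OF D'(2) g])
      then show "z \<in> conj_set G g H" using conj_in[OF D(2) g] I0(3) by blast
    qed
    obtain h where h: "h \<in> H" "a = pi_class (H, U) h" using pi_class_cases[OF HU] a xe by blast
    obtain T where T: "transversal H I T" "finite T" by (rule EO_transversal[OF HU IU I0(3)])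
    have TH: "t \<in> H" if "t \<in> T" for t using that T by (auto simp: transversal_def)
    let ?c = "\<lambda>z. g \<otimes> z \<otimes> inv g"
    let ?i = "\<lambda>t. t \<otimes> h \<otimes> inv (coset_rep I T (t \<otimes> h))"
    have th: "t \<otimes> h \<in> H" if "t \<in> T" for t using TH[OF that] h(1) subgroup.m_closed[OF Hs] by blast
    have i: "?i t \<in> I" if "t \<in> T" for t by (rule coset_rep(2)[OF Hs Is I0(3) T(1) th[OF that]])
    note AI = comm_group_pi_K[OF IU] and AgI = comm_group_pi_K[OF gI]
    interpret AgI: comm_group "Obj (pi_K G) (conj_set G g I, conj_set G g U)" by (rule AgI)
    note Tg = transversal_conj[OF D(2) D'(2) I0(3) T(1) g]
    have CH: "Con (pi_K G) g (I, U) \<in> hom (Obj (pi_K G) (I, U)) (Obj (pi_K G) (conj_set G g I, conj_set G g U))"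
    proof (rule homI)
      fix X Y assume X: "X \<in> carrier (Obj (pi_K G) (I, U))" and Y: "Y \<in> carrier (Obj (pi_K G) (I, U))"
      obtain p where p: "p \<in> I" "X = pi_class (I, U) p" by (rule pi_class_cases[OF IU X])
      obtain q where q: "q \<in> I" "Y = pi_class (I, U) q" by (rule pi_class_cases[OF IU Y])
      have pq: "p \<otimes> q \<in> I" using p q subgroup.m_closed[OF Is] by blast
      show "Con (pi_K G) g (I, U) (X \<otimes>\<^bsub>Obj (pi_K G) (I, U)\<^esub> Y) =
          Con (pi_K G) g (I, U) X \<otimes>\<^bsub>Obj (pi_K G) (conj_set G g I, conj_set G g U)\<^esub> Con (pi_K G) g (I, U) Y"
        unfolding p(2) q(2) pi_class_mult[OF IU p(1) q(1), symmetric]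
          pi_K_Con[OF IU g p(1)] pi_K_Con[OF IU g q(1)] pi_K_Con[OF IU g pq]
          conj_mult[OF g M_carrier[OF D'(2) p(1)] M_carrier[OF D'(2) q(1)]]
        by (rule pi_class_mult[OF gI conj_in[OF D'(2) g p(1)] conj_in[OF D'(2) g q(1)]])
      show "Con (pi_K G) g (I, U) X \<in> carrier (Obj (pi_K G) (conj_set G g I, conj_set G g U))"
        unfolding p(2) pi_K_Con[OF IU g p(1)] by (rule pi_class_closed[OF gI conj_in[OF D'(2) g p(1)]])
    qed
    then have Cg: "group_hom (Obj (pi_K G) (I, U)) (Obj (pi_K G) (conj_set G g I, conj_set G g U)) (Con (pi_K G) g (I, U))"
      using AI AgI by (auto intro!: group_hom.intro group_hom_axioms.intro simp: comm_group_def)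
    let ?F = "\<lambda>s. pi_class (conj_set G g I, conj_set G g U) (s \<otimes> ?c h \<otimes> inv (coset_rep (conj_set G g I) (?c ` T) (s \<otimes> ?c h)))"
    have Fe: "?F (?c t) = pi_class (conj_set G g I, conj_set G g U) (?c (?i t))" if t: "t \<in> T" for t
    proof -
      have c: "t \<in> carrier G" "h \<in> carrier G" using TH[OF t] h M_carrier[OF D(2)] by auto
      note r = coset_rep[OF Hs Is I0(3) T(1) th[OF t]]
      have e: "?c t \<otimes> ?c h = ?c (t \<otimes> h)" by (rule conj_mult[OF g c, symmetric])
      have "?c (t \<otimes> h) \<otimes> inv (?c (coset_rep I T (t \<otimes> h))) = ?c (?i t)"
        using g c M_carrier[OF D(2) r(3)] by (simp add: group_norm)
      then show ?thesis unfolding e Tg(2)[OF th[OF t]] by simp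
    qed
    have ci: "?c (?i t) \<in> conj_set G g I" if "t \<in> T" for t by (rule conj_in[OF D'(2) g i[OF that]])
    have "Con (pi_K G) g (I, U) (Res (pi_K G) (I, U) (H, U) (pi_class (H, U) h)) =
        (\<Otimes>\<^bsub>Obj (pi_K G) (conj_set G g I, conj_set G g U)\<^esub> t \<in> T. Con (pi_K G) g (I, U) (pi_class (I, U) (?i t)))"
      unfolding pi_K_Res[OF HU IU I0(3) T(1) h(1)] transfer_def
      by (rule finprod_group_hom[OF Cg AI AgI T(2)]) (use i pi_class_closed[OF IU] in blast)
    also have "\<dots> = (\<Otimes>\<^bsub>Obj (pi_K G) (conj_set G g I, conj_set G g U)\<^esub> t \<in> T. ?F (?c t))"
    proof (rule AgI.finprod_cong'[OF refl])
      show "(\<lambda>t. ?F (?c t)) \<in> T \<rightarrow> carrier (Obj (pi_K G) (conj_set G g I, conj_set G g U))"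
      proof
        show "?F (?c t) \<in> carrier (Obj (pi_K G) (conj_set G g I, conj_set G g U))" if "t \<in> T" for t
          unfolding Fe[OF that] by (rule pi_class_closed[OF gI ci[OF that]])
      qed
      show "Con (pi_K G) g (I, U) (pi_class (I, U) (?i t)) = ?F (?c t)" if "t \<in> T" for t
        unfolding Fe[OF that] by (rule pi_K_Con[OF IU g i[OF that]])
    qed
    also have "\<dots> = finprod (Obj (pi_K G) (conj_set G g I, conj_set G g U)) ?F (?c ` T)"
    proof (rule AgI.finprod_reindex[symmetric])
      show "?F \<in> ?c ` T \<rightarrow> carrier (Obj (pi_K G) (conj_set G g I, conj_set G g U))"
      proof
        fix s assume "s \<in> ?c ` T"
        then obtain t where t: "t \<in> T" "s = ?c t" by blast
        show "?F s \<in> carrier (Obj (pi_K G) (conj_set G g I, conj_set G g U))"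
          unfolding t(2) Fe[OF t(1)] by (rule pi_class_closed[OF gI ci[OF t(1)]])
      qed
      show "inj_on ?c T" using TH M_carrier[OF D(2)] g by (auto simp: inj_on_def)
    qed
    also have "\<dots> = Res (pi_K G) (conj_set G g I, conj_set G g U) (conj_set G g H, conj_set G g U) (pi_class (conj_set G g H, conj_set G g U) (?c h))"
      by (rule pi_K_Res[OF gH gI gsub Tg(1) conj_in[OF D(2) g h(1)], unfolded transfer_def, symmetric])
    finally show "Con (pi_K G) g y (Res (pi_K G) y x a) = Res (pi_K G) (conj_pair G g y) (conj_pair G g x) (Con (pi_K G) g x a)"
      unfolding xe ye h(2) VU conj_pair_simp pi_K_Con[OF HU g h(1)] .
  }
  {
    fix g y a assume g: "g \<in> carrier G" and "y \<in> idom EO x" and a: "a \<in> carrier (Obj (pi_K G) y)"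
    moreover obtain I V where ye: "y = (I, V)" by (cases y)
    ultimately have I': "(I, V) \<in> idom EO (H, U)" using xe by auto
    note IV = EO_idom[OF HU I']
    note D' = open_partD[OF IV(1)]
    obtain i where i: "i \<in> I" "a = pi_class (I, V) i" using pi_class_cases[OF IV(1)] a ye by blast
    have mono: "conj_set G g A \<subseteq> conj_set G g B" if "A \<in> base M" "B \<in> base M" "A \<subseteq> B" for A B
      using that conj_in[OF that(2) g] by (auto elim!: in_conjE[OF that(1) g])
    have sub: "conj_set G g I \<subseteq> conj_set G g H" "conj_set G g V \<subseteq> conj_set G g U"
      using mono[OF D'(2) D(2) IV(3)] mono[OF U_base[OF D'(2-4)] U_base[OF D(2-4)] IV(2)] .
    have iH: "i \<in> H" using i IV(3) by blast
    show "Con (pi_K G) g x (Ind (pi_K G) x y a) = Ind (pi_K G) (conj_pair G g x) (conj_pair G g y) (Con (pi_K G) g y a)"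
      unfolding xe ye i(2) conj_pair_simp pi_K_Ind[OF HU IV(1,3,2) i(1)] pi_K_Con[OF HU g iH] pi_K_Con[OF IV(1) g i(1)]
        pi_K_Ind[OF EO_conj[OF HU g] EO_conj[OF IV(1) g] sub conj_in[OF D'(2) g i(1)]] ..
  }
qed

section \<open>The functor of norm residue groups\<close>

lemma Con_ind_image:
  assumes HU: "(H, U) \<in> base EO" and g: "g \<in> carrier G"
  shows "Con C g H ` ind_image C H U \<subseteq> ind_image C (conj_set G g H) (conj_set G g U)"
proof -
  note D = open_partD[OF HU]
  show ?thesis
    unfolding ind_image_def
    using C.Con_Ind[OF g D(2) U_idom[OF HU]] Con_closed[OF g U_base[OF D(2-4)]] by auto
qed

text \<open>The two ways of inducing from \<open>V\<close> to \<open>H\<close>, through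
  \<open>I\<close> and through \<open>U\<close>, agree; the second exists because a Mackey cover
  puts \<open>V\<close> in \<open>idom M U\<close>.\<close>

lemma Ind_ind_image:
  assumes HU: "(H, U) \<in> base EO" and IV: "(I, V) \<in> idom EO (H, U)"
  shows "Ind C H I ` ind_image C I V \<subseteq> ind_image C H U"
proof -
  note D = open_partD[OF HU] and I = EO_idom[OF HU IV]
  have "Ind C H I (Ind C I V x) = Ind C H U (Ind C U V x)" if "x \<in> carrier (Obj C V)" for x
    using C.Ind_Ind[OF D(2) I(4) U_idom[OF I(1)] that] C.Ind_Ind[OF D(2) U_idom[OF HU] I(5) that] by simp
  then show ?thesis
    unfolding ind_image_def using Ind_closed[OF U_base[OF D(2-4)] I(5)] by auto
qed

text \<open>\<open>U\<close> is normal in \<open>H\<close> and contained in \<open>I\<close>, so the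
  intersections in the double coset formula all equal \<open>U\<close>, and each term is induced
  from \<open>U\<close>.\<close>

lemma Res_ind_image:
  assumes HU: "(H, U) \<in> base EO" and IU: "(I, U) \<in> base EO" "I \<in> rdom M H"
  shows "Res C I H ` ind_image C H U \<subseteq> ind_image C I U"
proof -
  note D = open_partD[OF HU] and D' = open_partD[OF IU(1)]
  have IH: "I \<subseteq> H" using rdom_idom_subset[OF D(2)] IU(2) by blast
  have UI: "U \<subseteq> I" using D'(3) by (simp add: open_in_group_def)
  have Ub: "U \<in> base M" by (rule U_base[OF D(2-4)])
  have "Res C I H (Ind C H U x) \<in> ind_image C I U" if x: "x \<in> carrier (Obj C U)" for x
  proof -
    obtain R where R: "R \<subseteq> H" "inj_on (\<lambda>h. I #> h <#> U) R" "double_cosets G H I U = (\<lambda>h. I #> h <#> U) ` R"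
      using subset_image_inj[of "double_cosets G H I U" "\<lambda>h. I #> h <#> U" H] by (auto simp: double_cosets_def)
    then have bij: "bij_betw (\<lambda>h. I #> h <#> U) R (double_cosets G H I U)" by (simp add: bij_betw_def)
    let ?t = "\<lambda>h. Ind C I (I \<inter> conj_set G h U) (Con C h (conj_set G (inv h) I \<inter> U) (Res C (conj_set G (inv h) I \<inter> U) U x))"
    have t: "?t h \<in> ind_image C I U" if h: "h \<in> R" for h
    proof -
      have hH: "h \<in> H" using h R by blast
      have hc: "h \<in> carrier G" using M_carrier[OF D(2) hH] .
      have ih: "inv h \<in> H" using hH subgroup.m_inv_closed[OF M_subgroup[OF D(2)]] by blast
      have c: "conj_set G h U = U" "conj_set G (inv h) U = U"
        using conj_set_normal[OF M_subgroup[OF D(2)] D(4)] hH ih by auto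
      have "conj_set G (inv h) U \<subseteq> conj_set G (inv h) I"
        using UI M_carrier[OF D'(2)] hc by (auto simp: conj_set_eq subset_iff M_carrier[OF Ub] conj_in[OF D'(2)] elim!: in_conjE[OF Ub])
      then have e: "I \<inter> conj_set G h U = U" "conj_set G (inv h) I \<inter> U = U" using c UI by auto
      have "Con C h U (Res C U U x) \<in> carrier (Obj C U)"
        using Con_closed[OF hc Ub] C.Res_id[OF Ub x] x c(1) by simp
      then show ?thesis unfolding e ind_image_def by blast
    qed
    show ?thesis
      unfolding mackey_formula[OF D(2) IU(2) U_idom[OF HU] x R(1) bij]
      by (rule finprod_subgroup_closed[OF C_comm[OF D'(2)] subgroup_ind_image[OF IU(1)]]) (use t in blast)
  qed
  then show ?thesis by (auto simp: ind_image_def[of C H U])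
qed

lemma H0_Con:
  assumes HU: "(H, U) \<in> base EO" and g: "g \<in> carrier G" and a: "a \<in> carrier (Obj C H)"
  shows "Con (H0 G C) g (H, U) (ind_image C H U #>\<^bsub>Obj C H\<^esub> a) =
    ind_image C (conj_set G g H) (conj_set G g U) #>\<^bsub>Obj C (conj_set G g H)\<^esub> Con C g H a"
  using quotient_fun_coset[OF group_hom_Con[OF g open_partD(2)[OF HU]] subgroup_ind_image[OF HU]
      subgroup_ind_image[OF EO_conj[OF HU g]] Con_ind_image[OF HU g] a]
  by (simp add: H0_def)

lemma H0_Ind:
  assumes HU: "(H, U) \<in> base EO" and IV: "(I, V) \<in> idom EO (H, U)" and a: "a \<in> carrier (Obj C I)"
  shows "Ind (H0 G C) (H, U) (I, V) (ind_image C I V #>\<^bsub>Obj C I\<^esub> a) =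
    ind_image C H U #>\<^bsub>Obj C H\<^esub> Ind C H I a"
  using quotient_fun_coset[OF group_hom_Ind[OF open_partD(2)[OF HU] EO_idom(4)[OF HU IV]]
      subgroup_ind_image[OF EO_idom(1)[OF HU IV]] subgroup_ind_image[OF HU] Ind_ind_image[OF HU IV] a]
  by (simp add: H0_def)

lemma H0_Res:
  assumes HU: "(H, U) \<in> base EO" and IU: "(I, U) \<in> base EO" "I \<in> rdom M H" and a: "a \<in> carrier (Obj C H)"
  shows "Res (H0 G C) (I, U) (H, U) (ind_image C H U #>\<^bsub>Obj C H\<^esub> a) =
    ind_image C I U #>\<^bsub>Obj C I\<^esub> Res C I H a"
  using quotient_fun_coset[OF group_hom_Res[OF open_partD(2)[OF HU] IU(2)] subgroup_ind_image[OF HU]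
      subgroup_ind_image[OF IU(1)] Res_ind_image[OF HU IU] a]
  by (simp add: H0_def)

lemma H0_homI:
  assumes HU: "(H, U) \<in> base EO" and IV: "(I, V) \<in> base EO"
    and gh: "group_hom (Obj C H) (Obj C I) F"
    and F: "\<And>a. a \<in> carrier (Obj C H) \<Longrightarrow> f (ind_image C H U #>\<^bsub>Obj C H\<^esub> a) = ind_image C I V #>\<^bsub>Obj C I\<^esub> F a"
  shows "f \<in> tgroup_hom (Obj (H0 G C) (H, U)) (Obj (H0 G C) (I, V))"
proof -
  interpret F: group_hom "Obj C H" "Obj C I" F by (rule gh)
  interpret p: group_hom "Obj C H" "Obj (H0 G C) (H, U)" "\<lambda>x. ind_image C H U #>\<^bsub>Obj C H\<^esub> x" by (rule H0_class_hom[OF HU])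
  interpret q: group_hom "Obj C I" "Obj (H0 G C) (I, V)" "\<lambda>x. ind_image C I V #>\<^bsub>Obj C I\<^esub> x" by (rule H0_class_hom[OF IV])
  have "f \<in> hom (Obj (H0 G C) (H, U)) (Obj (H0 G C) (I, V))"
  proof (rule homI)
    fix X Y assume X: "X \<in> carrier (Obj (H0 G C) (H, U))" and Y: "Y \<in> carrier (Obj (H0 G C) (H, U))"
    obtain a where a: "a \<in> carrier (Obj C H)" "X = ind_image C H U #>\<^bsub>Obj C H\<^esub> a" using X H0_simps[OF HU] by auto
    obtain b where b: "b \<in> carrier (Obj C H)" "Y = ind_image C H U #>\<^bsub>Obj C H\<^esub> b" using Y H0_simps[OF HU] by auto
    show "f X \<in> carrier (Obj (H0 G C) (I, V))" unfolding a(2) F[OF a(1)] using a(1) by simp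
    show "f (X \<otimes>\<^bsub>Obj (H0 G C) (H, U)\<^esub> Y) = f X \<otimes>\<^bsub>Obj (H0 G C) (I, V)\<^esub> f Y"
      unfolding a(2) b(2) p.hom_mult[OF a(1) b(1), symmetric] F[OF a(1)] F[OF b(1)] F[OF F.G.m_closed[OF a(1) b(1)]]
      using a(1) b(1) by simp
  qed
  then show ?thesis using tgroup_hom_discrete[OF discrete_H0[OF HU] discrete_H0[OF IV]] by blast
qed

lemma TAb_functor_H0: "TAb_functor G (conj_pair G) EO (H0 G C)"
proof (rule TAb_functor.intro)
  fix x assume x: "x \<in> base EO"
  obtain H U where xe: "x = (H, U)" by (cases x)
  have HU: "(H, U) \<in> base EO" using x xe by simp
  note D = open_partD[OF HU]
  have cases: "\<exists>b \<in> carrier (Obj C K). a = ind_image C K L #>\<^bsub>Obj C K\<^esub> b"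
    if "(K, L) \<in> base EO" "a \<in> carrier (Obj (H0 G C) (K, L))" for K L a
    using that(2) unfolding H0_simps[OF that(1)] by blast
  show "topological_group (Obj (H0 G C) x)" unfolding xe by (rule topological_group_discrete[OF discrete_H0[OF HU]])
  show "comm_group (Obj (H0 G C) x)" unfolding xe by (rule comm_group_H0[OF HU])
  {
    fix g assume g: "g \<in> carrier G"
    show "Con (H0 G C) g x \<in> tgroup_hom (Obj (H0 G C) x) (Obj (H0 G C) (conj_pair G g x))"
      unfolding xe conj_pair_simp by (rule H0_homI[OF HU EO_conj[OF HU g] group_hom_Con[OF g D(2)] H0_Con[OF HU g]])
    fix g' a assume g': "g' \<in> carrier G" and "a \<in> carrier (Obj (H0 G C) x)"
    then obtain b where b: "b \<in> carrier (Obj C H)" "a = ind_image C H U #>\<^bsub>Obj C H\<^esub> b" using cases[OF HU] xe by blast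
    have "conj_pair G (g' \<otimes> g) (H, U) = conj_pair G g' (conj_pair G g (H, U))" using E.act_mult[OF g g' D(5)] .
    then show "Con (H0 G C) g' (conj_pair G g x) (Con (H0 G C) g x a) = Con (H0 G C) (g' \<otimes> g) x a"
      unfolding xe b(2) conj_pair_simp H0_Con[OF HU g b(1)] H0_Con[OF HU m_closed[OF g' g] b(1)]
        H0_Con[OF EO_conj[OF HU g] g' Con_closed[OF g D(2) b(1)]] C.Con_Con[OF g g' D(2) b(1)] by simp
  }
  {
    fix y assume "y \<in> rdom EO x"
    moreover obtain I V where ye: "y = (I, V)" by (cases y)
    ultimately have I': "(I, V) \<in> rdom EO (H, U)" using xe by auto
    note I0 = EO_rdom[OF HU I']
    have VU: "V = U" by (rule I0(2))
    note IU = I0(1)[unfolded VU]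
    note D' = open_partD[OF IU]
    show "Res (H0 G C) y x \<in> tgroup_hom (Obj (H0 G C) x) (Obj (H0 G C) y)"
      unfolding xe ye VU by (rule H0_homI[OF HU IU group_hom_Res[OF D(2) I0(4)] H0_Res[OF HU IU I0(4)]])
    {
      fix z a assume "z \<in> rdom EO y" "a \<in> carrier (Obj (H0 G C) x)"
      moreover obtain J L where ze: "z = (J, L)" by (cases z)
      ultimately have J': "(J, L) \<in> rdom EO (I, U)" and a: "a \<in> carrier (Obj (H0 G C) (H, U))" using xe ye VU by auto
      note J0 = EO_rdom[OF IU J']
      have WU: "L = U" by (rule J0(2))
      note JU = J0(1)[unfolded WU]
      obtain b where b: "b \<in> carrier (Obj C H)" "a = ind_image C H U #>\<^bsub>Obj C H\<^esub> b" using cases[OF HU a] by blast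
      have JH: "J \<in> rdom M H" using M.rdom_trans[OF D(2) I0(4)] J0(4) by blast
      show "Res (H0 G C) z y (Res (H0 G C) y x a) = Res (H0 G C) z x a"
        unfolding xe ye ze b(2) VU WU H0_Res[OF HU IU I0(4) b(1)] H0_Res[OF HU JU JH b(1)]
          H0_Res[OF IU JU J0(4) Res_closed[OF D(2) I0(4) b(1)]] C.Res_Res[OF D(2) I0(4) J0(4) b(1)] ..
    }
    fix g a assume g: "g \<in> carrier G" and "a \<in> carrier (Obj (H0 G C) x)"
    then obtain b where b: "b \<in> carrier (Obj C H)" "a = ind_image C H U #>\<^bsub>Obj C H\<^esub> b" using cases[OF HU] xe by blast
    have gr: "conj_set G g I \<in> rdom M (conj_set G g H)" using M.rdom_act[OF g D(2)] I0(4) by blast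
    show "Con (H0 G C) g y (Res (H0 G C) y x a) = Res (H0 G C) (conj_pair G g y) (conj_pair G g x) (Con (H0 G C) g x a)"
      unfolding xe ye b(2) VU conj_pair_simp H0_Res[OF HU IU I0(4) b(1)] H0_Con[OF HU g b(1)]
        H0_Con[OF IU g Res_closed[OF D(2) I0(4) b(1)]]
        H0_Res[OF EO_conj[OF HU g] EO_conj[OF IU g] gr Con_closed[OF g D(2) b(1)]] C.Con_Res[OF g D(2) I0(4) b(1)] ..
  }
  {
    fix y assume "y \<in> idom EO x"
    moreover obtain I V where ye: "y = (I, V)" by (cases y)
    ultimately have I': "(I, V) \<in> idom EO (H, U)" using xe by auto
    note I0 = EO_idom[OF HU I']
    show "Ind (H0 G C) x y \<in> tgroup_hom (Obj (H0 G C) y) (Obj (H0 G C) x)"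
      unfolding xe ye by (rule H0_homI[OF I0(1) HU group_hom_Ind[OF D(2) I0(4)] H0_Ind[OF HU I']])
    {
      fix z a assume "z \<in> idom EO y" "a \<in> carrier (Obj (H0 G C) z)"
      moreover obtain J L where ze: "z = (J, L)" by (cases z)
      ultimately have J': "(J, L) \<in> idom EO (I, V)" and a: "a \<in> carrier (Obj (H0 G C) (J, L))" using ye by auto
      note J0 = EO_idom[OF I0(1) J']
      obtain b where b: "b \<in> carrier (Obj C J)" "a = ind_image C J L #>\<^bsub>Obj C J\<^esub> b" using cases[OF J0(1) a] by blast
      have "(J, L) \<in> idom E (H, U)" using E.idom_trans[OF D(5) I0(6)] J0(6) by blast
      then have JH: "(J, L) \<in> idom EO (H, U)" using J' by (simp add: open_part_def)
      show "Ind (H0 G C) x y (Ind (H0 G C) y z a) = Ind (H0 G C) x z a"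
        unfolding xe ye ze b(2) H0_Ind[OF I0(1) J' b(1)] H0_Ind[OF HU JH b(1)]
          H0_Ind[OF HU I' Ind_closed[OF open_partD(2)[OF I0(1)] J0(4) b(1)]] C.Ind_Ind[OF D(2) I0(4) J0(4) b(1)] ..
    }
    fix g a assume g: "g \<in> carrier G" and "a \<in> carrier (Obj (H0 G C) y)"
    then obtain b where b: "b \<in> carrier (Obj C I)" "a = ind_image C I V #>\<^bsub>Obj C I\<^esub> b" using cases[OF I0(1)] ye by blast
    have "(conj_set G g I, conj_set G g V) \<in> idom E (conj_set G g H, conj_set G g U)"
      using E.idom_act[OF g D(5)] I0(6) by (metis conj_pair_simp imageI)
    moreover have "(conj_set G g I, conj_set G g V) \<in> open_pairs G"
      using EO_conj[OF I0(1) g] by (simp add: open_part_def)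
    ultimately have gI: "(conj_set G g I, conj_set G g V) \<in> idom EO (conj_set G g H, conj_set G g U)"
      by (simp add: open_part_def)
    show "Con (H0 G C) g x (Ind (H0 G C) x y a) = Ind (H0 G C) (conj_pair G g x) (conj_pair G g y) (Con (H0 G C) g y a)"
      unfolding xe ye b(2) conj_pair_simp H0_Ind[OF HU I' b(1)] H0_Con[OF I0(1) g b(1)]
        H0_Con[OF HU g Ind_closed[OF D(2) I0(4) b(1)]]
        H0_Ind[OF EO_conj[OF HU g] gI Con_closed[OF g open_partD(2)[OF I0(1)] b(1)]] C.Con_Ind[OF g D(2) I0(4) b(1)] ..
  }
  {
    fix a assume a: "a \<in> carrier (Obj (H0 G C) x)"
    then obtain b where b: "b \<in> carrier (Obj C H)" "a = ind_image C H U #>\<^bsub>Obj C H\<^esub> b" using cases[OF HU] xe by blast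
    have op: "(H, U) \<in> open_pairs G" using HU by (simp add: open_part_def)
    have self: "(H, U) \<in> idom EO (H, U)" using op E.idom_refl[OF D(5)] by (simp add: open_part_def)
    show "Ind (H0 G C) x x a = a" unfolding xe b(2) H0_Ind[OF HU self b(1)] C.Ind_id[OF D(2) b(1)] ..
    show "Res (H0 G C) x x a = a"
      unfolding xe b(2) H0_Res[OF HU HU M.rdom_refl[OF D(2)] b(1)] C.Res_id[OF D(2) b(1)] ..
    have "conj_pair G \<one> (H, U) = (H, U)" using E.act_one[OF D(5)] .
    then show "Con (H0 G C) \<one> x a = a"
      unfolding xe b(2) H0_Con[OF HU one_closed b(1)] C.Con_id[OF D(2) b(1)] by simp
  }
qed

end

section \<open>Naturality\<close>

context fn_setting
begin

lemma d_conj_set: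
  assumes "K \<in> base M" "g \<in> carrier G"
  shows "d ` conj_set G g K = d ` K"
  unfolding conj_set_eq[OF subgroup.subset[OF M_subgroup[OF assms(1)]] assms(2)] image_image
  by (intro image_cong refl d_conj assms(2) M_carrier[OF assms(1)])

lemma fd_conj: "K \<in> base M \<Longrightarrow> g \<in> carrier G \<Longrightarrow> fd (conj_set G g K) = fd K"
  by (simp add: fd_eq d_conj_set)

lemma frob_exp_conj:
  assumes "K \<in> base M" "g \<in> carrier G" "frob_exp K h n"
  shows "frob_exp (conj_set G g K) (g \<otimes> h \<otimes> inv g) n"
  using assms(3) conj_in[OF assms(1,2)] d_conj[OF assms(2) M_carrier[OF assms(1)]]
  by (simp add: frob_exp_def fd_conj[OF assms(1,2)])

lemma conj_set_inv:
  assumes "K \<in> base M" "g \<in> carrier G"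
  shows "conj_set G (inv g) (conj_set G g K) = K"
  using conj_set_comp[OF subgroup.subset[OF M_subgroup[OF assms(1)]], of "inv g" g] M.act_one[OF assms(1)] assms(2) by simp

lemma conj_set_mono:
  assumes "A \<subseteq> B" "B \<subseteq> carrier G" "g \<in> carrier G"
  shows "conj_set G g A \<subseteq> conj_set G g B"
  using assms by (auto simp: conj_set_eq)

text \<open>One inclusion holds because the right-hand side is a closed group containing the
  conjugates of h and of the inertia group of \<open>U\<close>; the other is the same inclusion for
  the inverse of g.\<close>

lemma frobenius_group_conj:
  assumes HU: "(H, U) \<in> base EO" and g: "g \<in> carrier G" and h: "frob_exp H h n"
  shows "frobenius_group G \<Omega> d (g \<otimes> h \<otimes> inv g) (conj_set G g U) = conj_set G g (\<Sigma> U h)"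
proof -
  have sub: "frobenius_group G \<Omega> d (g \<otimes> h \<otimes> inv g) (conj_set G g U) \<subseteq> conj_set G g (\<Sigma> U h)"
    if HU: "(H, U) \<in> base EO" and g: "g \<in> carrier G" and h: "frob_exp H h n" for H U g h
  proof -
    note D = open_partD[OF HU]
    note Sb = frobenius_group_base[OF D(2-4) h] and Ub = U_base[OF D(2-4)]
    show ?thesis
    proof (rule frobenius_group_subset[OF M.act_closed[OF g Sb] conj_in[OF Sb g h_in_frobenius_group[OF D(2-4) h]]])
      show "inertia G \<Omega> d (conj_set G g U) \<subseteq> conj_set G g (\<Sigma> U h)"
      proof
        fix x assume "x \<in> inertia G \<Omega> d (conj_set G g U)"
        then have x: "x \<in> conj_set G g U" "d x = \<one>\<^bsub>\<Omega>\<^esub>" using in_inertia_iff[OF M.act_closed[OF g Ub]] by auto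
        obtain u where u: "u \<in> U" "x = g \<otimes> u \<otimes> inv g" by (rule in_conjE[OF Ub g x(1)])
        have "u \<in> inertia G \<Omega> d U" using u x(2) d_conj[OF g M_carrier[OF Ub u(1)]] in_inertia_iff[OF Ub] by simp
        then show "x \<in> conj_set G g (\<Sigma> U h)"
          using conj_in[OF Sb g] inertia_U_subset_frobenius_group[OF D(2-4) h] u(2) by blast
      qed
    qed
  qed
  note D = open_partD[OF HU] and gHU = EO_conj[OF HU g]
  note D' = open_partD[OF gHU] and gh = frob_exp_conj[OF D(2) g h]
  note Sb = frobenius_group_base[OF D(2-4) h] and Sb' = frobenius_group_base[OF D'(2-4) gh]
  have hc: "h \<in> carrier G" using h_carrier[OF D(2-4) h] .
  have "inv g \<otimes> (g \<otimes> h \<otimes> inv g) \<otimes> inv (inv g) = h" using g hc by (simp add: group_norm)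
  then have "\<Sigma> U h \<subseteq> conj_set G (inv g) (frobenius_group G \<Omega> d (g \<otimes> h \<otimes> inv g) (conj_set G g U))"
    using sub[OF gHU inv_closed[OF g] gh] conj_set_inv[OF U_base[OF D(2-4)] g] by metis
  then have "conj_set G g (\<Sigma> U h) \<subseteq> conj_set G g (conj_set G (inv g) (frobenius_group G \<Omega> d (g \<otimes> h \<otimes> inv g) (conj_set G g U)))"
    by (rule conj_set_mono[OF _ subgroup.subset[OF M_subgroup[OF M.act_closed[OF inv_closed[OF g] Sb']]] g])
  also have "\<dots> = frobenius_group G \<Omega> d (g \<otimes> h \<otimes> inv g) (conj_set G g U)"
    using conj_set_inv[OF Sb' inv_closed[OF g]] g by simp
  finally show ?thesis using sub[OF HU g h] by blast
qed

lemma Upsilon_Con: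
  assumes HU: "(H, U) \<in> base EO" and g: "g \<in> carrier G" and X: "X \<in> carrier (Obj (pi_K G) (H, U))"
  shows "Upsilon P G \<Omega> \<omega> d C v (conj_set G g H, conj_set G g U) (Con (pi_K G) g (H, U) X) =
    Con (H0 G C) g (H, U) (Upsilon P G \<Omega> \<omega> d C v (H, U) X)"
proof -
  note D = open_partD[OF HU] and gHU = EO_conj[OF HU g]
  obtain h n where h: "frob_exp H h n" "X = pi_class (H, U) h" by (rule pi_class_frob[OF HU X])
  note gh = frob_exp_conj[OF D(2) g h(1)]
  note Sb = frobenius_group_base[OF D(2-4) h(1)]
  note So = open_idom[OF D(2) open_frobenius_group[OF D(2-4) h(1)]]
  obtain \<pi> where \<pi>: "\<pi> \<in> prime_elements \<omega> C v (\<Sigma> U h)" using prime_exists[OF Sb] by blast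
  have \<pi>': "\<pi> \<in> carrier (Obj C (\<Sigma> U h))" "v (\<Sigma> U h) \<pi> = \<omega>" using \<pi> by (auto simp: prime_elements_def)
  note e = frobenius_group_conj[OF HU g h(1)]
  interpret S: group_hom "Obj C (\<Sigma> U h)" "Obj C (conj_set G g (\<Sigma> U h))" "Con C g (\<Sigma> U h)" by (rule group_hom_Con[OF g Sb])
  have g\<pi>: "Con C g (\<Sigma> U h) \<pi> \<in> prime_elements \<omega> C v (frobenius_group G \<Omega> d (g \<otimes> h \<otimes> inv g) (conj_set G g U))"
    unfolding e prime_elements_def using \<pi>' v_Con[OF g Sb] by simp
  have "recip_elem (conj_set G g H) (conj_set G g U) (g \<otimes> h \<otimes> inv g) n (Con C g (\<Sigma> U h) \<pi>) = Con C g H (recip_elem H U h n \<pi>)"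
    unfolding recip_elem_def e S.hom_nat_pow[OF \<pi>'(1), symmetric]
    by (rule C.Con_Ind[OF g D(2) So S.G.nat_pow_closed[OF \<pi>'(1)], symmetric])
  then show ?thesis
    unfolding h(2) pi_K_Con[OF HU g h_in[OF D(2-4) h(1)]] Upsilon_pi_class[OF gHU gh g\<pi>]
      Upsilon_pi_class[OF HU h(1) \<pi>] H0_Con[OF HU g recip_elem_closed[OF HU h(1) \<pi>]] by simp
qed

lemma inertia_mono: "A \<subseteq> B \<Longrightarrow> inertia G \<Omega> d A \<subseteq> inertia G \<Omega> d B"
  by (auto simp: inertia_def)

text \<open>Let s = f_I / f_H, a \<open>P\<close>-number. A lift of exponent n for \<open>I\<close>
  has exponent n s for \<open>H\<close>, so its two Frobenius groups have the same inertia degree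
  and the two exponents the same \<open>P'\<close>-part. Hence the norm of a prime element from the
  smaller group to the larger one is prime and can be used to compute the value for
  \<open>H\<close>.\<close>

lemma Upsilon_Ind:
  assumes HU: "(H, U) \<in> base EO" and IV: "(I, V) \<in> idom EO (H, U)" and X: "X \<in> carrier (Obj (pi_K G) (I, V))"
  shows "Upsilon P G \<Omega> \<omega> d C v (H, U) (Ind (pi_K G) (H, U) (I, V) X) =
    Ind (H0 G C) (H, U) (I, V) (Upsilon P G \<Omega> \<omega> d C v (I, V) X)"
proof -
  note D = open_partD[OF HU] and J = EO_idom[OF HU IV]
  note D' = open_partD[OF J(1)]
  obtain h n where h: "frob_exp I h n" "X = pi_class (I, V) h" by (rule pi_class_frob[OF J(1) X])
  note S'b = frobenius_group_base[OF D'(2-4) h(1)] and S'o = open_frobenius_group[OF D'(2-4) h(1)]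
  obtain s where s: "fd I = fd H * s" using fd_dvd[OF D(2) D'(2) J(3)] by (auto elim: dvdE)
  have Ps: "P_number P s" using P_number_dvd[OF P_number_fd[OF D'(2)]] s by simp
  then have s0: "s > 0" by (simp add: P_number_def)
  have n0: "n > 0" by (rule n_pos[OF D'(2-4) h(1)])
  have hH: "frob_exp H h (n * s)" using h(1) J(3) s s0 by (auto simp: frob_exp_def ac_simps)
  note Sb = frobenius_group_base[OF D(2-4) hH] and So = open_frobenius_group[OF D(2-4) hH]
  have sub: "\<Sigma> V h \<subseteq> \<Sigma> U h"
    by (rule frobenius_group_subset[OF Sb h_in_frobenius_group[OF D(2-4) hH]])
      (use inertia_mono[OF J(2)] inertia_U_subset_frobenius_group[OF D(2-4) hH] in blast)
  \<comment> \<open>The group \<Sigma> for \<open>(I, V)\<close> need not be open in the one for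
    \<open>(H, U)\<close>, as \<open>I\<close> need not be open in \<open>H\<close>. Induction
    between them passes through the intersection of \<open>I\<close> with the larger group, which
    the Mackey axiom provides.\<close>
  have "I \<inter> \<Sigma> U h \<in> idom M (\<Sigma> U h)"
    using mackey_M D(2) open_rdom[OF D(2) So] J(4) unfolding mackey_system_def Int_commute[of I] by blast
  moreover from this have b: "I \<inter> \<Sigma> U h \<in> base M" using M.idom_sub[OF Sb] by blast
  have "open_in_group G (I \<inter> \<Sigma> U h) (\<Sigma> V h)"
    by (rule open_in_group_subset[OF S'o]) (use sub frobenius_group_subset_H[OF D'(2-4) h(1)] in blast)+
  then have "\<Sigma> V h \<in> idom M (I \<inter> \<Sigma> U h)" by (rule open_idom[OF b])
  ultimately have id: "\<Sigma> V h \<in> idom M (\<Sigma> U h)" using M.idom_trans[OF Sb] by blast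
  obtain \<pi> where \<pi>: "\<pi> \<in> prime_elements \<omega> C v (\<Sigma> V h)" using prime_exists[OF S'b] by blast
  have \<pi>': "\<pi> \<in> carrier (Obj C (\<Sigma> V h))" "v (\<Sigma> V h) \<pi> = \<omega>" using \<pi> by (auto simp: prime_elements_def)
  interpret S: group_hom "Obj C (\<Sigma> V h)" "Obj C (\<Sigma> U h)" "Ind C (\<Sigma> U h) (\<Sigma> V h)" by (rule group_hom_Ind[OF Sb id])
  have "fd (\<Sigma> V h) = fd (\<Sigma> U h)"
    unfolding fd_frobenius_group[OF D'(2-4) h(1)] fd_frobenius_group[OF D(2-4) hH]
    using s P_part_mult'[OF n0 s0] P_part_P_number[of P s] Ps by simp
  then have \<pi>2: "Ind C (\<Sigma> U h) (\<Sigma> V h) \<pi> \<in> prime_elements \<omega> C v (\<Sigma> U h)"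
    unfolding prime_elements_def using \<pi>' v_Ind[OF Sb id] fd_pos[OF Sb] by simp
  have p: "P'_part P (n * s) = P'_part P n" using P'_part_mult'[OF n0 s0] P'_part_P_number[OF Ps] by simp
  let ?x = "\<pi> [^]\<^bsub>Obj C (\<Sigma> V h)\<^esub> P'_part P n"
  have x: "?x \<in> carrier (Obj C (\<Sigma> V h))" using \<pi>'(1) by simp
  have "recip_elem H U h (n * s) (Ind C (\<Sigma> U h) (\<Sigma> V h) \<pi>) = Ind C H I (recip_elem I V h n \<pi>)"
    unfolding recip_elem_def p S.hom_nat_pow[OF \<pi>'(1), symmetric] C.Ind_Ind[OF D(2) open_idom[OF D(2) So] id x]
    by (rule C.Ind_Ind[OF D(2) J(4) open_idom[OF D'(2) S'o] x, symmetric])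
  then show ?thesis
    unfolding h(2) pi_K_Ind[OF HU J(1,3,2) h_in[OF D'(2-4) h(1)]] Upsilon_pi_class[OF J(1) h(1) \<pi>]
      Upsilon_pi_class[OF HU hH \<pi>2] H0_Ind[OF HU IV recip_elem_closed[OF J(1) h(1) \<pi>]] by simp
qed

text \<open>Both groups have the same image under \<open>d\<close> and the same inertia
  group.\<close>

lemma frobenius_group_unramified:
  assumes HU: "(H, U) \<in> base EO" and U: "inertia G \<Omega> d H \<subseteq> U" and \<phi>: "frob_exp H \<phi> 1"
  shows "\<Sigma> U \<phi> = H"
proof
  note D = open_partD[OF HU]
  show "\<Sigma> U \<phi> \<subseteq> H" by (rule frobenius_group_subset_H[OF D(2-4) \<phi>])
  note Sb = frobenius_group_base[OF D(2-4) \<phi>]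
  show "H \<subseteq> \<Sigma> U \<phi>"
  proof
    fix x assume x: "x \<in> H"
    then have "d x \<in> d ` \<Sigma> U \<phi>" using d_frobenius_group[OF D(2-4) \<phi>] d_image[OF D(2)] by auto
    then obtain y where y: "y \<in> \<Sigma> U \<phi>" "d x = d y" by blast
    have yH: "y \<in> H" using y(1) frobenius_group_subset_H[OF D(2-4) \<phi>] by blast
    have c: "x \<in> carrier G" "y \<in> carrier G" using M_carrier[OF D(2)] x yH by auto
    have "x \<otimes> inv y \<in> H" using x yH M_subgroup[OF D(2)] by (simp add: subgroup.m_closed subgroup.m_inv_closed)
    moreover have "d (x \<otimes> inv y) = \<one>\<^bsub>\<Omega>\<^esub>" using c y(2) by simp
    ultimately have "x \<otimes> inv y \<in> inertia G \<Omega> d U" using U in_inertia_iff[OF D(2)] in_inertia_iff[OF U_base[OF D(2-4)]] by blast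
    then have "x \<otimes> inv y \<in> \<Sigma> U \<phi>" using inertia_U_subset_frobenius_group[OF D(2-4) \<phi>] by blast
    then have "x \<otimes> inv y \<otimes> y \<in> \<Sigma> U \<phi>" using y(1) subgroup.m_closed[OF M_subgroup[OF Sb]] by blast
    then show "x \<in> \<Sigma> U \<phi>" using c by (simp add: m_assoc)
  qed
qed

text \<open>A Frobenius element is a lift of exponent 1 with \<Sigma> = H, so its value is the class
  of \<pi>; the homomorphism property extends this to all integers k.\<close>

lemma Upsilon_unramified:
  assumes HU: "(H, U) \<in> base E" and U: "U \<in> unramified G \<Omega> d H" and \<pi>: "\<pi> \<in> prime_elements \<omega> C v H"
  shows "Upsilon P G \<Omega> \<omega> d C v (H, U) (ab_class G (H, U) (frobenius G \<Omega> \<omega> d H U [^]\<^bsub>quot G (H, U)\<^esub> (k::int))) =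
    ind_image C H U #>\<^bsub>Obj C H\<^esub> (\<pi> [^]\<^bsub>Obj C H\<^esub> k)"
proof -
  have HU': "(H, U) \<in> base EO" using HU U by (auto simp: open_part_def open_pairs_def unramified_def)
  note D = open_partD[OF HU']
  obtain \<phi> where \<phi>: "frob_exp H \<phi> 1" using frobenius_exists[OF D(2)] by blast
  have UI: "inertia G \<Omega> d H \<subseteq> U" using U by (simp add: unramified_def)
  note S = frobenius_group_unramified[OF HU' UI \<phi>]
  have \<pi>': "\<pi> \<in> prime_elements \<omega> C v (\<Sigma> U \<phi>)" "\<pi> \<in> carrier (Obj C H)" using \<pi> S by (auto simp: prime_elements_def)
  interpret u: group_hom "quot G (H, U)" "Obj (H0 G C) (H, U)" "Upsilon' P G \<Omega> \<omega> d C v (H, U)" by (rule group_hom_Upsilon'[OF HU'])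
  interpret c: group_hom "Obj C H" "Obj (H0 G C) (H, U)" "\<lambda>x. ind_image C H U #>\<^bsub>Obj C H\<^esub> x" by (rule H0_class_hom[OF HU'])
  have "U #> \<phi> \<in> carrier (quot G (H, U))" using h_in[OF D(2-4) \<phi>] by (simp add: carrier_quot)
  moreover have "P'_part P 1 = 1" by (rule P'_part_P_number) (simp add: P_number_def)
  then have "recip_elem H U \<phi> 1 \<pi> = \<pi>"
    unfolding recip_elem_def S using C.Ind_id[OF D(2)] \<pi>'(2) by simp
  ultimately show ?thesis
    unfolding frobenius_coset[OF D(2) U \<phi>]
    using Upsilon_ab_class[OF HU'] Upsilon'_eq[OF HU' \<phi> \<pi>'(1)] u.hom_int_pow c.hom_int_pow[OF \<pi>'(2)] by simp
qed

end

section \<open>The transfer computed along double cosets\<close>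

context group
begin

lemma nat_pow_conj:
  assumes "g \<in> carrier G" "h \<in> carrier G"
  shows "(g \<otimes> h \<otimes> inv g) [^] (n::nat) = g \<otimes> h [^] n \<otimes> inv g"
  using assms by (induction n) (simp_all add: group_norm)

text \<open>f is the length of the orbit of the coset \<open>I\<close> under right multiplication by
  x, and r is some multiple of it.\<close>

lemma nat_pow_in_subgroup_iff_dvd:
  assumes I: "subgroup I G" and x: "x \<in> carrier G" and r: "r > 0" "x [^] (r::nat) \<in> I"
  obtains f :: nat where "f > 0" "f dvd r" "\<And>j::nat. x [^] j \<in> I \<longleftrightarrow> f dvd j"
proof -
  interpret I: subgroup I G by fact
  define f where "f = (LEAST f::nat. f > 0 \<and> x [^] f \<in> I)"
  have f: "f > 0 \<and> x [^] f \<in> I" unfolding f_def by (rule LeastI) (use r in blast)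
  have least: "f \<le> j" if "j > 0" "x [^] j \<in> I" for j unfolding f_def by (rule Least_le) (use that in blast)
  have mult: "x [^] (f * q) \<in> I" for q
    using f x by (induction q) (simp_all add: nat_pow_mult[symmetric] mult_Suc_right)
  have iff: "x [^] j \<in> I \<longleftrightarrow> f dvd j" for j
  proof
    assume j: "x [^] j \<in> I"
    have "x [^] j = x [^] (f * (j div f)) \<otimes> x [^] (j mod f)" using x by (simp add: nat_pow_mult)
    then have "x [^] (j mod f) = inv (x [^] (f * (j div f))) \<otimes> x [^] j" using x by (simp add: inv_mult_cancel)
    then have "x [^] (j mod f) \<in> I" using j mult[of "j div f"] by simp
    then have "j mod f = 0" using least[of "j mod f"] f mod_less_divisor[of f j] by linarith
    then show "f dvd j" by auto
  qed (use mult in \<open>auto elim!: dvdE\<close>)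
  show ?thesis using that[of f] f iff r by blast
qed

text \<open>Right multiplication by h permutes the right cosets of \<open>I\<close> in
  \<open>H\<close>. By \<open>dec\<close>, the cosets inside one double coset of \<open>I\<close>
  and \<open>S\<close> form a single cycle through the coset of y, of length \<open>f y\<close>,
  although \<open>S\<close> may be larger than the group generated by h. Along a cycle all transfer
  factors are trivial except at the return to y, where y h^(f y) y^-1 appears.\<close>

lemma transfer_double_cosets:
  fixes f :: "'a \<Rightarrow> nat"
  assumes H: "subgroup H G" and I: "subgroup I G" "I \<subseteq> H" and S: "subgroup S G" "S \<subseteq> H" and h: "h \<in> S"
    and R: "R \<subseteq> H" "finite R" "bij_betw (\<lambda>y. I #> y <#> S) R (double_cosets G H I S)"
    and f: "\<And>y. y \<in> R \<Longrightarrow> f y > 0" "\<And>y j. y \<in> R \<Longrightarrow> y \<otimes> h [^] j \<otimes> inv y \<in> I \<longleftrightarrow> f y dvd j"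
    and dec: "\<And>y s. y \<in> R \<Longrightarrow> s \<in> S \<Longrightarrow> \<exists>j<f y. y \<otimes> s \<otimes> inv (h [^] j) \<otimes> inv y \<in> I"
    and A: "comm_group A" and \<theta>: "\<And>x. x \<in> I \<Longrightarrow> \<theta> x \<in> carrier A"
    "\<And>x y. x \<in> I \<Longrightarrow> y \<in> I \<Longrightarrow> \<theta> (x \<otimes> y) = \<theta> x \<otimes>\<^bsub>A\<^esub> \<theta> y"
  obtains T where "transversal H I T"
    "transfer I T A \<theta> h = (\<Otimes>\<^bsub>A\<^esub> y \<in> R. \<theta> (y \<otimes> h [^] f y \<otimes> inv y))"
proof -
  interpret H: subgroup H G by fact
  interpret I: subgroup I G by fact
  interpret S: subgroup S G by fact
  interpret A: comm_group A by fact
  have hc: "h \<in> carrier G" by (rule S.mem_carrier[OF h])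
  have Rc: "y \<in> carrier G" if "y \<in> R" for y using subsetD[OF R(1) that] by simp
  have hS: "h [^] (i::nat) \<in> S" for i by (induction i) (simp_all add: h)
  define t where "t y i = y \<otimes> h [^] (i::nat)" for y i
  have tH: "t y i \<in> H" if "y \<in> R" for y i using subsetD[OF R(1) that] subsetD[OF S(2) hS, of i] by (simp add: t_def)
  \<comment> \<open>The elements y h^i with i below the cycle length lie in distinct cosets of
    \<open>I\<close>: y is determined by its double coset and i by the cycle length.\<close>
  have key: "y = y' \<and> i = j"
    if y: "y \<in> R" "y' \<in> R" and ij: "i < f y" "j < f y'" and a: "t y i \<otimes> inv (t y' j) \<in> I" for y y' i j
  proof -
    note c = Rc[OF y(1)] Rc[OF y(2)]
    have yd: "(t y i \<otimes> inv (t y' j)) \<otimes> y' \<otimes> (h [^] j \<otimes> inv (h [^] i)) = y"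
      using c hc by (simp add: t_def group_norm)
    have "h [^] j \<otimes> inv (h [^] i) \<in> S" using hS by simp
    from double_coset_eqI[OF I(1) S(1) c(2) a this] have "I #> y <#> S = I #> y' <#> S" unfolding yd .
    then have e: "y' = y" using R(3) y by (auto simp: bij_betw_def inj_on_def)
    have *: "i = j" if ij: "i \<le> j" "j < f y" and a: "t y i \<otimes> inv (t y j) \<in> I" for i j
    proof -
      define b where "b = h [^] (j - i)"
      have b: "b \<in> carrier G" "h [^] j = b \<otimes> h [^] i" using ij(1) hc by (simp_all add: b_def nat_pow_mult)
      have "inv (t y i \<otimes> inv (t y j)) = y \<otimes> b \<otimes> inv y"
        unfolding t_def b(2) using c(1) hc b(1) by (simp add: group_norm)
      then have "y \<otimes> h [^] (j - i) \<otimes> inv y \<in> I" using I.m_inv_closed[OF a] unfolding b_def by metis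
      then have "f y dvd j - i" unfolding f(2)[OF y(1)] .
      moreover have "j - i < f y" using ij(2) by simp
      ultimately have "j - i = 0" using nat_dvd_not_less[of "j - i" "f y"] by blast
      then show ?thesis using ij(1) by simp
    qed
    have a': "t y i \<otimes> inv (t y j) \<in> I" using a unfolding e .
    have "inv (t y i \<otimes> inv (t y j)) = t y j \<otimes> inv (t y i)"
      using H.mem_carrier[OF tH[OF y(1), of i]] H.mem_carrier[OF tH[OF y(1), of j]] by (simp add: inv_mult_group)
    then have a'': "t y j \<otimes> inv (t y i) \<in> I" using I.m_inv_closed[OF a'] by metis
    have "j < f y" using ij(2) unfolding e .
    then have "i = j" using *[OF _ _ a'] *[OF _ ij(1) a''] nat_le_linear[of i j] by blast
    then show ?thesis using e by blast
  qed
  define T where "T = (\<Union>y\<in>R. t y ` {..<f y})"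
  have T: "transversal H I T"
    unfolding transversal_def
  proof (intro conjI ballI)
    show "T \<subseteq> H" using tH by (auto simp: T_def)
    fix x assume x: "x \<in> H"
    then have "I #> x <#> S \<in> double_cosets G H I S" by (auto simp: double_cosets_def)
    then obtain y where y: "y \<in> R" "I #> x <#> S = I #> y <#> S" using R(3) by (auto simp: bij_betw_def)
    note c = Rc[OF y(1)] H.mem_carrier[OF x]
    have "\<one> \<otimes> x \<otimes> \<one> \<in> I #> x <#> S"
      by (rule subgroup_in_double_coset[OF I(1) S(1) c(2)]) simp_all
    then have "x \<in> I #> y <#> S" using y c by simp
    then obtain a s where as: "a \<in> I" "s \<in> S" "x = a \<otimes> y \<otimes> s" unfolding set_mult_def r_coset_def by blast
    obtain j where j: "j < f y" "y \<otimes> s \<otimes> inv (h [^] j) \<otimes> inv y \<in> I" using dec[OF y(1) as(2)] by blast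
    have "x \<otimes> inv (t y j) = a \<otimes> (y \<otimes> s \<otimes> inv (h [^] j) \<otimes> inv y)"
      using as c hc by (simp add: t_def group_norm)
    then have tj: "x \<otimes> inv (t y j) \<in> I" using as(1) j(2) by simp
    show "\<exists>!t. t \<in> T \<and> x \<otimes> inv t \<in> I"
    proof (rule ex1I[of _ "t y j"])
      show "t y j \<in> T \<and> x \<otimes> inv (t y j) \<in> I" using tj y(1) j(1) by (auto simp: T_def)
      fix z assume z: "z \<in> T \<and> x \<otimes> inv z \<in> I"
      then obtain y' i where yi: "y' \<in> R" "i < f y'" "z = t y' i" by (auto simp: T_def)
      have zI: "inv (x \<otimes> inv z) \<in> I" using z I.m_inv_closed by blast
      have "inv (x \<otimes> inv z) \<otimes> (x \<otimes> inv (t y j)) = t y' i \<otimes> inv (t y j)"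
        unfolding yi(3) using H.mem_carrier[OF tH[OF yi(1), of i]] H.mem_carrier[OF tH[OF y(1), of j]] c(2) by (simp add: group_norm)
      then have "t y' i \<otimes> inv (t y j) \<in> I" using I.m_closed[OF zI tj] by simp
      then show "z = t y j" using key[OF yi(1) y(1) yi(2) j(1)] yi(3) by simp
    qed
  qed
  let ?g = "\<lambda>z. \<theta> (z \<otimes> h \<otimes> inv (coset_rep I T (z \<otimes> h)))"
  have \<theta>1: "\<theta> \<one> = \<one>\<^bsub>A\<^esub>"
    using \<theta>(2)[of \<one> \<one>] \<theta>(1)[of \<one>] A.l_cancel_one[of "\<theta> \<one>" "\<theta> \<one>"] subgroup.one_closed[OF I(1)] by simp
  \<comment> \<open>Multiplication by h moves y h^i to y h^(i+1), which is again in the transversal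
    unless i is the last index \<open>f y\<close> - 1; then the representative is y itself.\<close>
  have g: "?g (t y i) = (if Suc i = f y then \<theta> (y \<otimes> h [^] f y \<otimes> inv y) else \<one>\<^bsub>A\<^esub>)"
    if y: "y \<in> R" and i: "i < f y" for y i
  proof -
    note c = Rc[OF y]
    have e: "t y i \<otimes> h = t y (Suc i)" using c hc by (simp add: t_def m_assoc)
    have tT: "t y j \<in> T" if "j < f y" for j using that y by (auto simp: T_def)
    have tc: "t y j \<in> carrier G" for j by (rule H.mem_carrier[OF tH[OF y]])
    show ?thesis
    proof (cases "Suc i = f y")
      case True
      have t0: "t y (f y) \<otimes> inv (t y 0) = y \<otimes> h [^] f y \<otimes> inv y" using c hc by (simp add: t_def)
      then have "t y (f y) \<otimes> inv (t y 0) \<in> I" using f(2)[OF y, of "f y"] by simp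
      then have "coset_rep I T (t y (f y)) = t y 0"
        by (rule coset_rep_eqI[OF H I T tH[OF y] tT[OF f(1)[OF y]]])
      then show ?thesis unfolding e True using t0 by simp
    next
      case False
      then have si: "Suc i < f y" using i by simp
      have "t y (Suc i) \<otimes> inv (t y (Suc i)) \<in> I" using tc subgroup.one_closed[OF I(1)] by simp
      then have "coset_rep I T (t y (Suc i)) = t y (Suc i)"
        by (rule coset_rep_eqI[OF H I T tH[OF y] tT[OF si]])
      then show ?thesis unfolding e using False tc \<theta>1 by simp
    qed
  qed
  have xI: "y \<otimes> h [^] f y \<otimes> inv y \<in> I" if "y \<in> R" for y using f(2)[OF that, of "f y"] by simp
  have gc: "?g z \<in> carrier A" if "y \<in> R" "z \<in> t y ` {..<f y}" for y z
    using that g[OF that(1)] \<theta>(1)[OF xI[OF that(1)]] by auto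
  have inner: "finprod A ?g (t y ` {..<f y}) = \<theta> (y \<otimes> h [^] f y \<otimes> inv y)" if y: "y \<in> R" for y
  proof -
    have inj: "inj_on (t y) {..<f y}"
    proof (rule inj_onI)
      fix i j assume "i \<in> {..<f y}" "j \<in> {..<f y}" "t y i = t y j"
      then show "i = j" using key[OF y y, of i j] tH[OF y, of j] by simp
    qed
    obtain k where k: "f y = Suc k" using f(1)[OF y] gr0_implies_Suc by blast
    have "finprod A ?g (t y ` {..<f y}) = (\<Otimes>\<^bsub>A\<^esub> i \<in> {..<f y}. ?g (t y i))"
      by (rule A.finprod_reindex[OF _ inj]) (use gc[OF y] in auto)
    also have "\<dots> = (\<Otimes>\<^bsub>A\<^esub> i \<in> {..<Suc k}. if i = k then \<theta> (y \<otimes> h [^] f y \<otimes> inv y) else \<one>\<^bsub>A\<^esub>)"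
      by (rule A.finprod_cong') (use g[OF y] k \<theta>(1)[OF xI[OF y]] in auto)
    also have "\<dots> = \<theta> (y \<otimes> h [^] f y \<otimes> inv y)"
      using A.finprod_singleton[of k "{..<Suc k}" "\<lambda>_. \<theta> (y \<otimes> h [^] f y \<otimes> inv y)"] \<theta>(1)[OF xI[OF y]] 
      by (simp add: eq_commute)
    finally show ?thesis .
  qed
  have disj: "t y ` {..<f y} \<inter> t y' ` {..<f y'} = {}" if y: "y \<in> R" "y' \<in> R" "y \<noteq> y'" for y y'
  proof -
    have "t y i \<noteq> t y' j" if ij: "i < f y" "j < f y'" for i j
    proof
      assume "t y i = t y' j"
      then have "t y i \<otimes> inv (t y' j) \<in> I" using H.mem_carrier[OF tH[OF y(2), of j]] subgroup.one_closed[OF I(1)] by simp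
      then show False using key[OF y(1,2) ij] y(3) by simp
    qed
    then show ?thesis by blast
  qed
  have "finprod A ?g (\<Union>y\<in>R. t y ` {..<f y}) = (\<Otimes>\<^bsub>A\<^esub> y \<in> R. finprod A ?g (t y ` {..<f y}))"
    by (rule A.finprod_UN_disjoint[OF R(2) _ _ gc]) (simp_all add: pairwise_def disjnt_def disj)
  then have "transfer I T A \<theta> h = (\<Otimes>\<^bsub>A\<^esub> y \<in> R. finprod A ?g (t y ` {..<f y}))"
    unfolding transfer_def T_def[symmetric] .
  also have "\<dots> = (\<Otimes>\<^bsub>A\<^esub> y \<in> R. \<theta> (y \<otimes> h [^] f y \<otimes> inv y))"
    by (rule A.finprod_cong') (use inner \<theta>(1)[OF xI] in auto)
  finally show ?thesis using that T by blast
qed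

end

context fn_setting
begin

text \<open>Since f_H, f_I and f are \<open>P\<close>-numbers, the exponent m with f_H n f = f_I m
  has the same \<open>P'\<close>-part as n. The group \<Sigma> of x is the union of the translates
  by x^i, i < f, of the Frobenius group of x^f, and among these only the one with i = 0 meets
  \<open>I\<close>.\<close>

lemma frobenius_group_power:
  assumes HU: "(H, U) \<in> base EO" and IU: "(I, U) \<in> base EO" and sub: "I \<subseteq> H"
    and x: "frob_exp H x n" and f: "f > 0" "P_number P f" "\<And>j::nat. x [^] j \<in> I \<longleftrightarrow> f dvd j"
  obtains m where "frob_exp I (x [^] f) m" "P'_part P m = P'_part P n"
    "\<Sigma> U (x [^] f) = I \<inter> \<Sigma> U x"
    "\<And>s. s \<in> \<Sigma> U x \<Longrightarrow> \<exists>j<f. s \<otimes> inv (x [^] j) \<in> I"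
proof -
  note D = open_partD[OF HU] and D' = open_partD[OF IU]
  have UI: "U \<subseteq> I" using D'(3) by (simp add: open_in_group_def)
  interpret I: subgroup I G by (rule M_subgroup[OF D'(2)])
  note xc = h_carrier[OF D(2-4) x] and n0 = n_pos[OF D(2-4) x]
  note Sb = frobenius_group_base[OF D(2-4) x]
  interpret S: subgroup "\<Sigma> U x" G by (rule M_subgroup[OF Sb])
  have xI: "x [^] f \<in> I" using f(3) by simp
  have dx: "d (x [^] f) = \<omega> [^]\<^bsub>\<Omega>\<^esub> (fd H * n * f)"
    using d_pow[OF xc] d_h[OF D(2-4) x] by (simp add: Om.nat_pow_pow)
  then have "fd I dvd fd H * n * f" using omega_in_fd[OF D'(2), of "fd H * n * f"] xI by (metis imageI)
  then obtain m where m: "fd H * n * f = fd I * m" by (auto elim: dvdE)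
  have pos: "fd H > 0" "fd I > 0" "n > 0" "f > 0" using fd_pos D(2) D'(2) n0 f(1) by auto
  then have m0: "m > 0" using m by (metis gr0I mult_is_0 not_gr0)
  have fm: "frob_exp I (x [^] f) m" using xI m0 dx m by (simp add: frob_exp_def)
  have "P'_part P (fd H * n * f) = P'_part P n" "P'_part P (fd I * m) = P'_part P m"
    using pos m0 P'_part_P_number[OF P_number_fd[OF D(2)]] P'_part_P_number[OF P_number_fd[OF D'(2)]]
      P'_part_P_number[OF f(2)] by (simp_all add: P'_part_mult')
  then have pm: "P'_part P m = P'_part P n" using m by simp
  note Sb' = frobenius_group_base[OF D'(2-4) fm]
  note SI = frobenius_group_subset_H[OF D'(2-4) fm]
  have S'S: "\<Sigma> U (x [^] f) \<subseteq> \<Sigma> U x"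
    by (rule frobenius_group_subset[OF Sb nat_pow_in[OF D(2-4) Sb h_in_frobenius_group[OF D(2-4) x]] inertia_U_subset_frobenius_group[OF D(2-4) x]])
  have decomp: "\<exists>i<f. \<exists>b \<in> \<Sigma> U (x [^] f). s = x [^] i \<otimes> b" if s: "s \<in> \<Sigma> U x" for s
  proof -
    obtain c u where c: "c \<in> closed_generate x" "u \<in> inertia G \<Omega> d U" "s = c \<otimes> u"
      using s unfolding frobenius_group_def set_mult_def by blast
    obtain i a where i: "i < f" "a \<in> closed_generate (x [^] f)" "c = x [^] i \<otimes> a"
      by (rule closed_generate_decomp[OF xc f(1) c(1)])
    have b: "a \<otimes> u \<in> \<Sigma> U (x [^] f)" using i(2) c(2) unfolding frobenius_group_def set_mult_def by blast
    have "a \<in> carrier G" by (rule subgroup.mem_carrier[OF subgroup_closed_generate i(2)]) (use xc in simp)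
    moreover have "u \<in> carrier G" using c(2) inertia_subset M_carrier[OF U_base[OF D(2-4)]] by blast
    ultimately have "s = x [^] i \<otimes> (a \<otimes> u)" using c(3) i(3) xc by (simp add: m_assoc)
    then show ?thesis using i(1) b by blast
  qed
  have "I \<inter> \<Sigma> U x \<subseteq> \<Sigma> U (x [^] f)"
  proof
    fix z assume z: "z \<in> I \<inter> \<Sigma> U x"
    then obtain i b where ib: "i < f" "b \<in> \<Sigma> U (x [^] f)" "z = x [^] i \<otimes> b" using decomp by blast
    have bI: "b \<in> I" using ib(2) SI by blast
    have "x [^] i = z \<otimes> inv b" using ib(3) bI xc by (simp add: m_assoc)
    then have "x [^] i \<in> I" using z bI by simp
    then have "f dvd i" using f(3) by blast
    then have "i = 0" using ib(1) by (auto dest: dvd_imp_le)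
    then show "z \<in> \<Sigma> U (x [^] f)" using ib bI by simp
  qed
  then have eq: "\<Sigma> U (x [^] f) = I \<inter> \<Sigma> U x" using SI S'S by blast
  \<comment> \<open>\<open>decomp\<close> has the power of x on the left, while here it is needed on
    the right; it is applied to the inverse of s, which turns a nonzero i into f - i.\<close>
  have dec: "\<exists>j<f. s \<otimes> inv (x [^] j) \<in> I" if s: "s \<in> \<Sigma> U x" for s
  proof -
    obtain i b where ib: "i < f" "b \<in> \<Sigma> U (x [^] f)" "inv s = x [^] i \<otimes> b" using decomp[of "inv s"] s by blast
    have bI: "b \<in> I" using ib(2) SI by blast
    have sc: "s \<in> carrier G" using s by simp
    have si: "s = inv b \<otimes> inv (x [^] i)" using arg_cong[OF ib(3), of "m_inv G"] sc bI xc by (simp add: inv_mult_group)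
    show ?thesis
    proof (cases "i = 0")
      case True
      then have "s \<otimes> inv (x [^] (0::nat)) = inv b" using si bI by simp
      then show ?thesis using f(1) bI by (intro exI[of _ 0]) simp
    next
      case False
      have "s \<otimes> inv (x [^] (f - i)) = inv b \<otimes> inv (x [^] (f - i) \<otimes> x [^] i)"
        using si bI xc by (simp add: inv_mult_group m_assoc)
      also have "\<dots> = inv b \<otimes> inv (x [^] f)" using ib(1) xc by (simp add: nat_pow_mult)
      finally have "s \<otimes> inv (x [^] (f - i)) \<in> I" using bI xI by simp
      then show ?thesis using False f(1) by (intro exI[of _ "f - i"]) simp
    qed
  qed
  show ?thesis by (rule that[OF fm pm eq dec])
qed

text \<open>The terms match one by one. For a double coset representative y, the first power of y h
  y^-1 in \<open>I\<close> is a Frobenius element for \<open>I\<close>; its Frobenius group is the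
  intersection of \<open>I\<close> with y \<Sigma> y^-1, the very group in the double coset formula,
  and the conjugate of the restriction of \<pi> is a prime element for it.\<close>

lemma Upsilon_Res:
  assumes HU: "(H, U) \<in> base EO" and IU: "(I, U) \<in> base EO" "I \<in> rdom M H"
    and X: "X \<in> carrier (Obj (pi_K G) (H, U))"
  shows "Upsilon P G \<Omega> \<omega> d C v (I, U) (Res (pi_K G) (I, U) (H, U) X) =
    Res (H0 G C) (I, U) (H, U) (Upsilon P G \<Omega> \<omega> d C v (H, U) X)"
proof -
  note D = open_partD[OF HU] and D' = open_partD[OF IU(1)]
  have sub: "I \<subseteq> H" using rdom_idom_subset[OF D(2)] IU(2) by blast
  have UI: "U \<subseteq> I" using D'(3) by (simp add: open_in_group_def)
  note Hs = M_subgroup[OF D(2)] and Is = M_subgroup[OF D'(2)] and Ub = U_base[OF D(2-4)]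
  obtain h n where h: "frob_exp H h n" "X = pi_class (H, U) h" by (rule pi_class_frob[OF HU X])
  note hH = h_in[OF D(2-4) h(1)] and hc = h_carrier[OF D(2-4) h(1)]
  let ?S = "\<Sigma> U h"
  note Sb = frobenius_group_base[OF D(2-4) h(1)] and So = open_frobenius_group[OF D(2-4) h(1)]
  note Si = open_idom[OF D(2) So] and Ss = M_subgroup[OF Sb] and hS = h_in_frobenius_group[OF D(2-4) h(1)]
  note SH = frobenius_group_subset_H[OF D(2-4) h(1)]
  obtain \<pi> where \<pi>: "\<pi> \<in> prime_elements \<omega> C v ?S" using prime_exists[OF Sb] by blast
  have \<pi>': "\<pi> \<in> carrier (Obj C ?S)" "v ?S \<pi> = \<omega>" using \<pi> by (auto simp: prime_elements_def)
  interpret CS: comm_group "Obj C ?S" by (rule C_comm[OF Sb])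
  define k where "k = P'_part P n"
  have \<pi>k: "\<pi> [^]\<^bsub>Obj C ?S\<^esub> k \<in> carrier (Obj C ?S)" using \<pi>'(1) by simp
  have "finite (double_cosets G H I ?S)" using mackey_M D(2) IU(2) Si unfolding mackey_system_def by blast
  moreover obtain R where R: "R \<subseteq> H" "inj_on (\<lambda>h. I #> h <#> ?S) R" "double_cosets G H I ?S = (\<lambda>h. I #> h <#> ?S) ` R"
    using subset_image_inj[of "double_cosets G H I ?S" "\<lambda>h. I #> h <#> ?S" H] by (auto simp: double_cosets_def)
  ultimately have bij: "bij_betw (\<lambda>h. I #> h <#> ?S) R (double_cosets G H I ?S)" and finR: "finite R"
    by (simp_all add: bij_betw_def finite_image_iff)
  define x where "x y = y \<otimes> h \<otimes> inv y" for y
  have Hc: "y \<in> carrier G" if "y \<in> H" for y using M_carrier[OF D(2) that] .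
  have xp: "x y [^] (j::nat) = y \<otimes> h [^] j \<otimes> inv y" if "y \<in> H" for y j
    unfolding x_def by (rule nat_pow_conj[OF Hc[OF that] hc])
  have conjH: "conj_set G y H = H" if y: "y \<in> H" for y
  proof -
    have "normal_in G H H" unfolding normal_in_iff[OF Hs] using Hs by (simp add: subgroup.m_closed subgroup.m_inv_closed)
    then show ?thesis using conj_set_normal[OF Hs _ y] by blast
  qed
  have xf: "frob_exp H (x y) n" and xS: "\<Sigma> U (x y) = conj_set G y ?S" if y: "y \<in> H" for y
    using frob_exp_conj[OF D(2) Hc[OF y] h(1)] frobenius_group_conj[OF HU Hc[OF y] h(1)] conjH[OF y]
      conj_set_normal[OF Hs D(4) y] by (simp_all add: x_def)
  \<comment> \<open>\<open>f y\<close> is the least positive exponent that brings a power of y h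
    y^-1 into \<open>I\<close>. It divides [H:U], since \<open>U\<close> lies in \<open>I\<close>,
    and is therefore a \<open>P\<close>-number.\<close>
  have "\<exists>f::nat. f > 0 \<and> f dvd index G H U \<and> (\<forall>j::nat. x y [^] j \<in> I \<longleftrightarrow> f dvd j)" if y: "y \<in> H" for y
  proof -
    have "x y [^] index G H U \<in> I" by (rule subsetD[OF UI pow_index_in[OF D(2-4) h_in[OF D(2-4) xf[OF y]]]])
    then show ?thesis
      by (rule nat_pow_in_subgroup_iff_dvd[OF Is h_carrier[OF D(2-4) xf[OF y]] index_pos[OF D(2-4)]])
        (intro exI conjI allI, assumption+)
  qed
  then have "\<forall>y \<in> H. \<exists>f::nat. f > 0 \<and> f dvd index G H U \<and> (\<forall>j::nat. x y [^] j \<in> I \<longleftrightarrow> f dvd j)" by blast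
  from bchoice[OF this] obtain f :: "'g \<Rightarrow> nat" where f': "\<forall>y \<in> H. f y > 0 \<and> f y dvd index G H U \<and> (\<forall>j::nat. x y [^] j \<in> I \<longleftrightarrow> f y dvd j)" ..
  have f: "f y > 0" "f y dvd index G H U" "x y [^] (j::nat) \<in> I \<longleftrightarrow> f y dvd j" if "y \<in> H" for y j
    using bspec[OF f' that] by simp_all
  have "\<exists>m. frob_exp I (x y [^] f y) m \<and> P'_part P m = k \<and> \<Sigma> U (x y [^] f y) = I \<inter> conj_set G y ?S \<and>
      (\<forall>s \<in> conj_set G y ?S. \<exists>j<f y. s \<otimes> inv (x y [^] j) \<in> I)" if y: "y \<in> H" for y
    unfolding xS[OF y, symmetric]
    by (rule frobenius_group_power[OF HU IU(1) sub xf[OF y] f(1)[OF y] P_number_dvd[OF P_number_index[OF D(2-4)] f(2)[OF y]] f(3)[OF y]])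
      (auto simp: k_def)
  then have "\<forall>y \<in> H. \<exists>m. frob_exp I (x y [^] f y) m \<and> P'_part P m = k \<and> \<Sigma> U (x y [^] f y) = I \<inter> conj_set G y ?S \<and>
      (\<forall>s \<in> conj_set G y ?S. \<exists>j<f y. s \<otimes> inv (x y [^] j) \<in> I)" by blast
  from bchoice[OF this] obtain m where m': "\<forall>y \<in> H. frob_exp I (x y [^] f y) (m y) \<and> P'_part P (m y) = k \<and>
      \<Sigma> U (x y [^] f y) = I \<inter> conj_set G y ?S \<and> (\<forall>s \<in> conj_set G y ?S. \<exists>j<f y. s \<otimes> inv (x y [^] j) \<in> I)" ..
  have m: "frob_exp I (x y [^] f y) (m y)" "P'_part P (m y) = k"
      "\<Sigma> U (x y [^] f y) = I \<inter> conj_set G y ?S" "\<forall>s \<in> conj_set G y ?S. \<exists>j<f y. s \<otimes> inv (x y [^] j) \<in> I"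
    if "y \<in> H" for y using bspec[OF m' that] by simp_all
  let ?K = "\<lambda>y. conj_set G (inv y) I \<inter> ?S"
  define \<pi>y where "\<pi>y y = Con C y (?K y) (Res C (?K y) ?S \<pi>)" for y
  \<comment> \<open>\<open>U\<close> is contained in every conjugate of \<open>I\<close> by an
    element of \<open>H\<close>, so \<open>?K y\<close> and \<Sigma> have the same inertia group and
    restriction preserves prime elements.\<close>
  have K: "?K y \<in> rdom M ?S" "conj_set G y (?K y) = \<Sigma> U (x y [^] f y)" "inertia G \<Omega> d (?K y) = inertia G \<Omega> d ?S"
    if y: "y \<in> H" for y
  proof -
    have iy: "inv y \<in> H" using y Hs by (simp add: subgroup.m_inv_closed)
    have gI: "(conj_set G (inv y) H, conj_set G (inv y) U) \<in> base EO" by (rule EO_conj[OF HU Hc[OF iy]])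
    have "open_in_group G (conj_set G (inv y) H) (conj_set G (inv y) I)"
      by (rule open_in_group_conj[OF EO_open[OF HU IU(1) sub] Hs Hc[OF iy] M_subgroup[OF M.act_closed[OF Hc[OF iy] D'(2)]]])
    then have "open_in_group G H (conj_set G (inv y) I)" using conjH[OF iy] by simp
    then have "open_in_group G H (?K y)" by (rule open_in_group_Int[OF _ So])
    then have "open_in_group G ?S (?K y)" by (rule open_in_group_subset[OF _ Int_lower2 SH])
    then show "?K y \<in> rdom M ?S" by (rule open_rdom[OF Sb])
    have Ic: "conj_set G (inv y) I \<subseteq> carrier G" using M_subgroup[OF M.act_closed[OF Hc[OF iy] D'(2)]] by (rule subgroup.subset)
    have "conj_set G y (?K y) = conj_set G y (conj_set G (inv y) I) \<inter> conj_set G y ?S"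
      by (rule conj_set_Int[OF Ic subgroup.subset[OF Ss] Hc[OF y]])
    also have "conj_set G y (conj_set G (inv y) I) = I"
      using conj_set_inv[OF D'(2) Hc[OF iy]] Hc[OF y] by simp
    finally show "conj_set G y (?K y) = \<Sigma> U (x y [^] f y)" using m(3)[OF y] by simp
    have "conj_set G (inv y) U \<subseteq> conj_set G (inv y) I"
      by (rule conj_set_mono[OF UI subgroup.subset[OF Is] Hc[OF iy]])
    then have "U \<subseteq> conj_set G (inv y) I" using conj_set_normal[OF Hs D(4) iy] by simp
    then show "inertia G \<Omega> d (?K y) = inertia G \<Omega> d ?S"
      using inertia_frobenius_group[OF D(2-4) h(1)] inertia_subset[of U] by (auto simp: inertia_def)
  qed
  have Kb: "?K y \<in> base M" if "y \<in> H" for y using K(1)[OF that] M.rdom_sub[OF Sb] by blast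
  have r: "Res C (?K y) ?S \<pi> \<in> carrier (Obj C (?K y))" if "y \<in> H" for y by (rule Res_closed[OF Sb K(1)[OF that] \<pi>'(1)])
  have \<pi>yp: "\<pi>y y \<in> prime_elements \<omega> C v (\<Sigma> U (x y [^] f y))" if y: "y \<in> H" for y
    using Con_closed[OF Hc[OF y] Kb[OF y] r[OF y]] v_Con[OF Hc[OF y] Kb[OF y] r[OF y]]
      v_Res_same_inertia[OF Sb K(1)[OF y] \<pi>'(1) K(3)[OF y]] \<pi>'(2)
    unfolding prime_elements_def \<pi>y_def K(2)[OF y] by simp
  define \<rho>y where "\<rho>y y = recip_elem I U (x y [^] f y) (m y) (\<pi>y y)" for y
  have \<rho>c: "\<rho>y y \<in> carrier (Obj C I)" if "y \<in> H" for y
    unfolding \<rho>y_def by (rule recip_elem_closed[OF IU(1) m(1)[OF that] \<pi>yp[OF that]])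
  \<comment> \<open>Group by group, the term of the double coset formula at y is the definition of
    \<open>\<rho>y y\<close>; the exponents agree because passing to the power of y h y^-1 did not
    change the \<open>P'\<close>-part.\<close>
  have tm: "Ind C I (I \<inter> conj_set G y ?S) (Con C y (?K y) (Res C (?K y) ?S (\<pi> [^]\<^bsub>Obj C ?S\<^esub> k))) = \<rho>y y" if y: "y \<in> H" for y
  proof -
    interpret r: group_hom "Obj C ?S" "Obj C (?K y)" "Res C (?K y) ?S" by (rule group_hom_Res[OF Sb K(1)[OF y]])
    interpret c: group_hom "Obj C (?K y)" "Obj C (conj_set G y (?K y))" "Con C y (?K y)" by (rule group_hom_Con[OF Hc[OF y] Kb[OF y]])
    show ?thesis
      unfolding \<rho>y_def recip_elem_def \<pi>y_def m(2)[OF y] r.hom_nat_pow[OF \<pi>'(1)] c.hom_nat_pow[OF r[OF y]] K(2)[OF y] m(3)[OF y] ..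
  qed
  let ?\<Upsilon> = "Upsilon P G \<Omega> \<omega> d C v (I, U)" and ?A = "Obj (pi_K G) (I, U)" and ?B = "Obj (H0 G C) (I, U)"
  interpret CI: comm_group "Obj C I" by (rule C_comm[OF D'(2)])
  interpret B: comm_group ?B by (rule comm_group_H0[OF IU(1)])
  have hom: "group_hom ?A ?B ?\<Upsilon>"
    using Upsilon_hom[OF IU(1)] comm_group_pi_K[OF IU(1)] comm_group_H0[OF IU(1)]
    by (auto intro!: group_hom.intro group_hom_axioms.intro simp: tgroup_hom_def comm_group_def)
  have dec: "\<exists>j<f y. y \<otimes> s \<otimes> inv (h [^] j) \<otimes> inv y \<in> I" if y: "y \<in> R" and s: "s \<in> ?S" for y s
  proof -
    have yH: "y \<in> H" using y R(1) by blast
    obtain j where j: "j < f y" "y \<otimes> s \<otimes> inv y \<otimes> inv (x y [^] j) \<in> I" using bspec[OF m(4)[OF yH] conj_in[OF Sb Hc[OF yH] s]] by blast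
    have "y \<otimes> s \<otimes> inv y \<otimes> inv (x y [^] j) = y \<otimes> s \<otimes> inv (h [^] j) \<otimes> inv y"
      unfolding xp[OF yH] using Hc[OF yH] hc M_carrier[OF Sb s] by (simp add: group_norm)
    then show ?thesis using j by (intro exI[of _ j]) simp
  qed
  have fR: "f y > 0" "y \<otimes> h [^] j \<otimes> inv y \<in> I \<longleftrightarrow> f y dvd j" if "y \<in> R" for y j
    using f[OF subsetD[OF R(1) that]] xp[OF subsetD[OF R(1) that]] by simp_all
  obtain T where T: "transversal H I T"
    "transfer I T ?A (pi_class (I, U)) h = (\<Otimes>\<^bsub>?A\<^esub> y \<in> R. pi_class (I, U) (y \<otimes> h [^] f y \<otimes> inv y))"
    by (rule transfer_double_cosets[OF Hs Is sub Ss SH hS R(1) finR bij fR(1) fR(2) dec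
          comm_group_pi_K[OF IU(1)] pi_hom_class(1)[OF IU(1)] pi_hom_class(2)[OF IU(1)]]) assumption+
  have cl: "pi_class (I, U) (x y [^] f y) \<in> carrier ?A" if "y \<in> H" for y
    by (rule pi_class_closed[OF IU(1) h_in[OF D'(2-4) m(1)[OF that]]])
  have "?\<Upsilon> (Res (pi_K G) (I, U) (H, U) X) = ?\<Upsilon> (\<Otimes>\<^bsub>?A\<^esub> y \<in> R. pi_class (I, U) (y \<otimes> h [^] f y \<otimes> inv y))"
    unfolding h(2) pi_K_Res[OF HU IU(1) sub T(1) hH] T(2) ..
  also have "\<dots> = (\<Otimes>\<^bsub>?B\<^esub> y \<in> R. ?\<Upsilon> (pi_class (I, U) (y \<otimes> h [^] f y \<otimes> inv y)))"
    by (rule finprod_group_hom[OF hom comm_group_pi_K[OF IU(1)] comm_group_H0[OF IU(1)] finR])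
      (use cl xp subsetD[OF R(1)] in \<open>simp add: Pi_iff\<close>)
  also have "\<dots> = (\<Otimes>\<^bsub>?B\<^esub> y \<in> R. ind_image C I U #>\<^bsub>Obj C I\<^esub> \<rho>y y)"
  proof (rule B.finprod_cong'[OF refl])
    interpret c: group_hom "Obj C I" ?B "\<lambda>a. ind_image C I U #>\<^bsub>Obj C I\<^esub> a" by (rule H0_class_hom[OF IU(1)])
    show "(\<lambda>y. ind_image C I U #>\<^bsub>Obj C I\<^esub> \<rho>y y) \<in> R \<rightarrow> carrier ?B" using c.hom_closed[OF \<rho>c] R(1) by blast
    fix y assume "y \<in> R"
    then have y: "y \<in> H" using R(1) by blast
    show "?\<Upsilon> (pi_class (I, U) (y \<otimes> h [^] f y \<otimes> inv y)) = ind_image C I U #>\<^bsub>Obj C I\<^esub> \<rho>y y"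
      unfolding xp[OF y, symmetric] \<rho>y_def by (rule Upsilon_pi_class[OF IU(1) m(1)[OF y] \<pi>yp[OF y]])
  qed
  also have "\<dots> = ind_image C I U #>\<^bsub>Obj C I\<^esub> (\<Otimes>\<^bsub>Obj C I\<^esub> y \<in> R. \<rho>y y)"
    by (rule finprod_group_hom[OF H0_class_hom[OF IU(1)] C_comm[OF D'(2)] comm_group_H0[OF IU(1)] finR, symmetric])
      (use \<rho>c R(1) in blast)
  also have "(\<Otimes>\<^bsub>Obj C I\<^esub> y \<in> R. \<rho>y y) = Res C I H (Ind C H ?S (\<pi> [^]\<^bsub>Obj C ?S\<^esub> k))"
    unfolding mackey_formula[OF D(2) IU(2) Si \<pi>k R(1) bij]
  proof (rule CI.finprod_cong'[OF refl, symmetric])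
    show "\<rho>y \<in> R \<rightarrow> carrier (Obj C I)" using \<rho>c R(1) by blast
  qed (rule tm[OF subsetD[OF R(1)]])
  also have "Ind C H ?S (\<pi> [^]\<^bsub>Obj C ?S\<^esub> k) = recip_elem H U h n \<pi>"
    unfolding recip_elem_def k_def ..
  also have "ind_image C I U #>\<^bsub>Obj C I\<^esub> Res C I H (recip_elem H U h n \<pi>) =
      Res (H0 G C) (I, U) (H, U) (Upsilon P G \<Omega> \<omega> d C v (H, U) X)"
    unfolding h(2) Upsilon_pi_class[OF HU h(1) \<pi>] by (rule H0_Res[OF HU IU recip_elem_closed[OF HU h(1) \<pi>], symmetric])
  finally show ?thesis .
qed

lemma Upsilon_Fct_hom: "Upsilon P G \<Omega> \<omega> d C v \<in> Fct_hom G (conj_pair G) EO (pi_K G) (H0 G C)"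
  unfolding Fct_hom_def
proof (rule CollectI, intro conjI ballI)
  show "TAb_functor G (conj_pair G) EO (pi_K G)" "TAb_functor G (conj_pair G) EO (H0 G C)"
    by (rule TAb_functor_pi_K TAb_functor_H0)+
  fix x assume x: "x \<in> base EO"
  obtain H U where xe: "x = (H, U)" by (cases x)
  have HU: "(H, U) \<in> base EO" using x xe by simp
  show "Upsilon P G \<Omega> \<omega> d C v x \<in> tgroup_hom (Obj (pi_K G) x) (Obj (H0 G C) x)"
    unfolding xe by (rule Upsilon_hom[OF HU])
  fix y a assume y: "y \<in> rdom EO x" and a: "a \<in> carrier (Obj (pi_K G) x)"
  obtain I V where ye: "y = (I, V)" by (cases y)
  have I: "(I, V) \<in> rdom EO (H, U)" using y xe ye by simp
  have VU: "V = U" by (rule EO_rdom(2)[OF HU I])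
  show "Upsilon P G \<Omega> \<omega> d C v y (Res (pi_K G) y x a) = Res (H0 G C) y x (Upsilon P G \<Omega> \<omega> d C v x a)"
    using Upsilon_Res[OF HU EO_rdom(1)[OF HU I, unfolded VU] EO_rdom(4)[OF HU I]] a unfolding xe ye VU by blast
next
  fix x y a assume x: "x \<in> base EO" and y: "y \<in> idom EO x" and a: "a \<in> carrier (Obj (pi_K G) y)"
  obtain H U I V where e: "x = (H, U)" "y = (I, V)" by (cases x, cases y)
  show "Upsilon P G \<Omega> \<omega> d C v x (Ind (pi_K G) x y a) = Ind (H0 G C) x y (Upsilon P G \<Omega> \<omega> d C v y a)"
    using Upsilon_Ind x y a unfolding e by blast
next
  fix g x a assume g: "g \<in> carrier G" and x: "x \<in> base EO" and a: "a \<in> carrier (Obj (pi_K G) x)"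
  obtain H U where e: "x = (H, U)" by (cases x)
  show "Upsilon P G \<Omega> \<omega> d C v (conj_pair G g x) (Con (pi_K G) g x a) = Con (H0 G C) g x (Upsilon P G \<Omega> \<omega> d C v x a)"
    using Upsilon_Con g x a unfolding e conj_pair_simp by blast
qed

end

theorem theorem4p4p18:
  fixes P :: "nat set" and G :: "'g tgroup" and \<Omega> :: "'w tgroup" and \<omega> :: 'w
    and d :: "'g \<Rightarrow> 'w" and E :: "'g pair_dom" and M :: "'g set ric_dom"
    and C :: "('g, 'g set, 'c) ric_fun" and v :: "'g set \<Rightarrow> 'c \<Rightarrow> 'w"
  assumes "\<And>p. p \<in> P \<Longrightarrow> prime p"
    and "pro_group P G"
    and "topological_group \<Omega>" and "tgroup_isomorphic \<Omega> (Z_P P)"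
    and "topological_generator \<Omega> \<omega>"
    and "d \<in> tgroup_hom G \<Omega>" and "d ` carrier G = carrier \<Omega>"
    and "spectrum G E"
    and "FN_datum G \<Omega> \<omega> d E M C v"
  shows
    "(\<forall>(H, U) \<in> base (open_part G E).
        (\<forall>c \<in> carrier (quot G (H, U)). \<exists>h \<in> Frob G \<Omega> \<omega> d H. U #>\<^bsub>G\<^esub> h = c) \<and>
        (\<forall>h \<in> Frob G \<Omega> \<omega> d H.
          frobenius_group G \<Omega> d h U \<in> idom M H \<and>
          prime_elements \<omega> C v (frobenius_group G \<Omega> d h U) \<noteq> {} \<and>
          (\<forall>\<pi> \<in> prime_elements \<omega> C v (frobenius_group G \<Omega> d h U).
            Upsilon' P G \<Omega> \<omega> d C v (H, U) (U #>\<^bsub>G\<^esub> h) = recip_value P G \<Omega> \<omega> d C H U h \<pi>)) \<and>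
        Upsilon' P G \<Omega> \<omega> d C v (H, U) \<in> hom (quot G (H, U)) (Obj (H0 G C) (H, U)) \<and>
        (\<forall>c \<in> carrier (quot G (H, U)).
          Upsilon P G \<Omega> \<omega> d C v (H, U) (ab_class G (H, U) c) = Upsilon' P G \<Omega> \<omega> d C v (H, U) c) \<and>
        (\<forall>\<psi> \<in> tgroup_hom (Obj (pi_K G) (H, U)) (Obj (H0 G C) (H, U)).
          (\<forall>c \<in> carrier (quot G (H, U)).
            \<psi> (ab_class G (H, U) c) = Upsilon' P G \<Omega> \<omega> d C v (H, U) c) \<longrightarrow>
          (\<forall>X \<in> carrier (Obj (pi_K G) (H, U)). \<psi> X = Upsilon P G \<Omega> \<omega> d C v (H, U) X))) \<and>
     Upsilon P G \<Omega> \<omega> d C v \<in> Fct_hom G (conj_pair G) (open_part G E) (pi_K G) (H0 G C) \<and>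
     (\<forall>(H, U) \<in> base E. U \<in> unramified G \<Omega> d H \<longrightarrow>
        (\<forall>k :: int. \<forall>\<pi> \<in> prime_elements \<omega> C v H.
          Upsilon P G \<Omega> \<omega> d C v (H, U)
              (ab_class G (H, U) (frobenius G \<Omega> \<omega> d H U [^]\<^bsub>quot G (H, U)\<^esub> k))
            = ind_image C H U #>\<^bsub>Obj C H\<^esub> (\<pi> [^]\<^bsub>Obj C H\<^esub> k)))"
proof -
  interpret fn_setting P G \<Omega> \<omega> d E M C v by (rule fn_setting.intro) (fact assms)+
  have part: "(\<forall>c \<in> carrier (quot G (H, U)). \<exists>h \<in> Frob G \<Omega> \<omega> d H. U #>\<^bsub>G\<^esub> h = c) \<and>
      (\<forall>h \<in> Frob G \<Omega> \<omega> d H.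
        frobenius_group G \<Omega> d h U \<in> idom M H \<and>
        prime_elements \<omega> C v (frobenius_group G \<Omega> d h U) \<noteq> {} \<and>
        (\<forall>\<pi> \<in> prime_elements \<omega> C v (frobenius_group G \<Omega> d h U).
          Upsilon' P G \<Omega> \<omega> d C v (H, U) (U #>\<^bsub>G\<^esub> h) = recip_value P G \<Omega> \<omega> d C H U h \<pi>)) \<and>
      Upsilon' P G \<Omega> \<omega> d C v (H, U) \<in> hom (quot G (H, U)) (Obj (H0 G C) (H, U)) \<and>
      (\<forall>c \<in> carrier (quot G (H, U)).
        Upsilon P G \<Omega> \<omega> d C v (H, U) (ab_class G (H, U) c) = Upsilon' P G \<Omega> \<omega> d C v (H, U) c) \<and>
      (\<forall>\<psi> \<in> tgroup_hom (Obj (pi_K G) (H, U)) (Obj (H0 G C) (H, U)).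
        (\<forall>c \<in> carrier (quot G (H, U)).
          \<psi> (ab_class G (H, U) c) = Upsilon' P G \<Omega> \<omega> d C v (H, U) c) \<longrightarrow>
        (\<forall>X \<in> carrier (Obj (pi_K G) (H, U)). \<psi> X = Upsilon P G \<Omega> \<omega> d C v (H, U) X))"
    if HU: "(H, U) \<in> base (open_part G E)" for H U
  proof (intro conjI ballI impI)
    note D = open_partD[OF HU]
    show "\<exists>h \<in> Frob G \<Omega> \<omega> d H. U #>\<^bsub>G\<^esub> h = c" if c: "c \<in> carrier (quot G (H, U))" for c
    proof -
      obtain h n where "frob_exp H h n" "U #>\<^bsub>G\<^esub> h = c" by (rule frob_lift_exists[OF D(2-4) c])
      then show ?thesis using Frob_iff[OF D(2)] by blast
    qed
    fix h assume "h \<in> Frob G \<Omega> \<omega> d H"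
    then obtain n where n: "frob_exp H h n" using Frob_iff[OF D(2)] by blast
    show "frobenius_group G \<Omega> d h U \<in> idom M H"
      by (rule open_idom[OF D(2) open_frobenius_group[OF D(2-4) n]])
    show "prime_elements \<omega> C v (frobenius_group G \<Omega> d h U) \<noteq> {}"
      by (rule prime_exists[OF frobenius_group_base[OF D(2-4) n]])
    show "Upsilon' P G \<Omega> \<omega> d C v (H, U) (U #>\<^bsub>G\<^esub> h) = recip_value P G \<Omega> \<omega> d C H U h \<pi>"
      if "\<pi> \<in> prime_elements \<omega> C v (frobenius_group G \<Omega> d h U)" for \<pi>
      using Upsilon'_eq[OF HU n that] recip_value_eq[OF HU n that] by simp
  next
    show "Upsilon' P G \<Omega> \<omega> d C v (H, U) \<in> hom (quot G (H, U)) (Obj (H0 G C) (H, U))"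
      by (rule Upsilon'_hom[OF HU])
    show "Upsilon P G \<Omega> \<omega> d C v (H, U) (ab_class G (H, U) c) = Upsilon' P G \<Omega> \<omega> d C v (H, U) c"
      if "c \<in> carrier (quot G (H, U))" for c by (rule Upsilon_ab_class[OF HU that])
    fix \<psi> X
    assume \<psi>: "\<forall>c \<in> carrier (quot G (H, U)). \<psi> (ab_class G (H, U) c) = Upsilon' P G \<Omega> \<omega> d C v (H, U) c"
      and X: "X \<in> carrier (Obj (pi_K G) (H, U))"
    obtain c where "c \<in> carrier (quot G (H, U))" "X = ab_class G (H, U) c" using X carrier_pi_K[OF HU] by auto
    then show "\<psi> X = Upsilon P G \<Omega> \<omega> d C v (H, U) X" using \<psi> Upsilon_ab_class[OF HU] by simp
  qed
  show ?thesis
  proof (intro conjI)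
    show "Upsilon P G \<Omega> \<omega> d C v \<in> Fct_hom G (conj_pair G) (open_part G E) (pi_K G) (H0 G C)"
      by (rule Upsilon_Fct_hom)
  qed (use part Upsilon_unramified in \<open>auto simp only: split_paired_all case_prod_conv\<close>)
qed

end
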